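(* Let $\hat T$ be an expanding map of $[0,1]$ with properties (a), (b) of the context and let $H$ be a hole satisfying condition (A1) of the context. Set $H_t=H$, where $t>0$, and let $\{H_s\}$, $s\in(0,t]$, be a family of holes with the following properties: (1) $m(H_s)\le s$, $H_s\subset H_t$, and each component of $H_t$ contains at most one component of $H_s$; (2) either the closure of $H_t$ contains none of the endpoints of the $\hat I_j$, or if one endpoint is contained in the closure of $H_t$, then that endpoint is contained in the closure of $H_s$ for all $s\in(0,t]$; (3) with respect to the hole $H_t$, for each interval of monotonicity $I_j$ there exists $m_j$ such that $$I_j\cup\hat T I_j\cup\hat T^2I_{j,1}\cup\hat T^3I_{j,2}\cup\dots\cup\hat T^{m_j}I_{j,m_j-1}=[0,1].$$ Let $\nu_s$ denote the absolutely continuous conditionally invariant measure corresponding to $H_s$ obtained by the tower construction described in the context. Then $\nu_s$ converges weakly to $\nu$ as $s\to0$, where $\nu$ is the unique absolutely continuous invariant probability measure for $\hat T$ (with no holes). If $\alpha=1$, then the densities of $\nu_s$ converge to the density of $\nu$ in $L^1([0,1])$ as well.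
   Context: $m$ denotes Lebesgue measure. **The map.** $\hat T$ is a piecewise monotone map of $[0,1]$ into itself with finitely many intervals of monotonicity $\hat I_1,\dots,\hat I_{\hat K}$ such that (a) $\hat T$ is $C^{1+\alpha}$ on each $\hat I_j$, for a fixed $\alpha>0$; in particular there is $\hat C>0$ with $|\hat T'(x)-\hat T'(y)|\le\hat C|x-y|^\alpha$ whenever $x,y$ lie in the same $\hat I_j$ ($\alpha=1$ is understood to mean that $\hat T$ is $C^2$ on each $\hat I_j$); (b) $|\hat T'|\ge\mu>2$. **Holes.** A hole $H\subset[0,1]$ is a finite union of open intervals $H_{(1)},\dots,H_{(L)}$; $I=[0,1]\setminus H$. For $n\ge0$, $I^n=\bigcap_{i=0}^n\hat T^{-i}I$ and $T^n=\hat T^n|_{I^n}$; in particular $T=\hat T|_{I\cap\hat T^{-1}I}$. The intervals of monotonicity with respect to $H$, forming the partition $\mathcal{Q}=\{I_1,\dots,I_K\}$ of $I$, are the maximal intervals of the sets $\hat I_k\cap I$. $I_{j,n}=I_j\cap I^n$. A Borel probability measure $\nu$ on $I$ is conditionally invariant for $T$ if $\nu(T^{-1}A)=\lambda\nu(A)$ for all Borel $A\subset I$, where $\lambda=\nu(T^{-1}I)$. Measures on $I$ and their densities are extended by $0$ to $[0,1]$. **Condition (A1).** Let $d$ be the minimum length of the $I_j$ and $\tilde C=\exp\!\big(\frac{\hat C}{\mu(\mu^\alpha-1)}\big)-1$. For $\delta>0$ let $C=\tilde C(2\delta)^\alpha$. Choose and fix $\delta$ with $0<\delta\le d$ small enough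 that $\frac{2^\alpha(1+C)}{\mu^\alpha}<1$, and let $a=\max\{\sqrt{2/\mu},\frac{2^\alpha(1+C)}{\mu^\alpha}\}$. In the case $\alpha=1$, simply take $\delta=d$ (without requiring $\frac{2^\alpha(1+C)}{\mu^\alpha}<1$) and $a=\sqrt{2/\mu}$. Condition (A1) is $$m(H)\le\frac{(1-a)^2\mu\delta^2(1-\sqrt{2/\mu})}{1+C}.$$ The number $\delta$ (hence $C$, $a$) is chosen for $H=H_t$ and kept fixed for all $H_s$, $s\in(0,t]$ (properties (1), (2) guarantee that the intervals of monotonicity with respect to $H_s$ are no shorter than those with respect to $H_t$). **Tower construction of the measure for a hole $H$ (applied to each $H_s$).** *Stopping times.* Partition $I$ into $N$ intervals $\Lambda^{(1)},\dots,\Lambda^{(N)}$ of lengths between $\delta$ and $2\delta$, each contained in some $I_j$. Fix $k$ and put $\Omega_0=\Lambda^{(k)}$. Given $\Omega_{n-1}$ (a finite union of intervals, $n\ge1$), treat each component $\omega$ of $\Omega_{n-1}$ as follows. (Case 1) If $\hat T^n\omega$ covers no $I_j$, set $S=n$ on $\omega\cap\hat T^{-n}H$, make this interval an element of $\mathcal{Z}^{(k)}$, and put the remaining (at most two) intervals of $\hat T^{-n}\mathcal{Q}|_\omega$ into $\Omega_n$. (Case 2) If $\hat T^n\omega$ covers at least one $I_j$, set $S=n$ on each interval of $\hat T^{-n}\mathcal{Q}|_\omega$ whose image under $\hat T^n$ equals some $I_j$, and on each interval $\omega\cap\hat T^{-n}H_{(l)}$; all of these become elements of $\mathcal{Z}^{(k)}$.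 The (at most two) remaining intervals of $\hat T^{-n}\mathcal{Q}|_\omega$ are put into $\Omega_n$. *Return time.* Set $R=S$. Let $\mathcal{Z}$ be the partition of $I$ (mod a null set) consisting of the elements $\omega$ of the $\mathcal{Z}^{(k)}$ with $\hat T^{S}\omega\subset H$, together with, for those $\omega$ with $T^S\omega=I_j$, the pieces $\omega\cap T^{-S}\Lambda^{(i)}$, $\Lambda^{(i)}\subset I_j$. *Tower.* Let $\Delta_0=\bigcup_{i=1}^N\Delta_0^{(i)}$ be a union of $N$ disjoint unit intervals and let $\pi_0:\Delta_0\to I$ be the bijection mapping $\Delta_0^{(i)}$ affinely onto $\Lambda^{(i)}$; transport $R,\mathcal{Z}$ to $\Delta_0$. Let $\Delta=\{(x,n):x\in\Delta_0,\ 0\le n<R(x)\}$, with levels $\Delta_l$ carrying the metric and Lebesgue measure $m$ of $\Delta_0$, and $\pi(x,n)=\hat T^n(\pi_0x)$. The map $F$ is: $F(x,n)=(x,n+1)$ if $n+1<R(x)$; $F(x,n)=(\pi_0^{-1}(\hat T^{R(x)}\pi_0x),0)$ if $n+1=R(x)$ and $\hat T^{R(x)}\pi_0x\in I$; $F(x,n)$ is undefined (the point falls in the hole of the tower) if $n+1=R(x)$ and $\hat T^{R(x)}\pi_0x\in H$. Let $\Delta_{l,j}^{(i)}$ be the intervals of $\Delta_l$ over $\Delta_0^{(i)}$ which correspond (via $\pi_0$) to the components of $\Omega_l$ constructed from $\Lambda^{(i)}$. *Density on the tower.* Let $\mathcal{P}f(x)=\sum_{y\in F^{-1}x}f(y)/|F'(y)|$,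 $\mathcal{P}_1f=\mathcal{P}f/|\mathcal{P}f|_{L^1}$, $\xi=\min\{\frac12\log\frac\mu2,\alpha\log\mu\}$, $\|f\|_\infty=\sup_{i,l,j}e^{-\xi l}|f|_{L^\infty(\Delta_{l,j}^{(i)})}$, and $$\|f\|_r=\sup_{i,l,j}\ \sup_{x,y\in\Delta_{l,j}^{(i)},\,f(x)\neq0}\frac{|f(x)-f(y)|}{|x-y|^\alpha|f(x)|}e^{-\xi l};$$ for $\alpha=1$ one uses instead, for $f$ Lipschitz on each $\Delta_{l,j}^{(i)}$, $\|f\|_r=\sup_{i,l,j}e^{-\xi l}\,\mathrm{ess\,sup}\{|f'(x)|/|f(x)|:x\in\Delta_{l,j}^{(i)},f(x)\ne0\}$. With $M=\frac{1+C}{1-a}$ let $X_M=\{f\ge0:\int_\Delta f\,dm=1,\ \|f\|_\infty\le M,\ \|f\|_r\le M\}$. There is a density $\varphi\in X_M$ with $\mathcal{P}_1\varphi=\varphi$. The measure obtained for $H$ is $\nu(A)=\int_{\pi^{-1}A}\varphi\,dm$; it is an absolutely continuous conditionally invariant measure for $T$. For $H=H_s$ this gives $\nu_s$. *)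

theory Defs
  imports "HOL-Probability.Probability"
begin

section \<open>Piecewise expanding maps and holes\<close>

text \<open>
  Conventions.  Intervals of monotonicity are represented by their (nonempty, open) interiors, and
  all partitions and coverings of $[0,1]$ or of $I$ are understood up to finitely many points (a
  finite union of intervals omits only finitely many points of $[0,1]$ exactly when the union of
  their closures is $[0,1]$), so nothing depends on the values of the
  map at the endpoints of the intervals of monotonicity.  This is the usual reading in which the
  closed intervals share endpoints and the map is two-valued there.
  Measures on $[0,1]$ are measures on the Borel subsets of the space \<open>{0..1}\<close>.
\<close>

definition unit_borel :: "real measure" where
  "unit_borel = restrict_space borel {0..1}"

definition unit_lborel :: "real measure" where
  "unit_lborel = restrict_space lborel {0..1}"

definition C2_on :: "real set \<Rightarrow> (real \<Rightarrow> real) \<Rightarrow> bool" where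
  "C2_on J T \<longleftrightarrow> (\<forall>x\<in>J. T field_differentiable at x) \<and>
     (\<forall>x\<in>J. deriv T field_differentiable at x) \<and> continuous_on J (deriv (deriv T))"

definition expanding_map ::
  "(real \<Rightarrow> real) \<Rightarrow> real set set \<Rightarrow> real \<Rightarrow> real \<Rightarrow> real \<Rightarrow> bool" where
  "expanding_map T Ihat \<alpha> \<mu> Chat \<longleftrightarrow>
     0 < \<alpha> \<and> 2 < \<mu> \<and> 0 < Chat \<and> T ` {0..1} \<subseteq> {0..1} \<and>
     finite Ihat \<and> pairwise disjnt Ihat \<and> finite ({0..1} - \<Union>Ihat) \<and>
     (\<forall>J\<in>Ihat. (\<exists>l r. 0 \<le> l \<and> l < r \<and> r \<le> 1 \<and> J = {l<..<r}) \<and>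
        (strict_mono_on J T \<or> strict_antimono_on J T) \<and>
        (\<forall>x\<in>J. T field_differentiable at x) \<and>
        (\<forall>x\<in>J. \<forall>y\<in>J. \<bar>deriv T x - deriv T y\<bar> \<le> Chat * \<bar>x - y\<bar> powr \<alpha>) \<and>
        (\<alpha> = 1 \<longrightarrow> C2_on J T) \<and>
        (\<forall>x\<in>J. \<mu> \<le> \<bar>deriv T x\<bar>))"

definition hole :: "real set \<Rightarrow> bool" where
  "hole H \<longleftrightarrow> H \<subseteq> {0..1} \<and>
     (\<exists>\<U>. finite \<U> \<and> (\<forall>U\<in>\<U>. \<exists>l r. U = {l<..<r}) \<and> H = \<Union>\<U>)"

text \<open>
  The partition $\mathcal{Q}$.  Components consisting of a single point (which occur when a hole
  abuts an endpoint of an interval of monotonicity) are not intervals of monotonicity.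
\<close>
definition mono_intervals :: "real set set \<Rightarrow> real set \<Rightarrow> real set set" where
  "mono_intervals Ihat H =
     {interior J | J. (\<exists>K\<in>Ihat. J \<in> components (K \<inter> ({0..1} - H))) \<and> interior J \<noteq> {}}"

text \<open>The set $I^n$ of points which have not met the hole up to time $n$.\<close>
definition surviving :: "(real \<Rightarrow> real) \<Rightarrow> real set \<Rightarrow> nat \<Rightarrow> real set" where
  "surviving T H n = {x. \<forall>i\<le>n. (T ^^ i) x \<in> {0..1} - H}"

section \<open>Condition (A1)\<close>

definition min_length :: "real set set \<Rightarrow> real set \<Rightarrow> real" where
  "min_length Ihat H = Min (measure lborel ` mono_intervals Ihat H)"

definition C_const :: "real \<Rightarrow> real \<Rightarrow> real \<Rightarrow> real \<Rightarrow> real" where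
  "C_const \<alpha> \<mu> Chat \<delta> = (exp (Chat / (\<mu> * (\<mu> powr \<alpha> - 1))) - 1) * (2 * \<delta>) powr \<alpha>"

definition a_const :: "real \<Rightarrow> real \<Rightarrow> real \<Rightarrow> real \<Rightarrow> real" where
  "a_const \<alpha> \<mu> Chat \<delta> =
     (if \<alpha> = 1 then sqrt (2 / \<mu>)
      else max (sqrt (2 / \<mu>)) (2 powr \<alpha> * (1 + C_const \<alpha> \<mu> Chat \<delta>) / \<mu> powr \<alpha>))"

definition admissible_delta ::
  "real set set \<Rightarrow> real set \<Rightarrow> real \<Rightarrow> real \<Rightarrow> real \<Rightarrow> real \<Rightarrow> bool" where
  "admissible_delta Ihat H \<alpha> \<mu> Chat \<delta> \<longleftrightarrow>
     (if \<alpha> = 1 then \<delta> = min_length Ihat H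
      else 0 < \<delta> \<and> \<delta> \<le> min_length Ihat H \<and>
           2 powr \<alpha> * (1 + C_const \<alpha> \<mu> Chat \<delta>) / \<mu> powr \<alpha> < 1)"

definition condition_A1 ::
  "real set set \<Rightarrow> real set \<Rightarrow> real \<Rightarrow> real \<Rightarrow> real \<Rightarrow> real \<Rightarrow> bool" where
  "condition_A1 Ihat H \<alpha> \<mu> Chat \<delta> \<longleftrightarrow>
     admissible_delta Ihat H \<alpha> \<mu> Chat \<delta> \<and>
     measure lborel H \<le>
       (1 - a_const \<alpha> \<mu> Chat \<delta>)\<^sup>2 * \<mu> * \<delta>\<^sup>2 * (1 - sqrt (2 / \<mu>)) / (1 + C_const \<alpha> \<mu> Chat \<delta>)"

section \<open>Stopping times\<close>

definition small_partition ::
  "real set set \<Rightarrow> real set \<Rightarrow> real \<Rightarrow> nat \<Rightarrow> (nat \<Rightarrow> real set) \<Rightarrow> bool" where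
  "small_partition Q H \<delta> N \<Lambda> \<longleftrightarrow>
     disjoint_family_on \<Lambda> {..<N} \<and> finite (({0..1} - H) - (\<Union>k<N. \<Lambda> k)) \<and>
     (\<forall>k<N. (\<exists>l r. \<Lambda> k = {l<..<r} \<and> \<delta> \<le> r - l \<and> r - l \<le> 2 * \<delta>) \<and> (\<exists>J\<in>Q. \<Lambda> k \<subseteq> J))"

text \<open>The partition $\hat T^{-n}\mathcal{Q}|_\omega$.\<close>
definition pullback ::
  "(real \<Rightarrow> real) \<Rightarrow> real set set \<Rightarrow> nat \<Rightarrow> real set \<Rightarrow> real set set" where
  "pullback T Q n \<omega> = {\<omega> \<inter> (T ^^ n) -` J | J. J \<in> Q} - {{}}"

definition covers :: "(real \<Rightarrow> real) \<Rightarrow> real set set \<Rightarrow> nat \<Rightarrow> real set \<Rightarrow> bool" where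
  "covers T Q n \<omega> \<longleftrightarrow> (\<exists>J\<in>Q. J \<subseteq> (T ^^ n) ` \<omega>)"

definition stopped ::
  "(real \<Rightarrow> real) \<Rightarrow> real set set \<Rightarrow> real set \<Rightarrow> nat \<Rightarrow> real set \<Rightarrow> real set set" where
  "stopped T Q H n \<omega> =
     (if covers T Q n \<omega>
      then {\<zeta> \<in> pullback T Q n \<omega>. (T ^^ n) ` \<zeta> \<in> Q} \<union> {\<omega> \<inter> (T ^^ n) -` h | h. h \<in> components H}
      else {\<omega> \<inter> (T ^^ n) -` H}) - {{}}"

definition kept ::
  "(real \<Rightarrow> real) \<Rightarrow> real set set \<Rightarrow> nat \<Rightarrow> real set \<Rightarrow> real set set" where
  "kept T Q n \<omega> =
     (if covers T Q n \<omega> then {\<zeta> \<in> pullback T Q n \<omega>. (T ^^ n) ` \<zeta> \<notin> Q} else pullback T Q n \<omega>)"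

text \<open>
  \<open>Omega T Q A n\<close> is the set of components of $\Omega_n$ and \<open>stop_elements T Q H A n\<close> the set of
  those elements of $\mathcal{Z}^{(k)}$ on which the stopping time is $n$, when $\Lambda^{(k)} = A$.
\<close>
primrec Omega :: "(real \<Rightarrow> real) \<Rightarrow> real set set \<Rightarrow> real set \<Rightarrow> nat \<Rightarrow> real set set" where
  "Omega T Q A 0 = {A}"
| "Omega T Q A (Suc n) = (\<Union>\<omega>\<in>Omega T Q A n. kept T Q (Suc n) \<omega>)"

primrec stop_elements ::
  "(real \<Rightarrow> real) \<Rightarrow> real set set \<Rightarrow> real set \<Rightarrow> real set \<Rightarrow> nat \<Rightarrow> real set set" where
  "stop_elements T Q H A 0 = {}"
| "stop_elements T Q H A (Suc n) = (\<Union>\<omega>\<in>Omega T Q A n. stopped T Q H (Suc n) \<omega>)"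

text \<open>The value $\infty$ is taken only on a null set, on which the paper leaves $S$ undefined.\<close>
definition stop_time ::
  "(real \<Rightarrow> real) \<Rightarrow> real set set \<Rightarrow> real set \<Rightarrow> real set \<Rightarrow> real \<Rightarrow> enat" where
  "stop_time T Q H A x =
     (if \<exists>n. x \<in> \<Union>(stop_elements T Q H A n)
      then enat (LEAST n. x \<in> \<Union>(stop_elements T Q H A n)) else \<infinity>)"

section \<open>The tower\<close>

text \<open>
  $\Delta_0^{(k)}$ is the unit interval $(k,k+1)$ of the real line, \<open>k < N\<close>, so that points of the
  tower are pairs in \<open>real \<times> nat\<close> and the metric and measure of $\Delta_0$ are those of the line.
\<close>
definition base_interval :: "nat \<Rightarrow> real set" where
  "base_interval k = {real k<..<real k + 1}"

definition base :: "nat \<Rightarrow> real set" where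
  "base N = (\<Union>k<N. base_interval k)"

definition base_index :: "real \<Rightarrow> nat" where
  "base_index x = nat \<lfloor>x\<rfloor>"

definition base_proj :: "(nat \<Rightarrow> real set) \<Rightarrow> real \<Rightarrow> real" where
  "base_proj \<Lambda> x = (let A = \<Lambda> (base_index x)
     in Inf A + (x - real (base_index x)) * (Sup A - Inf A))"

definition return_time ::
  "(real \<Rightarrow> real) \<Rightarrow> real set set \<Rightarrow> real set \<Rightarrow> (nat \<Rightarrow> real set) \<Rightarrow> real \<Rightarrow> enat" where
  "return_time T Q H \<Lambda> x = stop_time T Q H (\<Lambda> (base_index x)) (base_proj \<Lambda> x)"

definition tower ::
  "(real \<Rightarrow> real) \<Rightarrow> real set set \<Rightarrow> real set \<Rightarrow> nat \<Rightarrow> (nat \<Rightarrow> real set) \<Rightarrow> (real \<times> nat) set" where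
  "tower T Q H N \<Lambda> = {(x, n). x \<in> base N \<and> enat n < return_time T Q H \<Lambda> x}"

definition tower_lborel ::
  "(real \<Rightarrow> real) \<Rightarrow> real set set \<Rightarrow> real set \<Rightarrow> nat \<Rightarrow> (nat \<Rightarrow> real set) \<Rightarrow> (real \<times> nat) measure" where
  "tower_lborel T Q H N \<Lambda> = restrict_space (lborel \<Otimes>\<^sub>M count_space UNIV) (tower T Q H N \<Lambda>)"

definition tower_proj :: "(real \<Rightarrow> real) \<Rightarrow> (nat \<Rightarrow> real set) \<Rightarrow> real \<times> nat \<Rightarrow> real" where
  "tower_proj T \<Lambda> = (\<lambda>(x, n). (T ^^ n) (base_proj \<Lambda> x))"

text \<open>
  The tower map; \<open>None\<close> means that the point falls into the hole of the tower.  The union of the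
  \<open>\<Lambda> k\<close> is $I$ up to finitely many points.
\<close>
definition tower_map ::
  "(real \<Rightarrow> real) \<Rightarrow> real set set \<Rightarrow> real set \<Rightarrow> nat \<Rightarrow> (nat \<Rightarrow> real set) \<Rightarrow>
   real \<times> nat \<Rightarrow> (real \<times> nat) option" where
  "tower_map T Q H N \<Lambda> = (\<lambda>(x, n).
     if enat (Suc n) < return_time T Q H \<Lambda> x then Some (x, Suc n)
     else if (T ^^ Suc n) (base_proj \<Lambda> x) \<in> (\<Union>k<N. \<Lambda> k)
     then Some (the_inv_into (base N) (base_proj \<Lambda>) ((T ^^ Suc n) (base_proj \<Lambda> x)), 0)
     else None)"

definition tower_deriv ::
  "(real \<Rightarrow> real) \<Rightarrow> real set set \<Rightarrow> real set \<Rightarrow> nat \<Rightarrow> (nat \<Rightarrow> real set) \<Rightarrow> real \<times> nat \<Rightarrow> real" where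
  "tower_deriv T Q H N \<Lambda> = (\<lambda>(x, n). deriv (\<lambda>u. fst (the (tower_map T Q H N \<Lambda> (u, n)))) x)"

text \<open>The intervals $\Delta_{l,j}^{(i)}$, for fixed $i$ and $l$.\<close>
definition tower_cells ::
  "(real \<Rightarrow> real) \<Rightarrow> real set set \<Rightarrow> (nat \<Rightarrow> real set) \<Rightarrow> nat \<Rightarrow> nat \<Rightarrow> real set set" where
  "tower_cells T Q \<Lambda> i l =
     (\<lambda>\<omega>. {x \<in> base_interval i. base_proj \<Lambda> x \<in> \<omega>}) ` Omega T Q (\<Lambda> i) l"

section \<open>Transfer operator, norms and the conditionally invariant measure\<close>

definition transfer ::
  "(real \<Rightarrow> real) \<Rightarrow> real set set \<Rightarrow> real set \<Rightarrow> nat \<Rightarrow> (nat \<Rightarrow> real set) \<Rightarrow>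
   (real \<times> nat \<Rightarrow> real) \<Rightarrow> real \<times> nat \<Rightarrow> real" where
  "transfer T Q H N \<Lambda> f p =
     (\<Sum>\<^sub>\<infinity> q \<in> {q \<in> tower T Q H N \<Lambda>. tower_map T Q H N \<Lambda> q = Some p}.
        f q / \<bar>tower_deriv T Q H N \<Lambda> q\<bar>)"

definition normalized_transfer ::
  "(real \<Rightarrow> real) \<Rightarrow> real set set \<Rightarrow> real set \<Rightarrow> nat \<Rightarrow> (nat \<Rightarrow> real set) \<Rightarrow>
   (real \<times> nat \<Rightarrow> real) \<Rightarrow> real \<times> nat \<Rightarrow> real" where
  "normalized_transfer T Q H N \<Lambda> f p =
     transfer T Q H N \<Lambda> f p / (LINT q|tower_lborel T Q H N \<Lambda>. \<bar>transfer T Q H N \<Lambda> f q\<bar>)"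

definition xi :: "real \<Rightarrow> real \<Rightarrow> real" where
  "xi \<alpha> \<mu> = min (ln (\<mu> / 2) / 2) (\<alpha> * ln \<mu>)"

definition norm_inf ::
  "(real \<Rightarrow> real) \<Rightarrow> real set set \<Rightarrow> nat \<Rightarrow> (nat \<Rightarrow> real set) \<Rightarrow> real \<Rightarrow> real \<Rightarrow>
   (real \<times> nat \<Rightarrow> real) \<Rightarrow> ennreal" where
  "norm_inf T Q N \<Lambda> \<alpha> \<mu> f =
     (SUP i\<in>{..<N}. SUP l. SUP D\<in>tower_cells T Q \<Lambda> i l.
        ennreal (exp (- xi \<alpha> \<mu> * real l)) *
        esssup (restrict_space lborel D) (\<lambda>x. ennreal \<bar>f (x, l)\<bar>))"

definition norm_r_holder ::
  "(real \<Rightarrow> real) \<Rightarrow> real set set \<Rightarrow> nat \<Rightarrow> (nat \<Rightarrow> real set) \<Rightarrow> real \<Rightarrow> real \<Rightarrow>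
   (real \<times> nat \<Rightarrow> real) \<Rightarrow> ennreal" where
  "norm_r_holder T Q N \<Lambda> \<alpha> \<mu> f =
     (SUP i\<in>{..<N}. SUP l. SUP D\<in>tower_cells T Q \<Lambda> i l.
        SUP x\<in>{x \<in> D. f (x, l) \<noteq> 0}. SUP y\<in>D.
          ennreal (\<bar>f (x, l) - f (y, l)\<bar> / (\<bar>x - y\<bar> powr \<alpha> * \<bar>f (x, l)\<bar>) *
                   exp (- xi \<alpha> \<mu> * real l)))"

definition norm_r_lipschitz ::
  "(real \<Rightarrow> real) \<Rightarrow> real set set \<Rightarrow> nat \<Rightarrow> (nat \<Rightarrow> real set) \<Rightarrow> real \<Rightarrow>
   (real \<times> nat \<Rightarrow> real) \<Rightarrow> ennreal" where
  "norm_r_lipschitz T Q N \<Lambda> \<mu> f =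
     (SUP i\<in>{..<N}. SUP l. SUP D\<in>tower_cells T Q \<Lambda> i l.
        ennreal (exp (- xi 1 \<mu> * real l)) *
        esssup (restrict_space lborel {x \<in> D. f (x, l) \<noteq> 0})
          (\<lambda>x. ennreal (\<bar>deriv (\<lambda>u. f (u, l)) x\<bar> / \<bar>f (x, l)\<bar>)))"

definition X_set ::
  "(real \<Rightarrow> real) \<Rightarrow> real set set \<Rightarrow> real set \<Rightarrow> nat \<Rightarrow> (nat \<Rightarrow> real set) \<Rightarrow> real \<Rightarrow> real \<Rightarrow> real \<Rightarrow>
   (real \<times> nat \<Rightarrow> real) set" where
  "X_set T Q H N \<Lambda> \<alpha> \<mu> M =
     {f \<in> borel_measurable (tower_lborel T Q H N \<Lambda>).
        (\<forall>p\<in>tower T Q H N \<Lambda>. 0 \<le> f p) \<and>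
        (LINT p|tower_lborel T Q H N \<Lambda>. f p) = 1 \<and>
        norm_inf T Q N \<Lambda> \<alpha> \<mu> f \<le> ennreal M \<and>
        (if \<alpha> = 1
         then (\<forall>i<N. \<forall>l. \<forall>D\<in>tower_cells T Q \<Lambda> i l. \<exists>L. L-lipschitz_on D (\<lambda>x. f (x, l))) \<and>
              norm_r_lipschitz T Q N \<Lambda> \<mu> f \<le> ennreal M
         else norm_r_holder T Q N \<Lambda> \<alpha> \<mu> f \<le> ennreal M)}"

definition projected_measure ::
  "(real \<Rightarrow> real) \<Rightarrow> real set set \<Rightarrow> real set \<Rightarrow> nat \<Rightarrow> (nat \<Rightarrow> real set) \<Rightarrow>
   (real \<times> nat \<Rightarrow> real) \<Rightarrow> real measure" where
  "projected_measure T Q H N \<Lambda> \<phi> =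
     distr (density (tower_lborel T Q H N \<Lambda>) (\<lambda>p. ennreal (\<phi> p))) unit_borel (tower_proj T \<Lambda>)"

text \<open>
  \<open>\<nu>\<close> is a measure obtained for the hole \<open>H\<close> by the tower construction with parameter \<open>\<delta>\<close>, for some
  choice of the partition into the intervals $\Lambda^{(k)}$ and of the fixed density on the tower.
  Densities are functions modulo null sets, hence the fixed point equation holds almost everywhere.
\<close>
definition tower_measure ::
  "(real \<Rightarrow> real) \<Rightarrow> real set set \<Rightarrow> real \<Rightarrow> real \<Rightarrow> real \<Rightarrow> real \<Rightarrow> real set \<Rightarrow> real measure \<Rightarrow> bool" where
  "tower_measure T Ihat \<alpha> \<mu> Chat \<delta> H \<nu> \<longleftrightarrow>
     (let Q = mono_intervals Ihat H;
          M = (1 + C_const \<alpha> \<mu> Chat \<delta>) / (1 - a_const \<alpha> \<mu> Chat \<delta>)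
      in \<exists>N \<Lambda>. \<exists>\<phi> \<in> X_set T Q H N \<Lambda> \<alpha> \<mu> M.
           small_partition Q H \<delta> N \<Lambda> \<and>
           (AE p in tower_lborel T Q H N \<Lambda>. normalized_transfer T Q H N \<Lambda> \<phi> p = \<phi> p) \<and>
           \<nu> = projected_measure T Q H N \<Lambda> \<phi>)"

section \<open>Invariant measures and convergence\<close>

definition acim :: "(real \<Rightarrow> real) \<Rightarrow> real measure \<Rightarrow> bool" where
  "acim T \<nu> \<longleftrightarrow> sets \<nu> = sets unit_borel \<and> prob_space \<nu> \<and>
     absolutely_continuous unit_lborel \<nu> \<and> distr \<nu> \<nu> T = \<nu>"

definition converges_weakly ::
  "('a \<Rightarrow> real measure) \<Rightarrow> real measure \<Rightarrow> 'a filter \<Rightarrow> bool" where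
  "converges_weakly \<nu> \<nu>0 F \<longleftrightarrow>
     (\<forall>g::real \<Rightarrow> real. continuous_on {0..1} g \<longrightarrow>
        ((\<lambda>s. LINT x|\<nu> s. g x) \<longlongrightarrow> (LINT x|\<nu>0. g x)) F)"

text \<open>Convergence in $L^1([0,1])$ of the densities with respect to Lebesgue measure.\<close>
definition densities_converge_L1 ::
  "('a \<Rightarrow> real measure) \<Rightarrow> real measure \<Rightarrow> 'a filter \<Rightarrow> bool" where
  "densities_converge_L1 \<nu> \<nu>0 F \<longleftrightarrow>
     ((\<lambda>s. \<integral>\<^sup>+x. ennreal \<bar>enn2real (RN_deriv unit_lborel (\<nu> s) x) -
                          enn2real (RN_deriv unit_lborel \<nu>0 x)\<bar> \<partial>unit_lborel) \<longlongrightarrow> 0) F"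

end

theory Submission
  imports Defs
begin

text \<open>
  On level $l$ of the tower the number $2^l$ of cells and the bound $M e^{\xi l}$ for the density are
  beaten by the expansion $|(\hat T^l)'| \ge \mu^l$ of the projection, because
  $2 e^{\xi}/\mu \le \sqrt{2/\mu} < 1$.  Hence all $\nu_s$ have densities bounded by the same constant
  $B$.  The fixed point equation shows that $\nu_s$ is conditionally invariant up to the mass that
  escapes, so $|\nu_s(\hat T^{-1}A) - \nu_s(A)|$ is at most a constant times $m(H_s) \le s$.  A weak limit of
  $\nu_s$ along a sequence $s \to 0$ again has density at most $B$; the convergence holds
  on every Borel set, and the limit is an absolutely continuous invariant measure.

  Such a measure is unique: if $h_1, h_2$ are two invariant densities, then $\{h_1 > h_2\}$ is
  invariant modulo null sets.  By bounded distortion an invariant set of positive measure contains a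
  branch domain modulo null sets, and the iterates of a branch domain cover $[0,1]$, so the set has full measure.  Condition (A1)
  is used to see that every $\hat I_j$ contains an interval of monotonicity for $H_t$.

  For $\alpha = 1$ the densities on the cells are Lipschitz.  Up to an error that is uniform
  in $s$ and tends to $0$ with the mesh, $\nu_s$ is therefore a multiple of Lebesgue measure on each
  interval of a grid, which makes the convergence uniform over all Borel sets.
\<close>

section \<open>Measures with bounded density and Lipschitz functions\<close>

text \<open>Because \<open>T\<close> has discontinuities, weak convergence alone does not carry
  invariance to a limit. The uniform bound on the densities does: a Borel set is squeezed between a
  closed and an open set of nearly equal Lebesgue measure, so the limit along a subsequence holds
  for the set and for its preimage alike. Uniformity in s rests on the base of the tower having at
  most 1/\<delta> intervals, with \<delta> and M common to all holes. The eigenvalue of conditional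
  invariance is never estimated directly: testing the mass balance with the whole interval shows
  that it is 1 minus the escaped mass. For \<alpha> = 1, condition (A1) prescribes \<delta> as a
  minimal length without saying that it is positive. Positivity is read off from the partition for a
  hole too small to fill a branch domain, and only then does (A1) give m(H_t) < \<delta>. Also for
  \<alpha> = 1, the seminorm controls a derivative only almost everywhere. Extracting a Lipschitz
  constant from it needs almost everywhere differentiability of Lipschitz functions, which the
  covering argument below provides.\<close>

lemma open_interval_eq:
  fixes J :: "real set"
  assumes "open J" "connected J" "J \<noteq> {}" "bounded J"
  shows "J = {Inf J<..<Sup J}" and "Inf J < Sup J"
proof -
  have bd: "bdd_below J" "bdd_above J"
    using assms(4) bounded_imp_bdd_below bounded_imp_bdd_above by auto
  show eq: "J = {Inf J<..<Sup J}"
  proof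
    show "J \<subseteq> {Inf J<..<Sup J}"
    proof
      fix x assume x: "x \<in> J"
      then obtain e where e: "e > 0" "ball x e \<subseteq> J" using assms(1) open_contains_ball by blast
      have "x - e/2 \<in> J" "x + e/2 \<in> J" using e by (auto simp: dist_real_def subset_iff)
      then have "Inf J \<le> x - e/2" "x + e/2 \<le> Sup J"
        using bd by (auto intro: cInf_lower cSup_upper)
      then show "x \<in> {Inf J<..<Sup J}" using e by auto
    qed
    show "{Inf J<..<Sup J} \<subseteq> J"
    proof
      fix x assume x: "x \<in> {Inf J<..<Sup J}"
      then obtain y z where "y \<in> J" "y < x" "z \<in> J" "x < z"
        using bd assms(3) by (metis cInf_less_iff less_cSup_iff greaterThanLessThan_iff)
      then show "x \<in> J"
        using assms(2) by (metis connected_iff_interval less_imp_le)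
    qed
  qed
  show "Inf J < Sup J" using eq assms(3) by (metis greaterThanLessThan_empty_iff not_le)
qed

text \<open>An open set is the disjoint union of its countably many components, so the bound for
  intervals sums up. Boundedness ensures that each component has two real endpoints.\<close>

lemma emeasure_open_le_lborel:
  fixes \<mu> :: "real measure"
  assumes sets [measurable_cong]: "sets \<mu> = sets borel" and c: "0 \<le> c"
    and le: "\<And>a b. a < b \<Longrightarrow> emeasure \<mu> {a<..<b} \<le> ennreal (c * (b - a))"
    and U: "open U" and bU: "bounded U"
  shows "emeasure \<mu> U \<le> ennreal c * emeasure lborel U"
proof -
  let ?K = "components U"
  have oJ: "open J" "connected J" "J \<noteq> {}" "bounded J" if "J \<in> ?K" for J
    using open_components[OF U that] in_components_connected[OF that] in_components_nonempty[OF that]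
      bounded_subset[OF bU in_components_subset[OF that]] by blast+
  have disj: "disjoint_family_on (\<lambda>J. J) ?K"
    using pairwise_disjoint_components[of U] by (auto simp: pairwise_def disjnt_def disjoint_family_on_def)
  have cnt: "countable ?K"
    by (rule countable_disjoint_open_subsets)
      (use oJ(1) disj in \<open>auto simp: disjoint_def disjoint_family_on_def\<close>)
  have bor: "J \<in> sets borel" if "J \<in> ?K" for J using oJ[OF that] by auto
  have UN: "U = (\<Union>J\<in>?K. J)" using Union_components[of U] by simp
  have "emeasure \<mu> U = (\<integral>\<^sup>+J. emeasure \<mu> J \<partial>count_space ?K)"
    by (subst UN, intro emeasure_UN_countable) (use bor disj cnt in \<open>auto simp: sets\<close>)
  also have "\<dots> \<le> (\<integral>\<^sup>+J. ennreal c * emeasure lborel J \<partial>count_space ?K)"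
  proof (intro nn_integral_mono)
    fix J assume "J \<in> space (count_space ?K)"
    then have J: "J \<in> ?K" by simp
    note eq = open_interval_eq[OF oJ[OF J]]
    have "emeasure \<mu> {Inf J<..<Sup J} \<le> ennreal (c * (Sup J - Inf J))" using le eq(2) by auto
    also have "\<dots> = ennreal c * emeasure lborel {Inf J<..<Sup J}"
      using eq(2) c by (simp add: ennreal_mult)
    finally show "emeasure \<mu> J \<le> ennreal c * emeasure lborel J" using eq(1) by simp
  qed
  also have "\<dots> = ennreal c * (\<integral>\<^sup>+J. emeasure lborel J \<partial>count_space ?K)"
    by (rule nn_integral_cmult) simp
  also have "(\<integral>\<^sup>+J. emeasure lborel J \<partial>count_space ?K) = emeasure lborel U"
    by (subst (2) UN, intro emeasure_UN_countable[symmetric]) (use bor disj cnt in auto)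
  finally show ?thesis .
qed

text \<open>Open sets approximate a bounded Borel set from outside in Lebesgue measure, and the
  previous bound applies to them; exhausting the line by bounded windows gives the general
  case.\<close>

lemma emeasure_le_lborel:
  fixes \<mu> :: "real measure"
  assumes sets [measurable_cong]: "sets \<mu> = sets borel" and c: "0 \<le> c"
    and le: "\<And>a b. a < b \<Longrightarrow> emeasure \<mu> {a<..<b} \<le> ennreal (c * (b - a))"
    and A [measurable]: "A \<in> sets borel"
  shows "emeasure \<mu> A \<le> ennreal c * emeasure lborel A"
proof -
  have bdd: "emeasure \<mu> B \<le> ennreal c * emeasure lborel B"
    if B[measurable]: "B \<in> sets borel" and bB: "B \<subseteq> {-n<..<n}" for B and n :: real
  proof (rule ennreal_le_epsilon)
    fix e :: real assume e: "e > 0"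
    \<comment> \<open>Dividing by c + 1 keeps the error c * e / (c + 1) below e and covers c =
      0.\<close>
    obtain U where U: "open U" "B \<subseteq> U" "emeasure lborel (U - B) < ennreal (e / (c + 1))"
      using outer_regular_lborel[OF B, of "e / (c+1)"] e c by auto
    define V where "V = U \<inter> {-n<..<n}"
    have V: "open V" "bounded V" "B \<subseteq> V" "V - B \<subseteq> U - B"
      unfolding V_def using U bB by (auto intro: bounded_subset[of "{-n<..<n}"])
    have [measurable]: "V \<in> sets borel" "U \<in> sets borel" using V U by auto
    have "emeasure \<mu> B \<le> emeasure \<mu> V" using V by (intro emeasure_mono) (auto simp: sets)
    also have "\<dots> \<le> ennreal c * emeasure lborel V"
      using emeasure_open_le_lborel[OF sets c le V(1,2)] .
    also have "\<dots> \<le> ennreal c * (emeasure lborel B + emeasure lborel (U - B))"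
      using V by (intro mult_left_mono order.trans[OF emeasure_mono emeasure_subadditive]) auto
    also have "\<dots> = ennreal c * emeasure lborel B + ennreal c * emeasure lborel (U - B)"
      by (simp add: distrib_left)
    also have "\<dots> \<le> ennreal c * emeasure lborel B + ennreal c * ennreal (e / (c + 1))"
      using U(3) by (intro add_left_mono mult_left_mono) auto
    also have "ennreal c * ennreal (e / (c + 1)) \<le> ennreal e"
      using c e by (subst ennreal_mult[symmetric]) (auto simp: field_simps intro!: ennreal_leI)
    finally show "emeasure \<mu> B \<le> ennreal c * emeasure lborel B + ennreal e"
      by (simp add: add_left_mono)
  qed
  have UN: "A = (\<Union>n::nat. A \<inter> {-real n<..<real n})"
    using reals_Archimedean2 by (auto simp: abs_less_iff[symmetric]) (metis abs_less_iff minus_less_iff reals_Archimedean2)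
  have inc: "incseq (\<lambda>n::nat. A \<inter> {-real n<..<real n})" by (auto simp: incseq_def)
  have "emeasure \<mu> A = (SUP n::nat. emeasure \<mu> (A \<inter> {-real n<..<real n}))"
    by (subst UN, rule SUP_emeasure_incseq[symmetric, OF _ inc]) (auto simp: sets)
  also have "\<dots> \<le> ennreal c * emeasure lborel A"
  proof (rule SUP_least)
    fix n :: nat
    have "emeasure \<mu> (A \<inter> {-real n<..<real n}) \<le> ennreal c * emeasure lborel (A \<inter> {-real n<..<real n})"
      by (rule bdd[of _ "real n"]) auto
    also have "\<dots> \<le> ennreal c * emeasure lborel A" by (intro mult_left_mono emeasure_mono) auto
    finally show "emeasure \<mu> (A \<inter> {-real n<..<real n}) \<le> ennreal c * emeasure lborel A" .
  qed
  finally show ?thesis .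
qed

text \<open>A form of Lebesgue differentiation. Each point of S lies in arbitrarily short intervals
  of mean density at least q, although the density on S is below p. A disjoint Vitali subfamily W,
  chosen inside an open set only slightly larger than A = {g < p}, satisfies q |W| \<le> p |W| + c
  |U0 - A|, so W is small; and W covers S up to a negligible set. Since S may fail to be Borel, the
  conclusion goes through covers of small measure.\<close>

lemma Vitali_density:
  fixes g :: "real \<Rightarrow> real"
  assumes g [measurable]: "g \<in> borel_measurable borel" and gc: "\<And>x. 0 \<le> g x" "\<And>x. g x \<le> c"
    and pq: "0 \<le> p" "p < q"
    and S: "\<And>x d. x \<in> S \<Longrightarrow> 0 < d \<Longrightarrow> \<exists>u v. u \<le> x \<and> x \<le> v \<and> u < v \<and> v - u < d \<and>
              ennreal (q * (v - u)) \<le> emeasure (density lborel (\<lambda>x. ennreal (g x))) {u..v}"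
    and Sp: "\<And>x. x \<in> S \<Longrightarrow> g x < p" and bS: "S \<subseteq> {-n<..<n}"
  shows "negligible S"
proof (rule negligible_outer_le[THEN iffD2], intro allI impI)
  fix e :: real assume e: "e > 0"
  define \<nu> where "\<nu> = density lborel (\<lambda>x. ennreal (g x))"
  have sets\<nu>[measurable_cong]: "sets \<nu> = sets borel" by (simp add: \<nu>_def)
  have c0: "0 \<le> c" using gc order_trans by blast
  define A where "A = {x. g x < p} \<inter> {-n<..<n}"
  have A[measurable]: "A \<in> sets borel" unfolding A_def by measurable
  \<comment> \<open>With this choice (q - p) |W| \<le> c * e' yields |W| \<le> e; the denominator c
    + 1 allows c = 0.\<close>
  define e' where "e' = e * (q - p) / (c + 1)"
  have e': "e' > 0" using e pq c0 by (simp add: e'_def)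
  obtain U0 where U0: "open U0" "A \<subseteq> U0" "emeasure lborel (U0 - A) < ennreal e'"
    using outer_regular_lborel[OF A e'] by auto
  define U where "U = U0 \<inter> {-n<..<n}"
  have U: "open U" "A \<subseteq> U" "U \<subseteq> {-n<..<n}" unfolding U_def using U0 by (auto simp: A_def)
  have [measurable]: "U \<in> sets borel" "U0 \<in> sets borel" using U U0 by auto
  define K where "K = {(u, v). u < v \<and> {u..v} \<subseteq> U \<and> ennreal (q * (v - u)) \<le> emeasure \<nu> {u..v}}"
  \<comment> \<open>The covering theorem speaks of balls, so an interval is coded by its midpoint
    and half its length.\<close>
  define a where "a = (\<lambda>(u, v). (u + v) / 2 :: real)"
  define r where "r = (\<lambda>(u, v). (v - u) / 2 :: real)"
  have cb: "cball (a i) (r i) = {fst i..snd i}" for i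
    by (cases i) (auto simp: a_def r_def cball_def dist_real_def abs_le_iff field_simps)
  obtain C where C: "countable C" "C \<subseteq> K"
    "pairwise (\<lambda>i j. disjnt (cball (a i) (r i)) (cball (a j) (r j))) C"
    "negligible (S - (\<Union>i\<in>C. cball (a i) (r i)))"
  proof (rule Vitali_covering_theorem_cballs[of K r S a])
    show "0 < r i" if "i \<in> K" for i using that by (auto simp: K_def r_def)
    fix x d :: real assume x: "x \<in> S" and d: "0 < d"
    have "x \<in> U" using x Sp[OF x] bS U(2) by (auto simp: A_def)
    then obtain d' where d': "d' > 0" "ball x d' \<subseteq> U" using U(1) open_contains_ball by blast
    obtain u v where uv: "u \<le> x" "x \<le> v" "u < v" "v - u < min d d'"
      "ennreal (q * (v - u)) \<le> emeasure \<nu> {u..v}"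
      using S[OF x, of "min d d'"] d d' by (auto simp: \<nu>_def)
    have "{u..v} \<subseteq> ball x d'" using uv by (auto simp: dist_real_def)
    then have "(u, v) \<in> K" using uv d' by (auto simp: K_def)
    then show "\<exists>i. i \<in> K \<and> x \<in> cball (a i) (r i) \<and> r i < d"
      using uv unfolding cb by (intro exI[of _ "(u, v)"]) (auto simp: r_def)
  qed auto
  define W where "W = (\<Union>i\<in>C. {fst i..snd i})"
  have W[measurable]: "W \<in> sets borel" unfolding W_def using C(1) by (intro sets.countable_UN') auto
  have WU: "W \<subseteq> U" using C(2) by (fastforce simp: W_def K_def)
  have disj: "disjoint_family_on (\<lambda>i. {fst i..snd i}) C"
    using C(3) unfolding cb by (auto simp: pairwise_def disjnt_def disjoint_family_on_def)
  have finW: "emeasure lborel W \<le> ennreal (2 * \<bar>n\<bar>)"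
  proof -
    have "emeasure lborel W \<le> emeasure lborel {-\<bar>n\<bar>..\<bar>n\<bar>}" using WU U(3) by (intro emeasure_mono) auto
    then show ?thesis by simp
  qed
  have "ennreal q * emeasure lborel W = ennreal q * (\<integral>\<^sup>+i. emeasure lborel {fst i..snd i} \<partial>count_space C)"
    unfolding W_def by (subst emeasure_UN_countable) (use disj C(1) in auto)
  also have "\<dots> = (\<integral>\<^sup>+i. ennreal q * emeasure lborel {fst i..snd i} \<partial>count_space C)"
    by (rule nn_integral_cmult[symmetric]) simp
  also have "\<dots> \<le> (\<integral>\<^sup>+i. emeasure \<nu> {fst i..snd i} \<partial>count_space C)"
    using C(2) pq by (intro nn_integral_mono) (auto simp: K_def ennreal_mult[symmetric])
  also have "\<dots> = emeasure \<nu> W"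
    unfolding W_def by (subst emeasure_UN_countable) (use disj C(1) in auto)
  also have "emeasure \<nu> W \<le> (\<integral>\<^sup>+x. ennreal p * indicator W x + ennreal c * indicator (U0 - A) x \<partial>lborel)"
  proof -
    have "emeasure \<nu> W = (\<integral>\<^sup>+x. ennreal (g x) * indicator W x \<partial>lborel)"
      by (simp add: \<nu>_def emeasure_density)
    also have "\<dots> \<le> (\<integral>\<^sup>+x. ennreal p * indicator W x + ennreal c * indicator (U0 - A) x \<partial>lborel)"
    proof (rule nn_integral_mono)
      fix x
      show "ennreal (g x) * indicator W x \<le> ennreal p * indicator W x + ennreal c * indicator (U0 - A) x"
      proof (cases "x \<in> W")
        case True
        then have "x \<in> U" using WU by auto
        then show ?thesis using True gc[of x]
          by (cases "g x < p") (auto simp: A_def U_def indicator_def intro!: ennreal_leI add_increasing)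
      qed auto
    qed
    finally show ?thesis .
  qed
  also have "\<dots> = ennreal p * emeasure lborel W + ennreal c * emeasure lborel (U0 - A)"
    by (subst nn_integral_add) (auto simp: nn_integral_cmult_indicator)
  also have "\<dots> \<le> ennreal p * emeasure lborel W + ennreal c * ennreal e'"
    using U0(3) by (intro add_left_mono mult_left_mono) auto
  finally have main: "ennreal q * emeasure lborel W \<le> ennreal p * emeasure lborel W + ennreal c * ennreal e'" .
  define w where "w = measure lborel W"
  have fin: "emeasure lborel W < \<infinity>" using finW by (rule order.strict_trans1) simp
  then have w: "emeasure lborel W = ennreal w" "0 \<le> w" by (simp_all add: w_def emeasure_eq_ennreal_measure)
  have "q * w \<le> p * w + c * e'"
    using main pq c0 w(2) e'
    by (simp add: w(1) flip: ennreal_mult ennreal_plus)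
  then have "(q - p) * w \<le> c * e'" by (simp add: algebra_simps)
  also have "c * e' \<le> (q - p) * e" using c0 e pq unfolding e'_def
    by (auto simp: field_simps intro!: mult_nonneg_nonneg)
  finally have we: "w \<le> e" using pq by simp
  have Wl: "W \<in> lmeasurable" using fin by (simp add: fmeasurable_def)
  have nl: "S - W \<in> lmeasurable" "measure lebesgue (S - W) = 0"
    using C(4) unfolding cb W_def[symmetric] by (auto simp: negligible_iff_measure)
  show "\<exists>T. S \<subseteq> T \<and> T \<in> lmeasurable \<and> measure lebesgue T \<le> e"
  proof (intro exI conjI)
    show "S \<subseteq> W \<union> (S - W)" by auto
    show "W \<union> (S - W) \<in> lmeasurable" using Wl nl(1) by (rule fmeasurable.Un)
    have "measure lebesgue (W \<union> (S - W)) \<le> measure lebesgue W + measure lebesgue (S - W)"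
      using Wl nl by (intro measure_Un_le) (auto dest: fmeasurableD)
    then show "measure lebesgue (W \<union> (S - W)) \<le> e" using we nl(2) by (simp add: w_def measure_completion)
  qed
qed


section \<open>Almost everywhere differentiability of Lipschitz functions\<close>

lemma AE_lborel_not_negligible: "negligible S \<Longrightarrow> AE x in lborel. x \<notin> S"
  by (subst AE_completion_iff[symmetric]) (auto simp: negligible_iff_null_sets intro: AE_not_in)

text \<open>Radon--Nikodym for the Stieltjes measure of \<open>F\<close>; Vitali covering excludes the sets where the
  difference quotients stay away from the density.\<close>
lemma monotone_Lipschitz_AE_derivative:
  fixes F :: "real \<Rightarrow> real"
  assumes mono: "\<And>u v. u \<le> v \<Longrightarrow> F u \<le> F v"
    and lip: "\<And>u v. u \<le> v \<Longrightarrow> F v - F u \<le> c * (v - u)" and c: "0 < c"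
  obtains g where "g \<in> borel_measurable borel" "\<And>x. 0 \<le> g x" "\<And>x. g x \<le> c"
    "\<And>u v. u \<le> v \<Longrightarrow> (\<integral>\<^sup>+x\<in>{u..v}. ennreal (g x) \<partial>lborel) = ennreal (F v - F u)"
    "AE x in lborel. (F has_field_derivative g x) (at x)"
proof -
  have cont: "continuous (at x) F" for x
  proof -
    have "c-lipschitz_on UNIV F"
    proof (rule lipschitz_onI)
      fix x y :: real show "dist (F x) (F y) \<le> c * dist x y"
        using mono[of x y] mono[of y x] lip[of x y] lip[of y x]
        by (cases "x \<le> y") (auto simp: dist_real_def)
    qed (use c in auto)
    then show ?thesis using lipschitz_on_continuous_on continuous_on_eq_continuous_at by blast
  qed
  define \<mu> where "\<mu> = interval_measure F"
  have s\<mu>[measurable_cong]: "sets \<mu> = sets borel" by (simp add: \<mu>_def)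
  have Ioc: "emeasure \<mu> {u<..v} = ennreal (F v - F u)" if "u \<le> v" for u v
    unfolding \<mu>_def using that mono cont
    by (intro emeasure_interval_measure_Ioc) (auto intro: continuous_within_subset)
  have le: "emeasure \<mu> A \<le> ennreal c * emeasure lborel A" if "A \<in> sets borel" for A
  proof (rule emeasure_le_lborel[OF s\<mu> _ _ that])
    fix a b :: real assume ab: "a < b"
    have "emeasure \<mu> {a<..<b} \<le> emeasure \<mu> {a<..b}" by (intro emeasure_mono) auto
    also have "\<dots> \<le> ennreal (c * (b - a))" using Ioc[of a b] ab lip[of a b] by (auto intro!: ennreal_leI)
    finally show "emeasure \<mu> {a<..<b} \<le> ennreal (c * (b - a))" .
  qed (use c in auto)
  have ac: "absolutely_continuous lborel \<mu>"
    unfolding absolutely_continuous_def null_sets_def using le by (auto simp: s\<mu>) (metis le_zero_eq mult_zero_right)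
  obtain f where f[measurable]: "f \<in> borel_measurable borel" and fd: "density lborel f = \<mu>"
    using sigma_finite_measure.Radon_Nikodym[OF sigma_finite_lborel ac] by (auto simp: s\<mu>)
  have fc: "AE x in lborel. f x \<le> ennreal c"
  proof -
    \<comment> \<open>Bounded windows keep the exceptional sets A of finite measure, so that
      comparing (c + 1/(n+1)) |A| with c |A| forces |A| = 0.\<close>
    have "AE x in lborel. \<not> (x \<in> {-real n..real n} \<and> ennreal (c + 1 / Suc n) \<le> f x)" for n
    proof -
      define A where "A = {x. x \<in> {-real n..real n} \<and> ennreal (c + 1 / Suc n) \<le> f x}"
      have [measurable]: "A \<in> sets borel" unfolding A_def by measurable
      have "emeasure lborel A \<le> emeasure lborel {-real n..real n}" by (intro emeasure_mono) (auto simp: A_def)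
      then have "emeasure lborel A < \<infinity>" by (rule order.strict_trans1) simp
      then have m: "emeasure lborel A = ennreal (measure lborel A)" by (simp add: emeasure_eq_ennreal_measure)
      have "ennreal (c + 1 / Suc n) * emeasure lborel A = (\<integral>\<^sup>+x. ennreal (c + 1 / Suc n) * indicator A x \<partial>lborel)"
        by (simp add: nn_integral_cmult_indicator)
      also have "\<dots> \<le> (\<integral>\<^sup>+x. f x * indicator A x \<partial>lborel)"
        by (intro nn_integral_mono) (auto simp: A_def indicator_def)
      also have "\<dots> = emeasure \<mu> A" by (simp add: fd[symmetric] emeasure_density)
      also have "\<dots> \<le> ennreal c * emeasure lborel A" by (rule le) simp
      finally have "ennreal ((c + 1 / Suc n) * measure lborel A) \<le> ennreal (c * measure lborel A)"
        using c unfolding m by (subst (1 2) ennreal_mult) auto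
      then have "(c + 1 / Suc n) * measure lborel A \<le> c * measure lborel A"
        using c by (simp add: ennreal_le_iff del: of_nat_Suc)
      then have "1 / real (Suc n) * measure lborel A \<le> 0" by (simp only: distrib_right)
      then have "measure lborel A \<le> 0"
        using mult_pos_pos[of "1 / real (Suc n)" "measure lborel A"] by (metis not_le of_nat_0_less_iff zero_less_Suc zero_less_divide_1_iff)
      then have "emeasure lborel A = 0" unfolding m by (rule ennreal_neg)
      then have "A \<in> null_sets lborel" by (simp add: null_sets_def)
      from AE_not_in[OF this] show ?thesis by (rule AE_mp) (auto simp: A_def)
    qed
    then have "AE x in lborel. \<forall>n. \<not> (x \<in> {-real n..real n} \<and> ennreal (c + 1 / Suc n) \<le> f x)"
      by (simp add: AE_all_countable)
    then show ?thesis
    proof (eventually_elim)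
      case (elim x)
      show "f x \<le> ennreal c"
      proof (rule ccontr)
        assume neg: "\<not> ?thesis"
        obtain e where e: "e > 0" "ennreal (c + e) < f x"
        proof -
          obtain z where z: "ennreal c < z" "z < f x" using neg dense[of "ennreal c" "f x"] by (auto simp: not_le)
          have "z < top" using z(2) top_greatest by (rule order.strict_trans2)
          then obtain r where r: "z = ennreal r" "0 \<le> r" by (cases z) auto
          then have "c < r" using z(1) c by (simp add: ennreal_less_iff)
          then show thesis using that[of "r - c"] z(2) r(1) by simp
        qed
        obtain N where N: "real N > max \<bar>x\<bar> (1 / e)" using reals_Archimedean2 by blast
        have "1 / e < real N" "\<bar>x\<bar> < real N" using N by simp_all
        then have "1 < e * real N" using e(1) by (simp add: divide_less_eq mult.commute)
        then have "1 < e * real (Suc N)" using e(1) by (simp add: distrib_left)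
        then have "1 / Suc N \<le> e" by (simp add: divide_le_eq del: of_nat_Suc)
        then have "ennreal (c + 1 / Suc N) \<le> ennreal (c + e)" by (intro ennreal_leI) simp
        also note less_imp_le[OF e(2)]
        finally have "ennreal (c + 1 / Suc N) \<le> f x" .
        then show False using elim[rule_format, of N] \<open>\<bar>x\<bar> < real N\<close> by (simp add: abs_less_iff)
      qed
    qed
  qed
  \<comment> \<open>Truncation makes the bounds hold at every point, as the covering lemma demands;
    g agrees with f almost everywhere.\<close>
  define g where "g x = min c (enn2real (f x))" for x
  have g[measurable]: "g \<in> borel_measurable borel" unfolding g_def by measurable
  have g0: "0 \<le> g x" "g x \<le> c" for x using c by (auto simp: g_def)
  have gf: "AE x in lborel. ennreal (g x) = f x"
    using fc
  proof (eventually_elim)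
    case (elim x)
    then obtain r where "f x = ennreal r" "0 \<le> r" by (cases "f x") (auto simp: top_unique)
    then show ?case using elim c by (auto simp: g_def min_def)
  qed
  have gd: "density lborel (\<lambda>x. ennreal (g x)) = \<mu>"
    unfolding fd[symmetric] by (rule density_cong) (use gf in auto)
  have Icc: "emeasure \<mu> {u..v} = ennreal (F v - F u)" if "u \<le> v" for u v
  proof -
    have "emeasure \<mu> {u} \<le> ennreal c * emeasure lborel {u}" by (rule le) simp
    then have 0: "{u} \<in> null_sets \<mu>" by (simp add: null_sets_def s\<mu>)
    have "{u..v} = {u<..v} \<union> {u}" using that by auto
    moreover have "emeasure \<mu> ({u<..v} \<union> {u}) = emeasure \<mu> {u<..v}"
      using 0 by (intro emeasure_Un_null_set) (auto simp: s\<mu>)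
    ultimately have "emeasure \<mu> {u..v} = emeasure \<mu> {u<..v}" by simp
    then show ?thesis using Ioc[OF that] by simp
  qed
  \<comment> \<open>Quotients over all intervals containing x are considered, since that is the
    shape of the covering lemma; the derivative is recovered from those with x as an
    endpoint.\<close>
  define R1 where "R1 q x d \<longleftrightarrow> (\<exists>u v. u \<le> x \<and> x \<le> v \<and> u < v \<and> v - u < d \<and> q * (v - u) \<le> F v - F u)" for q x d
  define R2 where "R2 p x d \<longleftrightarrow> (\<exists>u v. u \<le> x \<and> x \<le> v \<and> u < v \<and> v - u < d \<and> F v - F u \<le> p * (v - u))" for p x d
  define S1 where "S1 p q n = {x. x \<in> {-real n<..<real n} \<and> g x < p \<and> (\<forall>d>0. R1 q x d)}" for p q n
  define S2 where "S2 p q n = {x. x \<in> {-real n<..<real n} \<and> q < g x \<and> (\<forall>d>0. R2 p x d)}" for p q n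
  have n1: "negligible (S1 p q n)" if "0 \<le> p" "p < q" for p q n
  proof (rule Vitali_density[OF g g0 that, of _ "real n"])
    fix x d :: real assume "x \<in> S1 p q n" "0 < d"
    then obtain u v where uv: "u \<le> x" "x \<le> v" "u < v" "v - u < d" "q * (v - u) \<le> F v - F u"
      unfolding S1_def R1_def by blast
    then show "\<exists>u v. u \<le> x \<and> x \<le> v \<and> u < v \<and> v - u < d \<and>
        ennreal (q * (v - u)) \<le> emeasure (density lborel (\<lambda>x. ennreal (g x))) {u..v}"
      by (intro exI[of _ u] exI[of _ v]) (simp add: gd Icc ennreal_leI)
  qed (auto simp: S1_def)
  \<comment> \<open>The lower estimate is the upper one for the complementary density c - g, whose
    mean over [u, v] is c minus the difference quotient of F.\<close>
  have n2: "negligible (S2 p q n)" if "p < q" "q \<le> c" for p q n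
  proof (rule Vitali_density[of "\<lambda>x. c - g x" c "c - q" "c - p" _ "real n"])
    fix x d :: real assume "x \<in> S2 p q n" "0 < d"
    then obtain u v where uv: "u \<le> x" "x \<le> v" "u < v" "v - u < d" "F v - F u \<le> p * (v - u)"
      unfolding S2_def R2_def by blast
    have I: "(\<integral>\<^sup>+x\<in>{u..v}. ennreal (g x) \<partial>lborel) = ennreal (F v - F u)"
      using Icc[of u v] uv by (simp add: gd[symmetric] emeasure_density)
    have "(\<integral>\<^sup>+x\<in>{u..v}. ennreal (c - g x) \<partial>lborel) + (\<integral>\<^sup>+x\<in>{u..v}. ennreal (g x) \<partial>lborel)
       = (\<integral>\<^sup>+x\<in>{u..v}. ennreal c \<partial>lborel)"
      using g0 by (subst nn_integral_add[symmetric])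
         (auto intro!: nn_integral_cong simp: indicator_def simp flip: ennreal_plus)
    also have "\<dots> = ennreal (c * (v - u))" using uv c by (simp add: nn_integral_cmult_indicator ennreal_mult)
    finally have eq: "(\<integral>\<^sup>+x\<in>{u..v}. ennreal (c - g x) \<partial>lborel) + ennreal (F v - F u) = ennreal (c * (v - u))"
      by (simp add: I)
    have a: "0 \<le> (c - p) * (v - u)" using uv(3) that by (intro mult_nonneg_nonneg) linarith+
    have b: "0 \<le> F v - F u" using mono[of u v] uv(3) by linarith
    have "(c - p) * (v - u) + (F v - F u) \<le> c * (v - u)" using uv(5) by (simp add: left_diff_distrib)
    then have "ennreal ((c - p) * (v - u)) + ennreal (F v - F u) \<le> ennreal (c * (v - u))"
      unfolding ennreal_plus[OF a b, symmetric] by (rule ennreal_leI)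
    then have "ennreal ((c - p) * (v - u)) \<le> (\<integral>\<^sup>+x\<in>{u..v}. ennreal (c - g x) \<partial>lborel)"
      unfolding eq[symmetric] by (simp add: add.commute ennreal_add_left_cancel_le)
    then show "\<exists>u v. u \<le> x \<and> x \<le> v \<and> u < v \<and> v - u < d \<and>
        ennreal ((c - p) * (v - u)) \<le> emeasure (density lborel (\<lambda>x. ennreal (c - g x))) {u..v}"
      using uv by (intro exI[of _ u] exI[of _ v]) (auto simp: emeasure_density)
  qed (use that g0 in \<open>auto simp: S2_def\<close>)
  \<comment> \<open>Rational thresholds and integer windows leave only countably many negligible
    sets.\<close>
  define Z where "Z = (\<Union>i\<in>\<rat> \<times> \<rat> \<times> (UNIV :: nat set). case i of (p, q, n) \<Rightarrow>
     (if 0 \<le> p \<and> p < q then S1 p q n else {}) \<union> (if p < q \<and> q \<le> c then S2 p q n else {}))"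
  have "countable (\<rat> \<times> \<rat> \<times> (UNIV :: nat set) :: (real \<times> real \<times> nat) set)"
    by (intro countable_SIGMA countable_rat countableI_type)
  then have "negligible Z"
    unfolding Z_def
  proof (intro negligible_countable_Union countable_image)
    fix S assume "S \<in> (\<lambda>i. case i of (p, q, n) \<Rightarrow> (if 0 \<le> p \<and> p < q then S1 p q n else {}) \<union>
      (if p < q \<and> q \<le> c then S2 p q n else {})) ` (\<rat> \<times> \<rat> \<times> UNIV)"
    then obtain p q n where "S = (if 0 \<le> p \<and> p < q then S1 p q n else {}) \<union>
      (if p < q \<and> q \<le> c then S2 p q n else {})"
      by (elim imageE) (clarsimp split: prod.splits)
    then show "negligible S" using n1[of p q n] n2[of p q n] by (simp split: if_splits)
  qed
  from AE_lborel_not_negligible[OF this]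
  have der: "AE x in lborel. (F has_field_derivative g x) (at x)"
  proof (eventually_elim)
    case (elim x)
    obtain n where "\<bar>x\<bar> < real n" using reals_Archimedean2 by blast
    then have n: "x \<in> {-real n<..<real n}" by auto
    have up: "\<exists>d>0. \<not> R1 (g x + e) x d" if e: "e > 0" for e
    proof -
      obtain p where p: "p \<in> \<rat>" "g x < p" "p < g x + e" using Rats_dense_in_real[of "g x" "g x + e"] e by auto
      obtain q where q: "q \<in> \<rat>" "p < q" "q < g x + e" using Rats_dense_in_real[of p "g x + e"] p by auto
      have p0: "0 \<le> p" using g0(1)[of x] p by linarith
      have "x \<in> Z" if "x \<in> S1 p q n"
        unfolding Z_def by (rule UN_I[of "(p, q, n)"]) (use p q p0 that in simp_all)
      then have "\<not> (\<forall>d>0. R1 q x d)" using elim n p(2) unfolding S1_def by blast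
      then obtain d where d: "d > 0" "\<not> R1 q x d" by blast
      have "R1 q x d" if r: "R1 (g x + e) x d"
      proof -
        obtain u v where uv: "u \<le> x" "x \<le> v" "u < v" "v - u < d" "(g x + e) * (v - u) \<le> F v - F u"
          using r unfolding R1_def by blast
        have "q * (v - u) \<le> (g x + e) * (v - u)" using q(3) uv(3) by (intro mult_right_mono) linarith+
        then show ?thesis using uv unfolding R1_def by (intro exI[of _ u] exI[of _ v] conjI) linarith+
      qed
      then show ?thesis using d by (intro exI[of _ d]) auto
    qed
    have lo: "\<exists>d>0. \<not> R2 (g x - e) x d" if e: "e > 0" for e
    proof -
      obtain q where q: "q \<in> \<rat>" "g x - e < q" "q < g x" using Rats_dense_in_real[of "g x - e" "g x"] e by auto
      obtain p where p: "p \<in> \<rat>" "g x - e < p" "p < q" using Rats_dense_in_real[of "g x - e" q] q by auto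
      have p0: "q \<le> c" using g0(2)[of x] q by linarith
      have "x \<in> Z" if "x \<in> S2 p q n"
        unfolding Z_def by (rule UN_I[of "(p, q, n)"]) (use p q p0 that in simp_all)
      then have "\<not> (\<forall>d>0. R2 p x d)" using elim n q(3) unfolding S2_def by blast
      then obtain d where d: "d > 0" "\<not> R2 p x d" by blast
      have "R2 p x d" if r: "R2 (g x - e) x d"
      proof -
        obtain u v where uv: "u \<le> x" "x \<le> v" "u < v" "v - u < d" "F v - F u \<le> (g x - e) * (v - u)"
          using r unfolding R2_def by blast
        have "(g x - e) * (v - u) \<le> p * (v - u)" using p(2) uv(3) by (intro mult_right_mono) linarith+
        then show ?thesis using uv unfolding R2_def by (intro exI[of _ u] exI[of _ v] conjI) linarith+
      qed
      then show ?thesis using d by (intro exI[of _ d]) auto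
    qed
    show ?case
      unfolding has_field_derivative_def has_derivative_at_alt
    proof (intro conjI allI impI)
      show "bounded_linear ((*) (g x))" by (rule bounded_linear_mult_right)
      fix e :: real assume e: "e > 0"
      obtain d1 d2 where d1: "d1 > 0" "\<not> R1 (g x + e) x d1" and d2: "d2 > 0" "\<not> R2 (g x - e) x d2"
        using up[OF e] lo[OF e] by blast
      have bd: "(g x - e) * (v - u) < F v - F u \<and> F v - F u < (g x + e) * (v - u)"
        if "u \<le> x" "x \<le> v" "u < v" "v - u < min d1 d2" for u v
      proof (intro conjI; rule ccontr)
        assume "\<not> (g x - e) * (v - u) < F v - F u"
        then have "R2 (g x - e) x d2" unfolding R2_def using that by (intro exI[of _ u] exI[of _ v] conjI) linarith+
        then show False using d2(2) by simp
      next
        assume "\<not> F v - F u < (g x + e) * (v - u)"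
        then have "R1 (g x + e) x d1" unfolding R1_def using that by (intro exI[of _ u] exI[of _ v] conjI) linarith+
        then show False using d1(2) by simp
      qed
      show "\<exists>d>0. \<forall>y. norm (y - x) < d \<longrightarrow> norm (F y - F x - g x * (y - x)) \<le> e * norm (y - x)"
      proof (intro exI[of _ "min d1 d2"] conjI allI impI)
        fix y assume y: "norm (y - x) < min d1 d2"
        consider "y = x" | "x < y" | "y < x" by linarith
        then show "norm (F y - F x - g x * (y - x)) \<le> e * norm (y - x)"
        proof cases
          case 2
          then show ?thesis using bd[of x y] y
            by (simp add: abs_le_iff left_diff_distrib distrib_right right_diff_distrib)
        next
          case 3
          then show ?thesis using bd[of y x] y
            by (simp add: abs_le_iff left_diff_distrib distrib_right right_diff_distrib)
        qed simp
      qed (use d1(1) d2(1) in auto)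
    qed
  qed
  show thesis
  proof (rule that[OF g g0 _ der])
    fix u v :: real assume "u \<le> v"
    then show "(\<integral>\<^sup>+x\<in>{u..v}. ennreal (g x) \<partial>lborel) = ennreal (F v - F u)"
      using Icc[of u v] by (simp add: gd[symmetric] emeasure_density)
  qed
qed


text \<open>The difference quotients are only controlled where \<open>f\<close> is differentiable; almost everywhere
  differentiability of Lipschitz functions makes this sufficient.\<close>
lemma lipschitz_derivative_bound:
  fixes f :: "real \<Rightarrow> real"
  assumes lip: "L-lipschitz_on {a<..<b} f"
    and der: "AE x in lborel. x \<in> {a<..<b} \<longrightarrow> f differentiable (at x) \<longrightarrow> \<bar>deriv f x\<bar> \<le> K"
    and K: "0 \<le> K"
  shows "K-lipschitz_on {a<..<b} f"
proof -
  have L: "0 \<le> L" using lip by (rule lipschitz_on_nonneg)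
  have main: "\<bar>f y - f x\<bar> \<le> K * (y - x)" if xy: "x < y" "x \<in> {a<..<b}" "y \<in> {a<..<b}" for x y
  proof -
    \<comment> \<open>Clamping extends f constantly beyond [x, y], so h is Lipschitz on the whole
      line.\<close>
    define h where "h u = f (max x (min y u))" for u
    have h: "\<bar>h v - h u\<bar> \<le> L * (v - u)" if "u \<le> v" for u v
    proof -
      have "dist (h v) (h u) \<le> L * dist (max x (min y v)) (max x (min y u))"
        unfolding h_def using xy by (intro lipschitz_onD[OF lip]) auto
      also have "\<dots> \<le> L * (v - u)" using L that by (intro mult_left_mono) (auto simp: dist_real_def)
      finally show ?thesis by (simp add: dist_real_def)
    qed
    define F where "F u = h u + L * u" for u
    have mono: "F u \<le> F v" if "u \<le> v" for u v
      using h[OF that] by (auto simp: F_def algebra_simps)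
    have Flip: "F v - F u \<le> (2 * L + 1) * (v - u)" if "u \<le> v" for u v
      using h[OF that] that by (auto simp: F_def algebra_simps)
    obtain g where g[measurable]: "g \<in> borel_measurable borel" and g0: "\<And>x. 0 \<le> g x" "\<And>x. g x \<le> 2 * L + 1"
      and Icc: "\<And>u v. u \<le> v \<Longrightarrow> (\<integral>\<^sup>+x\<in>{u..v}. ennreal (g x) \<partial>lborel) = ennreal (F v - F u)"
      and dF: "AE x in lborel. (F has_field_derivative g x) (at x)"
      using monotone_Lipschitz_AE_derivative[OF mono Flip] L by auto
    have gK: "AE u in lborel. u \<in> {x..y} \<longrightarrow> L - K \<le> g u \<and> g u \<le> L + K"
      using der dF AE_lborel_singleton[of x] AE_lborel_singleton[of y]
    proof (eventually_elim)
      case (elim u)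
      show ?case
      proof
        assume "u \<in> {x..y}"
        then have u: "u \<in> {x<..<y}" using elim by auto
        have "((\<lambda>u. F u - L * u) has_field_derivative g u - L) (at u)"
          using elim(2) by (auto intro!: derivative_eq_intros)
        then have "(h has_field_derivative g u - L) (at u)" by (simp add: F_def)
        then have "(f has_field_derivative g u - L) (at u)"
        proof (rule has_field_derivative_transform_within_open[of _ _ _ "{x<..<y}"])
          show "h v = f v" if "v \<in> {x<..<y}" for v using that by (auto simp: h_def)
        qed (use u in auto)
        then have "f differentiable (at u)" "deriv f u = g u - L"
          by (auto intro: DERIV_imp_deriv simp: real_differentiable_def)
        then show "L - K \<le> g u \<and> g u \<le> L + K" using elim(1) u xy by auto
      qed
    qed
    have up: "F y - F x \<le> (L + K) * (y - x)"
    proof -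
      have "ennreal (F y - F x) \<le> (\<integral>\<^sup>+u\<in>{x..y}. ennreal (L + K) \<partial>lborel)"
        unfolding Icc[OF less_imp_le[OF xy(1)], symmetric]
        by (intro nn_integral_mono_AE) (use gK in \<open>eventually_elim, auto simp: indicator_def intro!: ennreal_leI\<close>)
      also have "\<dots> = ennreal ((L + K) * (y - x))" using xy L K by (simp add: nn_integral_cmult_indicator ennreal_mult)
      finally show ?thesis using L K xy by (simp add: ennreal_le_iff)
    qed
    have lo: "(L - K) * (y - x) \<le> F y - F x"
    \<comment> \<open>For L \<le> K the left side is nonpositive and monotonicity of F is enough;
      \<open>ennreal\<close> would lose the sign.\<close>
    proof (cases "L \<le> K")
      case True then show ?thesis using mono[of x y] xy
        by (smt (verit) mult_nonneg_nonneg mult_minus_left)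
    next
      case False
      then have "ennreal ((L - K) * (y - x)) = (\<integral>\<^sup>+u\<in>{x..y}. ennreal (L - K) \<partial>lborel)"
        using xy by (simp add: nn_integral_cmult_indicator ennreal_mult)
      also have "\<dots> \<le> ennreal (F y - F x)"
        unfolding Icc[OF less_imp_le[OF xy(1)], symmetric]
        by (intro nn_integral_mono_AE) (use gK in \<open>eventually_elim, auto simp: indicator_def intro!: ennreal_leI\<close>)
      finally show ?thesis using mono[of x y] xy by (simp add: ennreal_le_iff)
    qed
    have "h x = f x" "h y = f y" using xy by (auto simp: h_def)
    then show ?thesis using up lo by (simp add: F_def algebra_simps abs_le_iff)
  qed
  show ?thesis
  proof (rule lipschitz_onI[OF _ K])
    fix x y assume "x \<in> {a<..<b}" "y \<in> {a<..<b}"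
    then show "dist (f x) (f y) \<le> K * dist x y"
      using main[of x y] main[of y x] by (cases x y rule: linorder_cases) (auto simp: dist_real_def)
  qed
qed

text \<open>The formula for measures of images identifies the push-forward under f of the measure
  |f'| dx on D with Lebesgue measure on f(D); integrating G against both sides gives the claim for
  every nonnegative Borel G. Boundedness of the image keeps the measures finite.\<close>

lemma nn_integral_change_of_variables:
  fixes f f' :: "real \<Rightarrow> real" and G :: "real \<Rightarrow> ennreal"
  assumes D: "open D" and der: "\<And>x. x \<in> D \<Longrightarrow> (f has_field_derivative f' x) (at x)"
    and f': "continuous_on D f'" and inj: "inj_on f D" and bdd: "bounded (f ` D)"
    and G [measurable]: "G \<in> borel_measurable borel"
  shows "(\<integral>\<^sup>+x\<in>D. ennreal \<bar>f' x\<bar> * G (f x) \<partial>lborel) = (\<integral>\<^sup>+y\<in>f ` D. G y \<partial>lborel)"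
proof -
  have cf: "continuous_on D f" using der by (meson DERIV_isCont continuous_at_imp_continuous_on)
  have of: "open (f ` D)" using invariance_of_domain[OF cf D inj] .
  have [measurable]: "D \<in> sets borel" "f ` D \<in> sets borel" using D of by auto
  have fm: "(\<lambda>x. indicator D x *\<^sub>R f x) \<in> borel_measurable borel" "(\<lambda>x. indicator D x *\<^sub>R f' x) \<in> borel_measurable borel"
    by (intro borel_measurable_continuous_on_indicator cf f'; simp)+
  \<comment> \<open>f and f' are controlled only on D; cutting them off makes them Borel on the
    line.\<close>
  define F where "F x = indicator D x * f x" for x
  define F' where "F' x = indicator D x * f' x" for x
  have [measurable]: "F \<in> borel_measurable borel" "F' \<in> borel_measurable borel"
    using fm by (simp_all add: F_def[abs_def] F'_def[abs_def])
  have eq: "distr (density lborel (\<lambda>x. ennreal \<bar>F' x\<bar>* indicator D x)) borel F = density lborel (indicator (f ` D))"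
  proof (rule measure_eqI)
    fix A assume "A \<in> sets (distr (density lborel (\<lambda>x. ennreal \<bar>F' x\<bar> * indicator D x)) borel F)"
    then have A[measurable]: "A \<in> sets borel" by simp
    define S where "S = D \<inter> f -` A"
    have "S = D \<inter> F -` A" by (auto simp: S_def F_def)
    then have S[measurable]: "S \<in> sets borel" using measurable_sets[of F borel borel A] by auto
    have fS: "f ` S = A \<inter> f ` D" by (auto simp: S_def)
    have "bounded (f ` S)" using bdd by (rule bounded_subset) (auto simp: S_def)
    then have lm: "f ` S \<in> lmeasurable"
      unfolding fS by (intro bounded_set_imp_lmeasurable) (auto simp: fS)
    have *: "(\<lambda>x. \<bar>f' x\<bar> * 1) absolutely_integrable_on S \<and>
           integral S (\<lambda>x. \<bar>f' x\<bar> * 1) = measure lebesgue (f ` S)"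
    proof (subst has_absolute_integral_change_of_variables_1'[where f="\<lambda>_. 1"])
      show "S \<in> sets lebesgue" by simp
      show "inj_on f S" using inj by (rule inj_on_subset) (auto simp: S_def)
      show "(f has_field_derivative f' x) (at x within S)" if "x \<in> S" for x
        using der[of x] that by (auto simp: S_def intro: has_field_derivative_at_within)
      show "(\<lambda>_. 1::real) absolutely_integrable_on f ` S \<and> integral (f ` S) (\<lambda>_. 1) = measure lebesgue (f ` S)"
        using lm by (simp add: lmeasure_integral absolutely_integrable_on_const)
    qed
    have "(\<lambda>x. \<bar>F' x\<bar> * indicator S x) = (\<lambda>x. indicator S x *\<^sub>R (\<bar>f' x\<bar> * 1))"
      by (auto simp: F'_def S_def indicator_def)
    then have i: "integrable lebesgue (\<lambda>x. \<bar>F' x\<bar> * indicator S x)"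
      "integral\<^sup>L lebesgue (\<lambda>x. \<bar>F' x\<bar> * indicator S x) = measure lebesgue (f ` S)"
      using * set_lebesgue_integral_eq_integral(2)[of S "\<lambda>x. \<bar>f' x\<bar> * 1"]
      by (simp_all add: set_integrable_def set_lebesgue_integral_def)
    have m: "(\<lambda>x. \<bar>F' x\<bar> * indicator S x) \<in> borel_measurable lborel" by measurable
    have i': "integrable lborel (\<lambda>x. \<bar>F' x\<bar> * indicator S x)"
      "integral\<^sup>L lborel (\<lambda>x. \<bar>F' x\<bar> * indicator S x) = measure lborel (f ` S)"
      using i m by (auto simp: integrable_completion integral_completion fS measure_completion)
    have "emeasure (distr (density lborel (\<lambda>x. ennreal \<bar>F' x\<bar> * indicator D x)) borel F) A
       = (\<integral>\<^sup>+x. ennreal (\<bar>F' x\<bar> * indicator S x) \<partial>lborel)"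
      using measurable_sets[of F borel borel A]
      by (subst emeasure_distr) (auto simp: emeasure_density S_def F_def indicator_def intro!: nn_integral_cong)
    also have "\<dots> = ennreal (measure lborel (f ` S))"
      using i' by (subst nn_integral_eq_integral) auto
    also have "\<dots> = emeasure lborel (f ` S)"
      using lm by (subst emeasure_eq_ennreal_measure) (auto simp: fmeasurable_def fS)
    also have "\<dots> = emeasure (density lborel (indicator (f ` D))) A"
      unfolding fS by (simp add: emeasure_density Int_commute mult.commute flip: indicator_inter_arith)
    finally show "emeasure (distr (density lborel (\<lambda>x. ennreal \<bar>F' x\<bar>* indicator D x)) borel F) A =
      emeasure (density lborel (indicator (f ` D))) A" .
  qed simp
  have "(\<integral>\<^sup>+y\<in>f ` D. G y \<partial>lborel) = (\<integral>\<^sup>+y. G y \<partial>density lborel (indicator (f ` D)))"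
    by (simp add: nn_integral_density mult.commute)
  also have "\<dots> = (\<integral>\<^sup>+x. ennreal \<bar>F' x\<bar> * indicator D x * G (F x) \<partial>lborel)"
    by (simp add: eq[symmetric] nn_integral_distr nn_integral_density)
  also have "\<dots> = (\<integral>\<^sup>+x\<in>D. ennreal \<bar>f' x\<bar> * G (f x) \<partial>lborel)"
    by (intro nn_integral_cong) (auto simp: F_def F'_def indicator_def)
  finally show ?thesis by simp
qed

section \<open>Branches of iterates and bounded distortion\<close>

lemma card_le_2I:
  assumes "\<And>x y z. x \<in> S \<Longrightarrow> y \<in> S \<Longrightarrow> z \<in> S \<Longrightarrow> x \<noteq> y \<Longrightarrow> x \<noteq> z \<Longrightarrow> y \<noteq> z \<Longrightarrow> False"
  shows "finite S \<and> card S \<le> 2"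
proof (rule ccontr)
  assume *: "\<not> ?thesis"
  have "\<exists>U. U \<subseteq> S \<and> finite U \<and> card U = 3"
  proof (cases "finite S")
    case True
    then have "3 \<le> card S" using * by auto
    then show ?thesis using obtain_subset_with_card_n by metis
  qed (use infinite_arbitrarily_large in blast)
  then obtain U where "U \<subseteq> S" "card U = 3" by auto
  then obtain x y z where "U = {x, y, z}" "x \<noteq> y" "x \<noteq> z" "y \<noteq> z" by (auto simp: card_3_iff)
  then show False using assms[of x y z] \<open>U \<subseteq> S\<close> by auto
qed

lemma finite_frontier_interval:
  fixes S :: "real set"
  assumes "connected S" "bounded S"
  shows "finite (frontier S)"
proof (rule finite_subset)
  show "frontier S \<subseteq> {Inf S, Sup S}"
  proof
    fix x assume x: "x \<in> frontier S"
    have bd: "bdd_below S" "bdd_above S" using assms(2) bounded_imp_bdd_below bounded_imp_bdd_above by auto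
    show "x \<in> {Inf S, Sup S}"
    proof (rule ccontr)
      assume ne: "x \<notin> {Inf S, Sup S}"
      have "x \<in> closure S" "S \<noteq> {}" using x by (auto simp: frontier_def)
      have "closure S \<subseteq> {Inf S..Sup S}"
        by (rule closure_minimal) (use bd in \<open>auto intro: cInf_lower cSup_upper\<close>)
      then have "Inf S \<le> x" "x \<le> Sup S" using \<open>x \<in> closure S\<close> by auto
      then have "Inf S < x" "x < Sup S" using ne by auto
      then obtain y z where yz: "y \<in> S" "y < x" "z \<in> S" "x < z"
        unfolding cInf_less_iff[OF \<open>S \<noteq> {}\<close> bd(1)] less_cSup_iff[OF \<open>S \<noteq> {}\<close> bd(2)] by blast
      have "{y..z} \<subseteq> S" using connected_contains_Icc[OF assms(1) yz(1,3)] .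
      then have "{y<..<z} \<subseteq> interior S" by (intro interior_maximal) auto
      then have "x \<in> interior S" using yz by auto
      then show False using x by (simp add: frontier_def)
    qed
  qed
qed simp

lemma finite_frontier_Union:
  assumes "finite \<U>" "\<And>S. S \<in> \<U> \<Longrightarrow> finite (frontier S)"
  shows "finite (frontier (\<Union>\<U>))"
  using assms
proof (induction \<U>)
  case (insert S \<U>)
  then show ?case using finite_subset[OF frontier_Un_subset[of S "\<Union>\<U>"]] by auto
qed simp

locale expanding =
  fixes T :: "real \<Rightarrow> real" and Ihat :: "real set set" and \<alpha> \<mu> Chat :: real
  assumes expanding: "expanding_map T Ihat \<alpha> \<mu> Chat"
begin

lemma \<mu>_gt_2: "2 < \<mu>" and \<alpha>_pos: "0 < \<alpha>" and Chat_pos: "0 < Chat"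
  and finite_Ihat: "finite Ihat" and disjoint_Ihat: "pairwise disjnt Ihat"
  and cofinite_Ihat: "finite ({0..1} - \<Union>Ihat)"
  and T_image: "T ` {0..1} \<subseteq> {0..1}"
  using expanding unfolding expanding_map_def by - (elim conjE, assumption)+

lemma T_range: "x \<in> {0..1} \<Longrightarrow> T x \<in> {0..1}"
  by (rule subsetD[OF T_image imageI])

lemma funpow_range: "x \<in> {0..1} \<Longrightarrow> (T ^^ n) x \<in> {0..1}"
  by (induction n) (simp_all add: T_range del: atLeastAtMost_iff)

lemmas Ihat_props = expanding[unfolded expanding_map_def, THEN conjunct2, THEN conjunct2, THEN conjunct2, THEN conjunct2, THEN conjunct2, THEN conjunct2, THEN conjunct2, THEN bspec]

lemma Ihat_interval:
  assumes "J \<in> Ihat"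
  shows "open J" "connected J" "J \<noteq> {}" "J \<subseteq> {0<..<1}" "J \<subseteq> {0..1}"
proof -
  obtain l r where "0 \<le> l" "l < r" "r \<le> 1" "J = {l<..<r}"
    using Ihat_props[OF assms] by blast
  then show "open J" "connected J" "J \<noteq> {}" "J \<subseteq> {0<..<1}" "J \<subseteq> {0..1}" by auto
qed

lemma Ihat_mono: "J \<in> Ihat \<Longrightarrow> strict_mono_on J T \<or> strict_antimono_on J T"
  by (drule Ihat_props) blast

lemma deriv_Holder: "J \<in> Ihat \<Longrightarrow> x \<in> J \<Longrightarrow> y \<in> J \<Longrightarrow> \<bar>deriv T x - deriv T y\<bar> \<le> Chat * \<bar>x - y\<bar> powr \<alpha>"
  and deriv_ge: "J \<in> Ihat \<Longrightarrow> x \<in> J \<Longrightarrow> \<mu> \<le> \<bar>deriv T x\<bar>"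
  by (drule Ihat_props, blast)+

lemma T_has_deriv: "J \<in> Ihat \<Longrightarrow> x \<in> J \<Longrightarrow> (T has_field_derivative deriv T x) (at x)"
  using Ihat_props field_differentiable_derivI by blast

lemma continuous_on_deriv:
  assumes "J \<in> Ihat" shows "continuous_on J (deriv T)"
  unfolding continuous_on_def
proof
  fix x assume x: "x \<in> J"
  have "((\<lambda>y. Chat * \<bar>y - x\<bar> powr \<alpha>) \<longlongrightarrow> Chat * \<bar>x - x\<bar> powr \<alpha>) (at x within J)"
    using \<alpha>_pos by (intro tendsto_intros) auto
  then have "((\<lambda>y. Chat * \<bar>y - x\<bar> powr \<alpha>) \<longlongrightarrow> 0) (at x within J)" by simp
  then have "((\<lambda>y. deriv T y - deriv T x) \<longlongrightarrow> 0) (at x within J)"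
    by (rule Lim_null_comparison[rotated])
      (auto simp: eventually_at_topological intro!: exI[of _ UNIV] deriv_Holder[OF assms _ x])
  then show "(deriv T \<longlongrightarrow> deriv T x) (at x within J)" using LIM_zero_iff by blast
qed

definition branch :: "nat \<Rightarrow> real set \<Rightarrow> bool" where
  "branch n \<omega> \<longleftrightarrow> open \<omega> \<and> connected \<omega> \<and> \<omega> \<subseteq> {0..1} \<and> (\<forall>i<n. \<exists>J\<in>Ihat. (T ^^ i) ` \<omega> \<subseteq> J)"

text \<open>The chain rule product, kept as a product because expansion and distortion are estimated
  factor by factor.\<close>

definition iter_deriv :: "nat \<Rightarrow> real \<Rightarrow> real" where
  "iter_deriv n x = (\<Prod>i<n. deriv T ((T ^^ i) x))"

lemma branch_step:
  assumes "branch n \<omega>" "i < n"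
  obtains J where "J \<in> Ihat" "\<And>x. x \<in> \<omega> \<Longrightarrow> (T ^^ i) x \<in> J" "(T ^^ i) ` \<omega> \<subseteq> J"
  using assms unfolding branch_def by (metis image_subset_iff)

lemma branch_mono: "branch n \<omega> \<Longrightarrow> m \<le> n \<Longrightarrow> branch m \<omega>"
  by (auto simp: branch_def)

lemma branch_SucD: "branch (Suc n) \<omega> \<Longrightarrow> branch n \<omega>"
  by (rule branch_mono) auto

lemma branch_has_deriv:
  assumes "branch n \<omega>" "x \<in> \<omega>"
  shows "((T ^^ n) has_field_derivative iter_deriv n x) (at x)"
  using assms(1)
proof (induction n)
  case 0 show ?case by (simp add: iter_deriv_def)
next
  case (Suc n)
  obtain J where "J \<in> Ihat" "(T ^^ n) ` \<omega> \<subseteq> J" using Suc.prems by (auto simp: branch_def)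
  then have "((\<lambda>x. T ((T ^^ n) x)) has_field_derivative deriv T ((T ^^ n) x) * iter_deriv n x) (at x)"
    using Suc.IH[OF branch_SucD[OF Suc.prems]] assms(2) by (intro DERIV_chain2 T_has_deriv) auto
  then show ?case by (simp add: iter_deriv_def mult.commute o_def)
qed

lemma branch_continuous: "branch n \<omega> \<Longrightarrow> continuous_on \<omega> (T ^^ n)"
  by (meson DERIV_isCont branch_has_deriv continuous_at_imp_continuous_on)

lemma branch_iter_deriv_ge:
  assumes "branch n \<omega>" "x \<in> \<omega>" shows "\<mu> ^ n \<le> \<bar>iter_deriv n x\<bar>"
proof -
  have "(\<Prod>i<n. \<mu>) \<le> (\<Prod>i<n. \<bar>deriv T ((T ^^ i) x)\<bar>)"
  proof (intro prod_mono conjI)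
    fix i assume "i \<in> {..<n}"
    then obtain J where "J \<in> Ihat" "(T ^^ i) x \<in> J" using branch_step[OF assms(1)] assms(2) by (metis lessThan_iff)
    then show "\<mu> \<le> \<bar>deriv T ((T ^^ i) x)\<bar>" by (rule deriv_ge)
  qed (use \<mu>_gt_2 in auto)
  then show ?thesis by (simp add: iter_deriv_def abs_prod)
qed

lemma branch_iter_deriv_nz: "branch n \<omega> \<Longrightarrow> x \<in> \<omega> \<Longrightarrow> iter_deriv n x \<noteq> 0"
  using branch_iter_deriv_ge[of n \<omega> x] \<mu>_gt_2 zero_less_power[of \<mu> n] by linarith

lemma branch_continuous_iter_deriv:
  assumes "branch n \<omega>" shows "continuous_on \<omega> (iter_deriv n)"
  unfolding iter_deriv_def
proof (intro continuous_on_prod)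
  fix i assume i: "i \<in> {..<n}"
  then obtain J where J: "J \<in> Ihat" "(T ^^ i) ` \<omega> \<subseteq> J" using branch_step[OF assms] by (metis lessThan_iff)
  have "continuous_on \<omega> (T ^^ i)" using i by (intro branch_continuous branch_mono[OF assms]) auto
  then show "continuous_on \<omega> (\<lambda>x. deriv T ((T ^^ i) x))"
    by (rule continuous_on_compose2[OF continuous_on_deriv[OF J(1)] _ J(2)])
qed

lemma branch_strict_mono:
  assumes "branch n \<omega>"
  shows "strict_mono_on \<omega> (T ^^ n) \<or> strict_antimono_on \<omega> (T ^^ n)"
  using assms
proof (induction n)
  case 0 show ?case by (auto simp: strict_mono_on_def)
next
  case (Suc n)
  obtain J where J: "J \<in> Ihat" "(T ^^ n) ` \<omega> \<subseteq> J" using Suc.prems by (auto simp: branch_def)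
  then have *: "(T ^^ n) x \<in> J" if "x \<in> \<omega>" for x using that by auto
  from Suc.IH[OF branch_SucD[OF Suc.prems]] Ihat_mono[OF J(1)] show ?case
    unfolding monotone_on_def funpow.simps comp_apply using * by (elim disjE) metis+
qed

lemma branch_inj:
  assumes "branch n \<omega>" shows "inj_on (T ^^ n) \<omega>"
proof (rule linorder_inj_onI')
  fix x y assume xy: "x \<in> \<omega>" "y \<in> \<omega>" "x < y"
  from branch_strict_mono[OF assms] show "(T ^^ n) x \<noteq> (T ^^ n) y"
  proof
    assume "strict_mono_on \<omega> (T ^^ n)"
    from monotone_onD[OF this xy] show ?thesis by simp
  next
    assume "strict_antimono_on \<omega> (T ^^ n)"
    from monotone_onD[OF this xy] show ?thesis by simp
  qed
qed

lemma branch_image: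
  assumes "branch n \<omega>"
  shows "open ((T ^^ n) ` \<omega>)" "connected ((T ^^ n) ` \<omega>)" "(T ^^ n) ` \<omega> \<subseteq> {0..1}"
proof -
  show "open ((T ^^ n) ` \<omega>)"
    using invariance_of_domain[OF branch_continuous[OF assms] _ branch_inj[OF assms]] assms
    by (auto simp: branch_def)
  show "connected ((T ^^ n) ` \<omega>)"
    using branch_continuous[OF assms] assms unfolding branch_def by (blast intro: connected_continuous_image)
  have "\<omega> \<subseteq> {0..1}" using assms by (simp add: branch_def)
  then show "(T ^^ n) ` \<omega> \<subseteq> {0..1}"
    by (intro image_subsetI funpow_range) (rule subsetD)
qed

lemma branch_expands:
  assumes "branch n \<omega>" "x \<in> \<omega>" "y \<in> \<omega>"
  shows "\<mu> ^ n * \<bar>x - y\<bar> \<le> \<bar>(T ^^ n) x - (T ^^ n) y\<bar>"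
proof -
  have *: "\<mu> ^ n * (y - x) \<le> \<bar>(T ^^ n) y - (T ^^ n) x\<bar>" if xy: "x < y" "x \<in> \<omega>" "y \<in> \<omega>" for x y
  proof -
    have sub: "{x..y} \<subseteq> \<omega>" using assms(1) xy by (intro connected_contains_Icc) (simp_all add: branch_def)
    have "((T ^^ n) has_field_derivative iter_deriv n z) (at z)" if "x \<le> z" "z \<le> y" for z
      using sub that by (intro branch_has_deriv[OF assms(1)]) auto
    from MVT2[OF xy(1) this] obtain z where z: "x < z" "z < y" "(T ^^ n) y - (T ^^ n) x = (y - x) * iter_deriv n z"
      by blast
    have "z \<in> \<omega>" using sub z by auto
    then have "\<mu> ^ n \<le> \<bar>iter_deriv n z\<bar>" by (rule branch_iter_deriv_ge[OF assms(1)])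
    then show ?thesis using z xy by (simp add: abs_mult mult.commute mult_left_mono)
  qed
  show ?thesis using *[of x y] *[of y x] assms by (cases x y rule: linorder_cases) auto
qed

lemma branch_subset: "branch n \<omega> \<Longrightarrow> open \<zeta> \<Longrightarrow> connected \<zeta> \<Longrightarrow> \<zeta> \<subseteq> \<omega> \<Longrightarrow> branch n \<zeta>"
  unfolding branch_def by (meson image_mono order_trans)

text \<open>Monotonicity of the iterate is what makes the preimage of an interval within \<omega> an
  interval again.\<close>

lemma branch_pullback:
  assumes "branch n \<omega>" "open J" "connected J"
  shows "open (\<omega> \<inter> (T ^^ n) -` J)" "connected (\<omega> \<inter> (T ^^ n) -` J)" "branch n (\<omega> \<inter> (T ^^ n) -` J)"
proof -
  show o: "open (\<omega> \<inter> (T ^^ n) -` J)"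
    using branch_continuous[OF assms(1)] assms by (intro continuous_open_preimage) (auto simp: branch_def)
  have J: "z \<in> J" if "x \<in> J" "y \<in> J" "x \<le> z" "z \<le> y" for x y z
    using assms(3) that unfolding connected_iff_interval by blast
  have w: "z \<in> \<omega>" if "x \<in> \<omega>" "y \<in> \<omega>" "x \<le> z" "z \<le> y" for x y z
    using assms(1) that unfolding branch_def connected_iff_interval by blast
  show c: "connected (\<omega> \<inter> (T ^^ n) -` J)"
    unfolding connected_iff_interval
  proof (intro ballI allI impI)
    fix x y z assume x: "x \<in> \<omega> \<inter> (T ^^ n) -` J" and y: "y \<in> \<omega> \<inter> (T ^^ n) -` J" and z: "x \<le> z" "z \<le> y"
    have zw: "z \<in> \<omega>" using w x y z by blast
    from branch_strict_mono[OF assms(1)] have "(T ^^ n) z \<in> J"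
    proof
      assume m: "strict_mono_on \<omega> (T ^^ n)"
      have "(T ^^ n) x \<le> (T ^^ n) z" "(T ^^ n) z \<le> (T ^^ n) y"
        using monotone_onD[OF m, of x z] monotone_onD[OF m, of z y] x y zw z by (cases "x = z"; cases "z = y"; simp)+
      then show ?thesis using J[of "(T ^^ n) x" "(T ^^ n) y"] x y by auto
    next
      assume m: "strict_antimono_on \<omega> (T ^^ n)"
      have "(T ^^ n) z \<le> (T ^^ n) x" "(T ^^ n) y \<le> (T ^^ n) z"
        using monotone_onD[OF m, of x z] monotone_onD[OF m, of z y] x y zw z by (cases "x = z"; cases "z = y"; simp)+
      then show ?thesis using J[of "(T ^^ n) y" "(T ^^ n) x"] x y by auto
    qed
    then show "z \<in> \<omega> \<inter> (T ^^ n) -` J" using zw by auto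
  qed
  show "branch n (\<omega> \<inter> (T ^^ n) -` J)" using branch_subset[OF assms(1) o c] by auto
qed

lemma branch_Suc: "branch n \<omega> \<Longrightarrow> J \<in> Ihat \<Longrightarrow> (T ^^ n) ` \<omega> \<subseteq> J \<Longrightarrow> branch (Suc n) \<omega>"
  by (auto simp: branch_def less_Suc_eq)

lemma branch_change_of_variables:
  assumes b: "branch n \<omega>" and [measurable]: "G \<in> borel_measurable borel"
  shows "(\<integral>\<^sup>+x\<in>\<omega>. ennreal \<bar>iter_deriv n x\<bar> * G ((T ^^ n) x) \<partial>lborel) = (\<integral>\<^sup>+y\<in>(T ^^ n) ` \<omega>. G y \<partial>lborel)"
  using b branch_image[OF b]
  by (intro nn_integral_change_of_variables branch_has_deriv[OF b] branch_continuous_iter_deriv branch_inj)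
    (auto simp: branch_def intro: bounded_subset[of "{0..1}"])

lemma branch_integral_le:
  assumes b: "branch n \<omega>" and [measurable]: "G \<in> borel_measurable borel"
  shows "ennreal (\<mu> ^ n) * (\<integral>\<^sup>+x\<in>\<omega>. G ((T ^^ n) x) \<partial>lborel) \<le> (\<integral>\<^sup>+y\<in>(T ^^ n) ` \<omega>. G y \<partial>lborel)"
proof -
  have [measurable]: "\<omega> \<in> sets borel" using b by (auto simp: branch_def)
  have "(\<lambda>x. indicator \<omega> x *\<^sub>R (T ^^ n) x) \<in> borel_measurable borel"
    using branch_continuous[OF b] by (intro borel_measurable_continuous_on_indicator) auto
  then have [measurable]: "(\<lambda>x. indicator \<omega> x * (T ^^ n) x) \<in> borel_measurable borel" by simp
  \<comment> \<open>\<open>T ^^ n\<close> is known to be continuous only on \<omega>, so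
    measurability is obtained after cutting the iterate off.\<close>
  have eq: "(\<lambda>x. G ((T ^^ n) x) * indicator \<omega> x) = (\<lambda>x. G (indicator \<omega> x * (T ^^ n) x) * indicator \<omega> x)"
    by (auto simp: indicator_def)
  have meas: "(\<lambda>x. G ((T ^^ n) x) * indicator \<omega> x) \<in> borel_measurable lborel"
    unfolding eq by measurable
  have "ennreal (\<mu> ^ n) * (\<integral>\<^sup>+x\<in>\<omega>. G ((T ^^ n) x) \<partial>lborel) = (\<integral>\<^sup>+x. ennreal (\<mu> ^ n) * (G ((T ^^ n) x) * indicator \<omega> x) \<partial>lborel)"
    by (rule nn_integral_cmult[OF meas, symmetric])
  also have "\<dots> \<le> (\<integral>\<^sup>+x\<in>\<omega>. ennreal \<bar>iter_deriv n x\<bar> * G ((T ^^ n) x) \<partial>lborel)"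
    by (intro nn_integral_mono)
      (auto simp: indicator_def intro!: mult_right_mono ennreal_leI branch_iter_deriv_ge[OF b])
  finally show ?thesis using branch_change_of_variables[OF assms] by simp
qed

lemma branch_emeasure_le:
  assumes b: "branch n \<omega>" shows "ennreal (\<mu> ^ n) * emeasure lborel \<omega> \<le> 1"
proof -
  have [measurable]: "\<omega> \<in> sets borel" "(T ^^ n) ` \<omega> \<in> sets borel"
    using b branch_image[OF b] by (auto simp: branch_def)
  have "ennreal (\<mu> ^ n) * emeasure lborel \<omega> \<le> emeasure lborel ((T ^^ n) ` \<omega>)"
    using branch_integral_le[OF b, of "\<lambda>_. 1"] by simp
  also have "\<dots> \<le> emeasure lborel {0..1::real}"
    using branch_image[OF b] by (intro emeasure_mono) auto
  finally show ?thesis by simp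
qed

text \<open>Time i of n contributes a factor exp(Chat/\<mu> * q^(n-i)) with q = \<mu> powr
  -\<alpha>; a geometric series bounds the product of all these factors by this constant, for every
  n.\<close>

definition distortion :: real where
  "distortion = exp (Chat / \<mu> * (1 / (1 - \<mu> powr - \<alpha>)))"

text \<open>The image of the branch at time i is itself a branch of order n - i, to which expansion
  applies.\<close>

lemma branch_iterate_contraction:
  assumes b: "branch n \<omega>" and xy: "x \<in> \<omega>" "y \<in> \<omega>" and i: "i \<le> n"
  shows "\<mu> ^ (n - i) * \<bar>(T ^^ i) x - (T ^^ i) y\<bar> \<le> \<bar>(T ^^ n) x - (T ^^ n) y\<bar>"
proof -
  have eq: "(T ^^ n) z = (T ^^ (n - i)) ((T ^^ i) z)" for z
    using i by (metis comp_apply funpow_add le_add_diff_inverse2)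
  have bi: "branch i \<omega>" using branch_mono[OF b i] .
  have "branch (n - i) ((T ^^ i) ` \<omega>)"
    unfolding branch_def
  proof (intro conjI allI impI)
    fix j assume "j < n - i"
    then have "j + i < n" by simp
    from branch_step[OF b this] obtain J where "J \<in> Ihat" "(T ^^ (j + i)) ` \<omega> \<subseteq> J" by metis
    then show "\<exists>J\<in>Ihat. (T ^^ j) ` (T ^^ i) ` \<omega> \<subseteq> J" by (auto simp: funpow_add image_comp)
  qed (use branch_image[OF bi] in auto)
  from branch_expands[OF this, of "(T ^^ i) x" "(T ^^ i) y"] xy show ?thesis by (simp add: eq)
qed

text \<open>The last n - i steps expand the distance at time i to at most 1, so that distance is at
  most \<mu>^(i-n). Hoelder continuity turns this into a bound on the ratio of derivatives at time
  i, and the logarithms of these ratios sum geometrically.\<close>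

lemma branch_distortion:
  assumes b: "branch n \<omega>" and xy: "x \<in> \<omega>" "y \<in> \<omega>"
  shows "\<bar>iter_deriv n x\<bar> \<le> distortion * \<bar>iter_deriv n y\<bar>"
proof -
  define q where "q = \<mu> powr - \<alpha>"
  have q: "0 < q" "q < 1" using \<mu>_gt_2 \<alpha>_pos by (auto simp: q_def powr_less_one)
  have dist1: "\<bar>(T ^^ n) x - (T ^^ n) y\<bar> \<le> 1"
    using branch_image(3)[OF b] xy by (auto simp: abs_le_iff) (smt (verit) atLeastAtMost_iff image_subset_iff)+
  have step: "\<bar>deriv T ((T ^^ i) x)\<bar> \<le> exp (Chat / \<mu> * q ^ (n - i)) * \<bar>deriv T ((T ^^ i) y)\<bar>" if i: "i < n" for i
  proof -
    obtain J where J: "J \<in> Ihat" "(T ^^ i) x \<in> J" "(T ^^ i) y \<in> J" using branch_step[OF b i] xy by metis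
    have "\<mu> ^ (n - i) * \<bar>(T ^^ i) x - (T ^^ i) y\<bar> \<le> 1"
      using branch_iterate_contraction[OF b xy, of i] i dist1 by linarith
    then have "\<bar>(T ^^ i) x - (T ^^ i) y\<bar> \<le> 1 / \<mu> ^ (n - i)" using \<mu>_gt_2 by (simp add: field_simps)
    then have "\<bar>(T ^^ i) x - (T ^^ i) y\<bar> powr \<alpha> \<le> (1 / \<mu> ^ (n - i)) powr \<alpha>"
      using \<alpha>_pos by (intro powr_mono2) auto
    also have "\<dots> = q ^ (n - i)"
      using \<mu>_gt_2 by (simp add: q_def powr_divide powr_minus divide_simps powr_powr flip: powr_realpow)
        (simp add: mult.commute)
    finally have "\<bar>deriv T ((T ^^ i) x) - deriv T ((T ^^ i) y)\<bar> \<le> Chat * q ^ (n - i)"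
      using deriv_Holder[OF J] Chat_pos by (meson less_imp_le mult_left_mono order_trans)
    then have "\<bar>deriv T ((T ^^ i) x)\<bar> \<le> \<bar>deriv T ((T ^^ i) y)\<bar> + Chat * q ^ (n - i)" by linarith
    \<comment> \<open>The additive error becomes a relative one since |T'| \<ge> \<mu>.\<close>
    also have "\<dots> \<le> \<bar>deriv T ((T ^^ i) y)\<bar> + Chat / \<mu> * q ^ (n - i) * \<bar>deriv T ((T ^^ i) y)\<bar>"
      using deriv_ge[OF J(1,3)] \<mu>_gt_2 Chat_pos q
      by (auto simp: field_simps intro!: mult_left_mono mult_nonneg_nonneg)
    also have "\<dots> = (1 + Chat / \<mu> * q ^ (n - i)) * \<bar>deriv T ((T ^^ i) y)\<bar>" by (simp add: algebra_simps)
    also have "\<dots> \<le> exp (Chat / \<mu> * q ^ (n - i)) * \<bar>deriv T ((T ^^ i) y)\<bar>"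
      by (intro mult_right_mono exp_ge_add_one_self) auto
    finally show ?thesis .
  qed
  have "\<bar>iter_deriv n x\<bar> = (\<Prod>i<n. \<bar>deriv T ((T ^^ i) x)\<bar>)" by (simp add: iter_deriv_def abs_prod)
  also have "\<dots> \<le> (\<Prod>i<n. exp (Chat / \<mu> * q ^ (n - i)) * \<bar>deriv T ((T ^^ i) y)\<bar>)"
    using step by (intro prod_mono) auto
  also have "\<dots> = exp (\<Sum>i<n. Chat / \<mu> * q ^ (n - i)) * \<bar>iter_deriv n y\<bar>"
    by (simp add: prod.distrib exp_sum iter_deriv_def abs_prod)
  also have "(\<Sum>i<n. Chat / \<mu> * q ^ (n - i)) = Chat / \<mu> * (\<Sum>i<n. q ^ (n - i))" by (simp add: sum_distrib_left)
  also have "(\<Sum>i<n. q ^ (n - i)) = (\<Sum>i<n. q ^ Suc i)"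
    by (subst sum.nat_diff_reindex[symmetric]) (auto intro!: sum.cong simp: Suc_diff_Suc)
  also have "exp (Chat / \<mu> * (\<Sum>i<n. q ^ Suc i)) * \<bar>iter_deriv n y\<bar> \<le> distortion * \<bar>iter_deriv n y\<bar>"
  proof (intro mult_right_mono)
    have "(\<Sum>i<n. q ^ Suc i) \<le> (\<Sum>i<n. q ^ i)" using q by (intro sum_mono power_decreasing) auto
    also have "\<dots> \<le> 1 / (1 - q)" using q
      by (simp add: sum_gp_strict divide_right_mono)
    finally show "exp (Chat / \<mu> * (\<Sum>i<n. q ^ Suc i)) \<le> distortion"
      unfolding distortion_def q_def[symmetric] exp_le_cancel_iff
      by (rule mult_left_mono) (use Chat_pos \<mu>_gt_2 in simp)
  qed auto
  finally show ?thesis .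
qed

text \<open>Product rule for the reciprocals of the factors: each reciprocal is at most 1 and
  earlier distances are at most the final one, so every factor adds one Lipschitz constant. The
  growth in n is harmless, because the estimate is summed over finitely many levels only.\<close>

lemma branch_inverse_iter_deriv_Lipschitz:
  assumes \<alpha>: "\<alpha> = 1" and b: "branch n \<omega>" and xy: "x \<in> \<omega>" "y \<in> \<omega>"
  shows "\<bar>1 / iter_deriv n x - 1 / iter_deriv n y\<bar> \<le> real n * Chat * \<bar>(T ^^ n) x - (T ^^ n) y\<bar>"
proof -
  \<comment> \<open>The induction runs over an initial segment m while the distance stays at the
    final time n.\<close>
  have "\<bar>1 / iter_deriv m x - 1 / iter_deriv m y\<bar> \<le> real m * Chat * \<bar>(T ^^ n) x - (T ^^ n) y\<bar>" if "m \<le> n" for m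
    using that
  proof (induction m)
    case 0 show ?case by (simp add: iter_deriv_def)
  next
    case (Suc m)
    define a a' where "a = 1 / iter_deriv m x" and "a' = 1 / iter_deriv m y"
    define c c' where "c = deriv T ((T ^^ m) x)" and "c' = deriv T ((T ^^ m) y)"
    obtain J where J: "J \<in> Ihat" "(T ^^ m) x \<in> J" "(T ^^ m) y \<in> J"
      using branch_step[OF b Suc_le_lessD[OF Suc.prems]] xy by metis
    have c: "\<mu> \<le> \<bar>c\<bar>" "\<mu> \<le> \<bar>c'\<bar>" using deriv_ge[OF J(1)] J by (auto simp: c_def c'_def)
    have a: "\<bar>a\<bar> \<le> 1"
    proof -
      have bm: "branch m \<omega>" using Suc.prems by (intro branch_mono[OF b]) auto
      have "1 \<le> \<mu> ^ m" using \<mu>_gt_2 by simp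
      then show ?thesis using branch_iter_deriv_ge[OF bm xy(1)] by (simp add: a_def divide_le_eq)
    qed
    have IH: "\<bar>a - a'\<bar> \<le> real m * Chat * \<bar>(T ^^ n) x - (T ^^ n) y\<bar>"
      using Suc by (simp add: a_def a'_def)
    have cc: "\<bar>c - c'\<bar> \<le> Chat * \<bar>(T ^^ n) x - (T ^^ n) y\<bar>"
    proof -
      have "\<bar>c - c'\<bar> \<le> Chat * \<bar>(T ^^ m) x - (T ^^ m) y\<bar>"
        using deriv_Holder[OF J] \<alpha> by (simp add: c_def c'_def)
      moreover have "1 * \<bar>(T ^^ m) x - (T ^^ m) y\<bar> \<le> \<mu> ^ (n - m) * \<bar>(T ^^ m) x - (T ^^ m) y\<bar>"
        using \<mu>_gt_2 by (intro mult_right_mono) auto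
      ultimately show ?thesis
        using branch_iterate_contraction[OF b xy, of m] Suc.prems Chat_pos
        by (smt (verit, best) Suc_leD mult_left_mono)
    qed
    have "1 / iter_deriv (Suc m) x - 1 / iter_deriv (Suc m) y = a * (1 / c - 1 / c') + (a - a') * (1 / c')"
      by (simp add: iter_deriv_def a_def a'_def c_def c'_def algebra_simps)
    also have "\<bar>\<dots>\<bar> \<le> \<bar>a\<bar> * \<bar>1 / c - 1 / c'\<bar> + \<bar>a - a'\<bar> * \<bar>1 / c'\<bar>"
      using abs_triangle_ineq by (metis abs_mult)
    also have "\<dots> \<le> 1 * \<bar>c - c'\<bar> + \<bar>a - a'\<bar> * 1"
    proof (intro add_mono mult_mono a order_refl)
      have nz: "c \<noteq> 0" "c' \<noteq> 0" using c \<mu>_gt_2 by auto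
      have "1 * 1 \<le> \<bar>c\<bar> * \<bar>c'\<bar>" using c \<mu>_gt_2 by (intro mult_mono) auto
      then show "\<bar>1 / c - 1 / c'\<bar> \<le> \<bar>c - c'\<bar>"
        using nz mult_left_mono[of 1 "\<bar>c\<bar> * \<bar>c'\<bar>" "\<bar>c - c'\<bar>"]
        by (simp add: diff_frac_eq abs_mult divide_le_eq abs_minus_commute)
      show "\<bar>1 / c'\<bar> \<le> 1" using c \<mu>_gt_2 by (simp add: divide_le_eq)
    qed auto
    also have "\<dots> \<le> Chat * \<bar>(T ^^ n) x - (T ^^ n) y\<bar> + real m * Chat * \<bar>(T ^^ n) x - (T ^^ n) y\<bar>"
      using cc IH by simp
    finally show ?case by (simp add: algebra_simps)
  qed
  then show ?thesis by simp
qed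

end

section \<open>The cutting process\<close>

text \<open>The partition is kept abstract because the same process runs twice: with
  \<open>mono_intervals\<close> for the tower, and with \<open>Ihat\<close> and no hole in the proof
  of uniqueness.\<close>

locale cutting = expanding +
  fixes Q :: "real set set" and H :: "real set"
  assumes Q_open: "J \<in> Q \<Longrightarrow> open J" and Q_connected: "J \<in> Q \<Longrightarrow> connected J"
    and Q_nonempty: "J \<in> Q \<Longrightarrow> J \<noteq> {}"
    and Q_Ihat: "J \<in> Q \<Longrightarrow> \<exists>K\<in>Ihat. J \<subseteq> K"
    and Q_disjoint: "pairwise disjnt Q"
    and Q_H: "J \<in> Q \<Longrightarrow> J \<inter> H = {}"
    and H_open: "open H" and H_subset: "H \<subseteq> {0..1}"
    and Q_cofinite: "finite ({0..1} - H - \<Union>Q)"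
begin

lemma Q_unique: "J \<in> Q \<Longrightarrow> J' \<in> Q \<Longrightarrow> x \<in> J \<Longrightarrow> x \<in> J' \<Longrightarrow> J = J'"
  using Q_disjoint unfolding pairwise_def disjnt_def by blast

lemma pullbackE:
  assumes "\<zeta> \<in> pullback T Q n \<omega>"
  obtains J where "J \<in> Q" "\<zeta> = \<omega> \<inter> (T ^^ n) -` J" "\<zeta> \<noteq> {}"
  using assms unfolding pullback_def by blast

lemma pullbackI: "J \<in> Q \<Longrightarrow> x \<in> \<omega> \<Longrightarrow> (T ^^ n) x \<in> J \<Longrightarrow> \<omega> \<inter> (T ^^ n) -` J \<in> pullback T Q n \<omega>"
  unfolding pullback_def by blast

lemma pullback_unique:
  assumes "\<zeta> \<in> pullback T Q n \<omega>" "\<zeta>' \<in> pullback T Q n \<omega>" "x \<in> \<zeta>" "x \<in> \<zeta>'"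
  shows "\<zeta> = \<zeta>'"
proof -
  obtain J where J: "J \<in> Q" "\<zeta> = \<omega> \<inter> (T ^^ n) -` J" using assms(1) by (rule pullbackE)
  obtain J' where J': "J' \<in> Q" "\<zeta>' = \<omega> \<inter> (T ^^ n) -` J'" using assms(2) by (rule pullbackE)
  have "J = J'" using Q_unique[OF J(1) J'(1), of "(T ^^ n) x"] assms(3,4) J(2) J'(2) by simp
  then show ?thesis using J J' by simp
qed

text \<open>A piece with full image witnesses that \<omega> covers an element of Q; so in the other
  case there is nothing to remove, and both cases obey one formula.\<close>

lemma kept_eq: "kept T Q n \<omega> = {\<zeta> \<in> pullback T Q n \<omega>. (T ^^ n) ` \<zeta> \<notin> Q}"
proof -
  have "covers T Q n \<omega>" if "\<zeta> \<in> pullback T Q n \<omega>" "(T ^^ n) ` \<zeta> \<in> Q" for \<zeta>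
  proof -
    have "\<zeta> \<subseteq> \<omega>" using that(1) by (rule pullbackE) simp
    then have "(T ^^ n) ` \<zeta> \<subseteq> (T ^^ n) ` \<omega>" by (rule image_mono)
    then show ?thesis using that(2) unfolding covers_def by blast
  qed
  then show ?thesis unfolding kept_def by auto
qed

text \<open>Both cases of the construction stop the same points; they differ only in whether the
  hole is split into components.\<close>

lemma Union_stopped:
  "\<Union>(stopped T Q H n \<omega>) = \<Union>{\<zeta> \<in> pullback T Q n \<omega>. (T ^^ n) ` \<zeta> \<in> Q} \<union> (\<omega> \<inter> (T ^^ n) -` H)"
proof (cases "covers T Q n \<omega>")
  case True
  have "\<Union>({\<omega> \<inter> (T ^^ n) -` h | h. h \<in> components H}) = \<omega> \<inter> (T ^^ n) -` (\<Union>(components H))" by blast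
  moreover have "\<Union>(X - {{}}) = \<Union>X" for X :: "real set set" by auto
  ultimately show ?thesis using True unfolding stopped_def by (simp add: Union_Un_distrib)
next
  case False
  have e: "{\<zeta> \<in> pullback T Q n \<omega>. (T ^^ n) ` \<zeta> \<in> Q} = {}"
    using False kept_eq[of n \<omega>] unfolding kept_def by auto
  have "\<Union>(X - {{}}) = \<Union>X" for X :: "real set set" by auto
  then show ?thesis using False unfolding stopped_def e by simp
qed

text \<open>A kept piece comes from an element of Q that meets the interval V without lying in it.
  Of three disjoint intervals met by V the middle one lies in V, so there are at most two. This is
  the origin of the bound 2^n on the number of pieces.\<close>

lemma kept_card:
  assumes b: "branch n \<omega>"
  shows "finite (kept T Q n \<omega>)" "card (kept T Q n \<omega>) \<le> 2"
proof -
  define V where "V = (T ^^ n) ` \<omega>"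
  define S where "S = {J \<in> Q. V \<inter> J \<noteq> {} \<and> \<not> J \<subseteq> V}"
  have cV: "connected V" using branch_image(2)[OF b] by (simp add: V_def)
  have mid: False if J: "J1 \<in> S" "J2 \<in> S" "J3 \<in> S" and d: "J1 \<noteq> J2" "J2 \<noteq> J3"
    and v: "v1 \<in> V" "v1 \<in> J1" "v2 \<in> V" "v2 \<in> J2" "v3 \<in> V" "v3 \<in> J3" and lt: "v1 < v2" "v2 < v3"
  for J1 J2 J3 v1 v2 v3
  proof -
    have Q: "J1 \<in> Q" "J2 \<in> Q" "J3 \<in> Q" "\<not> J2 \<subseteq> V" using J by (auto simp: S_def)
    obtain w where w: "w \<in> J2" "w \<notin> V" using Q by blast
    have "w < v1 \<or> v3 < w" using w connected_contains_Icc[OF cV v(1,5)] by (metis atLeastAtMost_iff not_le subsetD)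
    then show False
    proof
      assume "w < v1"
      then have "v1 \<in> J2" using connected_contains_Icc[OF Q_connected[OF Q(2)] w(1) v(4)] lt by auto
      then show False using Q_unique[OF Q(1,2) v(2)] d by simp
    next
      assume "v3 < w"
      then have "v3 \<in> J2" using connected_contains_Icc[OF Q_connected[OF Q(2)] v(4) w(1)] lt by auto
      then show False using Q_unique[OF Q(2,3) _ v(6)] d by simp
    qed
  qed
  have S: "finite S \<and> card S \<le> 2"
  proof (rule card_le_2I)
    fix J1 J2 J3 assume J: "J1 \<in> S" "J2 \<in> S" "J3 \<in> S" and d: "J1 \<noteq> J2" "J1 \<noteq> J3" "J2 \<noteq> J3"
    obtain v1 v2 v3 where v: "v1 \<in> V" "v1 \<in> J1" "v2 \<in> V" "v2 \<in> J2" "v3 \<in> V" "v3 \<in> J3"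
      using J unfolding S_def by blast
    have "v1 \<noteq> v2" "v1 \<noteq> v3" "v2 \<noteq> v3"
      using J d v Q_unique unfolding S_def by blast+
    then consider "v1 < v2" "v2 < v3" | "v1 < v3" "v3 < v2" | "v2 < v1" "v1 < v3" | "v2 < v3" "v3 < v1"
      | "v3 < v1" "v1 < v2" | "v3 < v2" "v2 < v1" by linarith
    then show False
      using mid[of J1 J2 J3 v1 v2 v3] mid[of J1 J3 J2 v1 v3 v2] mid[of J2 J1 J3 v2 v1 v3]
        mid[of J2 J3 J1 v2 v3 v1] mid[of J3 J1 J2 v3 v1 v2] mid[of J3 J2 J1 v3 v2 v1] J d v
      by cases simp_all
  qed
  have sub: "kept T Q n \<omega> \<subseteq> (\<lambda>J. \<omega> \<inter> (T ^^ n) -` J) ` S"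
  proof
    fix \<zeta> assume "\<zeta> \<in> kept T Q n \<omega>"
    then have z: "\<zeta> \<in> pullback T Q n \<omega>" "(T ^^ n) ` \<zeta> \<notin> Q" by (simp_all add: kept_eq)
    from z(1) obtain J where J: "J \<in> Q" "\<zeta> = \<omega> \<inter> (T ^^ n) -` J" "\<zeta> \<noteq> {}" by (rule pullbackE)
    have im: "(T ^^ n) ` \<zeta> = V \<inter> J" unfolding J(2) V_def by blast
    have "V \<inter> J \<noteq> {}" using J(3) im by blast
    moreover have "\<not> J \<subseteq> V" using z(2) J(1) im by (metis inf.absorb2)
    ultimately have "J \<in> S" using J(1) by (simp add: S_def)
    then show "\<zeta> \<in> (\<lambda>J. \<omega> \<inter> (T ^^ n) -` J) ` S" using J(2) by blast
  qed
  show "finite (kept T Q n \<omega>)" using finite_subset[OF sub] S by simp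
  have "card (kept T Q n \<omega>) \<le> card ((\<lambda>J. \<omega> \<inter> (T ^^ n) -` J) ` S)" using S sub by (intro card_mono) simp_all
  also have "\<dots> \<le> card S" using S by (intro card_image_le) simp
  finally show "card (kept T Q n \<omega>) \<le> 2" using S by linarith
qed

text \<open>The lost points are mapped injectively into the finite set left over by H and Q.\<close>

lemma split_finite:
  assumes b: "branch n \<omega>"
  shows "finite (\<omega> - \<Union>(kept T Q n \<omega>) - \<Union>(stopped T Q H n \<omega>))" (is "finite ?R")
proof (rule finite_imageD)
  show "inj_on (T ^^ n) ?R" using branch_inj[OF b] by (rule inj_on_subset) blast
  have "(T ^^ n) ` ?R \<subseteq> {0..1} - H - \<Union>Q"
  proof (rule image_subsetI)
    fix x assume x: "x \<in> ?R"
    have "(T ^^ n) x \<in> {0..1}" using branch_image(3)[OF b] x by blast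
    moreover have "(T ^^ n) x \<notin> H" using x unfolding Union_stopped by blast
    moreover have "(T ^^ n) x \<notin> \<Union>Q"
    proof
      assume "(T ^^ n) x \<in> \<Union>Q"
      then obtain J where J: "J \<in> Q" "(T ^^ n) x \<in> J" by blast
      have "\<omega> \<inter> (T ^^ n) -` J \<in> pullback T Q n \<omega>" using x J by (intro pullbackI) auto
      moreover have "x \<in> \<omega> \<inter> (T ^^ n) -` J" using x J by simp
      ultimately show False using x unfolding Union_stopped kept_eq by blast
    qed
    ultimately show "(T ^^ n) x \<in> {0..1} - H - \<Union>Q" by blast
  qed
  then show "finite ((T ^^ n) ` ?R)" using Q_cofinite finite_subset by blast
qed

lemma kept_stopped_disjoint: "\<Union>(kept T Q n \<omega>) \<inter> \<Union>(stopped T Q H n \<omega>) = {}"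
proof -
  have False if x: "x \<in> \<zeta>" "\<zeta> \<in> kept T Q n \<omega>" "x \<in> \<Union>(stopped T Q H n \<omega>)" for x \<zeta>
  proof -
    have z: "\<zeta> \<in> pullback T Q n \<omega>" "(T ^^ n) ` \<zeta> \<notin> Q" using x(2) by (simp_all add: kept_eq)
    from z(1) obtain J where J: "J \<in> Q" "\<zeta> = \<omega> \<inter> (T ^^ n) -` J" by (rule pullbackE)
    have "(T ^^ n) x \<notin> H" using x(1) J Q_H[of J] by blast
    then obtain \<zeta>' where "\<zeta>' \<in> pullback T Q n \<omega>" "(T ^^ n) ` \<zeta>' \<in> Q" "x \<in> \<zeta>'"
      using x(3) unfolding Union_stopped by blast
    then show False using pullback_unique[OF z(1) _ x(1)] z(2) by blast
  qed
  then show ?thesis by blast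
qed

lemma Union_kept_subset: "\<Union>(kept T Q n \<omega>) \<subseteq> \<omega>" and Union_stopped_subset: "\<Union>(stopped T Q H n \<omega>) \<subseteq> \<omega>"
  unfolding Union_stopped kept_eq pullback_def by blast+

definition start_interval :: "real set \<Rightarrow> bool" where
  "start_interval A \<longleftrightarrow> open A \<and> connected A \<and> A \<noteq> {} \<and> (\<exists>J\<in>Q. A \<subseteq> J)"

text \<open>The branch has order n + 1, and not only n, because the n-th image lies in an element of
  Q, hence in a single branch domain.\<close>

lemma Omega_element:
  assumes A: "start_interval A" and \<omega>: "\<omega> \<in> Omega T Q A n"
  shows "branch (Suc n) \<omega> \<and> \<omega> \<noteq> {} \<and> \<omega> \<subseteq> A \<and> (\<exists>J\<in>Q. (T ^^ n) ` \<omega> \<subseteq> J)"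
  using \<omega>
proof (induction n arbitrary: \<omega>)
  case 0
  obtain J where J: "J \<in> Q" "A \<subseteq> J" using A unfolding start_interval_def by blast
  obtain K where K: "K \<in> Ihat" "J \<subseteq> K" using Q_Ihat[OF J(1)] by blast
  have "branch 0 A" using A J K Ihat_interval(5)[OF K(1)] unfolding branch_def start_interval_def by blast
  then have "branch (Suc 0) A" by (rule branch_Suc[OF _ K(1)]) (use J K in auto)
  then show ?case using 0 J A unfolding start_interval_def by auto
next
  case (Suc n)
  then obtain \<omega>' where w': "\<omega>' \<in> Omega T Q A n" "\<omega> \<in> kept T Q (Suc n) \<omega>'" by auto
  note IH = Suc.IH[OF w'(1)]
  from w'(2) have "\<omega> \<in> pullback T Q (Suc n) \<omega>'" unfolding kept_eq by blast
  then obtain J where J: "J \<in> Q" "\<omega> = \<omega>' \<inter> (T ^^ Suc n) -` J" "\<omega> \<noteq> {}" by (rule pullbackE)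
  obtain K where K: "K \<in> Ihat" "J \<subseteq> K" using Q_Ihat[OF J(1)] by blast
  have im: "(T ^^ Suc n) ` \<omega> \<subseteq> J" unfolding J(2) by blast
  have "branch (Suc n) \<omega>"
    unfolding J(2) using IH Q_open[OF J(1)] Q_connected[OF J(1)] by (intro branch_pullback) auto
  then have "branch (Suc (Suc n)) \<omega>" by (rule branch_Suc[OF _ K(1)]) (use im K in blast)
  then show ?case using J im IH by blast
qed

lemma Omega_card:
  assumes A: "start_interval A"
  shows "finite (Omega T Q A n) \<and> card (Omega T Q A n) \<le> 2 ^ n"
proof (induction n)
  case (Suc n)
  have k: "finite (kept T Q (Suc n) \<omega>)" "card (kept T Q (Suc n) \<omega>) \<le> 2" if "\<omega> \<in> Omega T Q A n" for \<omega>
    using kept_card[of "Suc n" \<omega>] Omega_element[OF A that] by blast+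
  have "card (Omega T Q A (Suc n)) \<le> (\<Sum>\<omega>\<in>Omega T Q A n. card (kept T Q (Suc n) \<omega>))"
    using Suc by (auto intro: card_UN_le)
  also have "\<dots> \<le> (\<Sum>\<omega>\<in>Omega T Q A n. 2)" by (intro sum_mono k)
  also have "\<dots> \<le> 2 ^ Suc n" using Suc by simp
  finally show ?case using Suc k by auto
qed simp

lemma Omega_disjoint: "pairwise disjnt (Omega T Q A n)"
proof (induction n)
  case (Suc n)
  show ?case
    unfolding pairwise_def
  proof (intro ballI impI)
    fix x y assume xy: "x \<in> Omega T Q A (Suc n)" "y \<in> Omega T Q A (Suc n)" "x \<noteq> y"
    then obtain u v where uv: "u \<in> Omega T Q A n" "x \<in> kept T Q (Suc n) u" "v \<in> Omega T Q A n" "y \<in> kept T Q (Suc n) v"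
      by auto
    show "disjnt x y"
    proof (cases "u = v")
      case True
      then have "x \<in> pullback T Q (Suc n) u" "y \<in> pullback T Q (Suc n) u" using uv unfolding kept_eq by blast+
      then show ?thesis using pullback_unique xy(3) unfolding disjnt_def by blast
    next
      case False
      then have "u \<inter> v = {}" using Suc uv unfolding pairwise_def disjnt_def by blast
      then show ?thesis using uv Union_kept_subset unfolding disjnt_def by blast
    qed
  qed
qed simp

lemma Omega_decreasing: "\<Union>(Omega T Q A (Suc n)) \<subseteq> \<Union>(Omega T Q A n)"
  unfolding Omega.simps using Union_kept_subset by blast

lemma Omega_antimono: "m \<le> n \<Longrightarrow> \<Union>(Omega T Q A n) \<subseteq> \<Union>(Omega T Q A m)"
  by (induction rule: dec_induct) (use Omega_decreasing in blast)+

lemma Omega_stop_disjoint: "\<Union>(Omega T Q A (Suc n)) \<inter> \<Union>(stop_elements T Q H A (Suc n)) = {}"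
proof -
  have False if "\<omega> \<in> Omega T Q A n" "\<omega>' \<in> Omega T Q A n" "x \<in> \<Union>(kept T Q (Suc n) \<omega>)" "x \<in> \<Union>(stopped T Q H (Suc n) \<omega>')" for \<omega> \<omega>' x
  proof (cases "\<omega> = \<omega>'")
    case True
    then show ?thesis using that kept_stopped_disjoint by blast
  next
    case False
    then have "\<omega> \<inter> \<omega>' = {}" using Omega_disjoint[of A n] that unfolding pairwise_def disjnt_def by blast
    then show ?thesis using that Union_kept_subset Union_stopped_subset by blast
  qed
  then show ?thesis unfolding Omega.simps stop_elements.simps by blast
qed

lemma Omega_split_finite:
  assumes A: "start_interval A"
  shows "finite (\<Union>(Omega T Q A n) - \<Union>(Omega T Q A (Suc n)) - \<Union>(stop_elements T Q H A (Suc n)))"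
proof (rule finite_subset)
  show "\<Union>(Omega T Q A n) - \<Union>(Omega T Q A (Suc n)) - \<Union>(stop_elements T Q H A (Suc n))
    \<subseteq> (\<Union>\<omega>\<in>Omega T Q A n. \<omega> - \<Union>(kept T Q (Suc n) \<omega>) - \<Union>(stopped T Q H (Suc n) \<omega>))"
  proof
    fix x assume x: "x \<in> \<Union>(Omega T Q A n) - \<Union>(Omega T Q A (Suc n)) - \<Union>(stop_elements T Q H A (Suc n))"
    then obtain \<omega> where w: "\<omega> \<in> Omega T Q A n" "x \<in> \<omega>" by auto
    have "x \<notin> \<Union>(kept T Q (Suc n) \<omega>)" "x \<notin> \<Union>(stopped T Q H (Suc n) \<omega>)"
      using x w(1) by auto
    then show "x \<in> (\<Union>\<omega>\<in>Omega T Q A n. \<omega> - \<Union>(kept T Q (Suc n) \<omega>) - \<Union>(stopped T Q H (Suc n) \<omega>))"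
      using w by (intro UN_I[of \<omega>]) simp_all
  qed
  show "finite (\<Union>\<omega>\<in>Omega T Q A n. \<omega> - \<Union>(kept T Q (Suc n) \<omega>) - \<Union>(stopped T Q H (Suc n) \<omega>))"
  proof (rule finite_UN_I)
    fix \<omega> assume "\<omega> \<in> Omega T Q A n"
    then show "finite (\<omega> - \<Union>(kept T Q (Suc n) \<omega>) - \<Union>(stopped T Q H (Suc n) \<omega>))"
      using Omega_element[OF A] by (intro split_finite) blast
  qed (use Omega_card[OF A] in blast)
qed

lemma less_stop_time_iff: "enat n < stop_time T Q H A x \<longleftrightarrow> (\<forall>k\<le>n. x \<notin> \<Union>(stop_elements T Q H A k))"
proof (cases "\<exists>n. x \<in> \<Union>(stop_elements T Q H A n)")
  case True
  then have st: "stop_time T Q H A x = enat (LEAST n. x \<in> \<Union>(stop_elements T Q H A n))"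
    unfolding stop_time_def by (rule if_P)
  have "n < (LEAST n. x \<in> \<Union>(stop_elements T Q H A n)) \<longleftrightarrow> (\<forall>k\<le>n. x \<notin> \<Union>(stop_elements T Q H A k))"
    using LeastI_ex[OF True] not_less_Least[of _ "\<lambda>n. x \<in> \<Union>(stop_elements T Q H A n)"]
    by (metis (no_types, lifting) le_less_trans not_le)
  then show ?thesis unfolding st enat_ord_simps .
qed (auto simp: stop_time_def)

lemma Omega_less_stop_time: "x \<in> \<Union>(Omega T Q A n) \<Longrightarrow> enat n < stop_time T Q H A x"
  unfolding less_stop_time_iff
proof (intro allI impI)
  fix k assume x: "x \<in> \<Union>(Omega T Q A n)" and "k \<le> n"
  then have "x \<in> \<Union>(Omega T Q A k)" using Omega_antimono by blast
  then show "x \<notin> \<Union>(stop_elements T Q H A k)"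
    using Omega_stop_disjoint by (cases k) (simp, blast)
qed

text \<open>Points that reach an endpoint of the partition leave \<open>Omega\<close> without being
  stopped; each step produces finitely many of them.\<close>

lemma less_stop_time_Omega:
  assumes A: "start_interval A"
  shows "finite ({x \<in> A. enat n < stop_time T Q H A x} - \<Union>(Omega T Q A n))"
proof (induction n)
  case 0
  have "{x \<in> A. enat 0 < stop_time T Q H A x} - \<Union>(Omega T Q A 0) = {}" by auto
  then show ?case by (rule ssubst) simp
next
  case (Suc n)
  have "{x \<in> A. enat (Suc n) < stop_time T Q H A x} - \<Union>(Omega T Q A (Suc n)) \<subseteq>
     ({x \<in> A. enat n < stop_time T Q H A x} - \<Union>(Omega T Q A n)) \<union>
     (\<Union>(Omega T Q A n) - \<Union>(Omega T Q A (Suc n)) - \<Union>(stop_elements T Q H A (Suc n)))"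
    unfolding less_stop_time_iff using le_SucI by blast
  then show ?case using finite_UnI[OF Suc Omega_split_finite[OF A, of n]] by (rule finite_subset)
qed

lemma Omega_open: "start_interval A \<Longrightarrow> open (\<Union>(Omega T Q A n))"
  using Omega_element unfolding branch_def by blast

lemma start_interval_subset: "start_interval A \<Longrightarrow> A \<subseteq> {0..1}"
  using Omega_element[of A A 0] unfolding branch_def by auto

text \<open>There are at most 2^n branches, each of length at most \<mu>^(-n); since \<mu> > 2, what
  is not yet stopped shrinks geometrically.\<close>

lemma Omega_emeasure:
  assumes A: "start_interval A"
  shows "emeasure lborel (\<Union>(Omega T Q A n)) \<le> ennreal ((2 / \<mu>) ^ n)"
proof -
  have m: "emeasure lborel \<omega> \<le> ennreal (1 / \<mu> ^ n)" if "\<omega> \<in> Omega T Q A n" for \<omega>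
  proof -
    have p: "0 < \<mu> ^ n" using \<mu>_gt_2 by simp
    have "branch n \<omega>" using Omega_element[OF A that] branch_SucD by blast
    then have "ennreal (1 / \<mu> ^ n) * (ennreal (\<mu> ^ n) * emeasure lborel \<omega>) \<le> ennreal (1 / \<mu> ^ n) * 1"
      by (intro mult_left_mono branch_emeasure_le) auto
    also have "ennreal (1 / \<mu> ^ n) * (ennreal (\<mu> ^ n) * emeasure lborel \<omega>) = emeasure lborel \<omega>"
      unfolding mult.assoc[symmetric] using p \<mu>_gt_2 by (simp add: ennreal_mult[symmetric])
    finally show ?thesis by simp
  qed
  have bor: "Omega T Q A n \<subseteq> sets borel"
    using Omega_element[OF A] unfolding branch_def by (blast intro: borel_open)
  have "emeasure lborel (\<Union>(Omega T Q A n)) \<le> (\<Sum>\<omega>\<in>Omega T Q A n. emeasure lborel \<omega>)"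
    using emeasure_subadditive_finite[of "Omega T Q A n" "\<lambda>\<omega>. \<omega>" lborel] Omega_card[OF A] bor by simp
  also have "\<dots> \<le> (\<Sum>\<omega>\<in>Omega T Q A n. ennreal (1 / \<mu> ^ n))" by (intro sum_mono m)
  also have "\<dots> = of_nat (card (Omega T Q A n)) * ennreal (1 / \<mu> ^ n)" by simp
  also have "\<dots> \<le> of_nat (2 ^ n) * ennreal (1 / \<mu> ^ n)"
    using Omega_card[OF A] by (intro mult_right_mono of_nat_mono) auto
  also have "of_nat (2 ^ n) * ennreal (1 / \<mu> ^ n) = ennreal ((2 / \<mu>) ^ n)"
    unfolding ennreal_of_nat_eq_real_of_nat using \<mu>_gt_2
    by (simp add: power_divide ennreal_mult[symmetric])
  finally show ?thesis .
qed

end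

section \<open>Uniqueness of the invariant measure\<close>

text \<open>With f = g + (f - g) on E, finiteness allows the integral of g to be cancelled, which
  leaves f - g = 0 almost everywhere on E.\<close>

lemma nn_integral_eq_imp_null_set:
  fixes f g :: "'a \<Rightarrow> ennreal"
  assumes [measurable]: "f \<in> borel_measurable M" "g \<in> borel_measurable M" "E \<in> sets M"
    and less: "\<And>x. x \<in> E \<Longrightarrow> g x < f x" and le: "(\<integral>\<^sup>+x\<in>E. f x \<partial>M) \<le> (\<integral>\<^sup>+x\<in>E. g x \<partial>M)"
    and fin: "(\<integral>\<^sup>+x\<in>E. g x \<partial>M) < \<infinity>"
  shows "E \<in> null_sets M"
proof -
  have "(\<integral>\<^sup>+x\<in>E. f x \<partial>M) = (\<integral>\<^sup>+x. g x * indicator E x + (f x - g x) * indicator E x \<partial>M)"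
  proof (intro nn_integral_cong)
    fix x show "f x * indicator E x = g x * indicator E x + (f x - g x) * indicator E x"
      using less[of x] by (cases "x \<in> E") (simp_all add: add_diff_inverse_ennreal less_imp_le)
  qed
  also have "\<dots> = (\<integral>\<^sup>+x\<in>E. g x \<partial>M) + (\<integral>\<^sup>+x. (f x - g x) * indicator E x \<partial>M)"
    by (rule nn_integral_add) measurable
  finally have "(\<integral>\<^sup>+x\<in>E. g x \<partial>M) + (\<integral>\<^sup>+x. (f x - g x) * indicator E x \<partial>M) \<le> (\<integral>\<^sup>+x\<in>E. g x \<partial>M) + 0"
    using le by simp
  then have "(\<integral>\<^sup>+x. (f x - g x) * indicator E x \<partial>M) = 0"
    using fin by (auto simp: ennreal_add_left_cancel_le)
  then have "AE x in M. (f x - g x) * indicator E x = 0"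
    by (subst (asm) nn_integral_0_iff_AE) measurable
  then have "AE x in M. x \<notin> E"
  proof (eventually_elim)
    case (elim x)
    show ?case
    proof
      assume "x \<in> E"
      then have "f x - g x = 0" using elim by simp
      then show False using less[OF \<open>x \<in> E\<close>] by (auto simp: diff_eq_0_iff_ennreal)
    qed
  qed
  then show ?thesis by (rule AE_iff_null_sets[THEN iffD2, rotated]) simp
qed

lemma emeasure_finite_set: "finite (F :: real set) \<Longrightarrow> emeasure lborel F = 0"
  by (rule emeasure_lborel_countable) (rule countable_finite)

section \<open>Nonsingularity of the map and sets with positive density in every interval\<close>

context expanding
begin

lemma branch_1: "J \<in> Ihat \<Longrightarrow> branch 1 J"
  using Ihat_interval[of J] unfolding branch_def by auto

text \<open>\<open>T\<close> is continuous on each branch domain, and the finitely many other points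
  of the unit interval contribute a finite set.\<close>

lemma T_preimage_sets [measurable]:
  assumes A: "A \<in> sets borel" shows "{x \<in> {0..1}. T x \<in> A} \<in> sets borel"
proof -
  have J: "J \<inter> T -` A \<in> sets borel" if "J \<in> Ihat" for J
  proof -
    have "continuous_on J T" using branch_continuous[OF branch_1[OF that]] by simp
    then have m: "T \<in> borel_measurable (restrict_space borel J)"
      by (rule borel_measurable_continuous_on_restrict)
    have "T -` A \<inter> space (restrict_space borel J) \<in> sets (restrict_space borel J)"
      using measurable_sets[OF m A] .
    then have "T -` A \<inter> J \<in> sets (restrict_space borel J)" unfolding space_restrict_space by simp
    then show ?thesis using borel_open[OF Ihat_interval(1)[OF that]]
      by (subst (asm) sets_restrict_space_iff) (auto simp: Int_commute)
  qed
  define F where "F = {x \<in> {0..1} - \<Union>Ihat. T x \<in> A}"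
  have fin: "finite F" unfolding F_def using cofinite_Ihat by (rule rev_finite_subset) blast
  have "{x \<in> {0..1}. T x \<in> A} = (\<Union>J\<in>Ihat. J \<inter> T -` A) \<union> F"
    unfolding F_def using Ihat_interval(5) by blast
  then show ?thesis
    by (rule ssubst) (intro sets.Un sets.finite_UN finite_Ihat J borel_closed finite_imp_closed fin)
qed

lemma funpow_preimage_sets [measurable]:
  assumes A: "A \<in> sets borel" shows "{x \<in> {0..1}. (T ^^ n) x \<in> A} \<in> sets borel"
proof (induction n)
  case 0
  have "{x \<in> {0..1}. (T ^^ 0) x \<in> A} = {0..1} \<inter> A" by auto
  then show ?case using A by simp
next
  case (Suc n)
  have "{x \<in> {0..1}. (T ^^ Suc n) x \<in> A} = {x \<in> {0..1}. T x \<in> {y \<in> {0..1}. (T ^^ n) y \<in> A}}"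
    unfolding funpow_Suc_right comp_apply using T_range by blast
  then show ?case using T_preimage_sets[OF Suc] by simp
qed

text \<open>T expands on every branch domain, so each inverse branch takes A to a set of no greater
  measure; the branches are then counted.\<close>

lemma emeasure_T_preimage:
  assumes A [measurable]: "A \<in> sets borel"
  shows "emeasure lborel {x \<in> {0..1}. T x \<in> A} \<le> ennreal (real (card Ihat)) * emeasure lborel A"
proof -
  have [measurable]: "J \<inter> T -` A \<in> sets borel" if "J \<in> Ihat" for J
  proof -
    have "J \<inter> T -` A = {x \<in> {0..1}. T x \<in> A} \<inter> J" using Ihat_interval(5)[OF that] by blast
    then show ?thesis by (rule ssubst) (intro sets.Int T_preimage_sets A borel_open Ihat_interval(1) that)
  qed
  have le: "emeasure lborel (J \<inter> T -` A) \<le> emeasure lborel A" if J: "J \<in> Ihat" for J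
  proof -
    have mJ: "J \<inter> T -` A \<in> sets borel" "T ` J \<in> sets borel"
      using branch_image(1)[OF branch_1[OF J]] J by simp_all
    have e: "emeasure lborel (J \<inter> T -` A) = (\<integral>\<^sup>+x\<in>J. indicator A ((T ^^ 1) x) \<partial>lborel)"
    proof -
      have "emeasure lborel (J \<inter> T -` A) = (\<integral>\<^sup>+x. indicator (J \<inter> T -` A) x \<partial>lborel)"
        using mJ by (intro nn_integral_indicator[symmetric]) simp
      also have "\<dots> = (\<integral>\<^sup>+x\<in>J. indicator A ((T ^^ 1) x) \<partial>lborel)"
        by (intro nn_integral_cong) (auto simp: indicator_def)
      finally show ?thesis .
    qed
    have "1 * emeasure lborel (J \<inter> T -` A) \<le> ennreal (\<mu> ^ 1) * emeasure lborel (J \<inter> T -` A)"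
      using \<mu>_gt_2 by (intro mult_right_mono) (auto simp: ennreal_1[symmetric] simp del: ennreal_1 intro!: ennreal_leI)
    also have "\<dots> \<le> (\<integral>\<^sup>+y\<in>(T ^^ 1) ` J. indicator A y \<partial>lborel)"
      unfolding e by (rule branch_integral_le[OF branch_1[OF J]]) measurable
    also have "\<dots> \<le> (\<integral>\<^sup>+y. indicator A y \<partial>lborel)" by (intro nn_integral_mono) (simp add: indicator_def)
    finally show ?thesis by simp
  qed
  have sub: "{x \<in> {0..1}. T x \<in> A} \<subseteq> (\<Union>J\<in>Ihat. J \<inter> T -` A) \<union> ({0..1} - \<Union>Ihat)" by blast
  have fin: "{0..1} - \<Union>Ihat \<in> null_sets lborel"
    using finite_imp_null_set_lborel[OF cofinite_Ihat] .
  have U: "(\<Union>J\<in>Ihat. J \<inter> T -` A) \<in> sets lborel"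
    by (rule sets.finite_UN[OF finite_Ihat]) simp
  have "emeasure lborel {x \<in> {0..1}. T x \<in> A} \<le> emeasure lborel ((\<Union>J\<in>Ihat. J \<inter> T -` A) \<union> ({0..1} - \<Union>Ihat))"
    by (intro emeasure_mono[OF sub] sets.Un U null_setsD2[OF fin])
  also have "\<dots> = emeasure lborel (\<Union>J\<in>Ihat. J \<inter> T -` A)"
    by (rule emeasure_Un_null_set[OF U fin])
  also have "\<dots> \<le> (\<Sum>J\<in>Ihat. emeasure lborel (J \<inter> T -` A))"
    using finite_Ihat by (intro emeasure_subadditive_finite) auto
  also have "\<dots> \<le> (\<Sum>J\<in>Ihat. emeasure lborel A)" by (intro sum_mono le)
  also have "\<dots> = ennreal (real (card Ihat)) * emeasure lborel A"
    by (simp add: ennreal_of_nat_eq_real_of_nat)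
  finally show ?thesis .
qed

lemma null_T_preimage: "A \<in> null_sets lborel \<Longrightarrow> {x \<in> {0..1}. T x \<in> A} \<in> null_sets lborel"
  using emeasure_T_preimage[of A] T_preimage_sets[of A] by (auto simp: null_sets_def)

text \<open>Forward images are not known to be Borel here, hence \<open>negligible\<close> in place
  of \<open>null_sets\<close>.\<close>

lemma negligible_T_image:
  assumes "negligible Z" "Z \<subseteq> {0..1}" shows "negligible (T ` Z)"
proof -
  have "negligible (T ` (Z \<inter> J))" if "J \<in> Ihat" for J
  proof (rule negligible_differentiable_image_negligible)
    show "negligible (Z \<inter> J)" using assms(1) by (rule negligible_subset) blast
    show "T differentiable_on Z \<inter> J"
      unfolding differentiable_on_def real_differentiable_def
      using has_field_derivative_at_within[OF T_has_deriv[OF that]] by blast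
  qed simp
  then have "negligible (\<Union>J\<in>Ihat. T ` (Z \<inter> J))" using finite_Ihat by (intro negligible_Union) auto
  moreover have "negligible (T ` ({0..1} - \<Union>Ihat))" using cofinite_Ihat by (intro negligible_finite) simp
  ultimately have "negligible ((\<Union>J\<in>Ihat. T ` (Z \<inter> J)) \<union> T ` ({0..1} - \<Union>Ihat))" by (rule negligible_Un)
  then show ?thesis by (rule negligible_subset) (use assms(2) in blast)
qed

lemma negligible_funpow_image:
  assumes "negligible Z" "Z \<subseteq> {0..1}" shows "negligible ((T ^^ n) ` Z)"
proof (induction n)
  case (Suc n)
  have "(T ^^ n) ` Z \<subseteq> {0..1}" using assms(2) funpow_range by blast
  from negligible_T_image[OF Suc this] show ?case by (simp add: image_comp)
qed (use assms in simp)

text \<open>An orbit outside A at time n + 1 has left A at the first step, or has moved to a point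
  of A whose orbit is outside A after n further steps. Preimages of null sets are null.\<close>

lemma invariant_funpow_null:
  assumes A [measurable]: "A \<in> sets borel" and sub: "A \<subseteq> {0..1}"
    and inv: "{x \<in> A. T x \<notin> A} \<in> null_sets lborel"
  shows "{x \<in> A. (T ^^ n) x \<notin> A} \<in> null_sets lborel"
proof (induction n)
  case 0
  have "{x \<in> A. (T ^^ 0) x \<notin> A} = {}" by auto
  then show ?case by simp
next
  case (Suc n)
  have m: "{x \<in> A. (T ^^ Suc n) x \<notin> A} \<in> sets borel"
  proof -
    have "{x \<in> A. (T ^^ Suc n) x \<notin> A} = A - {x \<in> {0..1}. (T ^^ Suc n) x \<in> A}" using sub by blast
    then show ?thesis using funpow_preimage_sets[OF A, of "Suc n"] by simp
  qed
  have sub': "{x \<in> A. (T ^^ Suc n) x \<notin> A} \<subseteq> {x \<in> A. T x \<notin> A} \<union> {x \<in> {0..1}. T x \<in> {x \<in> A. (T ^^ n) x \<notin> A}}"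
    unfolding funpow_Suc_right comp_apply using sub by blast
  show ?case
    by (rule null_sets_subset[OF null_sets.Un[OF inv null_T_preimage[OF Suc]] _ sub']) (use m in simp)
qed

lemma expanding_cutting: "cutting T Ihat \<alpha> \<mu> Chat Ihat {}"
  using Ihat_interval disjoint_Ihat cofinite_Ihat by unfold_locales auto

text \<open>Let d be the size of the derivative at a reference point. Distortion gives |\<zeta>|
  \<le> distortion / d, while the part of B in the full image, of measure at least c, pulls back to
  a set of measure at least c / (distortion * d); the two estimates together produce the square.
  Invariance replaces the preimage of B by B.\<close>

lemma full_branch_mass:
  assumes b: "branch n \<zeta>" and full: "(T ^^ n) ` \<zeta> \<in> Ihat"
    and B [measurable]: "B \<in> sets borel" and sub: "B \<subseteq> {0..1}"
    and inv: "{x \<in> {0..1} - B. (T ^^ n) x \<in> B} \<in> null_sets lborel"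
    and c: "0 < c" "\<And>J. J \<in> Ihat \<Longrightarrow> ennreal c \<le> emeasure lborel (J \<inter> B)"
  shows "ennreal (c / distortion\<^sup>2) * emeasure lborel \<zeta> \<le> emeasure lborel (\<zeta> \<inter> B)"
proof -
  obtain x0 where x0: "x0 \<in> \<zeta>" using Ihat_interval(3)[OF full] by blast
  define d where "d = \<bar>iter_deriv n x0\<bar>"
  have d: "0 < d" using branch_iter_deriv_nz[OF b x0] by (simp add: d_def)
  have D: "0 < distortion" by (simp add: distortion_def)
  have z: "open \<zeta>" "\<zeta> \<subseteq> {0..1}" using b by (auto simp: branch_def)
  have [measurable]: "\<zeta> \<in> sets borel" "(T ^^ n) ` \<zeta> \<in> sets borel" using z branch_image(1)[OF b] by simp_all
  define E where "E = {x \<in> {0..1}. (T ^^ n) x \<in> B}"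
  have E[measurable]: "E \<in> sets borel" unfolding E_def by (rule funpow_preimage_sets[OF B])
  have 1: "ennreal (d / distortion) * emeasure lborel \<zeta> \<le> 1"
  proof -
    have "ennreal (d / distortion) * emeasure lborel \<zeta> = (\<integral>\<^sup>+x. ennreal (d / distortion) * indicator \<zeta> x \<partial>lborel)"
      by (simp add: nn_integral_cmult_indicator)
    also have "\<dots> \<le> (\<integral>\<^sup>+x\<in>\<zeta>. ennreal \<bar>iter_deriv n x\<bar> * 1 \<partial>lborel)"
    proof (intro nn_integral_mono)
      fix x
      show "ennreal (d / distortion) * indicator \<zeta> x \<le> ennreal \<bar>iter_deriv n x\<bar> * 1 * indicator \<zeta> x"
        using branch_distortion[OF b x0, of x] D
        by (cases "x \<in> \<zeta>") (auto simp: d_def divide_le_eq mult.commute intro!: ennreal_leI)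
    qed
    also have "\<dots> = (\<integral>\<^sup>+y\<in>(T ^^ n) ` \<zeta>. 1 \<partial>lborel)" by (rule branch_change_of_variables[OF b]) simp
    also have "\<dots> = emeasure lborel ((T ^^ n) ` \<zeta>)" by simp
    also have "\<dots> \<le> emeasure lborel {0..1::real}" using branch_image(3)[OF b] by (intro emeasure_mono) auto
    finally show ?thesis by simp
  qed
  have 2: "ennreal c \<le> ennreal (distortion * d) * emeasure lborel (\<zeta> \<inter> E)"
  proof -
    have "ennreal c \<le> emeasure lborel ((T ^^ n) ` \<zeta> \<inter> B)" using c(2)[OF full] .
    also have "\<dots> = (\<integral>\<^sup>+y\<in>(T ^^ n) ` \<zeta>. indicator B y \<partial>lborel)"
    proof -
      have "emeasure lborel ((T ^^ n) ` \<zeta> \<inter> B) = (\<integral>\<^sup>+y. indicator ((T ^^ n) ` \<zeta> \<inter> B) y \<partial>lborel)"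
        by (intro nn_integral_indicator[symmetric]) simp
      also have "\<dots> = (\<integral>\<^sup>+y\<in>(T ^^ n) ` \<zeta>. indicator B y \<partial>lborel)"
        by (intro nn_integral_cong) (auto simp: indicator_def)
      finally show ?thesis .
    qed
    also have "\<dots> = (\<integral>\<^sup>+x\<in>\<zeta>. ennreal \<bar>iter_deriv n x\<bar> * indicator B ((T ^^ n) x) \<partial>lborel)"
      by (rule branch_change_of_variables[OF b, symmetric]) measurable
    also have "\<dots> \<le> (\<integral>\<^sup>+x. ennreal (distortion * d) * indicator (\<zeta> \<inter> E) x \<partial>lborel)"
    proof (intro nn_integral_mono)
      fix x
      show "ennreal \<bar>iter_deriv n x\<bar> * indicator B ((T ^^ n) x) * indicator \<zeta> x \<le> ennreal (distortion * d) * indicator (\<zeta> \<inter> E) x"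
        using branch_distortion[OF b _ x0, of x] z(2)
        by (cases "x \<in> \<zeta>"; cases "(T ^^ n) x \<in> B") (auto simp: d_def E_def intro!: ennreal_leI)
    qed
    also have "\<dots> = ennreal (distortion * d) * emeasure lborel (\<zeta> \<inter> E)"
      by (subst nn_integral_cmult_indicator) auto
    finally show ?thesis .
  qed
  have 3: "emeasure lborel (\<zeta> \<inter> E) \<le> emeasure lborel (\<zeta> \<inter> B)"
  proof -
    have "\<zeta> \<inter> E \<subseteq> (\<zeta> \<inter> B) \<union> {x \<in> {0..1} - B. (T ^^ n) x \<in> B}" unfolding E_def by blast
    then have "emeasure lborel (\<zeta> \<inter> E) \<le> emeasure lborel ((\<zeta> \<inter> B) \<union> {x \<in> {0..1} - B. (T ^^ n) x \<in> B})"
      using inv by (intro emeasure_mono) (auto dest: null_setsD2)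
    also have "\<dots> = emeasure lborel (\<zeta> \<inter> B)" using inv by (intro emeasure_Un_null_set) auto
    finally show ?thesis .
  qed
  have finz: "emeasure lborel \<zeta> = ennreal (measure lborel \<zeta>)" "emeasure lborel (\<zeta> \<inter> B) = ennreal (measure lborel (\<zeta> \<inter> B))"
  proof -
    have "emeasure lborel \<zeta> \<le> emeasure lborel {0..1::real}" using z by (intro emeasure_mono) auto
    moreover have "emeasure lborel (\<zeta> \<inter> B) \<le> emeasure lborel \<zeta>" by (intro emeasure_mono) auto
    ultimately have "emeasure lborel \<zeta> < top" "emeasure lborel (\<zeta> \<inter> B) < top"
      by (auto simp: order.strict_trans1)
    then show "emeasure lborel \<zeta> = ennreal (measure lborel \<zeta>)" "emeasure lborel (\<zeta> \<inter> B) = ennreal (measure lborel (\<zeta> \<inter> B))"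
      by (simp_all add: emeasure_eq_ennreal_measure)
  qed
  have r1: "d / distortion * measure lborel \<zeta> \<le> 1"
    using 1 d D unfolding finz by (simp add: ennreal_mult[symmetric])
  have "ennreal c \<le> ennreal (distortion * d) * emeasure lborel (\<zeta> \<inter> B)"
    using 2 mult_left_mono[OF 3] order_trans by (metis zero_le)
  then have r2: "c \<le> distortion * d * measure lborel (\<zeta> \<inter> B)"
    using d D unfolding finz by (simp add: ennreal_mult[symmetric])
  have "c / distortion\<^sup>2 * measure lborel \<zeta> \<le> distortion * d * measure lborel (\<zeta> \<inter> B) / distortion\<^sup>2 * measure lborel \<zeta>"
    using r2 D by (intro mult_right_mono divide_right_mono) auto
  also have "\<dots> = (d / distortion * measure lborel \<zeta>) * measure lborel (\<zeta> \<inter> B)"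
    using D by (simp add: power2_eq_square)
  also have "\<dots> \<le> 1 * measure lborel (\<zeta> \<inter> B)" by (intro mult_right_mono r1) auto
  finally have "ennreal (c / distortion\<^sup>2 * measure lborel \<zeta>) \<le> ennreal (measure lborel (\<zeta> \<inter> B))"
    by (intro ennreal_leI) simp
  then show ?thesis unfolding finz using c(1) D by (simp add: ennreal_mult[symmetric])
qed

text \<open>Run the cutting process for the trivial hole on \<open>\<omega>\<close>: up to a null set \<open>\<omega>\<close> is the union of pieces
  mapped onto full branch domains, and on each of them distortion is bounded.\<close>
lemma interval_mass:
  assumes B [measurable]: "B \<in> sets borel" and sub: "B \<subseteq> {0..1}"
    and inv: "\<And>n. {x \<in> {0..1} - B. (T ^^ n) x \<in> B} \<in> null_sets lborel"
    and c: "0 < c" "\<And>J. J \<in> Ihat \<Longrightarrow> ennreal c \<le> emeasure lborel (J \<inter> B)"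
    and \<omega>: "open \<omega>" "connected \<omega>" "\<omega> \<noteq> {}" "\<omega> \<subseteq> J" "J \<in> Ihat"
  shows "ennreal (c / distortion\<^sup>2) * emeasure lborel \<omega> \<le> emeasure lborel (\<omega> \<inter> B)"
proof -
  interpret cutting T Ihat \<alpha> \<mu> Chat Ihat "{}" by (rule expanding_cutting)
  have st: "start_interval \<omega>" using \<omega> by (auto simp: start_interval_def)
  define O' where "O' n = \<Union>(Omega T Ihat \<omega> n)" for n
  \<comment> \<open>These are the pieces stopped at time n + 1; with no hole, full image is the only
    reason to stop.\<close>
  define Fam where "Fam n = {\<zeta>. \<exists>\<omega>'\<in>Omega T Ihat \<omega> n. \<zeta> \<in> pullback T Ihat (Suc n) \<omega>' \<and> (T ^^ Suc n) ` \<zeta> \<in> Ihat}" for n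
  have UFam: "\<Union>(Fam n) = \<Union>(stop_elements T Ihat {} \<omega> (Suc n))" for n
  proof -
    have "\<Union>(stop_elements T Ihat {} \<omega> (Suc n)) = (\<Union>\<omega>'\<in>Omega T Ihat \<omega> n. \<Union>(stopped T Ihat {} (Suc n) \<omega>'))"
      unfolding stop_elements.simps by blast
    also have "\<dots> = \<Union>(Fam n)" unfolding Union_stopped Fam_def by blast
    finally show ?thesis by simp
  qed
  have Fam_branch: "branch (Suc n) \<zeta>" "(T ^^ Suc n) ` \<zeta> \<in> Ihat" "\<zeta> \<subseteq> \<omega>" "open \<zeta>" if "\<zeta> \<in> Fam n" for n \<zeta>
  proof -
    from that obtain \<omega>' where w: "\<omega>' \<in> Omega T Ihat \<omega> n" "\<zeta> \<in> pullback T Ihat (Suc n) \<omega>'" "(T ^^ Suc n) ` \<zeta> \<in> Ihat"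
      unfolding Fam_def by blast
    from w(2) obtain J where J: "J \<in> Ihat" "\<zeta> = \<omega>' \<inter> (T ^^ Suc n) -` J" by (rule pullbackE)
    have "branch (Suc n) \<omega>'" using Omega_element[OF st w(1)] by blast
    then show "branch (Suc n) \<zeta>" unfolding J(2)
      using branch_pullback Ihat_interval[OF J(1)] by blast
    then show "open \<zeta>" by (simp add: branch_def)
    show "(T ^^ Suc n) ` \<zeta> \<in> Ihat" by (rule w(3))
    show "\<zeta> \<subseteq> \<omega>" using J(2) Omega_element[OF st w(1)] by blast
  qed
  have finFam: "finite (Fam n)" for n
  proof -
    have "Fam n \<subseteq> (\<lambda>(\<omega>', J). \<omega>' \<inter> (T ^^ Suc n) -` J) ` (Omega T Ihat \<omega> n \<times> Ihat)"
      unfolding Fam_def pullback_def by (auto simp: image_iff)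
    then show ?thesis using Omega_card[OF st] finite_Ihat by (meson finite_SigmaI finite_imageI finite_subset)
  qed
  define F where "F = (\<Union>n. Fam n)"
  have cF: "countable F" unfolding F_def using finFam by (intro countable_UN) (auto intro: countable_finite)
  have Fam_O: "\<Union>(Fam n) \<subseteq> O' n" for n
    unfolding UFam O'_def stop_elements.simps using Union_stopped_subset by blast
  have cross: "\<zeta> \<inter> \<zeta>' = {}" if "\<zeta> \<in> Fam n" "\<zeta>' \<in> Fam m" "n < m" for \<zeta> \<zeta>' n m
  proof -
    have "\<zeta>' \<subseteq> O' m" using that(2) Fam_O by blast
    also have "O' m \<subseteq> O' (Suc n)" unfolding O'_def using that(3) by (intro Omega_antimono) simp
    finally have "\<zeta>' \<subseteq> O' (Suc n)" .
    moreover have "\<zeta> \<subseteq> \<Union>(stop_elements T Ihat {} \<omega> (Suc n))" using that(1) UFam by blast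
    ultimately show ?thesis using Omega_stop_disjoint unfolding O'_def by blast
  qed
  have same: "\<zeta> \<inter> \<zeta>' = {}" if z: "\<zeta> \<in> Fam n" "\<zeta>' \<in> Fam n" "\<zeta> \<noteq> \<zeta>'" for \<zeta> \<zeta>' n
  proof -
    obtain u v where uv: "u \<in> Omega T Ihat \<omega> n" "\<zeta> \<in> pullback T Ihat (Suc n) u" "v \<in> Omega T Ihat \<omega> n" "\<zeta>' \<in> pullback T Ihat (Suc n) v"
      using z unfolding Fam_def by blast
    show ?thesis
    proof (cases "u = v")
      case True then show ?thesis using pullback_unique uv z(3) by blast
    next
      case False
      then have "u \<inter> v = {}" using Omega_disjoint[of \<omega> n] uv unfolding pairwise_def disjnt_def by blast
      moreover have "\<zeta> \<subseteq> u" "\<zeta>' \<subseteq> v" using uv by (auto elim: pullbackE)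
      ultimately show ?thesis by blast
    qed
  qed
  have disj: "disjoint_family_on (\<lambda>\<zeta>. \<zeta>) F"
    unfolding disjoint_family_on_def
  proof (intro ballI impI)
    fix \<zeta> \<zeta>' assume z: "\<zeta> \<in> F" "\<zeta>' \<in> F" "\<zeta> \<noteq> \<zeta>'"
    then obtain n m where nm: "\<zeta> \<in> Fam n" "\<zeta>' \<in> Fam m" unfolding F_def by blast
    show "\<zeta> \<inter> \<zeta>' = {}"
      using cross[OF nm] cross[OF nm(2,1)] same[of \<zeta> n \<zeta>'] nm z(3) by (cases n m rule: linorder_cases) auto
  qed
  have disjB: "disjoint_family_on (\<lambda>\<zeta>. \<zeta> \<inter> B) F"
    using disj unfolding disjoint_family_on_def by blast
  have F_open: "\<zeta> \<in> sets borel" if "\<zeta> \<in> F" for \<zeta>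
    using that Fam_branch(4) unfolding F_def by (blast intro: borel_open)
  have UF[measurable]: "\<Union>F \<in> sets borel" using cF F_open by (intro sets.countable_Union) auto
  have [measurable]: "\<omega> \<in> sets borel" using \<omega> by simp
  have null: "\<omega> - \<Union>F \<in> null_sets lborel"
  proof -
    \<comment> \<open>What \<open>F\<close> misses is either a cut point, of which there are
      countably many, or never stopped; the set of the latter has measure at most (2/\<mu>)^n for
      every n.\<close>
    define Z where "Z = (\<Union>n. O' n - O' (Suc n) - \<Union>(stop_elements T Ihat {} \<omega> (Suc n)))"
    have "countable Z" unfolding Z_def O'_def using Omega_split_finite[OF st] by (intro countable_UN) (auto intro: countable_finite)
    then have Z: "Z \<in> null_sets lborel" by (rule countable_imp_null_set_lborel)
    have Om[measurable]: "O' n \<in> sets borel" for n unfolding O'_def using Omega_open[OF st] by simp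
    have "emeasure lborel (\<Inter>n. O' n) \<le> ennreal ((2 / \<mu>) ^ n)" for n
    proof -
      have "emeasure lborel (\<Inter>n. O' n) \<le> emeasure lborel (O' n)" by (intro emeasure_mono) auto
      also have "\<dots> \<le> ennreal ((2 / \<mu>) ^ n)" unfolding O'_def by (rule Omega_emeasure[OF st])
      finally show ?thesis .
    qed
    moreover have "(\<lambda>n. ennreal ((2 / \<mu>) ^ n)) \<longlonglongrightarrow> ennreal 0"
      using \<mu>_gt_2 by (intro tendsto_ennrealI LIMSEQ_power_zero) simp
    ultimately have "emeasure lborel (\<Inter>n. O' n) \<le> ennreal 0"
      by (intro LIMSEQ_le_const) auto
    then have I: "(\<Inter>n. O' n) \<in> null_sets lborel" by (auto simp: null_sets_def)
    have sub': "\<omega> - \<Union>F \<subseteq> (\<Inter>n. O' n) \<union> Z"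
    proof
      fix x assume x: "x \<in> \<omega> - \<Union>F"
      show "x \<in> (\<Inter>n. O' n) \<union> Z"
      proof (rule ccontr)
        assume n: "x \<notin> (\<Inter>n. O' n) \<union> Z"
        have "x \<in> O' n" for n
        proof (induction n)
          case 0 show ?case using x by (simp add: O'_def)
        next
          case (Suc n)
          have "x \<notin> \<Union>(Fam n)" using x unfolding F_def by blast
          then show ?case using n Suc unfolding Z_def UFam by blast
        qed
        then show False using n by blast
      qed
    qed
    then show ?thesis using null_sets.Un[OF I Z] by (intro null_sets_subset[OF _ _ sub']) auto
  qed
  have "emeasure lborel \<omega> \<le> emeasure lborel (\<Union>F \<union> (\<omega> - \<Union>F))" by (intro emeasure_mono) auto
  also have "\<dots> = emeasure lborel (\<Union>F)" using null by (intro emeasure_Un_null_set) auto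
  finally have "ennreal (c / distortion\<^sup>2) * emeasure lborel \<omega> \<le> ennreal (c / distortion\<^sup>2) * emeasure lborel (\<Union>\<zeta>\<in>F. \<zeta>)"
    by (intro mult_left_mono) auto
  also have "emeasure lborel (\<Union>\<zeta>\<in>F. \<zeta>) = (\<integral>\<^sup>+\<zeta>. emeasure lborel \<zeta> \<partial>count_space F)"
    using F_open by (intro emeasure_UN_countable cF disj) auto
  also have "ennreal (c / distortion\<^sup>2) * \<dots> = (\<integral>\<^sup>+\<zeta>. ennreal (c / distortion\<^sup>2) * emeasure lborel \<zeta> \<partial>count_space F)"
    by (rule nn_integral_cmult[symmetric]) simp
  also have "\<dots> \<le> (\<integral>\<^sup>+\<zeta>. emeasure lborel (\<zeta> \<inter> B) \<partial>count_space F)"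
  proof (intro nn_integral_mono)
    fix \<zeta> assume "\<zeta> \<in> space (count_space F)"
    then obtain n where "\<zeta> \<in> Fam n" unfolding F_def by auto
    from full_branch_mass[OF Fam_branch(1,2)[OF this] B sub inv c]
    show "ennreal (c / distortion\<^sup>2) * emeasure lborel \<zeta> \<le> emeasure lborel (\<zeta> \<inter> B)" .
  qed
  also have "\<dots> = emeasure lborel (\<Union>\<zeta>\<in>F. \<zeta> \<inter> B)"
    using F_open by (intro emeasure_UN_countable[symmetric] cF disjB) auto
  also have "\<dots> \<le> emeasure lborel (\<omega> \<inter> B)"
    using Fam_branch(3) unfolding F_def by (intro emeasure_mono) auto
  finally show ?thesis .
qed

end

lemma sets_unit_borel: "A \<in> sets unit_borel \<longleftrightarrow> A \<in> sets borel \<and> A \<subseteq> {0..1}"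
  unfolding unit_borel_def by (subst sets_restrict_space_iff) auto

lemma space_unit_borel: "space unit_borel = {0..1}"
  by (simp add: unit_borel_def space_restrict_space)

lemma sets_unit_lborel: "sets unit_lborel = sets unit_borel"
  unfolding unit_borel_def unit_lborel_def by (rule sets_restrict_space_cong) simp

lemma emeasure_unit_lborel: "A \<subseteq> {0..1} \<Longrightarrow> emeasure unit_lborel A = emeasure lborel A"
  unfolding unit_lborel_def by (rule emeasure_restrict_space) auto

lemma sigma_finite_unit_lborel: "sigma_finite_measure unit_lborel"
proof -
  have "emeasure unit_lborel (space unit_lborel) = 1"
    by (simp add: unit_lborel_def space_restrict_space emeasure_restrict_space)
  then have "finite_measure unit_lborel" by (intro finite_measureI) simp
  then show ?thesis by (rule finite_measure.sigma_finite_measure)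
qed

lemma unit_density:
  assumes "sets \<nu> = sets unit_borel" "absolutely_continuous unit_lborel \<nu>"
  obtains f where "f \<in> borel_measurable borel"
    "\<And>E. E \<in> sets borel \<Longrightarrow> E \<subseteq> {0..1} \<Longrightarrow> emeasure \<nu> E = (\<integral>\<^sup>+x\<in>E. f x \<partial>lborel)"
proof -
  obtain g where g: "g \<in> borel_measurable unit_lborel" "density unit_lborel g = \<nu>"
    using sigma_finite_measure.Radon_Nikodym[OF sigma_finite_unit_lborel assms(2)] assms(1) sets_unit_lborel by auto
  define f where "f x = g x * indicator {0..1} x" for x
  have f: "f \<in> borel_measurable borel"
    using g(1) unfolding f_def unit_lborel_def by (subst (asm) borel_measurable_restrict_space_iff_ennreal) auto
  show thesis
  proof (rule that[OF f])
    fix E :: "real set" assume E: "E \<in> sets borel" "E \<subseteq> {0..1}"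
    have Es: "E \<in> sets unit_lborel" using E sets_unit_lborel sets_unit_borel by blast
    have "emeasure \<nu> E = (\<integral>\<^sup>+x\<in>E. g x \<partial>unit_lborel)"
      using g Es by (simp add: g(2)[symmetric] emeasure_density)
    also have "\<dots> = (\<integral>\<^sup>+x. g x * indicator E x * indicator {0..1} x \<partial>lborel)"
      unfolding unit_lborel_def by (rule nn_integral_restrict_space) simp
    also have "\<dots> = (\<integral>\<^sup>+x\<in>E. f x \<partial>lborel)"
      unfolding f_def by (intro nn_integral_cong) (simp add: mult_ac)
    finally show "emeasure \<nu> E = (\<integral>\<^sup>+x\<in>E. f x \<partial>lborel)" .
  qed
qed

section \<open>Invariant sets are null or full; uniqueness\<close>

context expanding
begin

lemma T_measurable: "T \<in> measurable unit_borel unit_borel"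
proof (rule measurableI)
  show "T x \<in> space unit_borel" if "x \<in> space unit_borel" for x
    using that T_range unfolding space_unit_borel by blast
  fix A assume "A \<in> sets unit_borel"
  then have A: "A \<in> sets borel" by (simp add: sets_unit_borel)
  have "T -` A \<inter> space unit_borel = {x \<in> {0..1}. T x \<in> A}" unfolding space_unit_borel by blast
  then show "T -` A \<inter> space unit_borel \<in> sets unit_borel"
    using T_preimage_sets[OF A] unfolding sets_unit_borel by auto
qed

lemma acim_preimage:
  assumes "acim T \<nu>" "E \<in> sets borel" "E \<subseteq> {0..1}"
  shows "emeasure \<nu> {x \<in> {0..1}. T x \<in> E} = emeasure \<nu> E"
proof -
  have s: "sets \<nu> = sets unit_borel" and d: "distr \<nu> \<nu> T = \<nu>" using assms(1) by (auto simp: acim_def)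
  have sp: "space \<nu> = {0..1}" using sets_eq_imp_space_eq[OF s] space_unit_borel by simp
  have "T \<in> measurable \<nu> \<nu>" using T_measurable s by (simp cong: measurable_cong_sets)
  then have "emeasure (distr \<nu> \<nu> T) E = emeasure \<nu> (T -` E \<inter> space \<nu>)"
    using assms(2,3) by (intro emeasure_distr) (simp_all add: s sets_unit_borel)
  also have "T -` E \<inter> space \<nu> = {x \<in> {0..1}. T x \<in> E}" unfolding sp by blast
  finally show ?thesis unfolding d ..
qed

text \<open>If the complement \<open>B\<close> of \<open>A\<close> met every branch domain in positive measure, it would occupy a fixed
  proportion of every small interval, hence \<open>A\<close> would be null.  So \<open>A\<close> contains a branch domain.\<close>
lemma invariant_set_full:
  assumes covers: "\<And>J. J \<in> Ihat \<Longrightarrow> \<exists>m::nat. finite ({0..1} - (\<Union>i\<le>m. (T ^^ i) ` J))"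
    and A [measurable]: "A \<in> sets borel" and sub: "A \<subseteq> {0..1}"
    and inv: "{x \<in> A. T x \<notin> A} \<in> null_sets lborel" and pos: "A \<notin> null_sets lborel"
  shows "{0..1} - A \<in> null_sets lborel"
proof -
  define B where "B = {0..1} - A"
  have B[measurable]: "B \<in> sets borel" by (simp add: B_def)
  have Jm[measurable]: "J \<in> sets borel" if "J \<in> Ihat" for J using Ihat_interval(1)[OF that] by simp
  have "\<exists>J\<in>Ihat. emeasure lborel (J \<inter> B) = 0"
  proof (rule ccontr)
    assume neg: "\<not> ?thesis"
    have invB: "{x \<in> {0..1} - B. (T ^^ n) x \<in> B} \<in> null_sets lborel" for n
    proof -
      have "{x \<in> {0..1} - B. (T ^^ n) x \<in> B} = {x \<in> A. (T ^^ n) x \<notin> A}"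
        using sub funpow_range[of _ n] unfolding B_def by blast
      then show ?thesis using invariant_funpow_null[OF A sub inv] by simp
    qed
    \<comment> \<open>The inserted 1 makes this a minimum over a nonempty set.\<close>
    define c where "c = Min (insert 1 ((\<lambda>J. measure lborel (J \<inter> B)) ` Ihat))"
    have fm: "emeasure lborel (J \<inter> B) = ennreal (measure lborel (J \<inter> B))" for J
    proof -
      have "emeasure lborel (J \<inter> B) \<le> emeasure lborel {0..1::real}" by (intro emeasure_mono) (auto simp: B_def)
      then have "emeasure lborel (J \<inter> B) < top" by (rule order.strict_trans1) simp
      then show ?thesis by (simp add: emeasure_eq_ennreal_measure)
    qed
    have pm: "0 < measure lborel (J \<inter> B)" if "J \<in> Ihat" for J
      using neg that fm[of J] by (metis ennreal_0 measure_nonneg order.order_iff_strict)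
    have c: "0 < c" unfolding c_def using finite_Ihat pm by (subst Min_gr_iff) auto
    have cJ: "ennreal c \<le> emeasure lborel (J \<inter> B)" if "J \<in> Ihat" for J
      unfolding fm c_def using finite_Ihat that by (intro ennreal_leI Min_le) auto
    define \<kappa> where "\<kappa> = c / distortion\<^sup>2"
    have k: "0 < \<kappa>" using c by (simp add: \<kappa>_def distortion_def)
    have Bsub: "B \<subseteq> {0..1}" by (simp add: B_def)
    have opn: "ennreal \<kappa> * emeasure lborel V \<le> emeasure lborel (V \<inter> B)" if V: "open V" "V \<subseteq> J" "J \<in> Ihat" for V J
    proof -
      let ?K = "components V"
      have C: "open C" "connected C" "C \<noteq> {}" "C \<subseteq> J" if "C \<in> ?K" for C
        using open_components[OF V(1) that] in_components_connected[OF that] in_components_nonempty[OF that]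
          in_components_subset[OF that] V(2) by blast+
      have disj: "disjoint_family_on (\<lambda>C. C) ?K"
        using pairwise_disjoint_components[of V] by (auto simp: pairwise_def disjnt_def disjoint_family_on_def)
      then have disjB: "disjoint_family_on (\<lambda>C. C \<inter> B) ?K" unfolding disjoint_family_on_def by blast
      have cnt: "countable ?K"
        by (rule countable_disjoint_open_subsets)
          (use C(1) disj in \<open>auto simp: disjoint_def disjoint_family_on_def\<close>)
      have bor: "C \<in> sets borel" if "C \<in> ?K" for C using C(1)[OF that] by simp
      have UN: "V = (\<Union>C\<in>?K. C)" using Union_components[of V] by simp
      have "ennreal \<kappa> * emeasure lborel V = ennreal \<kappa> * (\<integral>\<^sup>+C. emeasure lborel C \<partial>count_space ?K)"
        by (subst UN, subst emeasure_UN_countable) (use bor disj cnt in auto)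
      also have "\<dots> = (\<integral>\<^sup>+C. ennreal \<kappa> * emeasure lborel C \<partial>count_space ?K)"
        by (rule nn_integral_cmult[symmetric]) simp
      also have "\<dots> \<le> (\<integral>\<^sup>+C. emeasure lborel (C \<inter> B) \<partial>count_space ?K)"
      proof (intro nn_integral_mono)
        fix C assume "C \<in> space (count_space ?K)"
        then have "C \<in> ?K" by simp
        then show "ennreal \<kappa> * emeasure lborel C \<le> emeasure lborel (C \<inter> B)"
          unfolding \<kappa>_def by (intro interval_mass[OF B Bsub invB c cJ _ _ _ _ V(3)] C)
      qed
      also have "\<dots> = emeasure lborel (\<Union>C\<in>?K. C \<inter> B)"
        by (rule emeasure_UN_countable[symmetric]) (use bor disjB cnt in auto)
      also have "(\<Union>C\<in>?K. C \<inter> B) = V \<inter> B" using UN by blast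
      finally show ?thesis .
    qed
    have AJ: "A \<inter> J \<in> null_sets lborel" if J: "J \<in> Ihat" for J
    proof -
      have "emeasure lborel (A \<inter> J) \<le> 0"
      proof (rule ennreal_le_epsilon)
        fix e :: real assume e: "0 < e"
        \<comment> \<open>The part of U \<inter> J in B lies in U - A \<inter> J, which is small;
          being at least \<kappa> times U \<inter> J in measure, it makes U \<inter> J small as
          well.\<close>
        obtain U where U: "open U" "A \<inter> J \<subseteq> U" "emeasure lborel (U - A \<inter> J) < ennreal (\<kappa> * e)"
          using outer_regular_lborel[of "A \<inter> J" "\<kappa> * e"] J k e by auto
        have [measurable]: "U \<in> sets borel" using U(1) by simp
        have oV: "open (U \<inter> J)" using U(1) Ihat_interval(1)[OF J] by blast
        have "ennreal \<kappa> * emeasure lborel (U \<inter> J) \<le> emeasure lborel (U \<inter> J \<inter> B)"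
          by (rule opn[OF oV _ J]) simp
        also have "\<dots> \<le> emeasure lborel (U - A \<inter> J)"
          using J by (intro emeasure_mono) (auto simp: B_def)
        also have "\<dots> \<le> ennreal (\<kappa> * e)" using U(3) by simp
        also have "\<dots> = ennreal \<kappa> * ennreal e" using k e by (simp add: ennreal_mult)
        finally have "emeasure lborel (U \<inter> J) \<le> ennreal e"
          using k by (simp add: ennreal_mult_le_mult_iff)
        moreover have "emeasure lborel (A \<inter> J) \<le> emeasure lborel (U \<inter> J)"
          using U(2) J by (intro emeasure_mono) auto
        ultimately show "emeasure lborel (A \<inter> J) \<le> 0 + ennreal e" by simp
      qed
      then show ?thesis using J by (auto simp: null_sets_def)
    qed
    have nul: "(\<Union>J\<in>Ihat. A \<inter> J) \<union> ({0..1} - \<Union>Ihat) \<in> null_sets lborel"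
      using AJ finite_Ihat finite_imp_null_set_lborel[OF cofinite_Ihat]
      by (intro null_sets.Un null_sets.finite_UN) auto
    have "A \<in> null_sets lborel" by (rule null_sets_subset[OF nul]) (simp, use sub in blast)
    then show False using pos by simp
  qed
  then obtain J where J: "J \<in> Ihat" "emeasure lborel (J \<inter> B) = 0" by blast
  obtain m where m: "finite ({0..1} - (\<Union>i\<le>m. (T ^^ i) ` J))" using covers[OF J(1)] by blast
  \<comment> \<open>A point of the image outside A comes from J \<inter> B, which is null, or from a
    point of A that leaves A.\<close>
  have neg: "negligible ((T ^^ i) ` J - A)" for i
  proof -
    have 1: "negligible ((T ^^ i) ` (J \<inter> B))"
      using J Ihat_interval(5)[OF J(1)] by (intro negligible_funpow_image) (auto simp: negligible_iff_null_sets null_sets_completionI null_sets_def)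
    have n2: "{x \<in> A. (T ^^ i) x \<notin> A} \<in> null_sets lborel" by (rule invariant_funpow_null[OF A sub inv])
    have "negligible {x \<in> A. (T ^^ i) x \<notin> A}"
      using null_sets_completionI[OF n2] by (simp add: negligible_iff_null_sets)
    then have "negligible ((T ^^ i) ` {x \<in> A. (T ^^ i) x \<notin> A})"
      by (rule negligible_funpow_image) (use sub in blast)
    from negligible_Un[OF 1 this] show ?thesis
      by (rule negligible_subset) (use Ihat_interval(5)[OF J(1)] in \<open>unfold B_def, blast\<close>)
  qed
  have "negligible (\<Union>i\<le>m. (T ^^ i) ` J - A)" by (rule negligible_Union) (auto simp: neg)
  from negligible_Un[OF this negligible_finite[OF m]] have "negligible B" by (rule negligible_subset) (unfold B_def, blast)
  then have "B \<in> null_sets lebesgue" by (simp add: negligible_iff_null_sets)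
  then have "B \<in> null_sets lborel" using B by (auto simp: null_sets_def)
  then show ?thesis by (simp add: B_def)
qed

text \<open>A = {f2 < f1} and its preimage A' have equal mass under each measure. On A' - A the
  first measure does not exceed the second, hence neither does it on A - A'; but there f1 > f2, so A
  - A' is null. Thus A, and likewise B = {f1 < f2}, is null or full, and being disjoint they are not
  both full.\<close>

lemma acim_unique:
  assumes covers: "\<And>J. J \<in> Ihat \<Longrightarrow> \<exists>m::nat. finite ({0..1} - (\<Union>i\<le>m. (T ^^ i) ` J))"
    and 1: "acim T \<nu>1" and 2: "acim T \<nu>2"
  shows "\<nu>1 = \<nu>2"
proof -
  have s: "sets \<nu>1 = sets unit_borel" "sets \<nu>2 = sets unit_borel" and p: "prob_space \<nu>1" "prob_space \<nu>2"
    and ac: "absolutely_continuous unit_lborel \<nu>1" "absolutely_continuous unit_lborel \<nu>2"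
    using 1 2 by (auto simp: acim_def)
  obtain f1 where f1[measurable]: "f1 \<in> borel_measurable borel"
    and d1: "\<And>E. E \<in> sets borel \<Longrightarrow> E \<subseteq> {0..1} \<Longrightarrow> emeasure \<nu>1 E = (\<integral>\<^sup>+x\<in>E. f1 x \<partial>lborel)"
    using unit_density[OF s(1) ac(1)] by blast
  obtain f2 where f2[measurable]: "f2 \<in> borel_measurable borel"
    and d2: "\<And>E. E \<in> sets borel \<Longrightarrow> E \<subseteq> {0..1} \<Longrightarrow> emeasure \<nu>2 E = (\<integral>\<^sup>+x\<in>E. f2 x \<partial>lborel)"
    using unit_density[OF s(2) ac(2)] by blast
  have key: "{x \<in> {0..1}. g x < f x} \<in> null_sets lborel \<or> {0..1} - {x \<in> {0..1}. g x < f x} \<in> null_sets lborel"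
    if ac': "acim T M" "acim T N" and f[measurable]: "f \<in> borel_measurable borel" "g \<in> borel_measurable borel"
      and dM: "\<And>E. E \<in> sets borel \<Longrightarrow> E \<subseteq> {0..1} \<Longrightarrow> emeasure M E = (\<integral>\<^sup>+x\<in>E. f x \<partial>lborel)"
      and dN: "\<And>E. E \<in> sets borel \<Longrightarrow> E \<subseteq> {0..1} \<Longrightarrow> emeasure N E = (\<integral>\<^sup>+x\<in>E. g x \<partial>lborel)"
    for M N and f g :: "real \<Rightarrow> ennreal"
  proof -
    define A where "A = {x \<in> {0..1}. g x < f x}"
    have A[measurable]: "A \<in> sets borel" and As: "A \<subseteq> {0..1}" unfolding A_def by (measurable, blast)
    define A' where "A' = {x \<in> {0..1}. T x \<in> A}"
    have A'[measurable]: "A' \<in> sets borel" and A's: "A' \<subseteq> {0..1}"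
      unfolding A'_def using T_preimage_sets[OF A] by (simp, blast)
    interpret M: prob_space M using ac'(1) by (simp add: acim_def)
    interpret N: prob_space N using ac'(2) by (simp add: acim_def)
    have sM: "sets M = sets unit_borel" "sets N = sets unit_borel" using ac' by (auto simp: acim_def)
    have sts: "E \<in> sets M" "E \<in> sets N" if "E \<in> sets borel" "E \<subseteq> {0..1}" for E
      using that by (simp_all add: sM sets_unit_borel)
    have eqM: "measure M A = measure M A'" "measure N A = measure N A'"
      unfolding measure_def A'_def using acim_preimage[OF ac'(1) A As] acim_preimage[OF ac'(2) A As] by simp_all
    have m1: "measure M A = measure M (A \<inter> A') + measure M (A - A')" "measure M A' = measure M (A \<inter> A') + measure M (A' - A)"
      and m2: "measure N A = measure N (A \<inter> A') + measure N (A - A')" "measure N A' = measure N (A \<inter> A') + measure N (A' - A)"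
      using M.finite_measure_Diff'[of A A'] M.finite_measure_Diff'[of A' A] N.finite_measure_Diff'[of A A'] N.finite_measure_Diff'[of A' A]
        sts As A's by (auto simp: Int_commute)
    have A'A: "A' - A \<in> sets borel" "A' - A \<subseteq> {0..1}" using A's by auto
    have "emeasure M (A' - A) \<le> emeasure N (A' - A)"
      unfolding dM[OF A'A] dN[OF A'A] using A's
      by (intro nn_integral_mono) (auto simp: A_def indicator_def not_less)
    then have "measure M (A' - A) \<le> measure N (A' - A)"
      by (simp add: M.emeasure_eq_measure N.emeasure_eq_measure)
    then have "measure M (A - A') \<le> measure N (A - A')" using eqM m1 m2 by linarith
    then have "emeasure M (A - A') \<le> emeasure N (A - A')"
      by (simp add: M.emeasure_eq_measure N.emeasure_eq_measure)
    moreover have AA: "A - A' \<in> sets borel" "A - A' \<subseteq> {0..1}" using As by auto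
    ultimately have le: "(\<integral>\<^sup>+x\<in>A - A'. f x \<partial>lborel) \<le> (\<integral>\<^sup>+x\<in>A - A'. g x \<partial>lborel)"
      using dM[OF AA] dN[OF AA] by simp
    have "A - A' \<in> null_sets lborel"
    proof (rule nn_integral_eq_imp_null_set[OF _ _ _ _ le])
      show "(\<integral>\<^sup>+x\<in>A - A'. g x \<partial>lborel) < \<infinity>"
        unfolding dN[OF AA, symmetric] by (simp add: less_top[symmetric])
    qed (auto simp: A_def)
    moreover have "{x \<in> A. T x \<notin> A} = A - A'" using As unfolding A'_def by blast
    ultimately show ?thesis
      using invariant_set_full[OF covers A As] unfolding A_def[symmetric] by auto
  qed
  define A where "A = {x \<in> {0..1}. f2 x < f1 x}"
  define B where "B = {x \<in> {0..1}. f1 x < f2 x}"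
  have [measurable]: "A \<in> sets borel" "B \<in> sets borel" and sub: "A \<subseteq> {0..1}" "B \<subseteq> {0..1}"
    unfolding A_def B_def by (measurable, measurable, blast, blast)
  have disj: "A \<inter> B = {}" unfolding A_def B_def by auto
  have "A \<in> null_sets lborel \<or> {0..1} - A \<in> null_sets lborel" unfolding A_def by (rule key[OF 1 2 f1 f2 d1 d2])
  moreover have "B \<in> null_sets lborel \<or> {0..1} - B \<in> null_sets lborel" unfolding B_def by (rule key[OF 2 1 f2 f1 d2 d1])
  moreover have "\<not> ({0..1} - A \<in> null_sets lborel \<and> {0..1} - B \<in> null_sets lborel)"
  proof
    assume "{0..1} - A \<in> null_sets lborel \<and> {0..1} - B \<in> null_sets lborel"
    then have "({0..1} - A) \<union> ({0..1} - B) \<in> null_sets lborel" by (intro null_sets.Un) auto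
    then have "{0..1::real} \<in> null_sets lborel" by (rule null_sets_subset) (use disj in auto)
    then show False by (simp add: null_sets_def)
  qed
  ultimately have one: "A \<in> null_sets lborel \<or> B \<in> null_sets lborel" by blast
  have tot: "emeasure \<nu>1 {0..1} = 1" "emeasure \<nu>2 {0..1} = 1"
    using prob_space.emeasure_space_1[OF p(1)] prob_space.emeasure_space_1[OF p(2)]
      sets_eq_imp_space_eq[OF s(1)] sets_eq_imp_space_eq[OF s(2)] by (simp_all add: space_unit_borel)
  \<comment> \<open>If one density dominates the other almost everywhere, equal total mass forces
    equality almost everywhere.\<close>
  have other: "{x \<in> {0..1}. f x < g x} \<in> null_sets lborel"
    if nul: "{x \<in> {0..1}. g x < f x} \<in> null_sets lborel" and [measurable]: "f \<in> borel_measurable borel" "g \<in> borel_measurable borel"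
      and t: "(\<integral>\<^sup>+x\<in>{0..1}. f x \<partial>lborel) = 1" "(\<integral>\<^sup>+x\<in>{0..1}. g x \<partial>lborel) = 1" for f g :: "real \<Rightarrow> ennreal"
  proof -
    have le: "AE x in lborel. x \<in> {0..1} \<longrightarrow> f x \<le> g x"
      using AE_not_in[OF nul] by eventually_elim (auto simp: not_less)
    have "(\<integral>\<^sup>+x. f x * indicator {0..1} x + (g x - f x) * indicator {0..1} x \<partial>lborel) = (\<integral>\<^sup>+x\<in>{0..1}. g x \<partial>lborel)"
      by (intro nn_integral_cong_AE) (use le in \<open>eventually_elim, auto simp: indicator_def add_diff_inverse_ennreal\<close>)
    then have "1 + (\<integral>\<^sup>+x. (g x - f x) * indicator {0..1} x \<partial>lborel) = 1 + 0"
      by (subst (asm) nn_integral_add) (simp_all add: t)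
    then have "(\<integral>\<^sup>+x. (g x - f x) * indicator {0..1} x \<partial>lborel) = 0"
      by (subst (asm) ennreal_add_left_cancel) auto
    then have z: "AE x in lborel. (g x - f x) * indicator {0..1} x = 0"
      by (subst (asm) nn_integral_0_iff_AE) measurable
    have "AE x in lborel. x \<notin> {x \<in> {0..1}. f x < g x}"
      using z by eventually_elim (auto simp: indicator_def diff_eq_0_iff_ennreal not_less)
    then show ?thesis by (rule AE_iff_null_sets[THEN iffD2, rotated]) measurable
  qed
  have t: "(\<integral>\<^sup>+x\<in>{0..1}. f1 x \<partial>lborel) = 1" "(\<integral>\<^sup>+x\<in>{0..1}. f2 x \<partial>lborel) = 1"
    using d1[of "{0..1}"] d2[of "{0..1}"] tot by simp_all
  have both: "A \<in> null_sets lborel" "B \<in> null_sets lborel"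
    using one other[of f2 f1] other[of f1 f2] t f1 f2 unfolding A_def B_def by blast+
  have ae: "AE x in lborel. x \<in> {0..1} \<longrightarrow> f1 x = f2 x"
    using AE_not_in[OF both(1)] AE_not_in[OF both(2)]
    by eventually_elim (auto simp: A_def B_def not_less intro: antisym)
  have eq: "emeasure \<nu>1 E = emeasure \<nu>2 E" if "E \<in> sets borel" "E \<subseteq> {0..1}" for E
    unfolding d1[OF that] d2[OF that]
    by (intro nn_integral_cong_AE) (use ae in \<open>eventually_elim, use that in \<open>auto simp: indicator_def\<close>\<close>)
  show ?thesis
    by (rule measure_eqI) (use eq s in \<open>auto simp: sets_unit_borel\<close>)
qed

end

section \<open>Levels and cells of the tower\<close>

locale tower_setup = cutting +
  fixes \<delta> :: real and N :: nat and \<Lambda> :: "nat \<Rightarrow> real set"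
  assumes \<delta>_pos: "0 < \<delta>" and partition: "small_partition Q H \<delta> N \<Lambda>"
begin

definition left_end :: "nat \<Rightarrow> real" where "left_end i = Inf (\<Lambda> i)"
definition width :: "nat \<Rightarrow> real" where "width i = Sup (\<Lambda> i) - Inf (\<Lambda> i)"
text \<open>Inverse to \<open>base_proj\<close> over the i-th base interval, where
  \<open>base_proj\<close> has slope \<open>width i\<close>.\<close>

definition lift :: "nat \<Rightarrow> real \<Rightarrow> real" where "lift i u = real i + (u - left_end i) / width i"

lemma Lam_interval:
  assumes "i < N"
  shows "\<Lambda> i = {left_end i<..<left_end i + width i}" "\<delta> \<le> width i" "0 < width i" "start_interval (\<Lambda> i)"
proof -
  obtain l r where lr: "\<Lambda> i = {l<..<r}" "\<delta> \<le> r - l" using partition assms unfolding small_partition_def by blast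
  have "l < r" using lr(2) \<delta>_pos by linarith
  then have "left_end i = l" "width i = r - l" unfolding left_end_def width_def lr(1) by simp_all
  then show "\<Lambda> i = {left_end i<..<left_end i + width i}" "\<delta> \<le> width i" "0 < width i" using lr \<delta>_pos by simp_all
  obtain J where "J \<in> Q" "\<Lambda> i \<subseteq> J" using partition assms unfolding small_partition_def by blast
  then show "start_interval (\<Lambda> i)" unfolding start_interval_def using lr(1) \<open>l < r\<close> by auto
qed

lemma Lam_disjoint: "i < N \<Longrightarrow> j < N \<Longrightarrow> u \<in> \<Lambda> i \<Longrightarrow> u \<in> \<Lambda> j \<Longrightarrow> i = j"
  using partition unfolding small_partition_def disjoint_family_on_def by (metis IntI empty_iff lessThan_iff)

lemma Lam_cofinite: "finite ({0..1} - H - (\<Union>k<N. \<Lambda> k))"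
  using partition unfolding small_partition_def by blast

lemma Lam_subset: "i < N \<Longrightarrow> \<Lambda> i \<subseteq> {0..1}"
  using start_interval_subset Lam_interval(4) by blast

lemma base_index_eq: "x \<in> base_interval i \<Longrightarrow> base_index x = i"
  unfolding base_interval_def base_index_def by (auto intro!: nat_eq_iff[THEN iffD2] floor_unique) 

lemma base_proj_eq: "x \<in> base_interval i \<Longrightarrow> base_proj \<Lambda> x = left_end i + (x - real i) * width i"
  unfolding base_proj_def Let_def by (simp add: base_index_eq left_end_def width_def)

lemma baseE:
  assumes "x \<in> base N" obtains i where "i < N" "x \<in> base_interval i"
  using assms unfolding base_def by blast

lemma base_proj_in: "i < N \<Longrightarrow> x \<in> base_interval i \<Longrightarrow> base_proj \<Lambda> x \<in> \<Lambda> i"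
  unfolding base_proj_eq using Lam_interval[of i]
  by (simp add: base_interval_def mult_less_cancel_right2)

lemma lift_proj: "i < N \<Longrightarrow> x \<in> base_interval i \<Longrightarrow> lift i (base_proj \<Lambda> x) = x"
  unfolding base_proj_eq using Lam_interval(3)[of i] by (simp add: lift_def)

lemma lift_in: "i < N \<Longrightarrow> u \<in> \<Lambda> i \<Longrightarrow> lift i u \<in> base_interval i"
  using Lam_interval[of i] by (simp add: lift_def base_interval_def divide_less_eq zero_less_divide_iff)

lemma proj_lift: "i < N \<Longrightarrow> u \<in> \<Lambda> i \<Longrightarrow> base_proj \<Lambda> (lift i u) = u"
  using lift_in[of i u] Lam_interval(3)[of i] by (simp add: base_proj_eq) (simp add: lift_def)

lemma base_proj_unit:
  assumes "x \<in> base N" shows "base_proj \<Lambda> x \<in> {0..1}"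
proof -
  obtain i where i: "i < N" "x \<in> base_interval i" using assms by (rule baseE)
  from base_proj_in[OF i] Lam_subset[OF i(1)] show ?thesis by (rule rev_subsetD)
qed

lemma base_proj_inj: "inj_on (base_proj \<Lambda>) (base N)"
proof (rule inj_onI)
  fix x y assume xy: "x \<in> base N" "y \<in> base N" "base_proj \<Lambda> x = base_proj \<Lambda> y"
  obtain i where i: "i < N" "x \<in> base_interval i" using xy(1) by (rule baseE)
  obtain j where j: "j < N" "y \<in> base_interval j" using xy(2) by (rule baseE)
  have a: "base_proj \<Lambda> x \<in> \<Lambda> j" unfolding xy(3) by (rule base_proj_in[OF j])
  have ij: "i = j" by (rule Lam_disjoint[OF i(1) j(1) base_proj_in[OF i] a])
  have "x = lift i (base_proj \<Lambda> x)" by (rule lift_proj[OF i, symmetric])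
  also have "\<dots> = y" unfolding xy(3) ij by (rule lift_proj[OF j])
  finally show "x = y" .
qed

lemma inv_proj_lift: "k < N \<Longrightarrow> u \<in> \<Lambda> k \<Longrightarrow> the_inv_into (base N) (base_proj \<Lambda>) u = lift k u"
  using proj_lift[of k u] lift_in[of k u]
  by (intro the_inv_into_f_eq[OF base_proj_inj]) (auto simp: base_def)

lemma lift_base: "k < N \<Longrightarrow> u \<in> \<Lambda> k \<Longrightarrow> lift k u \<in> base N"
  using lift_in by (auto simp: base_def)

text \<open>Disjoint intervals of length at least \<delta> in [0,1] are counted. This bounds the
  size of the base independently of the hole, as the uniform constants require.\<close>

lemma N_le: "real N * \<delta> \<le> 1"
proof -
  have "ennreal (real N * \<delta>) = (\<Sum>i<N. ennreal \<delta>)"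
    using \<delta>_pos by (simp add: ennreal_mult ennreal_of_nat_eq_real_of_nat)
  also have "\<dots> \<le> (\<Sum>i<N. emeasure lborel (\<Lambda> i))"
  proof (rule sum_mono)
    fix i assume "i \<in> {..<N}"
    then have i: "i < N" by simp
    show "ennreal \<delta> \<le> emeasure lborel (\<Lambda> i)"
      using Lam_interval[OF i] by (simp add: ennreal_leI)
  qed
  also have "\<dots> = emeasure lborel (\<Union>i<N. \<Lambda> i)"
    using partition Lam_interval(1) by (intro sum_emeasure) (auto simp: small_partition_def)
  also have "\<dots> \<le> emeasure lborel {0..1::real}" using Lam_subset by (intro emeasure_mono) auto
  finally show ?thesis by simp
qed

definition level :: "nat \<Rightarrow> real set" where "level l = {x \<in> base N. enat l < return_time T Q H \<Lambda> x}"
definition cells :: "nat \<Rightarrow> (nat \<times> real set) set" where "cells l = (SIGMA i:{..<N}. Omega T Q (\<Lambda> i) l)"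
definition cell :: "nat \<times> real set \<Rightarrow> real set" where "cell c = lift (fst c) ` snd c"
text \<open>The open part of \<open>level l\<close>. The two differ by finitely many points, so it
  replaces the level wherever derivatives or sums over cells are taken.\<close>

definition open_level :: "nat \<Rightarrow> real set" where "open_level l = (\<Union>c\<in>cells l. cell c)"

lemma tower_eq: "tower T Q H N \<Lambda> = {(x, l). x \<in> level l}"
  unfolding tower_def level_def by simp

lemma finite_cells: "finite (cells l)" and card_cells: "card (cells l) \<le> N * 2 ^ l"
proof -
  have f: "finite (Omega T Q (\<Lambda> i) l)" "card (Omega T Q (\<Lambda> i) l) \<le> 2 ^ l" if "i < N" for i
    using Omega_card[OF Lam_interval(4)[OF that]] by blast+
  show "finite (cells l)" unfolding cells_def using f by (intro finite_SigmaI) auto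
  have "card (cells l) = (\<Sum>i<N. card (Omega T Q (\<Lambda> i) l))" unfolding cells_def using f by (intro card_SigmaI) auto
  also have "\<dots> \<le> (\<Sum>i<N. 2 ^ l)" using f by (intro sum_mono) simp
  finally show "card (cells l) \<le> N * 2 ^ l" by simp
qed

lemma cellsD:
  assumes "c \<in> cells l"
  shows "fst c < N" "snd c \<in> Omega T Q (\<Lambda> (fst c)) l" "branch (Suc l) (snd c)" "snd c \<subseteq> \<Lambda> (fst c)"
    "cell c \<subseteq> base_interval (fst c)" "cell c \<subseteq> base N"
proof -
  show 1: "fst c < N" "snd c \<in> Omega T Q (\<Lambda> (fst c)) l" using assms unfolding cells_def by auto
  show 2: "branch (Suc l) (snd c)" "snd c \<subseteq> \<Lambda> (fst c)"
    using Omega_element[OF Lam_interval(4)[OF 1(1)] 1(2)] by blast+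
  show "cell c \<subseteq> base_interval (fst c)" unfolding cell_def using lift_in[OF 1(1)] 2(2) by blast
  then show "cell c \<subseteq> base N" using 1(1) unfolding base_def by blast
qed

lemma cell_eq: "c \<in> cells l \<Longrightarrow> cell c = {x \<in> base_interval (fst c). base_proj \<Lambda> x \<in> snd c}"
  unfolding cell_def using cellsD[of c l] lift_in lift_proj proj_lift
  by (auto simp: image_iff subset_iff) (metis lift_proj)+

lemma tower_cells_eq: "i < N \<Longrightarrow> tower_cells T Q \<Lambda> i l = cell ` ({i} \<times> Omega T Q (\<Lambda> i) l)"
  unfolding tower_cells_def using cell_eq[of "(i, _)" l] by (auto simp: cells_def image_iff)

lemma cell_tower_cells: "c \<in> cells l \<Longrightarrow> cell c \<in> tower_cells T Q \<Lambda> (fst c) l"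
  using tower_cells_eq[of "fst c" l] cellsD(1,2)[of c l] by (cases c) auto

lemma lift_continuous: "continuous_on A (lift i)"
  unfolding lift_def by (cases "width i = 0") (auto intro!: continuous_intros)

lemma cell_open:
  assumes "c \<in> cells l"
  shows "open (cell c)" "connected (cell c)" "bounded (cell c)"
proof -
  note c = cellsD[OF assms]
  have b: "open (snd c)" "connected (snd c)" using c(3) by (auto simp: branch_def)
  have "inj_on (lift (fst c)) (snd c)"
    by (rule inj_on_inverseI[of _ "base_proj \<Lambda>"]) (rule proj_lift[OF c(1) subsetD[OF c(4)]])
  then show "open (cell c)" unfolding cell_def using invariance_of_domain[OF lift_continuous b(1)] by blast
  show "connected (cell c)" unfolding cell_def by (rule connected_continuous_image[OF lift_continuous b(2)])
  show "bounded (cell c)" using c(5) by (rule bounded_subset[rotated]) (simp add: base_interval_def)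
qed

lemma cells_disjoint:
  assumes "c \<in> cells l" "c' \<in> cells l" "c \<noteq> c'" shows "cell c \<inter> cell c' = {}"
proof (rule ccontr)
  assume "\<not> ?thesis"
  then obtain x where x: "x \<in> cell c" "x \<in> cell c'" by blast
  have "base_index x = fst c" using base_index_eq cellsD(5)[OF assms(1)] x by blast
  moreover have "base_index x = fst c'" using base_index_eq cellsD(5)[OF assms(2)] x by blast
  ultimately have eq: "fst c = fst c'" by simp
  have "base_proj \<Lambda> x \<in> snd c" using x(1) unfolding cell_eq[OF assms(1)] by simp
  moreover have "base_proj \<Lambda> x \<in> snd c'" using x(2) unfolding cell_eq[OF assms(2)] by simp
  moreover have "snd c \<noteq> snd c'" using eq assms(3) prod_eqI by blast
  then have "disjnt (snd c) (snd c')"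
    using pairwiseD[OF Omega_disjoint cellsD(2)[OF assms(1)], of "snd c'"] cellsD(2)[OF assms(2)] eq by simp
  ultimately show False unfolding disjnt_def by blast
qed

lemma open_level_eq: "open_level l = {x \<in> base N. base_proj \<Lambda> x \<in> \<Union>(Omega T Q (\<Lambda> (base_index x)) l)}"
proof (intro set_eqI iffI)
  fix x assume "x \<in> open_level l"
  then obtain c where c: "c \<in> cells l" "x \<in> cell c" unfolding open_level_def by blast
  note d = cellsD[OF c(1)]
  have "base_index x = fst c" using base_index_eq d(5) c(2) by blast
  then show "x \<in> {x \<in> base N. base_proj \<Lambda> x \<in> \<Union>(Omega T Q (\<Lambda> (base_index x)) l)}"
    using d(2,6) c cell_eq[OF c(1)] by auto
next
  fix x assume x: "x \<in> {x \<in> base N. base_proj \<Lambda> x \<in> \<Union>(Omega T Q (\<Lambda> (base_index x)) l)}"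
  then obtain i where i: "i < N" "x \<in> base_interval i" by (auto elim: baseE)
  then obtain \<omega> where w: "\<omega> \<in> Omega T Q (\<Lambda> i) l" "base_proj \<Lambda> x \<in> \<omega>" using x base_index_eq[OF i(2)] by auto
  have c: "(i, \<omega>) \<in> cells l" using i w by (simp add: cells_def)
  then show "x \<in> open_level l" unfolding open_level_def using cell_eq[OF c] i w by auto
qed

lemma open_level_level: "open_level l \<subseteq> level l"
  unfolding open_level_eq level_def return_time_def using Omega_less_stop_time by blast

lemma finite_level_open_level: "finite (level l - open_level l)"
proof (rule finite_imageD)
  show "inj_on (base_proj \<Lambda>) (level l - open_level l)" by (rule inj_on_subset[OF base_proj_inj]) (auto simp: level_def)
  show "finite (base_proj \<Lambda> ` (level l - open_level l))"
  proof (rule finite_subset)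
    show "base_proj \<Lambda> ` (level l - open_level l) \<subseteq>
      (\<Union>i<N. {u \<in> \<Lambda> i. enat l < stop_time T Q H (\<Lambda> i) u} - \<Union>(Omega T Q (\<Lambda> i) l))"
    proof (rule image_subsetI)
      fix x assume x: "x \<in> level l - open_level l"
      then obtain i where i: "i < N" "x \<in> base_interval i" unfolding level_def by (auto elim: baseE)
      show "base_proj \<Lambda> x \<in> (\<Union>i<N. {u \<in> \<Lambda> i. enat l < stop_time T Q H (\<Lambda> i) u} - \<Union>(Omega T Q (\<Lambda> i) l))"
        using x i base_proj_in[OF i] base_index_eq[OF i(2)] unfolding level_def open_level_eq return_time_def by auto
    qed
    show "finite (\<Union>i<N. {u \<in> \<Lambda> i. enat l < stop_time T Q H (\<Lambda> i) u} - \<Union>(Omega T Q (\<Lambda> i) l))"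
      using less_stop_time_Omega Lam_interval(4) by (intro finite_UN_I) auto
  qed
qed

lemma open_level_open: "open (open_level l)" unfolding open_level_def using cell_open(1) by blast

lemma open_level_frontier: "finite (frontier (open_level l))"
  unfolding open_level_def using finite_cells cell_open
  by (intro finite_frontier_Union) (auto intro!: finite_frontier_interval)

lemma level_antimono: "level (Suc l) \<subseteq> level l"
  unfolding level_def using less_trans[of "enat l" "enat (Suc l)"] by auto

lemma level_0: "level 0 = base N"
  unfolding level_def return_time_def less_stop_time_iff by simp

lemma level_base: "level l \<subseteq> base N" unfolding level_def by blast

lemma base_subset: "base N \<subseteq> {0..real N}"
proof
  fix x assume "x \<in> base N"
  then obtain i where i: "i < N" "x \<in> base_interval i" by (rule baseE)
  have "real i + 1 \<le> real N" using i(1) by linarith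
  then show "x \<in> {0..real N}" using i(2) unfolding base_interval_def by auto
qed

lemma base_open: "open (base N)"
  unfolding base_def base_interval_def by (intro open_UN) simp

lemma level_sets [measurable]: "level l \<in> sets borel"
proof -
  have "level l = open_level l \<union> (level l - open_level l)" using open_level_level by blast
  then show ?thesis
    by (rule ssubst) (intro sets.Un borel_open[OF open_level_open] borel_closed finite_imp_closed finite_level_open_level)
qed

lemma base_sets [measurable]: "base N \<in> sets borel" using base_open by simp

lemma base_index_measurable [measurable]: "base_index \<in> borel \<rightarrow>\<^sub>M count_space UNIV"
  unfolding base_index_def by measurable

lemma base_proj_measurable [measurable]: "base_proj \<Lambda> \<in> borel_measurable borel"
  unfolding base_proj_def Let_def by measurable

text \<open>The value 0 off the base makes this Borel on the whole line with range in the unit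
  interval.\<close>

definition level_proj :: "nat \<Rightarrow> real \<Rightarrow> real" where "level_proj l x = (if x \<in> base N then (T ^^ l) (base_proj \<Lambda> x) else 0)"

lemma level_proj_range: "level_proj l x \<in> {0..1}"
  unfolding level_proj_def using funpow_range[OF base_proj_unit, of x l] by simp

lemma level_proj_measurable [measurable]: "level_proj l \<in> borel_measurable borel"
proof (rule borel_measurableI)
  fix S :: "real set" assume "open S"
  then have S: "S \<in> sets borel" by simp
  have "level_proj l -` S \<inter> space borel = (base N \<inter> base_proj \<Lambda> -` {u \<in> {0..1}. (T ^^ l) u \<in> S}) \<union> (if 0 \<in> S then - base N else {})"
  proof (rule set_eqI)
    fix x
    show "x \<in> level_proj l -` S \<inter> space borel \<longleftrightarrow> x \<in> (base N \<inter> base_proj \<Lambda> -` {u \<in> {0..1}. (T ^^ l) u \<in> S}) \<union> (if 0 \<in> S then - base N else {})"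
      using base_proj_unit[of x] by (cases "x \<in> base N") (simp_all add: level_proj_def)
  qed
  moreover have "base_proj \<Lambda> -` {u \<in> {0..1}. (T ^^ l) u \<in> S} \<in> sets borel"
    using measurable_sets[OF base_proj_measurable funpow_preimage_sets[OF S, of l]] by simp
  ultimately show "level_proj l -` S \<inter> space borel \<in> sets borel" by auto
qed

lemma tower_sets: "(\<And>l. S l \<in> sets borel) \<Longrightarrow> {(x, l). x \<in> S l} \<in> sets (lborel \<Otimes>\<^sub>M count_space (UNIV :: nat set))"
proof -
  assume S: "\<And>l. S l \<in> sets borel"
  have "{(x, l). x \<in> S l} = (\<Union>l. S l \<times> {l})" by auto
  moreover have "S l \<times> {l} \<in> sets (lborel \<Otimes>\<^sub>M count_space (UNIV :: nat set))" for l
    using S by (intro pair_measureI) auto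
  ultimately show ?thesis by auto
qed

lemma tower_in_sets: "tower T Q H N \<Lambda> \<in> sets (lborel \<Otimes>\<^sub>M count_space (UNIV :: nat set))"
  unfolding tower_eq by (rule tower_sets) (rule level_sets)

lemma space_tower: "space (tower_lborel T Q H N \<Lambda>) = tower T Q H N \<Lambda>"
  unfolding tower_lborel_def by (simp add: space_restrict_space space_pair_measure)

text \<open>Fubini with counting measure on the heights; from here on the tower is treated level by
  level on the line.\<close>

lemma nn_integral_tower:
  assumes F: "F \<in> borel_measurable (tower_lborel T Q H N \<Lambda>)"
  shows "(\<lambda>x. F (x, l) * indicator (level l) x) \<in> borel_measurable borel"
    "(\<integral>\<^sup>+p. F p \<partial>tower_lborel T Q H N \<Lambda>) = (\<Sum>l. \<integral>\<^sup>+x\<in>level l. F (x, l) \<partial>lborel)"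
proof -
  let ?P = "lborel \<Otimes>\<^sub>M count_space (UNIV :: nat set)"
  interpret c: sigma_finite_measure "count_space (UNIV :: nat set)" by (rule sigma_finite_measure_count_space)
  interpret P: pair_sigma_finite lborel "count_space (UNIV :: nat set)" ..
  have Fm: "(\<lambda>p. F p * indicator (tower T Q H N \<Lambda>) p) \<in> borel_measurable ?P"
    using F tower_in_sets unfolding tower_lborel_def
    by (subst (asm) borel_measurable_restrict_space_iff_ennreal) auto
  have ind: "indicator (tower T Q H N \<Lambda>) (x, l) = (indicator (level l) x :: ennreal)" for x l
    by (simp add: tower_eq indicator_def)
  have "(\<lambda>x. F (x, l) * indicator (tower T Q H N \<Lambda>) (x, l)) \<in> borel_measurable lborel"
    by (rule measurable_compose[OF _ Fm]) simp
  then show "(\<lambda>x. F (x, l) * indicator (level l) x) \<in> borel_measurable borel" by (simp add: ind)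
  have "(\<integral>\<^sup>+p. F p \<partial>tower_lborel T Q H N \<Lambda>) = (\<integral>\<^sup>+p. F p * indicator (tower T Q H N \<Lambda>) p \<partial>?P)"
    unfolding tower_lborel_def using tower_in_sets by (intro nn_integral_restrict_space) simp
  also have "\<dots> = (\<integral>\<^sup>+l. \<integral>\<^sup>+x. F (x, l) * indicator (tower T Q H N \<Lambda>) (x, l) \<partial>lborel \<partial>count_space UNIV)"
    by (rule P.nn_integral_snd[OF Fm, symmetric])
  also have "\<dots> = (\<Sum>l. \<integral>\<^sup>+x\<in>level l. F (x, l) \<partial>lborel)"
    by (simp add: nn_integral_count_space_nat ind)
  finally show "(\<integral>\<^sup>+p. F p \<partial>tower_lborel T Q H N \<Lambda>) = (\<Sum>l. \<integral>\<^sup>+x\<in>level l. F (x, l) \<partial>lborel)" .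
qed

lemma tower_proj_measurable: "tower_proj T \<Lambda> \<in> tower_lborel T Q H N \<Lambda> \<rightarrow>\<^sub>M unit_borel"
proof (rule measurableI)
  fix p assume "p \<in> space (tower_lborel T Q H N \<Lambda>)"
  then have "fst p \<in> base N" unfolding space_tower tower_eq using level_base by (cases p) auto
  then show "tower_proj T \<Lambda> p \<in> space unit_borel"
    unfolding space_unit_borel tower_proj_def using funpow_range[OF base_proj_unit] by (cases p) simp
next
  fix A assume "A \<in> sets unit_borel"
  then have A: "A \<in> sets borel" by (simp add: sets_unit_borel)
  have eq: "tower_proj T \<Lambda> -` A \<inter> space (tower_lborel T Q H N \<Lambda>) = {(x, l). x \<in> level l \<inter> level_proj l -` A}"
    unfolding space_tower tower_eq tower_proj_def level_proj_def using level_base by auto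
  have "{(x, l). x \<in> level l \<inter> level_proj l -` A} \<in> sets (lborel \<Otimes>\<^sub>M count_space (UNIV :: nat set))"
    using measurable_sets[OF level_proj_measurable A] by (intro tower_sets) simp
  then show "tower_proj T \<Lambda> -` A \<inter> space (tower_lborel T Q H N \<Lambda>) \<in> sets (tower_lborel T Q H N \<Lambda>)"
    unfolding eq unfolding tower_lborel_def using tower_in_sets
    by (subst sets_restrict_space_iff) (auto simp: tower_eq)
qed

end

section \<open>The density of the projected measure\<close>

context tower_setup
begin

lemma proj_has_deriv: "x \<in> base_interval i \<Longrightarrow> (base_proj \<Lambda> has_field_derivative width i) (at x)"
proof -
  assume x: "x \<in> base_interval i"
  have "((\<lambda>x. left_end i + (x - real i) * width i) has_field_derivative width i) (at x)"
    by (auto intro!: derivative_eq_intros)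
  then show ?thesis
    by (rule has_field_derivative_transform_within_open[of _ _ _ "base_interval i"])
      (use x in \<open>auto simp: base_interval_def base_proj_eq[symmetric]\<close>)
qed

lemma proj_continuous: "continuous_on (base_interval i) (base_proj \<Lambda>)"
  using proj_has_deriv by (meson DERIV_isCont continuous_at_imp_continuous_on)

lemma cell_proj: "c \<in> cells l \<Longrightarrow> x \<in> cell c \<Longrightarrow> base_proj \<Lambda> x \<in> snd c"
  by (simp add: cell_eq)

lemma cell_image:
  assumes c: "c \<in> cells l"
  shows "base_proj \<Lambda> ` cell c = snd c"
proof
  show "base_proj \<Lambda> ` cell c \<subseteq> snd c" using cell_proj[OF c] by blast
  show "snd c \<subseteq> base_proj \<Lambda> ` cell c"
  proof
    fix u assume u: "u \<in> snd c"
    have "u \<in> \<Lambda> (fst c)" using cellsD(4)[OF c] u by blast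
    from proj_lift[OF cellsD(1)[OF c] this] show "u \<in> base_proj \<Lambda> ` cell c"
      unfolding cell_def using u by (metis imageI)
  qed
qed

lemma cell_has_deriv:
  assumes c: "c \<in> cells l" and m: "m \<le> Suc l" and x: "x \<in> cell c"
  shows "((\<lambda>x. (T ^^ m) (base_proj \<Lambda> x)) has_field_derivative iter_deriv m (base_proj \<Lambda> x) * width (fst c)) (at x)"
proof -
  have "branch m (snd c)" by (rule branch_mono[OF cellsD(3)[OF c] m])
  from branch_has_deriv[OF this cell_proj[OF c x]] show ?thesis
    by (rule DERIV_chain2) (use cellsD(5)[OF c] x in \<open>blast intro: proj_has_deriv\<close>)
qed

lemma cell_inj:
  assumes c: "c \<in> cells l" and m: "m \<le> Suc l"
  shows "inj_on (\<lambda>x. (T ^^ m) (base_proj \<Lambda> x)) (cell c)"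
proof -
  have "branch m (snd c)" by (rule branch_mono[OF cellsD(3)[OF c] m])
  then have "inj_on (T ^^ m) (base_proj \<Lambda> ` cell c)" unfolding cell_image[OF c] by (rule branch_inj)
  moreover have "inj_on (base_proj \<Lambda>) (cell c)" by (rule inj_on_subset[OF base_proj_inj cellsD(6)[OF c]])
  ultimately have "inj_on ((T ^^ m) \<circ> base_proj \<Lambda>) (cell c)" by (rule comp_inj_on[rotated])
  then show ?thesis by (simp add: comp_def)
qed

lemma cell_continuous_deriv:
  assumes c: "c \<in> cells l" and m: "m \<le> Suc l"
  shows "continuous_on (cell c) (\<lambda>x. iter_deriv m (base_proj \<Lambda> x) * width (fst c))"
proof -
  have "branch m (snd c)" by (rule branch_mono[OF cellsD(3)[OF c] m])
  then have "continuous_on (snd c) (iter_deriv m)" by (rule branch_continuous_iter_deriv)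
  moreover have "continuous_on (cell c) (base_proj \<Lambda>)"
    by (rule continuous_on_subset[OF proj_continuous cellsD(5)[OF c]])
  ultimately have "continuous_on (cell c) (\<lambda>x. iter_deriv m (base_proj \<Lambda> x))"
    by (rule continuous_on_compose2) (use cell_proj[OF c] in blast)
  then show ?thesis by (intro continuous_on_mult_right)
qed

lemma cell_change_of_variables:
  assumes c: "c \<in> cells l" and m: "m \<le> Suc l" and [measurable]: "G \<in> borel_measurable borel"
  shows "(\<integral>\<^sup>+x\<in>cell c. ennreal \<bar>iter_deriv m (base_proj \<Lambda> x) * width (fst c)\<bar> * G ((T ^^ m) (base_proj \<Lambda> x)) \<partial>lborel)
    = (\<integral>\<^sup>+y\<in>(T ^^ m) ` snd c. G y \<partial>lborel)"
proof -
  have im: "(\<lambda>x. (T ^^ m) (base_proj \<Lambda> x)) ` cell c = (T ^^ m) ` snd c"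
    unfolding cell_image[OF c, symmetric] by (simp add: image_image)
  have b: "branch m (snd c)" by (rule branch_mono[OF cellsD(3)[OF c] m])
  show ?thesis unfolding im[symmetric]
  proof (rule nn_integral_change_of_variables)
    show "bounded ((\<lambda>x. (T ^^ m) (base_proj \<Lambda> x)) ` cell c)"
      unfolding im using branch_image(3)[OF b] by (rule bounded_subset[rotated]) simp
  qed (use cell_open(1)[OF c] cell_has_deriv[OF c m] cell_continuous_deriv[OF c m] cell_inj[OF c m] in simp_all)
qed

lemma cell_sets: "c \<in> cells l \<Longrightarrow> cell c \<in> sets borel"
  using cell_open(1) by simp

lemma open_level_sets [measurable]: "open_level l \<in> sets borel"
  using open_level_open by simp

lemma nn_integral_levels:
  assumes [measurable]: "f \<in> borel_measurable borel"
  shows "(\<integral>\<^sup>+x\<in>level l. f x \<partial>lborel) = (\<Sum>c\<in>cells l. \<integral>\<^sup>+x\<in>cell c. f x \<partial>lborel)"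
proof -
  have fin: "level l - open_level l \<in> null_sets lborel" by (rule finite_imp_null_set_lborel[OF finite_level_open_level])
  have "(\<integral>\<^sup>+x\<in>level l. f x \<partial>lborel) = (\<integral>\<^sup>+x\<in>open_level l. f x \<partial>lborel)"
    by (intro nn_integral_cong_AE)
      (use AE_not_in[OF fin] in \<open>eventually_elim, use open_level_level[of l] in \<open>auto simp: indicator_def\<close>\<close>)
  also have "\<dots> = (\<integral>\<^sup>+x. (\<Sum>c\<in>cells l. f x * indicator (cell c) x) \<partial>lborel)"
  proof (intro nn_integral_cong)
    fix x
    have "(indicator (open_level l) x :: ennreal) = (\<Sum>c\<in>cells l. indicator (cell c) x)"
      unfolding open_level_def using cells_disjoint
      by (intro indicator_UN_disjoint[OF finite_cells]) (auto simp: disjoint_family_on_def)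
    then show "f x * indicator (open_level l) x = (\<Sum>c\<in>cells l. f x * indicator (cell c) x)"
      by (simp add: sum_distrib_left)
  qed
  also have "\<dots> = (\<Sum>c\<in>cells l. \<integral>\<^sup>+x\<in>cell c. f x \<partial>lborel)"
    using cell_sets by (intro nn_integral_sum) auto
  finally show ?thesis .
qed

text \<open>The minimum defining \<open>xi\<close> contains half of ln(\<mu>/2). The weight of level
  l thus grows at most like sqrt(\<mu>/2)^l, which uses up only the square root of the gain
  (\<mu>/2)^l of expansion over branching.\<close>

lemma xi_bounds: "0 < xi \<alpha> \<mu>" "exp (xi \<alpha> \<mu> * real l) \<le> sqrt (\<mu> / 2) ^ l"
proof -
  show "0 < xi \<alpha> \<mu>" unfolding xi_def using \<mu>_gt_2 \<alpha>_pos by simp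
  have "exp (xi \<alpha> \<mu>) \<le> exp (ln (\<mu> / 2) / 2)" unfolding xi_def by simp
  also have "\<dots> = sqrt (\<mu> / 2)"
    using \<mu>_gt_2 by (simp add: ln_sqrt[symmetric] del: ln_sqrt)
  finally have "exp (xi \<alpha> \<mu>) ^ l \<le> sqrt (\<mu> / 2) ^ l" by (intro power_mono) auto
  then show "exp (xi \<alpha> \<mu> * real l) \<le> sqrt (\<mu> / 2) ^ l" by (simp add: exp_of_nat2_mult)
qed

end

text \<open>Collects what follows from nonnegativity, total mass 1 and the norm bound; the fixed
  point equation enters later, in \<open>tower_fixed\<close>.\<close>

locale tower_density = tower_setup +
  fixes \<phi> :: "real \<times> nat \<Rightarrow> real" and M :: real
  assumes \<phi>_measurable: "\<phi> \<in> borel_measurable (tower_lborel T Q H N \<Lambda>)"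
    and \<phi>_nonneg: "p \<in> tower T Q H N \<Lambda> \<Longrightarrow> 0 \<le> \<phi> p"
    and \<phi>_integral: "(LINT p|tower_lborel T Q H N \<Lambda>. \<phi> p) = 1"
    and \<phi>_norm: "norm_inf T Q N \<Lambda> \<alpha> \<mu> \<phi> \<le> ennreal M"
begin

definition level_density :: "nat \<Rightarrow> real \<Rightarrow> real" where "level_density l x = (if x \<in> level l then \<phi> (x, l) else 0)"
definition \<nu> :: "real measure" where "\<nu> = projected_measure T Q H N \<Lambda> \<phi>"

lemma level_density_nonneg: "0 \<le> level_density l x"
  unfolding level_density_def using \<phi>_nonneg[of "(x, l)"] by (simp add: tower_eq)

lemma level_density_measurable [measurable]: "level_density l \<in> borel_measurable borel"
proof -
  have "(\<lambda>p. ennreal (\<phi> p)) \<in> borel_measurable (tower_lborel T Q H N \<Lambda>)" using \<phi>_measurable by measurable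
  from nn_integral_tower(1)[OF this, of l]
  have m: "(\<lambda>x. ennreal (\<phi> (x, l)) * indicator (level l) x) \<in> borel_measurable borel" .
  have "level_density l = (\<lambda>x. enn2real (ennreal (\<phi> (x, l)) * indicator (level l) x))"
    using \<phi>_nonneg by (auto simp: level_density_def indicator_def tower_eq)
  then show ?thesis using m by simp
qed

lemma sets_\<nu>: "sets \<nu> = sets unit_borel"
  unfolding \<nu>_def projected_measure_def by simp

lemma space_\<nu>: "space \<nu> = {0..1}"
  using sets_eq_imp_space_eq[OF sets_\<nu>] space_unit_borel by simp

lemma nn_integral_\<nu>:
  assumes G [measurable]: "G \<in> borel_measurable borel"
  shows "(\<integral>\<^sup>+x. G x \<partial>\<nu>) = (\<Sum>l. \<integral>\<^sup>+x\<in>level l. ennreal (level_density l x) * G (level_proj l x) \<partial>lborel)"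
proof -
  let ?t = "tower_lborel T Q H N \<Lambda>"
  note \<phi>_measurable[measurable] tower_proj_measurable[measurable]
  have Gu: "G \<in> borel_measurable unit_borel" unfolding unit_borel_def using G by (rule measurable_restrict_space1)
  have Gp[measurable]: "(\<lambda>p. G (tower_proj T \<Lambda> p)) \<in> borel_measurable ?t"
    using measurable_compose[OF tower_proj_measurable Gu] .
  have "(\<integral>\<^sup>+x. G x \<partial>\<nu>) = (\<integral>\<^sup>+p. G (tower_proj T \<Lambda> p) \<partial>density ?t (\<lambda>p. ennreal (\<phi> p)))"
    unfolding \<nu>_def projected_measure_def using Gu by (intro nn_integral_distr) auto
  also have "\<dots> = (\<integral>\<^sup>+p. ennreal (\<phi> p) * G (tower_proj T \<Lambda> p) \<partial>?t)"
    by (rule nn_integral_density) measurable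
  also have "\<dots> = (\<Sum>l. \<integral>\<^sup>+x\<in>level l. ennreal (\<phi> (x, l)) * G (tower_proj T \<Lambda> (x, l)) \<partial>lborel)"
    by (rule nn_integral_tower(2)) measurable
  also have "\<dots> = (\<Sum>l. \<integral>\<^sup>+x\<in>level l. ennreal (level_density l x) * G (level_proj l x) \<partial>lborel)"
    using level_base by (intro suminf_cong nn_integral_cong) (auto simp: level_density_def level_proj_def tower_proj_def indicator_def)
  finally show ?thesis .
qed

lemma nn_integral_\<phi>: "(\<integral>\<^sup>+p. ennreal (\<phi> p) \<partial>tower_lborel T Q H N \<Lambda>) = 1"
proof -
  have "integrable (tower_lborel T Q H N \<Lambda>) \<phi>"
    using \<phi>_integral not_integrable_integral_eq by fastforce
  then show ?thesis
    using \<phi>_integral \<phi>_nonneg by (subst nn_integral_eq_integral) (auto simp: AE_I2 space_tower)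
qed

lemma level_mass: "(\<Sum>l. \<integral>\<^sup>+x\<in>level l. ennreal (level_density l x) \<partial>lborel) = 1"
proof -
  have "(\<Sum>l. \<integral>\<^sup>+x\<in>level l. ennreal (level_density l x) \<partial>lborel) = (\<Sum>l. \<integral>\<^sup>+x\<in>level l. ennreal (\<phi> (x, l)) \<partial>lborel)"
    by (intro suminf_cong nn_integral_cong) (simp add: level_density_def indicator_def)
  also have "\<dots> = 1"
    using nn_integral_tower(2)[of "\<lambda>p. ennreal (\<phi> p)"] nn_integral_\<phi> \<phi>_measurable by simp
  finally show ?thesis .
qed

lemma prob_space_\<nu>: "prob_space \<nu>"
proof (rule prob_spaceI)
  have "emeasure \<nu> (space \<nu>) = (\<integral>\<^sup>+x. 1 \<partial>\<nu>)" by simp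
  also have "\<dots> = 1" using nn_integral_\<nu>[of "\<lambda>_. 1"] level_mass by simp
  finally show "emeasure \<nu> (space \<nu>) = 1" .
qed

text \<open>\<open>ennreal M\<close> vanishes for negative M, and so does the truncation.\<close>

definition Mp :: real where "Mp = max 0 M"

lemma Mp_nonneg: "0 \<le> Mp" by (simp add: Mp_def)

lemma cell_bound:
  assumes c: "c \<in> cells l"
  shows "AE x in lborel. x \<in> cell c \<longrightarrow> \<bar>\<phi> (x, l)\<bar> \<le> Mp * exp (xi \<alpha> \<mu> * real l)"
proof -
  let ?e = "esssup (restrict_space lborel (cell c)) (\<lambda>x. ennreal \<bar>\<phi> (x, l)\<bar>)"
  have "ennreal (exp (- xi \<alpha> \<mu> * real l)) * ?e \<le> norm_inf T Q N \<Lambda> \<alpha> \<mu> \<phi>"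
    unfolding norm_inf_def
    by (intro SUP_upper2[of "fst c"] SUP_upper2[of l] SUP_upper2[OF cell_tower_cells[OF c]] order_refl)
      (use cellsD(1)[OF c] in auto)
  also have "\<dots> \<le> ennreal Mp" by (rule order_trans[OF \<phi>_norm]) (auto simp: Mp_def ennreal_leI)
  finally have 1: "ennreal (exp (- xi \<alpha> \<mu> * real l)) * ?e \<le> ennreal Mp" .
  have "?e = ennreal (exp (xi \<alpha> \<mu> * real l)) * (ennreal (exp (- xi \<alpha> \<mu> * real l)) * ?e)"
    unfolding mult.assoc[symmetric] by (simp add: ennreal_mult[symmetric] exp_add[symmetric])
  also have "\<dots> \<le> ennreal (exp (xi \<alpha> \<mu> * real l)) * ennreal Mp" by (intro mult_left_mono 1) simp
  also have "\<dots> = ennreal (Mp * exp (xi \<alpha> \<mu> * real l))"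
    by (simp add: ennreal_mult[symmetric] Mp_nonneg mult.commute)
  finally have 2: "?e \<le> ennreal (Mp * exp (xi \<alpha> \<mu> * real l))" .
  have "AE x in restrict_space lborel (cell c). ennreal \<bar>\<phi> (x, l)\<bar> \<le> ?e" by (rule esssup_AE)
  then have "AE x in restrict_space lborel (cell c). \<bar>\<phi> (x, l)\<bar> \<le> Mp * exp (xi \<alpha> \<mu> * real l)"
  proof (eventually_elim)
    case (elim x)
    then have "ennreal \<bar>\<phi> (x, l)\<bar> \<le> ennreal (Mp * exp (xi \<alpha> \<mu> * real l))" using 2 by (rule order_trans)
    then show ?case by (subst (asm) ennreal_le_iff) (auto simp: Mp_def)
  qed
  then show ?thesis using cell_sets[OF c] by (subst (asm) AE_restrict_space_iff) auto
qed

text \<open>After the change of variables by the chart and \<open>T ^^ l\<close>, the bound for the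
  density on the cell is divided by a Jacobian of at least \<delta> * \<mu>^l.\<close>

lemma cell_mass_le:
  assumes c: "c \<in> cells l" and [measurable]: "G \<in> borel_measurable borel"
  shows "(\<integral>\<^sup>+x\<in>cell c. ennreal (level_density l x) * G (level_proj l x) \<partial>lborel)
    \<le> ennreal (Mp * exp (xi \<alpha> \<mu> * real l) / (\<delta> * \<mu> ^ l)) * (\<integral>\<^sup>+y\<in>{0..1}. G y \<partial>lborel)"
proof -
  let ?b = "Mp * exp (xi \<alpha> \<mu> * real l)"
  have b0: "0 \<le> ?b" by (simp add: Mp_def)
  have dm: "0 < \<delta> * \<mu> ^ l" using \<delta>_pos \<mu>_gt_2 by simp
  have bl: "branch l (snd c)" by (rule branch_mono[OF cellsD(3)[OF c]]) simp
  note cs[measurable] = cell_sets[OF c]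
  have ls[measurable]: "(T ^^ l) ` snd c \<in> sets borel" using branch_image(1)[OF bl] by simp
  have "(\<integral>\<^sup>+x\<in>cell c. ennreal (level_density l x) * G (level_proj l x) \<partial>lborel)
     \<le> (\<integral>\<^sup>+x. ennreal (?b / (\<delta> * \<mu> ^ l)) * (ennreal \<bar>iter_deriv l (base_proj \<Lambda> x) * width (fst c)\<bar> * G ((T ^^ l) (base_proj \<Lambda> x)) * indicator (cell c) x) \<partial>lborel)"
  proof (intro nn_integral_mono_AE, use cell_bound[OF c] in eventually_elim)
    case (elim x)
    show ?case
    proof (cases "x \<in> cell c")
      case True
      have xb: "x \<in> base N" using cellsD(6)[OF c] True by blast
      have p: "level_density l x \<le> ?b" using elim True b0 by (auto simp: level_density_def)
      have "\<delta> * \<mu> ^ l \<le> width (fst c) * \<bar>iter_deriv l (base_proj \<Lambda> x)\<bar>"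
        using Lam_interval(2)[OF cellsD(1)[OF c]] branch_iter_deriv_ge[OF bl cell_proj[OF c True]] \<delta>_pos \<mu>_gt_2
        by (intro mult_mono) auto
      then have "\<delta> * \<mu> ^ l \<le> \<bar>iter_deriv l (base_proj \<Lambda> x) * width (fst c)\<bar>"
        using Lam_interval(3)[OF cellsD(1)[OF c]] by (simp add: abs_mult mult.commute)
      then have "?b * (\<delta> * \<mu> ^ l) \<le> ?b * \<bar>iter_deriv l (base_proj \<Lambda> x) * width (fst c)\<bar>" using b0 by (rule mult_left_mono)
      then have "?b \<le> ?b / (\<delta> * \<mu> ^ l) * \<bar>iter_deriv l (base_proj \<Lambda> x) * width (fst c)\<bar>"
        using dm by (simp add: pos_le_divide_eq)
      then have "ennreal (level_density l x) \<le> ennreal (?b / (\<delta> * \<mu> ^ l)) * ennreal \<bar>iter_deriv l (base_proj \<Lambda> x) * width (fst c)\<bar>"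
        using p b0 dm by (subst ennreal_mult[symmetric]) (auto intro!: ennreal_leI)
      then have "ennreal (level_density l x) * G (level_proj l x) \<le> ennreal (?b / (\<delta> * \<mu> ^ l)) * ennreal \<bar>iter_deriv l (base_proj \<Lambda> x) * width (fst c)\<bar> * G (level_proj l x)"
        by (rule mult_right_mono) simp
      then show ?thesis using True xb by (simp add: level_proj_def mult.assoc)
    qed simp
  qed
  also have "\<dots> = ennreal (?b / (\<delta> * \<mu> ^ l)) * (\<integral>\<^sup>+x\<in>cell c. ennreal \<bar>iter_deriv l (base_proj \<Lambda> x) * width (fst c)\<bar> * G ((T ^^ l) (base_proj \<Lambda> x)) \<partial>lborel)"
  proof (rule nn_integral_cmult)
    have "(\<lambda>x. indicator (cell c) x *\<^sub>R (iter_deriv l (base_proj \<Lambda> x) * width (fst c))) \<in> borel_measurable borel"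
      by (intro borel_measurable_continuous_on_indicator cell_continuous_deriv[OF c]) (use cs in auto)
    then have m: "(\<lambda>x. ennreal \<bar>indicator (cell c) x *\<^sub>R (iter_deriv l (base_proj \<Lambda> x) * width (fst c))\<bar> * G (level_proj l x)) \<in> borel_measurable lborel"
      by measurable
    have "(\<lambda>x. ennreal \<bar>iter_deriv l (base_proj \<Lambda> x) * width (fst c)\<bar> * G ((T ^^ l) (base_proj \<Lambda> x)) * indicator (cell c) x)
      = (\<lambda>x. ennreal \<bar>indicator (cell c) x *\<^sub>R (iter_deriv l (base_proj \<Lambda> x) * width (fst c))\<bar> * G (level_proj l x))"
      using cellsD(6)[OF c] by (auto simp: fun_eq_iff indicator_def level_proj_def)
    then show "(\<lambda>x. ennreal \<bar>iter_deriv l (base_proj \<Lambda> x) * width (fst c)\<bar> * G ((T ^^ l) (base_proj \<Lambda> x)) * indicator (cell c) x) \<in> borel_measurable lborel"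
      using m by simp
  qed
  also have "\<dots> = ennreal (?b / (\<delta> * \<mu> ^ l)) * (\<integral>\<^sup>+y\<in>(T ^^ l) ` snd c. G y \<partial>lborel)"
    by (subst cell_change_of_variables[OF c]) auto
  also have "\<dots> \<le> ennreal (?b / (\<delta> * \<mu> ^ l)) * (\<integral>\<^sup>+y\<in>{0..1}. G y \<partial>lborel)"
    using branch_image(3)[OF bl] by (intro mult_left_mono nn_integral_mono) (auto simp: indicator_def)
  finally show ?thesis .
qed

text \<open>There are at most 2^l / \<delta> cells, each contributing at most Mp * sqrt(\<mu>/2)^l /
  (\<delta> * \<mu>^l). The product is the constant claimed because 2 * sqrt(\<mu>/2) / \<mu> =
  sqrt(2/\<mu>).\<close>

lemma level_mass_le:
  assumes [measurable]: "G \<in> borel_measurable borel"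
  shows "(\<integral>\<^sup>+x\<in>level l. ennreal (level_density l x) * G (level_proj l x) \<partial>lborel)
    \<le> ennreal (Mp / \<delta>\<^sup>2 * sqrt (2 / \<mu>) ^ l) * (\<integral>\<^sup>+y\<in>{0..1}. G y \<partial>lborel)"
proof -
  let ?I = "\<integral>\<^sup>+y\<in>{0..1}. G y \<partial>lborel"
  let ?b = "Mp * exp (xi \<alpha> \<mu> * real l) / (\<delta> * \<mu> ^ l)"
  have b0: "0 \<le> ?b" using \<delta>_pos \<mu>_gt_2 by (simp add: Mp_def)
  have "(\<integral>\<^sup>+x\<in>level l. ennreal (level_density l x) * G (level_proj l x) \<partial>lborel) = (\<Sum>c\<in>cells l. \<integral>\<^sup>+x\<in>cell c. ennreal (level_density l x) * G (level_proj l x) \<partial>lborel)"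
    by (rule nn_integral_levels) measurable
  also have "\<dots> \<le> (\<Sum>c\<in>cells l. ennreal ?b * ?I)" by (intro sum_mono cell_mass_le) auto
  also have "\<dots> = ennreal (real (card (cells l)) * ?b) * ?I"
    by (simp only: sum_constant ennreal_of_nat_eq_real_of_nat mult.assoc[symmetric] ennreal_mult[OF of_nat_0_le_iff b0])
  also have "\<dots> \<le> ennreal (Mp / \<delta>\<^sup>2 * sqrt (2 / \<mu>) ^ l) * ?I"
  proof (intro mult_right_mono ennreal_leI)
    have N: "real N \<le> 1 / \<delta>" using N_le \<delta>_pos by (simp add: pos_le_divide_eq)
    have "real (card (cells l)) \<le> real (N * 2 ^ l)" using card_cells[of l] by (simp only: of_nat_le_iff)
    also have "\<dots> = real N * 2 ^ l" by simp
    also have "\<dots> \<le> 1 / \<delta> * 2 ^ l" by (rule mult_right_mono[OF N]) simp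
    finally have "real (card (cells l)) * ?b \<le> 1 / \<delta> * 2 ^ l * (Mp * sqrt (\<mu> / 2) ^ l / (\<delta> * \<mu> ^ l))"
      using xi_bounds(2)[of l] \<delta>_pos \<mu>_gt_2 b0
      by (intro mult_mono divide_right_mono mult_left_mono) (auto simp: Mp_def)
    also have "\<dots> = Mp / \<delta>\<^sup>2 * (2 * sqrt (\<mu> / 2) / \<mu>) ^ l"
      by (simp add: power2_eq_square power_divide power_mult_distrib mult_ac)
    also have "2 * sqrt (\<mu> / 2) / \<mu> = sqrt (2 / \<mu>)"
    proof (rule real_sqrt_unique[symmetric])
      show "(2 * sqrt (\<mu> / 2) / \<mu>)\<^sup>2 = 2 / \<mu>"
        using \<mu>_gt_2 by (simp add: power_divide power_mult_distrib) (simp add: power2_eq_square)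
    qed (use \<mu>_gt_2 in simp)
    finally show "real (card (cells l)) * ?b \<le> Mp / \<delta>\<^sup>2 * sqrt (2 / \<mu>) ^ l" .
  qed simp
  finally show ?thesis .
qed

text \<open>The geometric series of the bounds in \<open>level_mass_le\<close>, summed over all
  levels; no quantity of the hole enters.\<close>

definition density_bound :: real where "density_bound = Mp / \<delta>\<^sup>2 * (1 / (1 - sqrt (2 / \<mu>)))"

lemma nn_integral_\<nu>_le:
  assumes [measurable]: "G \<in> borel_measurable borel"
  shows "(\<integral>\<^sup>+x. G x \<partial>\<nu>) \<le> ennreal density_bound * (\<integral>\<^sup>+y\<in>{0..1}. G y \<partial>lborel)"
proof -
  let ?I = "\<integral>\<^sup>+y\<in>{0..1}. G y \<partial>lborel"
  have q: "0 \<le> sqrt (2 / \<mu>)" "sqrt (2 / \<mu>) < 1" using \<mu>_gt_2 by auto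
  have "(\<integral>\<^sup>+x. G x \<partial>\<nu>) \<le> (\<Sum>l. ennreal (Mp / \<delta>\<^sup>2 * sqrt (2 / \<mu>) ^ l) * ?I)"
    unfolding nn_integral_\<nu>[OF assms] by (intro suminf_le level_mass_le) auto
  also have "\<dots> = (\<Sum>l. ennreal (Mp / \<delta>\<^sup>2 * sqrt (2 / \<mu>) ^ l)) * ?I" by (rule ennreal_suminf_multc)
  also have "(\<lambda>l. Mp / \<delta>\<^sup>2 * sqrt (2 / \<mu>) ^ l) sums density_bound"
    unfolding density_bound_def by (intro sums_mult geometric_sums) (use q in auto)
  then have "(\<Sum>l. ennreal (Mp / \<delta>\<^sup>2 * sqrt (2 / \<mu>) ^ l)) = ennreal density_bound"
    using q by (intro suminf_ennreal_eq) (auto simp: Mp_def)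
  finally show ?thesis .
qed

lemma emeasure_\<nu>: "A \<in> sets borel \<Longrightarrow> A \<subseteq> {0..1} \<Longrightarrow> emeasure \<nu> A = (\<integral>\<^sup>+x. indicator A x \<partial>\<nu>)"
  by (rule nn_integral_indicator[symmetric]) (simp add: sets_\<nu> sets_unit_borel)

lemma emeasure_\<nu>_le: 
  assumes A [measurable]: "A \<in> sets borel" and sub: "A \<subseteq> {0..1}"
  shows "emeasure \<nu> A \<le> ennreal density_bound * emeasure lborel A"
proof -
  have "emeasure \<nu> A \<le> ennreal density_bound * (\<integral>\<^sup>+y\<in>{0..1}. indicator A y \<partial>lborel)"
    unfolding emeasure_\<nu>[OF assms] by (rule nn_integral_\<nu>_le) measurable
  also have "\<dots> \<le> ennreal density_bound * (\<integral>\<^sup>+y. indicator A y \<partial>lborel)"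
    by (intro mult_left_mono nn_integral_mono) (auto simp: indicator_def)
  finally show ?thesis by simp
qed

end

section \<open>Transfer operator and escape of mass\<close>

text \<open>Turns the unordered sum over preimages, in which \<open>transfer\<close> is expressed,
  into an ordinary series over heights; nonnegativity gives the summability over pairs.\<close>

lemma infsum_nonneg_levels:
  fixes f :: "'a \<times> nat \<Rightarrow> real"
  assumes fin: "\<And>l. finite (S l)" and nn: "\<And>l y. y \<in> S l \<Longrightarrow> 0 \<le> f (y, l)"
    and sum: "summable (\<lambda>l. \<Sum>y\<in>S l. f (y, l))"
  shows "(\<Sum>\<^sub>\<infinity>q\<in>{(y, l). y \<in> S l}. f q) = (\<Sum>l. \<Sum>y\<in>S l. f (y, l))"
proof -
  define s where "s l = (\<Sum>y\<in>S l. f (y, l))" for l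
  have s0: "0 \<le> s l" for l unfolding s_def using nn by (intro sum_nonneg) auto
  let ?A = "Sigma UNIV S"
  let ?g = "\<lambda>(l, y). f (y, l)"
  have hs: "((\<lambda>y. ?g (l, y)) has_sum s l) (S l)" for l
    using fin by (simp add: s_def has_sum_finiteI)
  have su: "(s has_sum suminf s) UNIV"
  proof (rule sums_nonneg_imp_has_sum[OF _ s0])
    show "s sums suminf s" using sum unfolding s_def[symmetric] by (rule summable_sums)
  qed
  have "?g summable_on ?A"
  proof (rule summable_on_SigmaI[where g = s])
    show "s summable_on UNIV" using su summable_on_def by blast
  qed (use hs nn in auto)
  then obtain a where a: "(?g has_sum a) ?A" unfolding summable_on_def by blast
  have "(s has_sum a) UNIV" by (rule has_sum_SigmaD[OF a hs])
  then have "a = suminf s" using su has_sum_unique by blast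
  have bij: "bij_betw (\<lambda>(l, y). (y, l)) ?A {(y, l). y \<in> S l}"
    by (rule bij_betwI[where g = "\<lambda>(y, l). (l, y)"]) auto
  have "(\<Sum>\<^sub>\<infinity>q\<in>{(y, l). y \<in> S l}. f q) = (\<Sum>\<^sub>\<infinity>p\<in>?A. f (case p of (l, y) \<Rightarrow> (y, l)))"
    by (rule infsum_reindex_bij_betw[OF bij, symmetric])
  also have "\<dots> = infsum ?g ?A" by (rule infsum_cong) auto
  also have "\<dots> = suminf s" using a \<open>a = suminf s\<close> infsumI by blast
  finally show ?thesis by (simp add: s_def[abs_def])
qed

section \<open>Preimages under the tower map and the return map\<close>

context tower_setup
begin

definition Lam_all :: "real set" where "Lam_all = (\<Union>k<N. \<Lambda> k)"
definition returning :: "nat \<Rightarrow> real set" where "returning l = {y \<in> level l - level (Suc l). level_proj (Suc l) y \<in> Lam_all}"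
text \<open>As in \<open>tower_map\<close>, escape means missing all base intervals; the landing
  points where this differs from hitting H are finite in number.\<close>

definition escaping :: "nat \<Rightarrow> real set" where "escaping l = {y \<in> level l - level (Suc l). level_proj (Suc l) y \<notin> Lam_all}"
definition return_map :: "nat \<Rightarrow> real \<Rightarrow> real" where "return_map l y = fst (the (tower_map T Q H N \<Lambda> (y, l)))"
text \<open>Here the tower map is smooth; only countably many points of \<open>returning l\<close> are lost, which is harmless
  for integrals.\<close>
definition V :: "nat \<Rightarrow> real set" where "V l = interior (returning l) \<inter> open_level l"

lemma Lam_all_open: "open Lam_all"
  unfolding Lam_all_def using Lam_interval(1) by (intro open_UN) simp

lemma Lam_all_sets [measurable]: "Lam_all \<in> sets borel" using Lam_all_open by simp

lemma returning_sets [measurable]: "returning l \<in> sets borel" and escaping_sets [measurable]: "escaping l \<in> sets borel"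
proof -
  have "returning l = (level l - level (Suc l)) \<inter> (level_proj (Suc l) -` Lam_all \<inter> space borel)" "escaping l = (level l - level (Suc l)) - (level_proj (Suc l) -` Lam_all \<inter> space borel)"
    unfolding returning_def escaping_def by auto
  then show "returning l \<in> sets borel" "escaping l \<in> sets borel"
    using measurable_sets[OF level_proj_measurable Lam_all_sets, of "Suc l"] by simp_all
qed

lemma level_proj_base: "x \<in> base N \<Longrightarrow> level_proj l x = (T ^^ l) (base_proj \<Lambda> x)" by (simp add: level_proj_def)

lemma tower_map_up: "x \<in> level (Suc l) \<Longrightarrow> tower_map T Q H N \<Lambda> (x, l) = Some (x, Suc l)"
  unfolding tower_map_def level_def by simp

lemma tower_map_returning:
  assumes "y \<in> returning l"
  shows "tower_map T Q H N \<Lambda> (y, l) = Some (return_map l y, 0)" "return_map l y \<in> base N" "base_proj \<Lambda> (return_map l y) = level_proj (Suc l) y"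
proof -
  have y: "y \<in> base N" "\<not> enat (Suc l) < return_time T Q H \<Lambda> y" using assms unfolding returning_def level_def by auto
  have L: "(T ^^ Suc l) (base_proj \<Lambda> y) \<in> (\<Union>k<N. \<Lambda> k)"
    using assms level_proj_base[OF y(1)] unfolding returning_def Lam_all_def by simp
  have tm: "tower_map T Q H N \<Lambda> (y, l) = Some (the_inv_into (base N) (base_proj \<Lambda>) ((T ^^ Suc l) (base_proj \<Lambda> y)), 0)"
    unfolding tower_map_def using y L by simp
  obtain k where k: "k < N" "(T ^^ Suc l) (base_proj \<Lambda> y) \<in> \<Lambda> k" using L by blast
  have r: "return_map l y = lift k ((T ^^ Suc l) (base_proj \<Lambda> y))" unfolding return_map_def tm using inv_proj_lift[OF k] by simp
  show "tower_map T Q H N \<Lambda> (y, l) = Some (return_map l y, 0)" unfolding r tm using inv_proj_lift[OF k] by simp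
  show "return_map l y \<in> base N" unfolding r by (rule lift_base[OF k])
  show "base_proj \<Lambda> (return_map l y) = level_proj (Suc l) y" unfolding r level_proj_base[OF y(1)] by (rule proj_lift[OF k])
qed

lemma tower_map_other: "x \<in> level l - level (Suc l) - returning l \<Longrightarrow> tower_map T Q H N \<Lambda> (x, l) = None"
  unfolding tower_map_def returning_def level_def level_proj_def Lam_all_def by auto

lemma tower_map_0: "{q \<in> tower T Q H N \<Lambda>. tower_map T Q H N \<Lambda> q = Some (x, 0)} = {(y, l). y \<in> returning l \<and> return_map l y = x}"
proof (intro set_eqI iffI)
  fix q assume q: "q \<in> {q \<in> tower T Q H N \<Lambda>. tower_map T Q H N \<Lambda> q = Some (x, 0)}"
  obtain y l where yl: "q = (y, l)" by (cases q)
  have y: "y \<in> level l" "tower_map T Q H N \<Lambda> (y, l) = Some (x, 0)" using q unfolding yl tower_eq by auto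
  have "y \<notin> level (Suc l)" using tower_map_up y(2) by fastforce
  then have "y \<in> returning l" using tower_map_other[of y l] y by auto
  then show "q \<in> {(y, l). y \<in> returning l \<and> return_map l y = x}" using tower_map_returning(1) y(2) yl by simp
next
  fix q assume "q \<in> {(y, l). y \<in> returning l \<and> return_map l y = x}"
  then obtain y l where yl: "q = (y, l)" "y \<in> returning l" "return_map l y = x" by blast
  then show "q \<in> {q \<in> tower T Q H N \<Lambda>. tower_map T Q H N \<Lambda> q = Some (x, 0)}"
    using tower_map_returning(1)[OF yl(2)] unfolding tower_eq returning_def by simp
qed

lemma tower_map_Suc:
  assumes "x \<in> level (Suc n)"
  shows "{q \<in> tower T Q H N \<Lambda>. tower_map T Q H N \<Lambda> q = Some (x, Suc n)} = {(x, n)}"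
proof (intro set_eqI iffI)
  fix q assume q: "q \<in> {q \<in> tower T Q H N \<Lambda>. tower_map T Q H N \<Lambda> q = Some (x, Suc n)}"
  obtain y l where yl: "q = (y, l)" by (cases q)
  have y: "y \<in> level l" "tower_map T Q H N \<Lambda> (y, l) = Some (x, Suc n)" using q unfolding yl tower_eq by auto
  consider "y \<in> level (Suc l)" | "y \<in> returning l" | "y \<in> level l - level (Suc l) - returning l" using y(1) by blast
  then show "q \<in> {(x, n)}"
    by cases (use y(2) tower_map_up tower_map_returning(1) tower_map_other yl in auto)
next
  fix q assume "q \<in> {(x, n)}"
  then show "q \<in> {q \<in> tower T Q H N \<Lambda>. tower_map T Q H N \<Lambda> q = Some (x, Suc n)}"
    using tower_map_up[OF assms] level_antimono assms unfolding tower_eq by blast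
qed

text \<open>Moving up leaves the base coordinate fixed, so the derivative is 1. A derivative sees a
  neighbourhood, which is why the point is taken in the open part of the next level.\<close>

lemma transfer_Suc:
  assumes x: "x \<in> open_level (Suc n)"
  shows "transfer T Q H N \<Lambda> f (x, Suc n) = f (x, n)"
proof -
  have xE: "x \<in> level (Suc n)" using x open_level_level by blast
  have "((\<lambda>u. u) has_field_derivative 1) (at x)" by (rule DERIV_ident)
  then have "((\<lambda>u. fst (the (tower_map T Q H N \<Lambda> (u, n)))) has_field_derivative 1) (at x)"
  proof (rule has_field_derivative_transform_within_open[OF _ open_level_open x])
    fix u assume "u \<in> open_level (Suc n)"
    then show "u = fst (the (tower_map T Q H N \<Lambda> (u, n)))" using tower_map_up open_level_level by (metis fst_conv option.sel subsetD)
  qed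
  then have "tower_deriv T Q H N \<Lambda> (x, n) = 1" unfolding tower_deriv_def by (simp add: DERIV_imp_deriv)
  then show ?thesis unfolding transfer_def tower_map_Suc[OF xE] by simp
qed

lemma V_open: "open (V l)" and V_returning: "V l \<subseteq> returning l"
  unfolding V_def using open_level_open interior_subset by blast+

lemma cell_level_proj_continuous:
  assumes c: "c \<in> cells l" and m: "m \<le> Suc l"
  shows "continuous_on (cell c) (level_proj m)"
proof -
  have "continuous_on (cell c) (\<lambda>x. (T ^^ m) (base_proj \<Lambda> x))"
    using cell_has_deriv[OF c m] by (meson DERIV_isCont continuous_at_imp_continuous_on)
  then show ?thesis
    by (rule continuous_on_eq) (use cellsD(6)[OF c] level_proj_base in auto)
qed

text \<open>A returning point outside V lies on the boundary of the next open level or in one of the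
  finite sets by which levels and open levels differ.\<close>

lemma countable_returning_V: "countable (returning l - V l)"
proof -
  define U where "U = {y \<in> open_level l. level_proj (Suc l) y \<in> Lam_all}"
  have U: "open U"
  proof -
    have "open (cell c \<inter> level_proj (Suc l) -` Lam_all)" if "c \<in> cells l" for c
      using cell_level_proj_continuous[OF that, of "Suc l"] cell_open(1)[OF that] Lam_all_open
      by (intro continuous_open_preimage) auto
    then have "open (\<Union>c\<in>cells l. cell c \<inter> level_proj (Suc l) -` Lam_all)" by (intro open_UN ballI)
    moreover have "U = (\<Union>c\<in>cells l. cell c \<inter> level_proj (Suc l) -` Lam_all)" unfolding U_def open_level_def by blast
    ultimately show ?thesis by (rule ssubst[rotated])
  qed
  define F where "F = level (Suc l) - open_level (Suc l)"
  have F: "finite F" unfolding F_def by (rule finite_level_open_level)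
  \<comment> \<open>Removing the closure of the next open level leaves an open set inside
    \<open>returning l\<close>.\<close>
  define W where "W = U - closure (open_level (Suc l)) - F"
  have W: "open W" unfolding W_def using U F by (intro open_Diff) (auto intro: finite_imp_closed)
  have "W \<subseteq> returning l"
    unfolding W_def U_def F_def returning_def using closure_subset[of "open_level (Suc l)"] open_level_level[of l] by blast
  then have "W \<subseteq> interior (returning l)" using W by (rule interior_maximal)
  then have WV: "W \<subseteq> V l" unfolding V_def W_def U_def by blast
  have "returning l - V l \<subseteq> (level l - open_level l) \<union> frontier (open_level (Suc l)) \<union> F"
  proof
    fix y assume y: "y \<in> returning l - V l"
    then have "y \<notin> W" using WV by blast
    moreover have "y \<in> level l" "y \<notin> level (Suc l)" "level_proj (Suc l) y \<in> Lam_all" using y unfolding returning_def by auto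
    moreover have "y \<notin> interior (open_level (Suc l))" using \<open>y \<notin> level (Suc l)\<close> open_level_level interior_subset by blast
    ultimately show "y \<in> (level l - open_level l) \<union> frontier (open_level (Suc l)) \<union> F"
      unfolding W_def U_def frontier_def by blast
  qed
  moreover have "countable ((level l - open_level l) \<union> frontier (open_level (Suc l)) \<union> F)"
    using finite_level_open_level open_level_frontier F by (intro countable_Un countable_finite) auto
  ultimately show ?thesis by (rule countable_subset)
qed

text \<open>Near a point of V the target interval is constant, so the return map is a composition of
  the chart, the iterate and one inverse chart; its slope is the derivative of the iterate times the
  ratio of the widths.\<close>

lemma return_map_local:
  assumes c: "c \<in> cells l" and y: "y \<in> V l \<inter> cell c"
  obtains U k where "open U" "y \<in> U" "U \<subseteq> V l \<inter> cell c" "k < N"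
    "\<And>u. u \<in> U \<Longrightarrow> return_map l u = lift k ((T ^^ Suc l) (base_proj \<Lambda> u))"
    "\<And>u. u \<in> U \<Longrightarrow> (return_map l has_field_derivative iter_deriv (Suc l) (base_proj \<Lambda> u) * width (fst c) / width k) (at u)"
proof -
  have yR: "y \<in> returning l" using y V_returning by blast
  then obtain k where k: "k < N" "level_proj (Suc l) y \<in> \<Lambda> k" unfolding returning_def Lam_all_def by blast
  define U where "U = V l \<inter> (cell c \<inter> level_proj (Suc l) -` \<Lambda> k)"
  have "open (cell c \<inter> level_proj (Suc l) -` \<Lambda> k)"
    using cell_level_proj_continuous[OF c, of "Suc l"] cell_open(1)[OF c] Lam_interval(1)[OF k(1)]
    by (intro continuous_open_preimage) auto
  then have U: "open U" unfolding U_def using V_open by blast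
  have yU: "y \<in> U" unfolding U_def using y k by blast
  have rk: "return_map l u = lift k ((T ^^ Suc l) (base_proj \<Lambda> u))" if u: "u \<in> U" for u
  proof -
    have "u \<in> returning l" "level_proj (Suc l) u \<in> \<Lambda> k" "u \<in> base N" using u V_returning cellsD(6)[OF c] unfolding U_def by auto
    from tower_map_returning(2,3)[OF this(1)] inv_proj_lift[OF k(1) this(2)] the_inv_into_f_f[OF base_proj_inj, of "return_map l u"] level_proj_base[OF this(3)]
    show ?thesis by simp
  qed
  have dr: "(return_map l has_field_derivative iter_deriv (Suc l) (base_proj \<Lambda> u) * width (fst c) / width k) (at u)" if u: "u \<in> U" for u
  proof -
    have uc: "u \<in> cell c" using u by (simp add: U_def)
    have "((\<lambda>u. lift k ((T ^^ Suc l) (base_proj \<Lambda> u))) has_field_derivative iter_deriv (Suc l) (base_proj \<Lambda> u) * width (fst c) / width k) (at u)"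
      unfolding lift_def using Lam_interval(3)[OF k(1)] cell_has_deriv[OF c order_refl uc]
      by (auto intro!: derivative_eq_intros)
    then show ?thesis
      by (rule has_field_derivative_transform_within_open[OF _ U u]) (rule rk[symmetric])
  qed
  show thesis
    by (rule that[OF U yU _ k(1) rk dr]) (auto simp: U_def)
qed

lemma return_map_has_deriv:
  assumes c: "c \<in> cells l" and y: "y \<in> V l \<inter> cell c"
  shows "(return_map l has_field_derivative tower_deriv T Q H N \<Lambda> (y, l)) (at y)" "tower_deriv T Q H N \<Lambda> (y, l) \<noteq> 0"
proof -
  obtain U k where U: "open U" "y \<in> U" "U \<subseteq> V l \<inter> cell c" "k < N"
    and d: "\<And>u. u \<in> U \<Longrightarrow> (return_map l has_field_derivative iter_deriv (Suc l) (base_proj \<Lambda> u) * width (fst c) / width k) (at u)"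
    using return_map_local[OF assms] by metis
  have td: "tower_deriv T Q H N \<Lambda> (y, l) = iter_deriv (Suc l) (base_proj \<Lambda> y) * width (fst c) / width k"
    unfolding tower_deriv_def using DERIV_imp_deriv[OF d[OF U(2)]] by (simp add: return_map_def[abs_def])
  show "(return_map l has_field_derivative tower_deriv T Q H N \<Lambda> (y, l)) (at y)" unfolding td by (rule d[OF U(2)])
  have "y \<in> cell c" using y by blast
  then show "tower_deriv T Q H N \<Lambda> (y, l) \<noteq> 0"
    unfolding td using branch_iter_deriv_nz[OF cellsD(3)[OF c] cell_proj[OF c]] Lam_interval(3)[OF U(4)] Lam_interval(3)[OF cellsD(1)[OF c]] by simp
qed

lemma tower_deriv_continuous:
  assumes c: "c \<in> cells l"
  shows "continuous_on (V l \<inter> cell c) (\<lambda>y. tower_deriv T Q H N \<Lambda> (y, l))"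
proof (rule continuous_at_imp_continuous_on, rule ballI)
  fix y assume y: "y \<in> V l \<inter> cell c"
  obtain U k where U: "open U" "y \<in> U" "U \<subseteq> V l \<inter> cell c" "k < N"
    and d: "\<And>u. u \<in> U \<Longrightarrow> (return_map l has_field_derivative iter_deriv (Suc l) (base_proj \<Lambda> u) * width (fst c) / width k) (at u)"
    using return_map_local[OF assms y] by metis
  have td: "tower_deriv T Q H N \<Lambda> (u, l) = iter_deriv (Suc l) (base_proj \<Lambda> u) * width (fst c) / width k" if "u \<in> U" for u
    unfolding tower_deriv_def using DERIV_imp_deriv[OF d[OF that]] by (simp add: return_map_def[abs_def])
  have "continuous_on U (\<lambda>u. iter_deriv (Suc l) (base_proj \<Lambda> u) * width (fst c) / width k)"
    using continuous_on_subset[OF cell_continuous_deriv[OF c order_refl]] U(3) Lam_interval(3)[OF U(4)]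
    by (intro continuous_on_divide) auto
  then have "continuous_on U (\<lambda>u. tower_deriv T Q H N \<Lambda> (u, l))"
    by (rule continuous_on_eq) (simp add: td)
  then show "isCont (\<lambda>y. tower_deriv T Q H N \<Lambda> (y, l)) y"
    using U(1,2) continuous_on_eq_continuous_at by blast
qed

lemma return_map_inj:
  assumes c: "c \<in> cells l" shows "inj_on (return_map l) (V l \<inter> cell c)"
proof (rule inj_onI)
  fix x y assume x: "x \<in> V l \<inter> cell c" and y: "y \<in> V l \<inter> cell c" and eq: "return_map l x = return_map l y"
  have "x \<in> returning l" "y \<in> returning l" and b: "x \<in> base N" "y \<in> base N"
    using x y V_returning cellsD(6)[OF c] by blast+
  then have "level_proj (Suc l) x = level_proj (Suc l) y" using tower_map_returning(3) eq by metis
  then have "(T ^^ Suc l) (base_proj \<Lambda> x) = (T ^^ Suc l) (base_proj \<Lambda> y)" unfolding level_proj_base[OF b(1)] level_proj_base[OF b(2)] .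
  then show "x = y" using inj_onD[OF cell_inj[OF c order_refl]] x y by blast
qed

end

section \<open>The transfer operator cell by cell\<close>

context tower_density
begin

text \<open>The contribution of the cell \<open>c\<close> at height \<open>l\<close> to the transfer operator at the base point \<open>x\<close>.\<close>
definition return_term :: "nat \<Rightarrow> nat \<times> real set \<Rightarrow> real \<Rightarrow> real" where
  "return_term l c x = (if x \<in> return_map l ` (V l \<inter> cell c)
     then level_density l (the_inv_into (V l \<inter> cell c) (return_map l) x) /
       \<bar>tower_deriv T Q H N \<Lambda> (the_inv_into (V l \<inter> cell c) (return_map l) x, l)\<bar> else 0)"

lemma return_term_nonneg: "0 \<le> return_term l c x"
  unfolding return_term_def using level_density_nonneg by auto

lemma return_term_return_map:
  assumes c: "c \<in> cells l" and y: "y \<in> V l \<inter> cell c"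
  shows "return_term l c (return_map l y) = level_density l y / \<bar>tower_deriv T Q H N \<Lambda> (y, l)\<bar>"
  unfolding return_term_def using y the_inv_into_f_f[OF return_map_inj[OF c] y] by simp

text \<open>The return map is injective and smooth on the open set
  \<open>V l \<inter> cell c\<close>, so the formula is a change of variables whose Jacobian cancels
  the denominator in \<open>return_term\<close>.\<close>

lemma cell_transfer:
  assumes c: "c \<in> cells l" and G [measurable]: "G \<in> borel_measurable borel"
  shows "return_term l c \<in> borel_measurable borel"
    "(\<integral>\<^sup>+x. ennreal (return_term l c x) * G (base_proj \<Lambda> x) \<partial>lborel) =
     (\<integral>\<^sup>+y\<in>V l \<inter> cell c. ennreal (level_density l y) * G (level_proj (Suc l) y) \<partial>lborel)"
proof -
  let ?W = "V l \<inter> cell c"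
  let ?td = "\<lambda>y. tower_deriv T Q H N \<Lambda> (y, l)"
  have oW: "open ?W" using V_open cell_open(1)[OF c] by blast
  have cont: "continuous_on ?W (return_map l)"
    using return_map_has_deriv(1)[OF c] by (meson DERIV_isCont continuous_at_imp_continuous_on)
  \<comment> \<open>The continuity of the inverse is what makes \<open>return_term\<close>
    Borel.\<close>
  obtain g where g: "homeomorphism ?W (return_map l ` ?W) (return_map l) g"
    using invariance_of_domain_homeomorphism[OF oW cont order_refl return_map_inj[OF c]] by blast
  have oI: "open (return_map l ` ?W)" by (rule invariance_of_domain[OF cont oW return_map_inj[OF c]])
  have gi: "the_inv_into ?W (return_map l) x = g x" if x: "x \<in> return_map l ` ?W" for x
  proof -
    obtain y where "y \<in> ?W" "x = return_map l y" using x by blast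
    then show ?thesis using the_inv_into_f_f[OF return_map_inj[OF c]] homeomorphism_apply1[OF g] by metis
  qed
  have gW: "g ` (return_map l ` ?W) \<subseteq> ?W" using homeomorphism_image2[OF g] by blast
  have gc: "continuous_on (return_map l ` ?W) g" by (rule homeomorphism_cont2[OF g])
  have tc: "continuous_on (return_map l ` ?W) (\<lambda>x. ?td (g x))"
    by (rule continuous_on_compose2[OF tower_deriv_continuous[OF c] gc gW])
  have m1: "(\<lambda>x. indicator (return_map l ` ?W) x *\<^sub>R g x) \<in> borel_measurable borel"
    and m2: "(\<lambda>x. indicator (return_map l ` ?W) x *\<^sub>R ?td (g x)) \<in> borel_measurable borel"
    using oI by (intro borel_measurable_continuous_on_indicator gc tc; simp)+
  have I[measurable]: "return_map l ` ?W \<in> sets borel" using oI by simp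
  have "return_term l c = (\<lambda>x. indicator (return_map l ` ?W) x * (level_density l (indicator (return_map l ` ?W) x *\<^sub>R g x) / \<bar>indicator (return_map l ` ?W) x *\<^sub>R ?td (g x)\<bar>))"
    unfolding return_term_def using gi by (auto simp: fun_eq_iff)
  also have "\<dots> \<in> borel_measurable borel" using m1 m2 by measurable
  finally show am[measurable]: "return_term l c \<in> borel_measurable borel" .
  have "(\<integral>\<^sup>+x. ennreal (return_term l c x) * G (base_proj \<Lambda> x) \<partial>lborel)
     = (\<integral>\<^sup>+x\<in>return_map l ` ?W. ennreal (return_term l c x) * G (base_proj \<Lambda> x) \<partial>lborel)"
    by (intro nn_integral_cong) (auto simp: return_term_def indicator_def)
  also have "\<dots> = (\<integral>\<^sup>+y\<in>?W. ennreal \<bar>?td y\<bar> * (ennreal (return_term l c (return_map l y)) * G (base_proj \<Lambda> (return_map l y))) \<partial>lborel)"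
  proof (rule nn_integral_change_of_variables[symmetric])
    have "return_map l ` ?W \<subseteq> {0..real N}" using tower_map_returning(2) V_returning base_subset by blast
    then show "bounded (return_map l ` ?W)" by (rule bounded_subset[rotated]) simp
  qed (use oW return_map_has_deriv(1)[OF c] tower_deriv_continuous[OF c] return_map_inj[OF c] in simp_all)
  also have "\<dots> = (\<integral>\<^sup>+y\<in>?W. ennreal (level_density l y) * G (level_proj (Suc l) y) \<partial>lborel)"
  proof (intro nn_integral_cong)
    fix y
    show "ennreal \<bar>?td y\<bar> * (ennreal (return_term l c (return_map l y)) * G (base_proj \<Lambda> (return_map l y))) * indicator ?W y
      = ennreal (level_density l y) * G (level_proj (Suc l) y) * indicator ?W y"
    proof (cases "y \<in> ?W")
      case True
      have "y \<in> returning l" using True V_returning by blast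
      then have 1: "base_proj \<Lambda> (return_map l y) = level_proj (Suc l) y" by (rule tower_map_returning(3))
      have "ennreal \<bar>?td y\<bar> * ennreal (return_term l c (return_map l y)) = ennreal (level_density l y)"
        unfolding return_term_return_map[OF c True] using return_map_has_deriv(2)[OF c True] level_density_nonneg[of l y]
        by (subst ennreal_mult[symmetric]) auto
      then show ?thesis using True by (simp add: 1 mult.assoc[symmetric])
    qed simp
  qed
  finally show "(\<integral>\<^sup>+x. ennreal (return_term l c x) * G (base_proj \<Lambda> x) \<partial>lborel) =
     (\<integral>\<^sup>+y\<in>?W. ennreal (level_density l y) * G (level_proj (Suc l) y) \<partial>lborel)" .
qed

definition return_density :: "nat \<Rightarrow> real \<Rightarrow> real" where "return_density l x = (\<Sum>c\<in>cells l. return_term l c x)"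

lemma return_density_nonneg: "0 \<le> return_density l x" unfolding return_density_def by (intro sum_nonneg return_term_nonneg)

lemma return_density_measurable [measurable]: "return_density l \<in> borel_measurable borel"
  unfolding return_density_def[abs_def] using cell_transfer(1)[of _ l "\<lambda>_. 0"] by (intro borel_measurable_sum) simp

lemma level_transfer:
  assumes [measurable]: "G \<in> borel_measurable borel"
  shows "(\<integral>\<^sup>+y\<in>returning l. ennreal (level_density l y) * G (level_proj (Suc l) y) \<partial>lborel)
    = (\<integral>\<^sup>+x. ennreal (return_density l x) * G (base_proj \<Lambda> x) \<partial>lborel)"
proof -
  have n: "returning l - V l \<in> null_sets lborel" by (rule countable_imp_null_set_lborel[OF countable_returning_V])
  have Vm[measurable]: "V l \<in> sets borel" using V_open by simp
  have "(\<integral>\<^sup>+y\<in>returning l. ennreal (level_density l y) * G (level_proj (Suc l) y) \<partial>lborel)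
    = (\<integral>\<^sup>+y\<in>V l. ennreal (level_density l y) * G (level_proj (Suc l) y) \<partial>lborel)"
    by (intro nn_integral_cong_AE)
      (use AE_not_in[OF n] in \<open>eventually_elim, use V_returning[of l] in \<open>auto simp: indicator_def\<close>\<close>)
  also have "\<dots> = (\<integral>\<^sup>+y. (\<Sum>c\<in>cells l. ennreal (level_density l y) * G (level_proj (Suc l) y) * indicator (V l \<inter> cell c) y) \<partial>lborel)"
  proof (intro nn_integral_cong)
    fix y
    have VU: "V l = (\<Union>c\<in>cells l. V l \<inter> cell c)" unfolding V_def open_level_def by blast
    have "(indicator (\<Union>c\<in>cells l. V l \<inter> cell c) y :: ennreal) = (\<Sum>c\<in>cells l. indicator (V l \<inter> cell c) y)"
    proof (rule indicator_UN_disjoint[OF finite_cells])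
      show "disjoint_family_on (\<lambda>c. V l \<inter> cell c) (cells l)"
        using cells_disjoint unfolding disjoint_family_on_def by blast
    qed
    then show "ennreal (level_density l y) * G (level_proj (Suc l) y) * indicator (V l) y
       = (\<Sum>c\<in>cells l. ennreal (level_density l y) * G (level_proj (Suc l) y) * indicator (V l \<inter> cell c) y)"
      using VU by (simp add: sum_distrib_left)
  qed
  also have "\<dots> = (\<Sum>c\<in>cells l. \<integral>\<^sup>+y\<in>V l \<inter> cell c. ennreal (level_density l y) * G (level_proj (Suc l) y) \<partial>lborel)"
    using cell_sets by (intro nn_integral_sum) auto
  also have "\<dots> = (\<Sum>c\<in>cells l. \<integral>\<^sup>+x. ennreal (return_term l c x) * G (base_proj \<Lambda> x) \<partial>lborel)"
    by (intro sum.cong refl cell_transfer(2)[symmetric]) auto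
  also have "\<dots> = (\<integral>\<^sup>+x. (\<Sum>c\<in>cells l. ennreal (return_term l c x) * G (base_proj \<Lambda> x)) \<partial>lborel)"
    using cell_transfer(1) by (intro nn_integral_sum[symmetric]) auto
  also have "\<dots> = (\<integral>\<^sup>+x. ennreal (return_density l x) * G (base_proj \<Lambda> x) \<partial>lborel)"
    unfolding return_density_def by (intro nn_integral_cong) (simp add: sum_distrib_right[symmetric] return_term_nonneg)
  finally show ?thesis .
qed

lemma total_transfer:
  assumes [measurable]: "G \<in> borel_measurable borel"
  shows "(\<Sum>l. \<integral>\<^sup>+y\<in>returning l. ennreal (level_density l y) * G (level_proj (Suc l) y) \<partial>lborel)
    = (\<integral>\<^sup>+x. (\<Sum>l. ennreal (return_density l x)) * G (base_proj \<Lambda> x) \<partial>lborel)"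
  unfolding level_transfer[OF assms]
  by (subst nn_integral_suminf[symmetric]) (auto intro!: nn_integral_cong simp: ennreal_suminf_multc)

text \<open>The integral of the sum is at most the total mass 1, so the sum is finite almost
  everywhere.\<close>

lemma return_density_summable: "AE x in lborel. summable (\<lambda>l. return_density l x)"
proof -
  have "(\<integral>\<^sup>+x. (\<Sum>l. ennreal (return_density l x)) \<partial>lborel) = (\<Sum>l. \<integral>\<^sup>+y\<in>returning l. ennreal (level_density l y) \<partial>lborel)"
    using total_transfer[of "\<lambda>_. 1"] by simp
  also have "\<dots> \<le> (\<Sum>l. \<integral>\<^sup>+y\<in>level l. ennreal (level_density l y) \<partial>lborel)"
    by (intro suminf_le nn_integral_mono) (auto simp: indicator_def returning_def)
  also have "\<dots> = 1" by (rule level_mass)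
  finally have "(\<integral>\<^sup>+x. (\<Sum>l. ennreal (return_density l x)) \<partial>lborel) \<noteq> \<infinity>" by (auto simp: top_unique)
  then have "AE x in lborel. (\<Sum>l. ennreal (return_density l x)) \<noteq> \<infinity>"
    by (intro nn_integral_PInf_AE) auto
  then show ?thesis
    by eventually_elim (intro summable_suminf_not_top return_density_nonneg, simp)
qed

text \<open>Matches the sum over preimages with the series of cell contributions. Excluded are the
  points reached from outside V, whose preimages no cell term sees, and those where the series
  diverges.\<close>

lemma transfer_0: "AE x in lborel. x \<in> base N \<longrightarrow> ennreal (transfer T Q H N \<Lambda> \<phi> (x, 0)) = (\<Sum>l. ennreal (return_density l x))"
proof -
  define X where "X = (\<Union>l. return_map l ` (returning l - V l))"
  have "countable X" unfolding X_def using countable_returning_V by (intro countable_UN countable_image) auto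
  then have "X \<in> null_sets lborel" by (rule countable_imp_null_set_lborel)
  from AE_not_in[OF this] return_density_summable show ?thesis
  proof (eventually_elim)
    case (elim x)
    define S where "S l = {y \<in> returning l. return_map l y = x}" for l
    let ?f = "\<lambda>q. \<phi> q / \<bar>tower_deriv T Q H N \<Lambda> q\<bar>"
    have SV: "S l = (\<Union>c\<in>cells l. {y \<in> V l \<inter> cell c. return_map l y = x})" for l
    proof -
      have "S l \<subseteq> V l" using elim(1) unfolding S_def X_def by blast
      then show ?thesis using V_returning[of l] unfolding S_def V_def open_level_def by blast
    qed
    have one: "{y \<in> V l \<inter> cell c. return_map l y = x} = (if x \<in> return_map l ` (V l \<inter> cell c) then {the_inv_into (V l \<inter> cell c) (return_map l) x} else {})"
      if c: "c \<in> cells l" for l c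
    proof (cases "x \<in> return_map l ` (V l \<inter> cell c)")
      case True
      then obtain y where y: "y \<in> V l \<inter> cell c" "x = return_map l y" by blast
      have "the_inv_into (V l \<inter> cell c) (return_map l) x = y" using the_inv_into_f_f[OF return_map_inj[OF c] y(1)] y(2) by simp
      moreover have "{y \<in> V l \<inter> cell c. return_map l y = x} = {y}"
        using y inj_onD[OF return_map_inj[OF c]] by blast
      ultimately show ?thesis using True by simp
    qed auto
    have fin: "finite (S l)" for l
      unfolding SV using one finite_cells by (intro finite_UN_I) auto
    have sumS: "(\<Sum>y\<in>S l. ?f (y, l)) = return_density l x" for l
    proof -
      have "(\<Sum>y\<in>S l. ?f (y, l)) = (\<Sum>c\<in>cells l. \<Sum>y\<in>{y \<in> V l \<inter> cell c. return_map l y = x}. ?f (y, l))"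
        unfolding SV
      proof (rule sum.UNION_disjoint[OF finite_cells])
        show "\<forall>c\<in>cells l. finite {y \<in> V l \<inter> cell c. return_map l y = x}" using one by auto
        show "\<forall>i\<in>cells l. \<forall>j\<in>cells l. i \<noteq> j \<longrightarrow> {y \<in> V l \<inter> cell i. return_map l y = x} \<inter> {y \<in> V l \<inter> cell j. return_map l y = x} = {}"
          using cells_disjoint by blast
      qed
      also have "\<dots> = (\<Sum>c\<in>cells l. return_term l c x)"
      proof (rule sum.cong[OF refl])
        fix c assume c: "c \<in> cells l"
        show "(\<Sum>y\<in>{y \<in> V l \<inter> cell c. return_map l y = x}. ?f (y, l)) = return_term l c x"
        proof (cases "x \<in> return_map l ` (V l \<inter> cell c)")
          case True
          have "the_inv_into (V l \<inter> cell c) (return_map l) x \<in> V l \<inter> cell c"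
            by (rule the_inv_into_into[OF return_map_inj[OF c] True order_refl])
          then have "the_inv_into (V l \<inter> cell c) (return_map l) x \<in> level l" using V_returning unfolding returning_def by blast
          then show ?thesis unfolding one[OF c] using True by (simp add: return_term_def level_density_def)
        next
          case False
          then show ?thesis unfolding one[OF c] by (simp add: return_term_def)
        qed
      qed
      finally show ?thesis by (simp add: return_density_def)
    qed
    have "transfer T Q H N \<Lambda> \<phi> (x, 0) = (\<Sum>\<^sub>\<infinity>q\<in>{(y, l). y \<in> S l}. ?f q)"
      unfolding transfer_def tower_map_0 S_def by simp
    also have "\<dots> = (\<Sum>l. \<Sum>y\<in>S l. ?f (y, l))"
    proof (rule infsum_nonneg_levels[OF fin])
      show "0 \<le> ?f (y, l)" if "y \<in> S l" for l y
        using that \<phi>_nonneg[of "(y, l)"] unfolding S_def returning_def tower_eq by simp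
      show "summable (\<lambda>l. \<Sum>y\<in>S l. ?f (y, l))" using elim(2) by (simp add: sumS)
    qed
    also have "\<dots> = (\<Sum>l. return_density l x)" by (simp add: sumS)
    finally show ?case using suminf_ennreal2[OF return_density_nonneg elim(2)] by simp
  qed
qed

end

section \<open>Mass balance of the fixed point\<close>

locale tower_fixed = tower_density +
  assumes \<phi>_fixed: "AE p in tower_lborel T Q H N \<Lambda>. normalized_transfer T Q H N \<Lambda> \<phi> p = \<phi> p"
begin

text \<open>The normalizing factor, in the role of the eigenvalue \<lambda> of conditional
  invariance.\<close>

definition lam :: real where "lam = (LINT q|tower_lborel T Q H N \<Lambda>. \<bar>transfer T Q H N \<Lambda> \<phi> q\<bar>)"

text \<open>Division by zero yields 0, so a vanishing factor would make \<phi> vanish almost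
  everywhere, against its integral 1.\<close>

lemma lam_pos: "0 < lam"
proof (rule ccontr)
  assume "\<not> ?thesis"
  moreover have "0 \<le> lam" unfolding lam_def by (rule integral_nonneg_AE) simp
  ultimately have "lam = 0" by simp
  then have "AE p in tower_lborel T Q H N \<Lambda>. \<phi> p = 0"
    using \<phi>_fixed unfolding normalized_transfer_def lam_def[symmetric] by simp
  then have "(LINT p|tower_lborel T Q H N \<Lambda>. \<phi> p) = 0" by (rule integral_eq_zero_AE)
  then show False using \<phi>_integral by simp
qed

lemma AE_tower_level:
  assumes "AE p in tower_lborel T Q H N \<Lambda>. P p"
  shows "AE x in lborel. x \<in> level l \<longrightarrow> P (x, l)"
proof -
  let ?t = "tower_lborel T Q H N \<Lambda>"
  obtain Z where Z: "{p \<in> space ?t. \<not> P p} \<subseteq> Z" "emeasure ?t Z = 0" "Z \<in> sets ?t"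
    using AE_E[OF assms] by blast
  have ind: "indicator Z \<in> borel_measurable ?t" using Z(3) by simp
  have "(\<Sum>l. \<integral>\<^sup>+x\<in>level l. indicator Z (x, l) \<partial>lborel) = (0 :: ennreal)"
    using nn_integral_tower(2)[OF ind] Z(2,3) by simp
  then have "(\<integral>\<^sup>+x\<in>level l. indicator Z (x, l) \<partial>lborel) = (0 :: ennreal)"
    by (subst (asm) suminf_eq_zero_iff) auto
  then have "AE x in lborel. indicator Z (x, l) * indicator (level l) x = (0 :: ennreal)"
    using nn_integral_tower(1)[OF ind, of l] by (subst (asm) nn_integral_0_iff_AE) auto
  then show ?thesis
  proof (eventually_elim)
    case (elim x)
    show ?case
    proof
      assume x: "x \<in> level l"
      then have "(x, l) \<notin> Z" using elim by (auto simp: indicator_def split: if_splits)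
      then show "P (x, l)" using Z(1) x unfolding space_tower tower_eq by blast
    qed
  qed
qed

lemma transfer_fixed: "AE x in lborel. x \<in> level l \<longrightarrow> transfer T Q H N \<Lambda> \<phi> (x, l) = lam * level_density l x"
  using AE_tower_level[OF \<phi>_fixed, of l]
  by eventually_elim (use lam_pos in \<open>auto simp: normalized_transfer_def lam_def[symmetric] level_density_def field_simps\<close>)

definition escaping_mass :: "(real \<Rightarrow> ennreal) \<Rightarrow> ennreal" where
  "escaping_mass G = (\<Sum>l. \<integral>\<^sup>+y\<in>escaping l. ennreal (level_density l y) * G (level_proj (Suc l) y) \<partial>lborel)"

text \<open>Integrate \<open>G\<close> along one step up the tower: mass on level \<open>l\<close> moves to level \<open>l + 1\<close>, returns to the
  base (both multiplied by \<open>lam\<close> through the fixed point equation), or escapes.\<close>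
lemma conditional_invariance:
  assumes G [measurable]: "G \<in> borel_measurable borel"
  shows "ennreal lam * (\<integral>\<^sup>+x. G x \<partial>\<nu>) + escaping_mass G =
    (\<Sum>l. \<integral>\<^sup>+x\<in>level l. ennreal (level_density l x) * G (level_proj (Suc l) x) \<partial>lborel)"
proof -
  let ?t = "\<lambda>l. \<integral>\<^sup>+x\<in>level l. ennreal (level_density l x) * G (level_proj l x) \<partial>lborel"
  let ?u = "\<lambda>A l. \<integral>\<^sup>+y\<in>A. ennreal (level_density l y) * G (level_proj (Suc l) y) \<partial>lborel"
  have t0: "ennreal lam * ?t 0 = (\<Sum>l. ?u (returning l) l)"
  proof -
    have "ennreal lam * ?t 0 = (\<integral>\<^sup>+x. ennreal lam * (ennreal (level_density 0 x) * G (level_proj 0 x) * indicator (level 0) x) \<partial>lborel)"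
      by (rule nn_integral_cmult[symmetric]) measurable
    also have "\<dots> = (\<integral>\<^sup>+x. (\<Sum>l. ennreal (return_density l x)) * G (base_proj \<Lambda> x) \<partial>lborel)"
    proof (intro nn_integral_cong_AE, use transfer_fixed[of 0] transfer_0 in eventually_elim)
      case (elim x)
      show ?case
      proof (cases "x \<in> base N")
        case True
        then have "ennreal lam * ennreal (level_density 0 x) = (\<Sum>l. ennreal (return_density l x))"
          using elim lam_pos level_density_nonneg[of 0 x] by (simp add: level_0 ennreal_mult[symmetric])
        then show ?thesis using True by (simp add: level_0 level_proj_def mult.assoc[symmetric])
      next
        \<comment> \<open>Off the base nothing arrives: the return map takes its values in
          \<open>base N\<close> on V.\<close>
        case False
        have "return_term l c x = 0" if "c \<in> cells l" for l c
        proof -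
          have "x \<notin> return_map l ` (V l \<inter> cell c)" using False tower_map_returning(2) V_returning by blast
          then show ?thesis by (simp add: return_term_def)
        qed
        then have "return_density l x = 0" for l unfolding return_density_def by (intro sum.neutral) simp
        then show ?thesis using False by (simp add: level_0)
      qed
    qed
    also have "\<dots> = (\<Sum>l. ?u (returning l) l)" by (rule total_transfer[symmetric]) simp
    finally show ?thesis .
  qed
  have tS: "ennreal lam * ?t (Suc n) = ?u (level (Suc n)) n" for n
  proof -
    have nul: "level (Suc n) - open_level (Suc n) \<in> null_sets lborel" by (rule finite_imp_null_set_lborel[OF finite_level_open_level])
    have "ennreal lam * ?t (Suc n) = (\<integral>\<^sup>+x. ennreal lam * (ennreal (level_density (Suc n) x) * G (level_proj (Suc n) x) * indicator (level (Suc n)) x) \<partial>lborel)"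
      by (rule nn_integral_cmult[symmetric]) measurable
    also have "\<dots> = ?u (level (Suc n)) n"
    proof (intro nn_integral_cong_AE, use transfer_fixed[of "Suc n"] AE_not_in[OF nul] in eventually_elim)
      case (elim x)
      show ?case
      proof (cases "x \<in> level (Suc n)")
        case True
        then have "x \<in> open_level (Suc n)" using elim(2) by blast
        then have "lam * level_density (Suc n) x = level_density n x"
          using elim(1) True transfer_Suc[of x n \<phi>] level_antimono[of n] by (auto simp: level_density_def)
        then have "ennreal lam * ennreal (level_density (Suc n) x) = ennreal (level_density n x)"
          using lam_pos level_density_nonneg[of "Suc n" x] by (simp add: ennreal_mult[symmetric])
        then show ?thesis using True by (simp add: mult.assoc[symmetric])
      qed simp
    qed
    finally show ?thesis .
  qed
  have split: "?u (level l) l = ?u (returning l) l + ?u (level (Suc l)) l + ?u (escaping l) l" for l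
  proof -
    have "?u (level l) l = (\<integral>\<^sup>+y. ennreal (level_density l y) * G (level_proj (Suc l) y) * indicator (returning l) y
       + ennreal (level_density l y) * G (level_proj (Suc l) y) * indicator (level (Suc l)) y
       + ennreal (level_density l y) * G (level_proj (Suc l) y) * indicator (escaping l) y \<partial>lborel)"
      using level_antimono[of l] by (intro nn_integral_cong) (auto simp: indicator_def returning_def escaping_def)
    also have "\<dots> = ?u (returning l) l + ?u (level (Suc l)) l + ?u (escaping l) l"
      by (simp add: nn_integral_add)
    finally show ?thesis .
  qed
  \<comment> \<open>The base level is split off because it receives the returning mass, whereas each
    higher level receives the one below it.\<close>
  have "(\<lambda>n. ?t (Suc n)) sums (\<Sum>n. ?t (Suc n))" by (rule summable_sums) simp
  then have "?t sums ((\<Sum>n. ?t (Suc n)) + ?t 0)" by (rule sums_Suc)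
  then have "suminf ?t = (\<Sum>n. ?t (Suc n)) + ?t 0" by (rule sums_unique[symmetric])
  then have "ennreal lam * (\<integral>\<^sup>+x. G x \<partial>\<nu>) = ennreal lam * (\<Sum>n. ?t (Suc n)) + ennreal lam * ?t 0"
    unfolding nn_integral_\<nu>[OF G] by (simp add: distrib_left)
  also have "\<dots> = (\<Sum>n. ?u (level (Suc n)) n) + (\<Sum>l. ?u (returning l) l)"
    unfolding t0 by (simp add: ennreal_suminf_cmult[symmetric] tS)
  finally have "ennreal lam * (\<integral>\<^sup>+x. G x \<partial>\<nu>) + escaping_mass G
     = (\<Sum>n. ?u (level (Suc n)) n) + (\<Sum>l. ?u (returning l) l) + (\<Sum>l. ?u (escaping l) l)"
    unfolding escaping_mass_def by simp
  also have "\<dots> = (\<Sum>l. ?u (level l) l)"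
    unfolding split by (simp add: suminf_add[symmetric] add.commute add.left_commute)
  finally show ?thesis .
qed

text \<open>Let e(A) be the escaped mass landing in A. The mass balance for A reads lam * \<nu>(A) +
  e(A) = \<nu>(preimage of A), and for the whole interval lam + r = 1. The difference in question is
  therefore e(A) - r * \<nu>(A), which lies between -r and r. Finally r is at most the mass of the
  preimage of H together with finitely many points.\<close>

lemma almost_invariance:
  assumes A [measurable]: "A \<in> sets borel" and sub: "A \<subseteq> {0..1}"
  shows "\<bar>measure \<nu> {x \<in> {0..1}. T x \<in> A} - measure \<nu> A\<bar> \<le> density_bound * real (card Ihat) * measure lborel H"
proof -
  interpret nu: prob_space \<nu> by (rule prob_space_\<nu>)
  \<comment> \<open>Projecting from level l and then applying \<open>T\<close> once more is the same
    as projecting with l + 1 iterates.\<close>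
  have pre: "(\<Sum>l. \<integral>\<^sup>+x\<in>level l. ennreal (level_density l x) * indicator B (level_proj (Suc l) x) \<partial>lborel) = emeasure \<nu> {x \<in> {0..1}. T x \<in> B}"
    if B: "B \<in> sets borel" for B
  proof -
    have P[measurable]: "{x \<in> {0..1}. T x \<in> B} \<in> sets borel" by (rule T_preimage_sets[OF B])
    have "emeasure \<nu> {x \<in> {0..1}. T x \<in> B} = (\<integral>\<^sup>+x. indicator {x \<in> {0..1}. T x \<in> B} x \<partial>\<nu>)"
      by (rule emeasure_\<nu>[OF P]) blast
    also have "\<dots> = (\<Sum>l. \<integral>\<^sup>+x\<in>level l. ennreal (level_density l x) * indicator {x \<in> {0..1}. T x \<in> B} (level_proj l x) \<partial>lborel)"
      by (rule nn_integral_\<nu>) measurable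
    also have "\<dots> = (\<Sum>l. \<integral>\<^sup>+x\<in>level l. ennreal (level_density l x) * indicator B (level_proj (Suc l) x) \<partial>lborel)"
    proof (intro suminf_cong nn_integral_cong)
      fix l x
      show "ennreal (level_density l x) * indicator {x \<in> {0..1}. T x \<in> B} (level_proj l x) * indicator (level l) x
        = ennreal (level_density l x) * indicator B (level_proj (Suc l) x) * indicator (level l) x"
      proof (cases "x \<in> level l")
        case True
        then have "x \<in> base N" using level_base by blast
        then have "T (level_proj l x) = level_proj (Suc l) x" by (simp add: level_proj_def)
        then show ?thesis using level_proj_range[of l x] by (simp add: indicator_def)
      qed simp
    qed
    finally show ?thesis by simp
  qed
  define e where "e B = escaping_mass (indicator B)" for B
  have eq: "ennreal lam * emeasure \<nu> B + e B = emeasure \<nu> {x \<in> {0..1}. T x \<in> B}" if B: "B \<in> sets borel" "B \<subseteq> {0..1}" for B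
    unfolding e_def emeasure_\<nu>[OF B] pre[OF B(1), symmetric]
    by (rule conditional_invariance) (use B in measurable)
  have e_mono: "e A \<le> e {0..1}"
    unfolding e_def escaping_mass_def using sub
    by (intro suminf_le nn_integral_mono) (auto simp: indicator_def)
  define Zs where "Zs = {0..1} - Lam_all"
  have Zs[measurable]: "Zs \<in> sets borel" unfolding Zs_def by simp
  have e1: "e {0..1} \<le> emeasure \<nu> {x \<in> {0..1}. T x \<in> Zs}"
    unfolding e_def escaping_mass_def pre[OF Zs, symmetric]
  proof (intro suminf_le nn_integral_mono)
    fix l y
    show "ennreal (level_density l y) * indicator {0..1} (level_proj (Suc l) y) * indicator (escaping l) y
      \<le> ennreal (level_density l y) * indicator Zs (level_proj (Suc l) y) * indicator (level l) y"
      using level_proj_range[of "Suc l" y] by (auto simp: escaping_def Zs_def indicator_def)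
  qed auto
  also have "\<dots> \<le> ennreal density_bound * emeasure lborel {x \<in> {0..1}. T x \<in> Zs}"
    by (rule emeasure_\<nu>_le[OF T_preimage_sets[OF Zs]]) blast
  also have "\<dots> \<le> ennreal density_bound * (ennreal (real (card Ihat)) * emeasure lborel Zs)"
    by (intro mult_left_mono emeasure_T_preimage) auto
  also have "emeasure lborel Zs \<le> emeasure lborel H"
  proof -
    have f: "{0..1} - H - (\<Union>k<N. \<Lambda> k) \<in> null_sets lborel" by (rule finite_imp_null_set_lborel[OF Lam_cofinite])
    have Hm: "H \<in> sets borel" using H_open by simp
    have "emeasure lborel Zs \<le> emeasure lborel (H \<union> ({0..1} - H - (\<Union>k<N. \<Lambda> k)))"
      using Hm f by (intro emeasure_mono) (auto simp: Zs_def Lam_all_def dest: null_setsD2)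
    also have "\<dots> = emeasure lborel H" using f Hm by (intro emeasure_Un_null_set) auto
    finally show ?thesis .
  qed
  also have "emeasure lborel H = ennreal (measure lborel H)"
  proof -
    have "emeasure lborel H \<le> emeasure lborel {0..1::real}" using H_subset by (intro emeasure_mono) auto
    then have "emeasure lborel H < top" by (rule order.strict_trans1) simp
    then show ?thesis by (simp add: emeasure_eq_ennreal_measure)
  qed
  finally have e2: "e {0..1} \<le> ennreal density_bound * (ennreal (real (card Ihat)) * ennreal (measure lborel H))"
    by (simp add: mult_left_mono)
  have Bc0: "0 \<le> density_bound" unfolding density_bound_def using Mp_nonneg \<mu>_gt_2 by simp
  define r where "r = enn2real (e {0..1})"
  define a where "a = enn2real (e A)"
  have ef: "e {0..1} = ennreal r"
    using e2 by (simp add: r_def less_top[symmetric] ennreal_mult[symmetric] Bc0 top_unique) (metis ennreal_enn2real ennreal_less_top order.strict_trans1)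
  have r: "r \<le> density_bound * real (card Ihat) * measure lborel H"
    using e2 Bc0 unfolding ef by (simp add: ennreal_mult[symmetric] mult.assoc)
  have r0: "0 \<le> r" by (simp add: r_def)
  have ea: "e A = ennreal a" "0 \<le> a" "a \<le> r"
  proof -
    have "e A < top" using e_mono unfolding ef by (rule order.strict_trans1) simp
    then show 1: "e A = ennreal a" by (simp add: a_def)
    show "0 \<le> a" by (simp add: a_def)
    then show "a \<le> r" using e_mono r0 unfolding ef 1 by simp
  qed
  have "emeasure \<nu> {x \<in> {0..1}. T x \<in> {0..1}} = 1"
  proof -
    have "{x \<in> {0..1}. T x \<in> {0..1}} = space \<nu>" unfolding space_\<nu> using T_range by blast
    then show ?thesis using nu.emeasure_space_1 by simp
  qed
  moreover have "emeasure \<nu> {0..1} = 1" using nu.emeasure_space_1 unfolding space_\<nu> .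
  ultimately have "ennreal lam + ennreal r = 1" using eq[of "{0..1}"] unfolding ef by simp
  then have lr: "lam + r = 1" using lam_pos r0 by (simp add: ennreal_plus[symmetric] del: ennreal_plus)
  have "ennreal (lam * measure \<nu> A + a) = ennreal (measure \<nu> {x \<in> {0..1}. T x \<in> A})"
    using eq[OF A sub] lam_pos ea by (simp add: nu.emeasure_eq_measure ennreal_mult)
  then have "lam * measure \<nu> A + a = measure \<nu> {x \<in> {0..1}. T x \<in> A}"
    by (subst (asm) ennreal_inj) (use lam_pos ea in auto)
  moreover have "lam * measure \<nu> A = measure \<nu> A - r * measure \<nu> A"
    using lr by (metis add_diff_cancel_right' left_diff_distrib mult_1)
  ultimately have "measure \<nu> {x \<in> {0..1}. T x \<in> A} - measure \<nu> A = a - r * measure \<nu> A" by linarith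
  moreover have "0 \<le> r * measure \<nu> A" "r * measure \<nu> A \<le> r * 1"
    using r0 mult_left_mono[OF nu.prob_le_1[of A] r0] by auto
  ultimately show ?thesis using ea r by linarith
qed

end

section \<open>Approximation on a grid for Lipschitz densities\<close>

lemma AE_le_imp_le:
  fixes f :: "real \<Rightarrow> real"
  assumes D: "open D" and f: "continuous_on D f" and ae: "AE x in lborel. x \<in> D \<longrightarrow> f x \<le> b" and x: "x \<in> D"
  shows "f x \<le> b"
proof (rule ccontr)
  assume n: "\<not> f x \<le> b"
  define U where "U = D \<inter> f -` {b<..}"
  have U: "open U" unfolding U_def using f D by (intro continuous_open_preimage) auto
  have "x \<in> U" using x n by (simp add: U_def)
  have "AE x in lborel. x \<notin> U" using ae by eventually_elim (auto simp: U_def)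
  then have "U \<in> null_sets lborel" using U by (subst AE_iff_null_sets) auto
  then have "emeasure lborel U = 0" by auto
  moreover obtain e where e: "0 < e" "ball x e \<subseteq> U" using U \<open>x \<in> U\<close> open_contains_ball by blast
  moreover have "emeasure lborel {x - e<..<x + e} \<le> emeasure lborel U"
    using e(2) U by (intro emeasure_mono) (auto simp: ball_def dist_real_def abs_less_iff subset_iff)
  ultimately show False by simp
qed

text \<open>Half-open intervals tile [0,1); the remaining point 1 has measure zero for the measures
  compared.\<close>

definition grid :: "nat \<Rightarrow> nat \<Rightarrow> real set" where
  "grid n k = {real k / real n..<real (Suc k) / real n}"

text \<open>Same argument as in \<open>kept_card\<close>: a grid interval between two others that
  meet W lies in W.\<close>

lemma grid_straddle:
  fixes W :: "real set"
  assumes W: "connected W" and n: "0 < n"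
  shows "card {k \<in> {..<n}. grid n k \<inter> W \<noteq> {} \<and> \<not> grid n k \<subseteq> W} \<le> 2"
proof -
  have mono: "y < z" if "k < l" "y \<in> grid n k" "z \<in> grid n l" for k l y z
  proof -
    have "real (Suc k) / real n \<le> real l / real n" using that(1) by (intro divide_right_mono) auto
    then show ?thesis using that unfolding grid_def by auto
  qed
  define S where "S = {k \<in> {..<n}. grid n k \<inter> W \<noteq> {} \<and> \<not> grid n k \<subseteq> W}"
  have mid: False if k: "k1 \<in> S" "k2 \<in> S" "k3 \<in> S" "k1 < k2" "k2 < k3" for k1 k2 k3
  proof -
    obtain y1 y3 where y: "y1 \<in> grid n k1 \<inter> W" "y3 \<in> grid n k3 \<inter> W" using k unfolding S_def by blast
    have "grid n k2 \<subseteq> W"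
    proof
      fix z assume z: "z \<in> grid n k2"
      have "y1 < z" "z < y3" using mono[OF k(4) _ z] mono[OF k(5) z] y by blast+
      then show "z \<in> W" using connected_contains_Icc[OF W, of y1 y3] y by force
    qed
    then show False using k unfolding S_def by blast
  qed
  have "finite S \<and> card S \<le> 2"
  proof (rule card_le_2I)
    fix x y z assume "x \<in> S" "y \<in> S" "z \<in> S" "x \<noteq> y" "x \<noteq> z" "y \<noteq> z"
    then show False using mid by (metis linorder_neqE_nat)
  qed
  then show ?thesis by (simp add: S_def)
qed

lemma grid_facts:
  assumes "k < n"
  shows "grid n k \<in> sets borel" "grid n k \<subseteq> {0..1}" "measure lborel (grid n k) = 1 / n"
    "\<And>y z. y \<in> grid n k \<Longrightarrow> z \<in> grid n k \<Longrightarrow> \<bar>y - z\<bar> \<le> 1 / real n" "grid n k \<noteq> {}"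
proof -
  have n: "0 < real n" using assms by simp
  have lt: "real k / real n < real (Suc k) / real n" using n by (intro divide_strict_right_mono) auto
  have d: "real (Suc k) / real n - real k / real n = 1 / real n" by (simp add: diff_divide_distrib[symmetric])
  show "grid n k \<in> sets borel" unfolding grid_def by simp
  have "real (Suc k) / real n \<le> 1" using assms n by (simp add: divide_le_eq)
  moreover have "0 \<le> real k / real n" by simp
  ultimately show "grid n k \<subseteq> {0..1}" unfolding grid_def subset_iff atLeastLessThan_iff atLeastAtMost_iff
    by (meson le_less_trans less_imp_le order_trans)
  show "measure lborel (grid n k) = 1 / n" unfolding grid_def using lt d by simp
  show "\<bar>y - z\<bar> \<le> 1 / real n" if "y \<in> grid n k" "z \<in> grid n k" for y z
    using that d unfolding grid_def by auto
  show "grid n k \<noteq> {}" unfolding grid_def using lt by auto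
qed

lemma emeasure_eq_measure_unit: "B \<in> sets borel \<Longrightarrow> B \<subseteq> {0..1::real} \<Longrightarrow> emeasure lborel B = ennreal (measure lborel B)"
proof -
  assume B: "B \<in> sets borel" "B \<subseteq> {0..1}"
  then have "emeasure lborel B \<le> emeasure lborel {0..1::real}" by (intro emeasure_mono) auto
  then have "emeasure lborel B < top" by (rule order.strict_trans1) simp
  then show ?thesis by (simp add: emeasure_eq_ennreal_measure)
qed

lemma measure_sub_grid:
  assumes "k < n" "A \<in> sets borel"
  shows "0 \<le> measure lborel (A \<inter> grid n k)" "measure lborel (A \<inter> grid n k) \<le> 1 / n"
proof -
  note g = grid_facts[OF assms(1)]
  have "measure lborel (A \<inter> grid n k) \<le> measure lborel (grid n k)"
    using g assms(2) emeasure_eq_measure_unit[of "grid n k"] by (intro measure_mono_fmeasurable) (auto simp: fmeasurable_def)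
  then show "measure lborel (A \<inter> grid n k) \<le> 1 / n" using g(3) by simp
qed simp

section \<open>Image of a single cell compared with uniform distribution on a grid\<close>

context tower_density
begin

definition cell_measure :: "nat \<Rightarrow> nat \<times> real set \<Rightarrow> real set \<Rightarrow> ennreal" where
  "cell_measure l c B = (\<integral>\<^sup>+x\<in>cell c. ennreal (level_density l x) * indicator B (level_proj l x) \<partial>lborel)"

definition level_bound :: "nat \<Rightarrow> real" where "level_bound l = Mp * exp (xi \<alpha> \<mu> * real l)"
text \<open>A Lipschitz constant, by the product rule, for the density $\varphi/|(\pi|_c)'|$ of the image under
  $\pi$ of the measure on a cell $c$ of level \<open>l\<close>.\<close>
definition image_Lipschitz :: "nat \<Rightarrow> real" where "image_Lipschitz l = (level_bound l * level_bound l / \<delta> + level_bound l * (real l * Chat)) / \<delta>"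

lemma level_bound_nonneg: "0 \<le> level_bound l" and image_Lipschitz_nonneg: "0 \<le> image_Lipschitz l"
  unfolding image_Lipschitz_def level_bound_def using Mp_nonneg \<delta>_pos Chat_pos by (auto intro!: add_nonneg_nonneg divide_nonneg_pos mult_nonneg_nonneg)

text \<open>The factor \<mu>^(-l) is given up, since here the bound serves one level at a
  time.\<close>

lemma cell_measure_le:
  assumes c: "c \<in> cells l" and B: "B \<in> sets borel" "B \<subseteq> {0..1}"
  shows "cell_measure l c B \<le> ennreal (level_bound l / \<delta>) * emeasure lborel B"
proof -
  have "cell_measure l c B \<le> ennreal (level_bound l / (\<delta> * \<mu> ^ l)) * (\<integral>\<^sup>+y\<in>{0..1}. indicator B y \<partial>lborel)"
    unfolding cell_measure_def level_bound_def by (rule cell_mass_le[OF c]) (use B in measurable)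
  also have "(\<integral>\<^sup>+y\<in>{0..1}. indicator B y \<partial>lborel) = (\<integral>\<^sup>+y. indicator B y \<partial>lborel)"
    using B(2) by (intro nn_integral_cong) (auto simp: indicator_def)
  also have "\<dots> = emeasure lborel B" using B(1) by simp
  also have "ennreal (level_bound l / (\<delta> * \<mu> ^ l)) * emeasure lborel B \<le> ennreal (level_bound l / \<delta>) * emeasure lborel B"
  proof (intro mult_right_mono ennreal_leI divide_left_mono)
    have "1 \<le> \<mu> ^ l" using \<mu>_gt_2 by simp
    then show "\<delta> \<le> \<delta> * \<mu> ^ l" using \<delta>_pos by simp
    show "0 < \<delta> * \<mu> ^ l * \<delta>" using \<delta>_pos \<mu>_gt_2 by simp
  qed (use level_bound_nonneg in auto)
  finally show ?thesis .
qed

text \<open>w is the image density at one reference point, and \<open>image_Lipschitz l * h\<close>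
  bounds its variation over I. Two inequalities with the error added stand in for a two-sided
  estimate, as subtraction in \<open>ennreal\<close> is truncated.\<close>

lemma cell_measure_uniform:
  assumes \<alpha>: "\<alpha> = 1" and c: "c \<in> cells l"
    and lip: "(level_bound l * level_bound l)-lipschitz_on (cell c) (\<lambda>x. \<phi> (x, l))"
    and sup: "\<And>x. x \<in> cell c \<Longrightarrow> \<phi> (x, l) \<le> level_bound l"
    and h: "0 < h" and I: "I \<subseteq> (T ^^ l) ` snd c" "\<And>y z. y \<in> I \<Longrightarrow> z \<in> I \<Longrightarrow> \<bar>y - z\<bar> \<le> h" "I \<noteq> {}"
  obtains w where "0 \<le> w"
    "\<And>B. B \<in> sets borel \<Longrightarrow> B \<subseteq> I \<Longrightarrow> cell_measure l c B \<le> ennreal (w + image_Lipschitz l * h) * emeasure lborel B"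
    "\<And>B. B \<in> sets borel \<Longrightarrow> B \<subseteq> I \<Longrightarrow> ennreal w * emeasure lborel B \<le> cell_measure l c B + ennreal (image_Lipschitz l * h) * emeasure lborel B"
proof -
  let ?d = "\<lambda>x. \<bar>iter_deriv l (base_proj \<Lambda> x) * width (fst c)\<bar>"
  define w where "w x = \<phi> (x, l) / ?d x" for x
  have b: "branch l (snd c)" by (rule branch_mono[OF cellsD(3)[OF c]]) simp
  have wdp: "0 < width (fst c)" "\<delta> \<le> width (fst c)" using Lam_interval(2,3)[OF cellsD(1)[OF c]] by auto
  have xE: "x \<in> level l" "x \<in> base N" if "x \<in> cell c" for x
    using that c open_level_level[of l] cellsD(6)[OF c] unfolding open_level_def by blast+
  have p0: "0 \<le> \<phi> (x, l)" "level_density l x = \<phi> (x, l)" if "x \<in> cell c" for x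
    using xE[OF that] level_density_nonneg[of l x] by (auto simp: level_density_def)
  have dpos: "\<delta> \<le> ?d x" if "x \<in> cell c" for x
  proof -
    have "1 \<le> \<mu> ^ l" using \<mu>_gt_2 by simp
    then have "1 \<le> \<bar>iter_deriv l (base_proj \<Lambda> x)\<bar>" using branch_iter_deriv_ge[OF b cell_proj[OF c that]] by linarith
    then have "1 * \<delta> \<le> \<bar>iter_deriv l (base_proj \<Lambda> x)\<bar> * width (fst c)" using wdp \<delta>_pos by (intro mult_mono) auto
    then show ?thesis using wdp by (simp add: abs_mult)
  qed
  have w0: "0 \<le> w x" if "x \<in> cell c" for x using p0[OF that] by (simp add: w_def)
  have osc: "w x \<le> w x' + image_Lipschitz l * h" if x: "x \<in> cell c" "x' \<in> cell c" "level_proj l x \<in> I" "level_proj l x' \<in> I" for x x'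
  proof -
    define u u' where "u = base_proj \<Lambda> x" and "u' = base_proj \<Lambda> x'"
    have uc: "u \<in> snd c" "u' \<in> snd c" using cell_proj[OF c] x by (auto simp: u_def u'_def)
    have Ld: "\<bar>(T ^^ l) u - (T ^^ l) u'\<bar> \<le> h"
      using I(2)[OF x(3,4)] xE(2)[OF x(1)] xE(2)[OF x(2)] by (simp add: level_proj_base u_def u'_def)
    have uu: "\<bar>u - u'\<bar> \<le> h"
    proof -
      have "1 * \<bar>u - u'\<bar> \<le> \<mu> ^ l * \<bar>u - u'\<bar>" using \<mu>_gt_2 by (intro mult_right_mono) auto
      also note branch_expands[OF b uc]
      also note Ld
      finally show ?thesis by simp
    qed
    \<comment> \<open>The iterate expands and the chart has slope at least \<delta>, so points with
      nearby images are close in the cell.\<close>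
    have xx: "\<bar>x - x'\<bar> \<le> h / \<delta>"
    proof -
      have "x \<in> base_interval (fst c)" "x' \<in> base_interval (fst c)" using cellsD(5)[OF c] x by auto
      then have "u - u' = (x - x') * width (fst c)" by (simp add: u_def u'_def base_proj_eq algebra_simps)
      then have "\<bar>x - x'\<bar> * width (fst c) \<le> h" using uu wdp by (simp add: abs_mult)
      moreover have "\<bar>x - x'\<bar> * \<delta> \<le> \<bar>x - x'\<bar> * width (fst c)" using wdp by (intro mult_left_mono) auto
      ultimately show ?thesis using \<delta>_pos by (simp add: pos_le_divide_eq)
    qed
    have f: "\<bar>\<phi> (x, l) - \<phi> (x', l)\<bar> \<le> level_bound l * level_bound l * (h / \<delta>)"
      using lipschitz_onD[OF lip x(1,2)] mult_left_mono[OF xx, of "level_bound l * level_bound l"] level_bound_nonneg[of l]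
      by (simp add: dist_real_def)
    have D1: "\<bar>1 / iter_deriv l u\<bar> \<le> 1"
    proof -
      have "1 \<le> \<mu> ^ l" using \<mu>_gt_2 by simp
      then have "1 \<le> \<bar>iter_deriv l u\<bar>" using branch_iter_deriv_ge[OF b uc(1)] by linarith
      then show ?thesis by (simp add: divide_le_eq)
    qed
    have DD: "\<bar>1 / iter_deriv l u - 1 / iter_deriv l u'\<bar> \<le> real l * Chat * h"
    proof -
      have "\<bar>1 / iter_deriv l u - 1 / iter_deriv l u'\<bar> \<le> real l * Chat * \<bar>(T ^^ l) u - (T ^^ l) u'\<bar>"
        by (rule branch_inverse_iter_deriv_Lipschitz[OF \<alpha> b uc])
      also have "\<dots> \<le> real l * Chat * h" using Ld Chat_pos by (intro mult_left_mono) auto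
      finally show ?thesis .
    qed
    have eq: "w x = \<phi> (x, l) * \<bar>1 / iter_deriv l u\<bar> / width (fst c)" "w x' = \<phi> (x', l) * \<bar>1 / iter_deriv l u'\<bar> / width (fst c)"
      using wdp by (simp_all add: w_def u_def u'_def abs_mult)
    have "\<phi> (x, l) * \<bar>1 / iter_deriv l u\<bar> - \<phi> (x', l) * \<bar>1 / iter_deriv l u'\<bar>
       = (\<phi> (x, l) - \<phi> (x', l)) * \<bar>1 / iter_deriv l u\<bar> + \<phi> (x', l) * (\<bar>1 / iter_deriv l u\<bar> - \<bar>1 / iter_deriv l u'\<bar>)"
      by (simp add: algebra_simps)
    also have "\<dots> \<le> \<bar>\<phi> (x, l) - \<phi> (x', l)\<bar> * 1 + \<phi> (x', l) * \<bar>1 / iter_deriv l u - 1 / iter_deriv l u'\<bar>"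
    proof (intro add_mono)
      show "(\<phi> (x, l) - \<phi> (x', l)) * \<bar>1 / iter_deriv l u\<bar> \<le> \<bar>\<phi> (x, l) - \<phi> (x', l)\<bar> * 1"
        by (rule mult_mono) (use D1 in auto)
      show "\<phi> (x', l) * (\<bar>1 / iter_deriv l u\<bar> - \<bar>1 / iter_deriv l u'\<bar>) \<le> \<phi> (x', l) * \<bar>1 / iter_deriv l u - 1 / iter_deriv l u'\<bar>"
        by (intro mult_left_mono p0(1)[OF x(2)] abs_triangle_ineq2)
    qed
    also have "\<dots> \<le> level_bound l * level_bound l * (h / \<delta>) + level_bound l * (real l * Chat * h)"
    proof (rule add_mono)
      show "\<bar>\<phi> (x, l) - \<phi> (x', l)\<bar> * 1 \<le> level_bound l * level_bound l * (h / \<delta>)" using f by simp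
      show "\<phi> (x', l) * \<bar>1 / iter_deriv l u - 1 / iter_deriv l u'\<bar> \<le> level_bound l * (real l * Chat * h)"
        by (rule mult_mono[OF sup[OF x(2)] DD level_bound_nonneg]) simp
    qed
    also have "\<dots> = (level_bound l * level_bound l / \<delta> + level_bound l * (real l * Chat)) * h" by (simp add: algebra_simps)
    finally have n: "\<phi> (x, l) * \<bar>1 / iter_deriv l u\<bar> - \<phi> (x', l) * \<bar>1 / iter_deriv l u'\<bar> \<le> (level_bound l * level_bound l / \<delta> + level_bound l * (real l * Chat)) * h" .
    have k0: "0 \<le> (level_bound l * level_bound l / \<delta> + level_bound l * (real l * Chat)) * h"
      using level_bound_nonneg \<delta>_pos Chat_pos h by (intro mult_nonneg_nonneg add_nonneg_nonneg divide_nonneg_pos) auto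
    have "w x - w x' = (\<phi> (x, l) * \<bar>1 / iter_deriv l u\<bar> - \<phi> (x', l) * \<bar>1 / iter_deriv l u'\<bar>) / width (fst c)"
      unfolding eq by (simp add: diff_divide_distrib)
    also have "\<dots> \<le> (level_bound l * level_bound l / \<delta> + level_bound l * (real l * Chat)) * h / width (fst c)"
      using n wdp by (intro divide_right_mono) auto
    also have "\<dots> \<le> (level_bound l * level_bound l / \<delta> + level_bound l * (real l * Chat)) * h / \<delta>"
      using k0 wdp \<delta>_pos by (intro divide_left_mono) auto
    finally show ?thesis by (simp add: image_Lipschitz_def)
  qed
  obtain y0 where y0: "y0 \<in> I" using I(3) by blast
  then obtain u0 where u0: "u0 \<in> snd c" "y0 = (T ^^ l) u0" using I(1) by blast
  have "u0 \<in> base_proj \<Lambda> ` cell c" unfolding cell_image[OF c] by (rule u0(1))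
  then obtain x0 where x0: "x0 \<in> cell c" "base_proj \<Lambda> x0 = u0" by (elim imageE) simp
  have L0: "level_proj l x0 \<in> I" using xE(2)[OF x0(1)] x0(2) u0(2) y0 by (simp add: level_proj_base)
  have cs[measurable]: "cell c \<in> sets borel" by (rule cell_sets[OF c])
  have dm: "(\<lambda>x. ennreal (?d x) * indicator B (level_proj l x) * indicator (cell c) x) \<in> borel_measurable borel"
    if [measurable]: "B \<in> sets borel" for B
  proof -
    have "(\<lambda>x. indicator (cell c) x *\<^sub>R (iter_deriv l (base_proj \<Lambda> x) * width (fst c))) \<in> borel_measurable borel"
      by (intro borel_measurable_continuous_on_indicator cell_continuous_deriv[OF c]) (use cs in auto)
    then have m: "(\<lambda>x. ennreal \<bar>indicator (cell c) x *\<^sub>R (iter_deriv l (base_proj \<Lambda> x) * width (fst c))\<bar> * indicator B (level_proj l x)) \<in> borel_measurable borel"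
      by measurable
    have "(\<lambda>x. ennreal (?d x) * indicator B (level_proj l x) * indicator (cell c) x)
      = (\<lambda>x. ennreal \<bar>indicator (cell c) x *\<^sub>R (iter_deriv l (base_proj \<Lambda> x) * width (fst c))\<bar> * indicator B (level_proj l x))"
      by (auto simp: fun_eq_iff indicator_def)
    then show ?thesis using m by simp
  qed
  have cv: "(\<integral>\<^sup>+x\<in>cell c. ennreal (?d x) * indicator B (level_proj l x) \<partial>lborel) = emeasure lborel B"
    if B: "B \<in> sets borel" "B \<subseteq> I" for B
  proof -
    have "(\<integral>\<^sup>+x\<in>cell c. ennreal (?d x) * indicator B (level_proj l x) \<partial>lborel)
      = (\<integral>\<^sup>+x\<in>cell c. ennreal (?d x) * indicator B ((T ^^ l) (base_proj \<Lambda> x)) \<partial>lborel)"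
      using xE(2) by (intro nn_integral_cong) (simp add: indicator_def level_proj_base)
    also have "\<dots> = (\<integral>\<^sup>+y\<in>(T ^^ l) ` snd c. indicator B y \<partial>lborel)"
      by (rule cell_change_of_variables[OF c]) (use B in simp_all)
    also have "\<dots> = (\<integral>\<^sup>+y. indicator B y \<partial>lborel)" using B(2) I(1) by (intro nn_integral_cong) (auto simp: indicator_def)
    also have "\<dots> = emeasure lborel B" using B(1) by simp
    finally show ?thesis .
  qed
  have phw: "level_density l x = w x * ?d x" if "x \<in> cell c" for x
  proof -
    have "?d x \<noteq> 0" using dpos[OF that] \<delta>_pos by linarith
    from nonzero_eq_divide_eq[OF this, THEN iffD1, OF refl] show ?thesis
      unfolding w_def p0(2)[OF that] by (rule sym)
  qed
  show thesis
  proof (rule that[OF w0[OF x0(1)]])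
    fix B :: "real set" assume B: "B \<in> sets borel" "B \<subseteq> I"
    note [measurable] = B(1)
    have "cell_measure l c B \<le> (\<integral>\<^sup>+x. ennreal (w x0 + image_Lipschitz l * h) * (ennreal (?d x) * indicator B (level_proj l x) * indicator (cell c) x) \<partial>lborel)"
      unfolding cell_measure_def
    proof (intro nn_integral_mono)
      fix x
      show "ennreal (level_density l x) * indicator B (level_proj l x) * indicator (cell c) x
        \<le> ennreal (w x0 + image_Lipschitz l * h) * (ennreal (?d x) * indicator B (level_proj l x) * indicator (cell c) x)"
      proof (cases "x \<in> cell c \<and> level_proj l x \<in> B")
        case True
        have "level_density l x \<le> (w x0 + image_Lipschitz l * h) * ?d x"
          unfolding phw[OF conjunct1[OF True]] using osc[of x x0] True B(2) x0(1) L0 by (intro mult_right_mono) auto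
        then have "ennreal (level_density l x) \<le> ennreal (w x0 + image_Lipschitz l * h) * ennreal (?d x)"
          using w0[OF x0(1)] image_Lipschitz_nonneg[of l] h by (subst ennreal_mult[symmetric]) (auto intro!: ennreal_leI)
        then show ?thesis using True by simp
      qed (auto simp: indicator_def)
    qed
    also have "\<dots> = ennreal (w x0 + image_Lipschitz l * h) * emeasure lborel B"
      using dm[OF B(1)] by (subst nn_integral_cmult) (simp_all add: cv[OF B])
    finally show "cell_measure l c B \<le> ennreal (w x0 + image_Lipschitz l * h) * emeasure lborel B" .
    have "ennreal (w x0) * emeasure lborel B = (\<integral>\<^sup>+x. ennreal (w x0) * (ennreal (?d x) * indicator B (level_proj l x) * indicator (cell c) x) \<partial>lborel)"
      using dm[OF B(1)] by (subst nn_integral_cmult) (simp_all add: cv[OF B])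
    also have "\<dots> \<le> (\<integral>\<^sup>+x. ennreal (level_density l x) * indicator B (level_proj l x) * indicator (cell c) x
        + ennreal (image_Lipschitz l * h) * (ennreal (?d x) * indicator B (level_proj l x) * indicator (cell c) x) \<partial>lborel)"
    proof (intro nn_integral_mono)
      fix x
      show "ennreal (w x0) * (ennreal (?d x) * indicator B (level_proj l x) * indicator (cell c) x)
        \<le> ennreal (level_density l x) * indicator B (level_proj l x) * indicator (cell c) x
          + ennreal (image_Lipschitz l * h) * (ennreal (?d x) * indicator B (level_proj l x) * indicator (cell c) x)"
      proof (cases "x \<in> cell c \<and> level_proj l x \<in> B")
        case True
        have "w x0 * ?d x \<le> (w x + image_Lipschitz l * h) * ?d x"
          using osc[of x0 x] True B(2) x0(1) L0 by (intro mult_right_mono) auto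
        also have "\<dots> = level_density l x + image_Lipschitz l * h * ?d x" using phw True by (simp add: distrib_right)
        finally have "ennreal (w x0 * ?d x) \<le> ennreal (level_density l x + image_Lipschitz l * h * ?d x)" by (rule ennreal_leI)
        then have "ennreal (w x0) * ennreal (?d x) \<le> ennreal (level_density l x) + ennreal (image_Lipschitz l * h) * ennreal (?d x)"
          using w0[OF x0(1)] image_Lipschitz_nonneg[of l] h level_density_nonneg[of l x] by (simp add: ennreal_mult ennreal_plus)
        then show ?thesis using True by simp
      qed (auto simp: indicator_def)
    qed
    also have "\<dots> = cell_measure l c B + ennreal (image_Lipschitz l * h) * emeasure lborel B"
      unfolding cell_measure_def using dm[OF B(1)]
      by (subst nn_integral_add) (simp_all add: nn_integral_cmult cv[OF B])
    finally show "ennreal (w x0) * emeasure lborel B \<le> cell_measure l c B + ennreal (image_Lipschitz l * h) * emeasure lborel B" .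
  qed
qed

text \<open>The seminorm bounds |f'| / |f| where f does not vanish, and only almost everywhere. At a
  zero the nonnegative f has a minimum, so a derivative there is 0. Hence |f'| is at most the square
  of \<open>level_bound l\<close>: one factor for the logarithmic derivative, one for f
  itself.\<close>

lemma cell_regular:
  assumes \<alpha>: "\<alpha> = 1" and c: "c \<in> cells l"
    and lip: "\<And>i l D. i < N \<Longrightarrow> D \<in> tower_cells T Q \<Lambda> i l \<Longrightarrow> \<exists>L. L-lipschitz_on D (\<lambda>x. \<phi> (x, l))"
    and nr: "norm_r_lipschitz T Q N \<Lambda> \<mu> \<phi> \<le> ennreal M"
  shows "(level_bound l * level_bound l)-lipschitz_on (cell c) (\<lambda>x. \<phi> (x, l))"
    and "\<And>x. x \<in> cell c \<Longrightarrow> \<phi> (x, l) \<le> level_bound l"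
proof -
  let ?D = "cell c" let ?f = "\<lambda>x. \<phi> (x, l)"
  note oD = cell_open(1)[OF c]
  obtain L where L: "L-lipschitz_on ?D ?f" using lip[OF cellsD(1)[OF c] cell_tower_cells[OF c]] by blast
  have cf: "continuous_on ?D ?f" by (rule lipschitz_on_continuous_on[OF L])
  have f0: "0 \<le> ?f x" if "x \<in> ?D" for x
  proof -
    have "x \<in> level l" using that c open_level_level[of l] unfolding open_level_def by blast
    then show ?thesis using level_density_nonneg[of l x] by (simp add: level_density_def)
  qed
  have "AE x in lborel. x \<in> ?D \<longrightarrow> ?f x \<le> level_bound l"
    using cell_bound[OF c] by eventually_elim (auto simp: level_bound_def)
  then show sup: "?f x \<le> level_bound l" if "x \<in> ?D" for x by (rule AE_le_imp_le[OF oD cf _ that])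
  let ?Z = "{x \<in> ?D. ?f x \<noteq> 0}"
  have oZ: "open ?Z"
  proof -
    have "?Z = ?D \<inter> ?f -` (- {0})" by blast
    then show ?thesis using continuous_open_preimage[OF cf oD, of "- {0}"] by auto
  qed
  let ?e = "esssup (restrict_space lborel ?Z) (\<lambda>x. ennreal (\<bar>deriv ?f x\<bar> / \<bar>?f x\<bar>))"
  have "ennreal (exp (- xi 1 \<mu> * real l)) * ?e \<le> norm_r_lipschitz T Q N \<Lambda> \<mu> \<phi>"
    unfolding norm_r_lipschitz_def
    by (intro SUP_upper2[of "fst c"] SUP_upper2[of l] SUP_upper2[OF cell_tower_cells[OF c]] order_refl)
      (use cellsD(1)[OF c] in auto)
  also have "\<dots> \<le> ennreal Mp" by (rule order_trans[OF nr]) (auto simp: Mp_def ennreal_leI)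
  finally have 1: "ennreal (exp (- xi 1 \<mu> * real l)) * ?e \<le> ennreal Mp" .
  have "?e = ennreal (exp (xi 1 \<mu> * real l)) * (ennreal (exp (- xi 1 \<mu> * real l)) * ?e)"
    unfolding mult.assoc[symmetric] by (simp add: ennreal_mult[symmetric] exp_add[symmetric])
  also have "\<dots> \<le> ennreal (exp (xi 1 \<mu> * real l)) * ennreal Mp" by (intro mult_left_mono 1) simp
  also have "\<dots> = ennreal (Mp * exp (xi 1 \<mu> * real l))"
    by (simp add: ennreal_mult[symmetric] Mp_nonneg mult.commute)
  also have "\<dots> = ennreal (level_bound l)" unfolding level_bound_def by (simp add: \<alpha>)
  finally have 2: "?e \<le> ennreal (level_bound l)" .
  have "AE x in restrict_space lborel ?Z. ennreal (\<bar>deriv ?f x\<bar> / \<bar>?f x\<bar>) \<le> ?e" by (rule esssup_AE)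
  then have "AE x in lborel. x \<in> ?Z \<longrightarrow> ennreal (\<bar>deriv ?f x\<bar> / \<bar>?f x\<bar>) \<le> ?e"
    using oZ by (subst (asm) AE_restrict_space_iff) auto
  then have der: "AE x in lborel. x \<in> ?D \<longrightarrow> ?f differentiable (at x) \<longrightarrow> \<bar>deriv ?f x\<bar> \<le> level_bound l * level_bound l"
  proof (eventually_elim)
    case (elim x)
    show ?case
    proof (intro impI)
      assume x: "x \<in> ?D" and d: "?f differentiable (at x)"
      show "\<bar>deriv ?f x\<bar> \<le> level_bound l * level_bound l"
      proof (cases "?f x = 0")
        case True
        obtain d where dd: "(?f has_real_derivative d) (at x)" using d real_differentiable_def by blast
        obtain e where e: "0 < e" "ball x e \<subseteq> ?D" using oD x open_contains_ball by blast
        have "d = 0"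
        proof (rule DERIV_local_min[OF dd e(1)], intro allI impI)
          fix y assume "\<bar>x - y\<bar> < e"
          then have "y \<in> ?D" using e(2) by (auto simp: dist_real_def)
          then show "?f x \<le> ?f y" using f0 True by simp
        qed
        then show ?thesis using DERIV_imp_deriv[OF dd] level_bound_nonneg[of l] by simp
      next
        case False
        then have "ennreal (\<bar>deriv ?f x\<bar> / \<bar>?f x\<bar>) \<le> ennreal (level_bound l)" using elim x 2 order_trans by blast
        then have "\<bar>deriv ?f x\<bar> / \<bar>?f x\<bar> \<le> level_bound l" using level_bound_nonneg by simp
        then have "\<bar>deriv ?f x\<bar> \<le> level_bound l * \<bar>?f x\<bar>" using False by (simp add: divide_le_eq)
        also have "\<dots> \<le> level_bound l * level_bound l" using sup[OF x] f0[OF x] level_bound_nonneg by (intro mult_left_mono) auto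
        finally show ?thesis .
      qed
    qed
  qed
  have "snd c \<noteq> {}" using Omega_element[OF Lam_interval(4)[OF cellsD(1)[OF c]] cellsD(2)[OF c]] by blast
  then have ne: "?D \<noteq> {}" unfolding cell_def by simp
  note eq = open_interval_eq(1)[OF oD cell_open(2)[OF c] ne cell_open(3)[OF c]]
  have "(level_bound l * level_bound l)-lipschitz_on {Inf ?D<..<Sup ?D} ?f"
  proof (rule lipschitz_derivative_bound)
    show "L-lipschitz_on {Inf ?D<..<Sup ?D} ?f" using L eq by simp
    show "AE x in lborel. x \<in> {Inf ?D<..<Sup ?D} \<longrightarrow> ?f differentiable (at x) \<longrightarrow> \<bar>deriv ?f x\<bar> \<le> level_bound l * level_bound l"
      using der eq by simp
  qed (simp add: level_bound_nonneg)
  then show "(level_bound l * level_bound l)-lipschitz_on ?D ?f" using eq by simp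
qed

text \<open>At most two grid intervals meet the image of the cell without being contained in it; on the others
  the image density is nearly constant.\<close>
lemma cell_grid:
  assumes \<alpha>: "\<alpha> = 1" and c: "c \<in> cells l"
    and lip: "(level_bound l * level_bound l)-lipschitz_on (cell c) (\<lambda>x. \<phi> (x, l))"
    and sup: "\<And>x. x \<in> cell c \<Longrightarrow> \<phi> (x, l) \<le> level_bound l"
    and n: "0 < n" and A [measurable]: "A \<in> sets borel"
  shows "(\<Sum>k<n. \<bar>enn2real (cell_measure l c (A \<inter> grid n k)) - n * measure lborel (A \<inter> grid n k) * enn2real (cell_measure l c (grid n k))\<bar>)
    \<le> (2 * image_Lipschitz l + 2 * level_bound l / \<delta>) / n"
proof -
  define W where "W = (T ^^ l) ` snd c"
  define S where "S = {k \<in> {..<n}. grid n k \<inter> W \<noteq> {} \<and> \<not> grid n k \<subseteq> W}"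
  have b: "branch l (snd c)" by (rule branch_mono[OF cellsD(3)[OF c]]) simp
  have W: "connected W" unfolding W_def by (rule branch_image(2)[OF b])
  have cardS: "card S \<le> 2" unfolding S_def by (rule grid_straddle[OF W n])
  define \<beta> where "\<beta> = level_bound l / \<delta>"
  define h where "h = 1 / real n"
  have h: "0 < h" "real n * h = 1" using n by (simp_all add: h_def)
  have bd: "\<bar>enn2real (cell_measure l c (A \<inter> grid n k)) - n * measure lborel (A \<inter> grid n k) * enn2real (cell_measure l c (grid n k))\<bar>
    \<le> 2 * image_Lipschitz l * h * h + (if k \<in> S then \<beta> * h else 0)" if k: "k < n" for k
  proof -
    let ?I = "grid n k" let ?B = "A \<inter> grid n k"
    note g = grid_facts[OF k]
    have Bs: "?B \<in> sets borel" "?B \<subseteq> {0..1}" using g by auto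
    define m where "m = measure lborel ?B"
    have m: "0 \<le> m" "m \<le> h" using measure_sub_grid[OF k A] by (simp_all add: m_def h_def)
    have eB: "emeasure lborel ?B = ennreal m" unfolding m_def by (rule emeasure_eq_measure_unit[OF Bs])
    have eI: "emeasure lborel ?I = ennreal h" using emeasure_eq_measure_unit[OF g(1,2)] g(3) by (simp add: h_def)
    have bd0: "0 \<le> \<beta>" using level_bound_nonneg \<delta>_pos by (simp add: \<beta>_def)
    have bh: "0 \<le> \<beta> * h" using bd0 h by simp
    have kB: "cell_measure l c ?B \<le> ennreal (\<beta> * m)" "cell_measure l c ?I \<le> ennreal (\<beta> * h)"
      using cell_measure_le[OF c Bs] cell_measure_le[OF c g(1,2)] bd0 m h unfolding eB eI \<beta>_def[symmetric] by (simp_all add: ennreal_mult)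
    define r s where "r = enn2real (cell_measure l c ?B)" and "s = enn2real (cell_measure l c ?I)"
    have r: "cell_measure l c ?B = ennreal r" "0 \<le> r"
      unfolding r_def using order.strict_trans1[OF kB(1) ennreal_less_top] by simp_all
    have s: "cell_measure l c ?I = ennreal s" "0 \<le> s"
      unfolding s_def using order.strict_trans1[OF kB(2) ennreal_less_top] by simp_all
    have rs: "r \<le> \<beta> * m" "s \<le> \<beta> * h"
      using kB bd0 m h r(2) s(2) unfolding r(1) s(1) by (simp_all add: ennreal_le_iff)
    have KK: "0 \<le> 2 * image_Lipschitz l * h * h" using image_Lipschitz_nonneg h by simp
    \<comment> \<open>n * m is the share of the grid interval occupied by A, so r is compared with
      what A would receive if the mass s were spread evenly.\<close>
    have goal: "\<bar>r - n * m * s\<bar> \<le> 2 * image_Lipschitz l * h * h + (if k \<in> S then \<beta> * h else 0)"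
    proof (cases "?I \<subseteq> W")
      case True
      obtain w where w: "0 \<le> w"
        "\<And>B. B \<in> sets borel \<Longrightarrow> B \<subseteq> ?I \<Longrightarrow> cell_measure l c B \<le> ennreal (w + image_Lipschitz l * h) * emeasure lborel B"
        "\<And>B. B \<in> sets borel \<Longrightarrow> B \<subseteq> ?I \<Longrightarrow> ennreal w * emeasure lborel B \<le> cell_measure l c B + ennreal (image_Lipschitz l * h) * emeasure lborel B"
        using cell_measure_uniform[OF \<alpha> c lip sup h(1) True[unfolded W_def] _ g(5)] g(4) unfolding h_def by blast
      have K0: "0 \<le> image_Lipschitz l * h" using image_Lipschitz_nonneg h by simp
      have 1: "r \<le> (w + image_Lipschitz l * h) * m" "w * m \<le> r + image_Lipschitz l * h * m"
        using w(2)[OF Bs(1)] w(3)[OF Bs(1)] w(1) K0 m r(2) unfolding eB r(1)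
        by (simp_all add: ennreal_mult[symmetric] ennreal_plus[symmetric] ennreal_le_iff del: ennreal_plus)
      have 2: "s \<le> (w + image_Lipschitz l * h) * h" "w * h \<le> s + image_Lipschitz l * h * h"
        using w(2)[OF g(1)] w(3)[OF g(1)] w(1) K0 h s(2) unfolding eI s(1)
        by (simp_all add: ennreal_mult[symmetric] ennreal_plus[symmetric] ennreal_le_iff del: ennreal_plus)
      have 3: "n * m * s \<le> m * (w + image_Lipschitz l * h)"
      proof -
        have "n * m * s \<le> n * m * ((w + image_Lipschitz l * h) * h)" using 2(1) m by (intro mult_left_mono) auto
        also have "\<dots> = (real n * h) * (m * (w + image_Lipschitz l * h))" by (simp only: mult_ac)
        finally show ?thesis using h(2) by simp
      qed
      have 4: "m * (w - image_Lipschitz l * h) \<le> n * m * s"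
      proof -
        have "m * (w - image_Lipschitz l * h) = (real n * h) * (m * (w - image_Lipschitz l * h))" using h(2) by simp
        also have "\<dots> = n * m * (w * h - image_Lipschitz l * h * h)" by (simp add: algebra_simps)
        also have "\<dots> \<le> n * m * s" using 2(2) m by (intro mult_left_mono) auto
        finally show ?thesis .
      qed
      have 5: "image_Lipschitz l * h * m \<le> image_Lipschitz l * h * h" using K0 m by (intro mult_left_mono) auto
      have "\<bar>r - n * m * s\<bar> \<le> 2 * (image_Lipschitz l * h * m)"
        using 1 3 4 by (simp add: algebra_simps abs_le_iff)
      also have "\<dots> \<le> 2 * image_Lipschitz l * h * h" using 5 by simp
      finally show ?thesis using bh by (cases "k \<in> S") simp_all
    next
      case F: False
      show ?thesis
      proof (cases "?I \<inter> W = {}")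
        case True
        have z: "cell_measure l c B = 0" if "B \<subseteq> ?I" for B
        proof -
          have "level_proj l x \<notin> B" if "x \<in> cell c" for x
          proof -
            have "x \<in> base N" using cellsD(6)[OF c] that by blast
            then have "level_proj l x \<in> W" unfolding level_proj_def W_def using cell_proj[OF c that] by simp
            then show ?thesis using True \<open>B \<subseteq> ?I\<close> by blast
          qed
          then have "ennreal (level_density l x) * indicator B (level_proj l x) * indicator (cell c) x = 0" for x
            by (cases "x \<in> cell c") auto
          then have "cell_measure l c B = (\<integral>\<^sup>+x. 0 \<partial>(lborel :: real measure))" unfolding cell_measure_def by (intro nn_integral_cong)
          then show ?thesis by simp
        qed
        have "r = 0" "s = 0" unfolding r_def s_def using z by simp_all
        then show ?thesis using KK bh by (cases "k \<in> S") simp_all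
      next
        \<comment> \<open>A straddling interval: both terms lie between 0 and \<beta> * h.\<close>
        case False
        then have "k \<in> S" using F k by (simp add: S_def)
        have "r \<le> \<beta> * h" using rs(1) mult_left_mono[OF m(2) bd0] by linarith
        moreover have "n * m * s \<le> \<beta> * h"
        proof -
          have "n * m * s \<le> n * h * (\<beta> * h)" using rs(2) m s(2) h by (intro mult_mono) auto
          then show ?thesis using h(2) by simp
        qed
        moreover have "0 \<le> n * m * s" using m s(2) by simp
        ultimately show ?thesis using r(2) KK bh unfolding if_P[OF \<open>k \<in> S\<close>] by linarith
      qed
    qed
    then show ?thesis by (simp add: r_def s_def m_def)
  qed
  have "(\<Sum>k<n. \<bar>enn2real (cell_measure l c (A \<inter> grid n k)) - n * measure lborel (A \<inter> grid n k) * enn2real (cell_measure l c (grid n k))\<bar>)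
    \<le> (\<Sum>k<n. 2 * image_Lipschitz l * h * h + (if k \<in> S then \<beta> * h else 0))"
    using bd by (intro sum_mono) simp
  also have "\<dots> = 2 * image_Lipschitz l * h + card S * (\<beta> * h)"
  proof -
    have "(\<Sum>k<n. if k \<in> S then \<beta> * h else 0) = card S * (\<beta> * h)"
      by (subst sum.inter_restrict[symmetric]) (simp_all add: S_def Int_def)
    moreover have "(\<Sum>k<n. 2 * image_Lipschitz l * h * h) = 2 * image_Lipschitz l * h" using h(2) by (simp add: mult_ac)
    ultimately show ?thesis by (simp add: sum.distrib)
  qed
  also have "\<dots> \<le> 2 * image_Lipschitz l * h + 2 * (\<beta> * h)"
    using cardS level_bound_nonneg \<delta>_pos h by (intro add_left_mono mult_right_mono) (auto simp: \<beta>_def)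
  also have "\<dots> = (2 * image_Lipschitz l + 2 * \<beta>) / n" by (simp add: h_def \<beta>_def add_divide_distrib)
  finally show ?thesis unfolding \<beta>_def by simp
qed

end

section \<open>Summation over cells and levels\<close>

context tower_density
begin

definition C0 :: real where "C0 = Mp / \<delta>\<^sup>2"
text \<open>The levels below L have at most 2^l / \<delta> cells each, and every cell costs the
  error of \<open>cell_grid\<close>.\<close>

definition grid_const :: "nat \<Rightarrow> real" where
  "grid_const L = (\<Sum>l<L. 2 ^ l / \<delta> * (2 * image_Lipschitz l + 2 * level_bound l / \<delta>))"
definition level_measure :: "nat \<Rightarrow> real set \<Rightarrow> real" where
  "level_measure l B = enn2real (\<integral>\<^sup>+x\<in>level l. ennreal (level_density l x) * indicator B (level_proj l x) \<partial>lborel)"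

lemma C0_nonneg: "0 \<le> C0" unfolding C0_def using Mp_nonneg by simp

lemma q_bounds: "0 \<le> sqrt (2 / \<mu>)" "sqrt (2 / \<mu>) < 1" using \<mu>_gt_2 by auto

lemma level_measure_facts:
  assumes B: "B \<in> sets borel" "B \<subseteq> {0..1}"
  shows "(\<integral>\<^sup>+x\<in>level l. ennreal (level_density l x) * indicator B (level_proj l x) \<partial>lborel) = ennreal (level_measure l B)"
    "0 \<le> level_measure l B" "level_measure l B \<le> C0 * sqrt (2 / \<mu>) ^ l * measure lborel B"
    "level_measure l B = (\<Sum>c\<in>cells l. enn2real (cell_measure l c B))"
proof -
  let ?I = "\<integral>\<^sup>+x\<in>level l. ennreal (level_density l x) * indicator B (level_proj l x) \<partial>lborel"
  have p: "0 \<le> C0 * sqrt (2 / \<mu>) ^ l" using C0_nonneg q_bounds by simp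
  have "?I \<le> ennreal (C0 * sqrt (2 / \<mu>) ^ l) * (\<integral>\<^sup>+y\<in>{0..1}. indicator B y \<partial>lborel)"
    unfolding C0_def by (rule level_mass_le) (use B in measurable)
  also have "(\<integral>\<^sup>+y\<in>{0..1}. indicator B y \<partial>lborel) = (\<integral>\<^sup>+y. indicator B y \<partial>lborel)"
    using B(2) by (intro nn_integral_cong) (auto simp: indicator_def)
  also have "\<dots> = ennreal (measure lborel B)" using B(1) emeasure_eq_measure_unit[OF B] by simp
  finally have le: "?I \<le> ennreal (C0 * sqrt (2 / \<mu>) ^ l * measure lborel B)"
    using p by (simp add: ennreal_mult)
  show 1: "?I = ennreal (level_measure l B)" unfolding level_measure_def using order.strict_trans1[OF le ennreal_less_top] by simp
  show 2: "0 \<le> level_measure l B" by (simp add: level_measure_def)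
  show "level_measure l B \<le> C0 * sqrt (2 / \<mu>) ^ l * measure lborel B"
    using le p unfolding 1 by (simp add: ennreal_le_iff)
  have fin: "cell_measure l c B < top" if "c \<in> cells l" for c
  proof -
    have "cell_measure l c B \<le> ennreal (level_bound l / \<delta>) * ennreal (measure lborel B)" using cell_measure_le[OF that B] emeasure_eq_measure_unit[OF B] by simp
    then show ?thesis by (rule order.strict_trans1) (simp add: ennreal_mult_less_top)
  qed
  note B(1)[measurable]
  have "?I = (\<Sum>c\<in>cells l. cell_measure l c B)" unfolding cell_measure_def by (intro nn_integral_levels) measurable
  then show "level_measure l B = (\<Sum>c\<in>cells l. enn2real (cell_measure l c B))" unfolding level_measure_def using fin by (simp add: enn2real_sum)
qed

lemma level_measure_sums:
  assumes B: "B \<in> sets borel" "B \<subseteq> {0..1}"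
  shows "(\<lambda>l. level_measure l B) sums measure \<nu> B"
proof -
  have su: "summable (\<lambda>l. level_measure l B)"
  proof (rule summable_comparison_test')
    show "summable (\<lambda>l. C0 * sqrt (2 / \<mu>) ^ l * measure lborel B)"
      using q_bounds by (intro summable_mult2 summable_mult summable_geometric) simp
    show "norm (level_measure l B) \<le> C0 * sqrt (2 / \<mu>) ^ l * measure lborel B" for l
      using level_measure_facts(2,3)[OF B, of l] by simp
  qed
  have "emeasure \<nu> B = (\<Sum>l. ennreal (level_measure l B))"
    unfolding emeasure_\<nu>[OF B] level_measure_facts(1)[OF B, symmetric] by (rule nn_integral_\<nu>) (use B in measurable)
  also have "\<dots> = ennreal (\<Sum>l. level_measure l B)" by (rule suminf_ennreal2[OF level_measure_facts(2)[OF B] su])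
  finally have "measure \<nu> B = (\<Sum>l. level_measure l B)" unfolding measure_def using suminf_nonneg[OF su level_measure_facts(2)[OF B]] by simp
  then show ?thesis using summable_sums[OF su] by simp
qed

lemma level_grid:
  assumes \<alpha>: "\<alpha> = 1"
    and lip: "\<And>i l D. i < N \<Longrightarrow> D \<in> tower_cells T Q \<Lambda> i l \<Longrightarrow> \<exists>L. L-lipschitz_on D (\<lambda>x. \<phi> (x, l))"
    and nr: "norm_r_lipschitz T Q N \<Lambda> \<mu> \<phi> \<le> ennreal M"
    and n: "0 < n" and A [measurable]: "A \<in> sets borel"
  shows "(\<Sum>k<n. \<bar>level_measure l (A \<inter> grid n k) - n * measure lborel (A \<inter> grid n k) * level_measure l (grid n k)\<bar>)
    \<le> 2 ^ l / \<delta> * (2 * image_Lipschitz l + 2 * level_bound l / \<delta>) / n"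
proof -
  let ?m = "\<lambda>k. n * measure lborel (A \<inter> grid n k)"
  let ?d = "\<lambda>c k. enn2real (cell_measure l c (A \<inter> grid n k)) - ?m k * enn2real (cell_measure l c (grid n k))"
  have eq: "level_measure l (A \<inter> grid n k) - ?m k * level_measure l (grid n k) = (\<Sum>c\<in>cells l. ?d c k)" if k: "k < n" for k
  proof -
    note g = grid_facts[OF k]
    have "A \<inter> grid n k \<in> sets borel" "A \<inter> grid n k \<subseteq> {0..1}" using g by auto
    from level_measure_facts(4)[OF this] level_measure_facts(4)[OF g(1,2)] show ?thesis
      by (simp add: sum_subtractf sum_distrib_left)
  qed
  have "(\<Sum>k<n. \<bar>level_measure l (A \<inter> grid n k) - ?m k * level_measure l (grid n k)\<bar>) \<le> (\<Sum>k<n. \<Sum>c\<in>cells l. \<bar>?d c k\<bar>)"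
    by (intro sum_mono) (simp add: eq)
  also have "\<dots> = (\<Sum>c\<in>cells l. \<Sum>k<n. \<bar>?d c k\<bar>)" by (rule sum.swap)
  also have "\<dots> \<le> (\<Sum>c\<in>cells l. (2 * image_Lipschitz l + 2 * level_bound l / \<delta>) / n)"
    by (intro sum_mono cell_grid[OF \<alpha> _ cell_regular(1)[OF \<alpha> _ lip nr] cell_regular(2)[OF \<alpha> _ lip nr] n A])
  also have "\<dots> = card (cells l) * ((2 * image_Lipschitz l + 2 * level_bound l / \<delta>) / n)" by simp
  also have "\<dots> \<le> 2 ^ l / \<delta> * ((2 * image_Lipschitz l + 2 * level_bound l / \<delta>) / n)"
  proof (rule mult_right_mono)
    have N: "real N \<le> 1 / \<delta>" using N_le \<delta>_pos by (simp add: pos_le_divide_eq)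
    have "real (card (cells l)) \<le> real (N * 2 ^ l)" using card_cells[of l] by (simp only: of_nat_le_iff)
    also have "\<dots> = real N * 2 ^ l" by simp
    also have "\<dots> \<le> 1 / \<delta> * 2 ^ l" by (rule mult_right_mono[OF N]) simp
    finally show "real (card (cells l)) \<le> 2 ^ l / \<delta>" by simp
    show "0 \<le> (2 * image_Lipschitz l + 2 * level_bound l / \<delta>) / real n"
      using image_Lipschitz_nonneg level_bound_nonneg \<delta>_pos by (intro divide_nonneg_nonneg add_nonneg_nonneg mult_nonneg_nonneg) (auto intro: less_imp_le)
  qed
  finally show ?thesis by simp
qed

text \<open>The levels below \<open>L\<close> are treated cell by cell, the remaining ones by the geometric decay of their
  mass.\<close>
lemma grid_bound:
  assumes \<alpha>: "\<alpha> = 1"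
    and lip: "\<And>i l D. i < N \<Longrightarrow> D \<in> tower_cells T Q \<Lambda> i l \<Longrightarrow> \<exists>L. L-lipschitz_on D (\<lambda>x. \<phi> (x, l))"
    and nr: "norm_r_lipschitz T Q N \<Lambda> \<mu> \<phi> \<le> ennreal M"
    and n: "0 < n" and A [measurable]: "A \<in> sets borel"
  shows "(\<Sum>k<n. \<bar>measure \<nu> (A \<inter> grid n k) - n * measure lborel (A \<inter> grid n k) * measure \<nu> (grid n k)\<bar>)
    \<le> grid_const L / n + C0 * sqrt (2 / \<mu>) ^ L / (1 - sqrt (2 / \<mu>))"
proof -
  define q where "q = sqrt (2 / \<mu>)"
  have q: "0 \<le> q" "q < 1" using q_bounds by (simp_all add: q_def)
  define m where "m k = n * measure lborel (A \<inter> grid n k)" for k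
  define d where "d l k = level_measure l (A \<inter> grid n k) - m k * level_measure l (grid n k)" for l k
  have one: "\<bar>measure \<nu> (A \<inter> grid n k) - m k * measure \<nu> (grid n k)\<bar>
    \<le> (\<Sum>l<L. \<bar>d l k\<bar>) + C0 * q ^ L / (1 - q) / n" if k: "k < n" for k
  proof -
    note g = grid_facts[OF k]
    have B: "A \<inter> grid n k \<in> sets borel" "A \<inter> grid n k \<subseteq> {0..1}" using g by auto
    have m: "0 \<le> m k" "m k \<le> 1" using measure_sub_grid[OF k A] n by (simp_all add: m_def pos_le_divide_eq mult.commute)
    \<comment> \<open>Besides the geometric factor there is the length 1/n, so summing over the n
      grid intervals does not enlarge the tail.\<close>
    have dn: "\<bar>d l k\<bar> \<le> C0 * q ^ l / n" for l
    proof -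
      have p: "0 \<le> C0 * q ^ l" using C0_nonneg q by simp
      have "level_measure l (A \<inter> grid n k) \<le> C0 * q ^ l * (1 / n)"
        using level_measure_facts(3)[OF B, of l] mult_left_mono[OF measure_sub_grid(2)[OF k A] p] by (simp add: q_def)
      moreover have "m k * level_measure l (grid n k) \<le> 1 * (C0 * q ^ l * (1 / n))"
        using level_measure_facts(2,3)[OF g(1,2), of l] m g(3) p by (intro mult_mono) (auto simp: q_def)
      moreover have "0 \<le> m k * level_measure l (grid n k)" using m(1) level_measure_facts(2)[OF g(1,2)] by simp
      ultimately show ?thesis unfolding d_def using level_measure_facts(2)[OF B, of l] by (simp add: abs_le_iff)
    qed
    have ds: "(\<lambda>l. d l k) sums (measure \<nu> (A \<inter> grid n k) - m k * measure \<nu> (grid n k))"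
      unfolding d_def by (intro sums_diff sums_mult level_measure_sums B g)
    then have su: "summable (\<lambda>l. d l k)" by (rule sums_summable)
    have tail: "\<bar>\<Sum>l. d (l + L) k\<bar> \<le> C0 * q ^ L / (1 - q) / n"
    proof -
      have gs: "(\<lambda>l. C0 * q ^ L / n * q ^ l) sums (C0 * q ^ L / n * (1 / (1 - q)))"
        using q by (intro sums_mult geometric_sums) simp
      have "norm (\<Sum>l. d (l + L) k) \<le> (\<Sum>l. C0 * q ^ L / n * q ^ l)"
      proof (rule norm_suminf_le[OF _ sums_summable[OF gs]])
        show "norm (d (l + L) k) \<le> C0 * q ^ L / n * q ^ l" for l
          using dn[of "l + L"] by (simp add: power_add mult_ac)
      qed
      also have "\<dots> = C0 * q ^ L / n * (1 / (1 - q))" by (rule sums_unique[OF gs, symmetric])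
      finally show ?thesis by (simp add: mult_ac)
    qed
    have "measure \<nu> (A \<inter> grid n k) - m k * measure \<nu> (grid n k) = (\<Sum>l. d (l + L) k) + (\<Sum>l<L. d l k)"
      using suminf_split_initial_segment[OF su, of L] sums_unique[OF ds] by simp
    then show ?thesis using tail sum_abs[of "\<lambda>l. d l k" "{..<L}"] by linarith
  qed
  have "(\<Sum>k<n. \<bar>measure \<nu> (A \<inter> grid n k) - m k * measure \<nu> (grid n k)\<bar>)
    \<le> (\<Sum>k<n. (\<Sum>l<L. \<bar>d l k\<bar>) + C0 * q ^ L / (1 - q) / n)"
    using one by (intro sum_mono) simp
  also have "\<dots> = (\<Sum>l<L. \<Sum>k<n. \<bar>d l k\<bar>) + C0 * q ^ L / (1 - q)"
    using n by (subst sum.swap) (simp add: sum.distrib)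
  also have "(\<Sum>l<L. \<Sum>k<n. \<bar>d l k\<bar>) \<le> (\<Sum>l<L. 2 ^ l / \<delta> * (2 * image_Lipschitz l + 2 * level_bound l / \<delta>) / n)"
    unfolding d_def m_def by (intro sum_mono level_grid[OF \<alpha> lip nr n A])
  also have "\<dots> = grid_const L / n" by (simp add: grid_const_def sum_divide_distrib)
  finally show ?thesis unfolding m_def q_def by simp
qed

end

section \<open>From holes to the tower, with constants common to all holes\<close>

lemma component_interval:
  fixes S :: "real set"
  assumes "J \<in> components S" "S \<subseteq> {0..1}"
  shows "open (interior J)" "connected (interior J)"
proof -
  have "is_interval J" using in_components_connected[OF assms(1)] is_interval_connected_1 by blast
  then have "convex J" by (rule is_interval_convex)
  then show "connected (interior J)" using convex_connected convex_interior by blast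
qed simp

lemma hole_open: "hole H \<Longrightarrow> open H"
  unfolding hole_def by (metis open_Union open_greaterThanLessThan)

context expanding
begin

text \<open>That Q exhausts the complement of the hole is read off from the partition, whose
  elements lie in elements of Q and leave out finitely many points.\<close>

lemma hole_cutting:
  assumes H: "hole H" and sp: "small_partition (mono_intervals Ihat H) H \<delta> N \<Lambda>"
  shows "cutting T Ihat \<alpha> \<mu> Chat (mono_intervals Ihat H) H"
proof unfold_locales
  have ex: "\<exists>K J'. K \<in> Ihat \<and> J' \<in> components (K \<inter> ({0..1} - H)) \<and> J = interior J' \<and> J \<noteq> {} \<and> J \<subseteq> K \<inter> ({0..1} - H)"
    if J: "J \<in> mono_intervals Ihat H" for J
  proof -
    obtain K J' where "K \<in> Ihat" "J' \<in> components (K \<inter> ({0..1} - H))" "J = interior J'" "J \<noteq> {}"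
      using J unfolding mono_intervals_def by blast
    moreover then have "J \<subseteq> K \<inter> ({0..1} - H)" using in_components_subset interior_subset by blast
    ultimately show ?thesis by blast
  qed
  fix J assume J: "J \<in> mono_intervals Ihat H"
  obtain K J' where K: "K \<in> Ihat" "J' \<in> components (K \<inter> ({0..1} - H))" "J = interior J'" "J \<noteq> {}" "J \<subseteq> K \<inter> ({0..1} - H)"
    using ex[OF J] by blast
  have s: "K \<inter> ({0..1} - H) \<subseteq> {0..1}" by blast
  show "open J" "connected J" using component_interval[OF K(2) s] K(3) by simp_all
  show "J \<noteq> {}" by (rule K(4))
  show "\<exists>K\<in>Ihat. J \<subseteq> K" "J \<inter> H = {}" using K(1,5) by blast+
next
  show "pairwise disjnt (mono_intervals Ihat H)"
    unfolding pairwise_def disjnt_def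
  proof (intro ballI impI)
    fix J1 J2 assume J: "J1 \<in> mono_intervals Ihat H" "J2 \<in> mono_intervals Ihat H" "J1 \<noteq> J2"
    obtain K1 J1' where 1: "K1 \<in> Ihat" "J1' \<in> components (K1 \<inter> ({0..1} - H))" "J1 = interior J1'"
      using J(1) unfolding mono_intervals_def by blast
    obtain K2 J2' where 2: "K2 \<in> Ihat" "J2' \<in> components (K2 \<inter> ({0..1} - H))" "J2 = interior J2'"
      using J(2) unfolding mono_intervals_def by blast
    have "J1' \<inter> J2' = {}"
    proof (cases "K1 = K2")
      case True
      then show ?thesis using components_nonoverlap[OF 1(2)] 2 1 J(3) by metis
    next
      case False
      then have "K1 \<inter> K2 = {}" using disjoint_Ihat 1(1) 2(1) unfolding pairwise_def disjnt_def by blast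
      then show ?thesis using in_components_subset[OF 1(2)] in_components_subset[OF 2(2)] by blast
    qed
    then show "J1 \<inter> J2 = {}" using 1(3) 2(3) interior_subset by blast
  qed
  show "open H" by (rule hole_open[OF H])
  show "H \<subseteq> {0..1}" using H by (simp add: hole_def)
  have "{0..1} - H - \<Union>(mono_intervals Ihat H) \<subseteq> {0..1} - H - (\<Union>k<N. \<Lambda> k)"
    using sp unfolding small_partition_def by blast
  then show "finite ({0..1} - H - \<Union>(mono_intervals Ihat H))"
    using sp unfolding small_partition_def by (meson finite_subset)
qed

text \<open>Leaves the locales: B, C0 and P are fixed before the hole is, so one choice serves all
  H_s at once.\<close>

lemma tower_measure_facts:
  assumes \<delta>: "0 < \<delta>"
  obtains B C0 :: real and P :: "nat \<Rightarrow> real" where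
    "\<And>H \<nu>. hole H \<Longrightarrow> tower_measure T Ihat \<alpha> \<mu> Chat \<delta> H \<nu> \<Longrightarrow> sets \<nu> = sets unit_borel \<and> prob_space \<nu>"
    "\<And>H \<nu> A. hole H \<Longrightarrow> tower_measure T Ihat \<alpha> \<mu> Chat \<delta> H \<nu> \<Longrightarrow> A \<in> sets borel \<Longrightarrow> A \<subseteq> {0..1} \<Longrightarrow>
        emeasure \<nu> A \<le> ennreal B * emeasure lborel A"
    "\<And>H \<nu> A. hole H \<Longrightarrow> tower_measure T Ihat \<alpha> \<mu> Chat \<delta> H \<nu> \<Longrightarrow> A \<in> sets borel \<Longrightarrow> A \<subseteq> {0..1} \<Longrightarrow>
        \<bar>measure \<nu> {x \<in> {0..1}. T x \<in> A} - measure \<nu> A\<bar> \<le> B * real (card Ihat) * measure lborel H"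
    "\<And>H \<nu> A n L. hole H \<Longrightarrow> tower_measure T Ihat \<alpha> \<mu> Chat \<delta> H \<nu> \<Longrightarrow> \<alpha> = 1 \<Longrightarrow> 0 < n \<Longrightarrow> A \<in> sets borel \<Longrightarrow>
        (\<Sum>k<n. \<bar>measure \<nu> (A \<inter> grid n k) - n * measure lborel (A \<inter> grid n k) * measure \<nu> (grid n k)\<bar>)
        \<le> P L / n + C0 * sqrt (2 / \<mu>) ^ L / (1 - sqrt (2 / \<mu>))"
    "0 \<le> B"
proof -
  define M where "M = (1 + C_const \<alpha> \<mu> Chat \<delta>) / (1 - a_const \<alpha> \<mu> Chat \<delta>)"
  have ex: "\<exists>N \<Lambda> \<phi>. tower_fixed T Ihat \<alpha> \<mu> Chat (mono_intervals Ihat H) H \<delta> N \<Lambda> \<phi> M \<and>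
      \<nu> = projected_measure T (mono_intervals Ihat H) H N \<Lambda> \<phi> \<and>
      \<phi> \<in> X_set T (mono_intervals Ihat H) H N \<Lambda> \<alpha> \<mu> M"
    if H: "hole H" and tm: "tower_measure T Ihat \<alpha> \<mu> Chat \<delta> H \<nu>" for H \<nu>
  proof -
    obtain N \<Lambda> \<phi> where X: "\<phi> \<in> X_set T (mono_intervals Ihat H) H N \<Lambda> \<alpha> \<mu> M"
      and sp: "small_partition (mono_intervals Ihat H) H \<delta> N \<Lambda>"
      and fx: "AE p in tower_lborel T (mono_intervals Ihat H) H N \<Lambda>. normalized_transfer T (mono_intervals Ihat H) H N \<Lambda> \<phi> p = \<phi> p"
      and nu: "\<nu> = projected_measure T (mono_intervals Ihat H) H N \<Lambda> \<phi>"
      using tm unfolding tower_measure_def Let_def M_def[symmetric] by blast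
    have "tower_fixed T Ihat \<alpha> \<mu> Chat (mono_intervals Ihat H) H \<delta> N \<Lambda> \<phi> M"
    proof (intro tower_fixed.intro tower_density.intro tower_setup.intro hole_cutting[OF H sp])
      show "tower_setup_axioms (mono_intervals Ihat H) H \<delta> N \<Lambda>" by unfold_locales (use \<delta> sp in auto)
      show "tower_density_axioms T \<alpha> \<mu> (mono_intervals Ihat H) H N \<Lambda> \<phi> M"
        using X unfolding X_set_def by unfold_locales auto
      show "tower_fixed_axioms T (mono_intervals Ihat H) H N \<Lambda> \<phi>" by unfold_locales (rule fx)
    qed
    then show ?thesis using X nu by blast
  qed
  \<comment> \<open>These repeat the constants of the locales, in which only M, \<delta>, \<alpha>,
    \<mu> and Chat occur.\<close>
  define B where "B = max 0 M / \<delta>\<^sup>2 * (1 / (1 - sqrt (2 / \<mu>)))"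
  define C0 where "C0 = max 0 M / \<delta>\<^sup>2"
  define b where "b l = max 0 M * exp (xi \<alpha> \<mu> * real l)" for l :: nat
  define K where "K l = (b l * b l / \<delta> + b l * (real l * Chat)) / \<delta>" for l :: nat
  define P where "P L = (\<Sum>l<L. 2 ^ l / \<delta> * (2 * K l + 2 * b l / \<delta>))" for L :: nat
  show thesis
  proof (rule that[of B P C0])
    fix H \<nu> assume H: "hole H" "tower_measure T Ihat \<alpha> \<mu> Chat \<delta> H \<nu>"
    obtain N \<Lambda> \<phi> where tf: "tower_fixed T Ihat \<alpha> \<mu> Chat (mono_intervals Ihat H) H \<delta> N \<Lambda> \<phi> M"
      and nu: "\<nu> = projected_measure T (mono_intervals Ihat H) H N \<Lambda> \<phi>"
      and X: "\<phi> \<in> X_set T (mono_intervals Ihat H) H N \<Lambda> \<alpha> \<mu> M"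
      using ex[OF H] by blast
    interpret t: tower_fixed T Ihat \<alpha> \<mu> Chat "mono_intervals Ihat H" H \<delta> N \<Lambda> \<phi> M by (rule tf)
    have nu': "\<nu> = t.\<nu>" unfolding nu t.\<nu>_def ..
    have Beq: "t.density_bound = B" unfolding t.density_bound_def t.Mp_def B_def ..
    show "sets \<nu> = sets unit_borel \<and> prob_space \<nu>" unfolding nu' using t.sets_\<nu> t.prob_space_\<nu> by blast
    show "emeasure \<nu> A \<le> ennreal B * emeasure lborel A" if "A \<in> sets borel" "A \<subseteq> {0..1}" for A
      unfolding nu' Beq[symmetric] using that by (rule t.emeasure_\<nu>_le)
    show "\<bar>measure \<nu> {x \<in> {0..1}. T x \<in> A} - measure \<nu> A\<bar> \<le> B * real (card Ihat) * measure lborel H"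
      if "A \<in> sets borel" "A \<subseteq> {0..1}" for A
      unfolding nu' Beq[symmetric] using that by (rule t.almost_invariance)
    have b: "t.level_bound l = b l" for l unfolding t.level_bound_def t.Mp_def b_def ..
    have Keq: "t.image_Lipschitz l = K l" for l unfolding t.image_Lipschitz_def K_def b ..
    have Peq: "t.grid_const L = P L" for L unfolding t.grid_const_def P_def b Keq ..
    have Ceq: "t.C0 = C0" unfolding t.C0_def t.Mp_def C0_def ..
    show "(\<Sum>k<n. \<bar>measure \<nu> (A \<inter> grid n k) - n * measure lborel (A \<inter> grid n k) * measure \<nu> (grid n k)\<bar>)
        \<le> P L / n + C0 * sqrt (2 / \<mu>) ^ L / (1 - sqrt (2 / \<mu>))" if a: "\<alpha> = 1" "0 < n" "A \<in> sets borel" for A n L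
      unfolding nu' Peq[symmetric] Ceq[symmetric]
      by (rule t.grid_bound[OF a(1) _ _ a(2,3)]) (use X a(1) in \<open>auto simp: X_set_def\<close>)
  next
    show "0 \<le> B" unfolding B_def using \<mu>_gt_2 by simp
  qed
qed

end

section \<open>Convergence of measures with bounded densities\<close>

text \<open>Helly selection yields a weak limit. Its density bound is tested on open intervals
  through continuous functions lying between a compact subset and the interval; the common bound
  then upgrades weak convergence to convergence on every Borel set.\<close>

lemma bounded_densities_compact:
  fixes \<nu> :: "nat \<Rightarrow> real measure"
  assumes s: "\<And>n. sets (\<nu> n) = sets unit_borel" and p: "\<And>n. prob_space (\<nu> n)" and B: "0 \<le> B"
    and le: "\<And>n A. A \<in> sets borel \<Longrightarrow> A \<subseteq> {0..1} \<Longrightarrow> emeasure (\<nu> n) A \<le> ennreal B * emeasure lborel A"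
  obtains r M where "strict_mono (r :: nat \<Rightarrow> nat)" "sets M = sets unit_borel" "prob_space M"
    "\<And>A. A \<in> sets borel \<Longrightarrow> A \<subseteq> {0..1} \<Longrightarrow> emeasure M A \<le> ennreal B * emeasure lborel A"
    "\<And>A. A \<in> sets borel \<Longrightarrow> A \<subseteq> {0..1} \<Longrightarrow> (\<lambda>n. measure (\<nu> (r n)) A) \<longlonglongrightarrow> measure M A"
    "\<And>g :: real \<Rightarrow> real. continuous_on {0..1} g \<Longrightarrow> (\<lambda>n. LINT x|\<nu> (r n). g x) \<longlonglongrightarrow> (LINT x|M. g x)"
proof -
  have sp: "space (\<nu> n) = {0..1}" for n using sets_eq_imp_space_eq[OF s] space_unit_borel by simp
  have idm[measurable]: "(\<lambda>x. x) \<in> \<nu> n \<rightarrow>\<^sub>M borel" for n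
    using measurable_restrict_space1[of "\<lambda>x. x" borel borel "{0..1}"] s[of n]
    by (simp add: unit_borel_def cong: measurable_cong_sets)
  \<comment> \<open>The selection theorem concerns distributions on the line, so the measures are
    pushed forward along the inclusion.\<close>
  define \<rho> where "\<rho> n = distr (\<nu> n) borel (\<lambda>x. x)" for n
  have rho: "real_distribution (\<rho> n)" for n
    unfolding \<rho>_def by (rule prob_space.real_distribution_distr[OF p idm])
  have em: "emeasure (\<rho> n) A = emeasure (\<nu> n) (A \<inter> {0..1})" if "A \<in> sets borel" for n A
    unfolding \<rho>_def using that by (subst emeasure_distr) (simp_all add: sp)
  have ms: "measure (\<rho> n) A = measure (\<nu> n) (A \<inter> {0..1})" if "A \<in> sets borel" for n A
    unfolding measure_def em[OF that] ..
  have rle: "emeasure (\<rho> n) A \<le> ennreal B * emeasure lborel A" if A: "A \<in> sets borel" for n A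
  proof -
    have "emeasure (\<rho> n) A \<le> ennreal B * emeasure lborel (A \<inter> {0..1})" unfolding em[OF A] using A by (intro le) auto
    also have "\<dots> \<le> ennreal B * emeasure lborel A" using A by (intro mult_left_mono emeasure_mono) auto
    finally show ?thesis .
  qed
  have "tight \<rho>"
    unfolding tight_def
  proof (intro conjI allI impI)
    fix e :: real assume e: "0 < e"
    \<comment> \<open>The interval is open on the left, hence the endpoint -1 in place of 0.\<close>
    have "measure (\<rho> n) {-1<..1} = 1" for n
    proof -
      have "{-1<..1} \<inter> {0..1} = space (\<nu> n)" by (auto simp: sp)
      then show ?thesis using ms[of "{-1<..1}" n] prob_space.prob_space[OF p[of n]] by simp
    qed
    then show "\<exists>a b. a < b \<and> (\<forall>n. 1 - e < measure (\<rho> n) {a<..b})"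
      using e by (intro exI[of _ "-1"] exI[of _ 1]) simp
  qed (rule rho)
  from tight_imp_convergent_subsubsequence[OF this strict_mono_id]
  obtain r M0 where r: "strict_mono r" and M0: "real_distribution M0" and wc: "weak_conv_m (\<rho> \<circ> id \<circ> r) M0" by blast
  interpret M0: real_distribution M0 by (rule M0)
  have wi: "(\<lambda>n. LINT x|\<rho> (r n). f x) \<longlonglongrightarrow> (LINT x|M0. f x)" if "\<And>x. isCont f x" "\<And>x. \<bar>f x\<bar> \<le> K" for f :: "real \<Rightarrow> real" and K
  proof -
    have "(\<lambda>n. integral\<^sup>L ((\<rho> \<circ> id \<circ> r) n) f) \<longlonglongrightarrow> integral\<^sup>L M0 f"
      using weak_conv_imp_integral_bdd_continuous_conv[of "\<rho> \<circ> id \<circ> r" M0 f K] rho M0 wc that by (simp add: comp_def)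
    then show ?thesis by (simp add: comp_def)
  qed
  have urysohn: "\<exists>f. (\<forall>x. isCont f x) \<and> (\<forall>x. 0 \<le> f x \<and> f x \<le> (1::real)) \<and> (\<forall>x\<in>K. f x = 1) \<and> (\<forall>x. x \<notin> U \<longrightarrow> f x = 0)"
    if K: "closed K" "open U" "K \<subseteq> U" for K U :: "real set"
  proof -
    obtain f :: "real \<Rightarrow> real" where f: "continuous_on UNIV f" "\<And>x. f x \<in> closed_segment 1 0" "\<And>x. x \<in> K \<Longrightarrow> f x = 1" "\<And>x. x \<in> - U \<Longrightarrow> f x = 0"
      using Urysohn[of K "- U" 1 "0 :: real"] K by (auto simp: closed_Compl)
    have "0 \<le> f x \<and> f x \<le> 1" for x using f(2)[of x] by (auto simp: closed_segment_eq_real_ivl)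
    then show ?thesis using f(1,3,4) by (intro exI[of _ f]) (auto simp: continuous_on_eq_continuous_at)
  qed
  have between: "measure \<sigma> K \<le> (LINT x|\<sigma>. f x)" "(LINT x|\<sigma>. f x) \<le> measure \<sigma> U"
    if \<sigma>: "real_distribution \<sigma>" and f: "\<forall>x. isCont f x" "\<forall>x. 0 \<le> f x \<and> f x \<le> (1::real)" "\<forall>x\<in>K. f x = 1" "\<forall>x. x \<notin> U \<longrightarrow> f x = 0"
      and KU: "closed K" "open U" for \<sigma> f and K U :: "real set"
  proof -
    interpret \<sigma>: real_distribution \<sigma> by (rule \<sigma>)
    have fm: "f \<in> borel_measurable \<sigma>"
      using f(1) by (simp add: borel_measurable_continuous_onI continuous_at_imp_continuous_on)
    have fi: "integrable \<sigma> f" by (rule \<sigma>.integrable_const_bound[of _ 1]) (use f fm in auto)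
    have ii: "integrable \<sigma> (indicator A :: real \<Rightarrow> real)" if "A \<in> sets borel" for A
      by (rule \<sigma>.integrable_const_bound[of _ 1]) (use that in \<open>auto simp: indicator_def\<close>)
    have "measure \<sigma> K = (LINT x|\<sigma>. indicator K x)" using KU by simp
    also have "\<dots> \<le> (LINT x|\<sigma>. f x)"
      using KU f by (intro integral_mono ii fi) (auto simp: indicator_def)
    finally show "measure \<sigma> K \<le> (LINT x|\<sigma>. f x)" .
    have "(LINT x|\<sigma>. f x) \<le> (LINT x|\<sigma>. indicator U x)"
      using KU f by (intro integral_mono ii fi) (auto simp: indicator_def)
    also have "\<dots> = measure \<sigma> U" using KU by simp
    finally show "(LINT x|\<sigma>. f x) \<le> measure \<sigma> U" .
  qed
  have M0le: "emeasure M0 A \<le> ennreal B * emeasure lborel A" if A: "A \<in> sets borel" for A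
  proof (rule emeasure_le_lborel[OF _ B _ A])
    show "sets M0 = sets borel" by simp
    fix a b :: real assume ab: "a < b"
    have "emeasure M0 {a<..<b} = (SUP K\<in>{K. K \<subseteq> {a<..<b} \<and> compact K}. emeasure M0 K)"
      by (rule inner_regular) auto
    also have "\<dots> \<le> ennreal (B * (b - a))"
    proof (rule SUP_least)
      fix K assume "K \<in> {K. K \<subseteq> {a<..<b} \<and> compact K}"
      then have K: "closed K" "K \<subseteq> {a<..<b}" by (auto intro: compact_imp_closed)
      obtain f where f: "\<forall>x. isCont f x" "\<forall>x. 0 \<le> f x \<and> f x \<le> (1::real)" "\<forall>x\<in>K. f x = 1" "\<forall>x. x \<notin> {a<..<b} \<longrightarrow> f x = 0"
        using urysohn[OF K(1) _ K(2)] by auto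
      have "(LINT x|\<rho> (r n). f x) \<le> B * (b - a)" for n
      proof -
        interpret \<rho>: real_distribution "\<rho> (r n)" by (rule rho)
        have "(LINT x|\<rho> (r n). f x) \<le> measure (\<rho> (r n)) {a<..<b}" by (rule between(2)[OF rho f K(1)]) simp
        also have "ennreal \<dots> \<le> ennreal B * emeasure lborel {a<..<b}"
          unfolding \<rho>.emeasure_eq_measure[symmetric] by (rule rle) simp
        then have "measure (\<rho> (r n)) {a<..<b} \<le> B * (b - a)"
          using ab B by (simp add: ennreal_mult[symmetric])
        finally show ?thesis .
      qed
      then have "(LINT x|M0. f x) \<le> B * (b - a)"
        using f by (intro LIMSEQ_le_const2[OF wi[of f 1]]) (auto simp: abs_le_iff intro: order_trans[of _ 0])
      then have "measure M0 K \<le> B * (b - a)" using between(1)[OF M0 f K(1)] by simp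
      then show "emeasure M0 K \<le> ennreal (B * (b - a))" by (simp add: M0.emeasure_eq_measure ennreal_leI)
    qed
    finally show "emeasure M0 {a<..<b} \<le> ennreal (B * (b - a))" .
  qed
  have conv: "(\<lambda>n. measure (\<rho> (r n)) A) \<longlonglongrightarrow> measure M0 A" if A: "A \<in> sets borel" "A \<subseteq> {0..1}" for A
  proof (rule LIMSEQ_I)
    fix e :: real assume e: "0 < e"
    \<comment> \<open>U - K will have Lebesgue measure at most 2 * d, hence mass at most e/4 under
      every measure with density bound B; B + 1 allows B = 0.\<close>
    define d where "d = e / (8 * (B + 1))"
    have d: "0 < d" "B * (2 * d) \<le> e / 4"
      using e B by (simp_all add: d_def field_simps)
    obtain U where U: "open U" "A \<subseteq> U" "emeasure lborel (U - A) < ennreal d" using outer_regular_lborel[OF A(1) d(1)] by auto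
    \<comment> \<open>Outer regularity applied to the complement of A provides a closed set inside
      A.\<close>
    obtain V where V: "open V" "- A \<subseteq> V" "emeasure lborel (V - (- A)) < ennreal d"
      using outer_regular_lborel[of "- A" d] A d(1) by auto
    define K where "K = - V"
    have K: "closed K" "K \<subseteq> A" using V by (auto simp: K_def)
    have KU: "K \<subseteq> U" using K U by blast
    obtain f where f: "\<forall>x. isCont f x" "\<forall>x. 0 \<le> f x \<and> f x \<le> (1::real)" "\<forall>x\<in>K. f x = 1" "\<forall>x. x \<notin> U \<longrightarrow> f x = 0"
      using urysohn[OF K(1) U(1) KU] by auto
    have mb: "U \<in> sets borel" "K \<in> sets borel" "V \<in> sets borel" using U K V by auto
    have UK: "emeasure lborel (U - K) \<le> ennreal (2 * d)"
    proof -
      have "U - K \<subseteq> (U - A) \<union> (V - (- A))" by (auto simp: K_def)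
      then have "emeasure lborel (U - K) \<le> emeasure lborel ((U - A) \<union> (V - (- A)))"
        using mb A by (intro emeasure_mono) auto
      also have "\<dots> \<le> emeasure lborel (U - A) + emeasure lborel (V - (- A))"
        using mb A by (intro emeasure_subadditive) auto
      also have "\<dots> \<le> ennreal d + ennreal d" using U V by (intro add_mono) auto
      also have "\<dots> = ennreal (2 * d)" using d by (simp add: ennreal_plus[symmetric] del: ennreal_plus)
      finally show ?thesis .
    qed
    have close: "\<bar>measure \<sigma> A - (LINT x|\<sigma>. f x)\<bar> \<le> e / 4"
      if \<sigma>: "real_distribution \<sigma>" and \<sigma>le: "\<And>A. A \<in> sets borel \<Longrightarrow> emeasure \<sigma> A \<le> ennreal B * emeasure lborel A" for \<sigma>
    proof -
      interpret \<sigma>: real_distribution \<sigma> by (rule \<sigma>)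
      have "emeasure \<sigma> (U - K) \<le> ennreal B * ennreal (2 * d)"
        using \<sigma>le[of "U - K"] mb mult_left_mono[OF UK, of "ennreal B"] by (auto intro: order_trans)
      then have "measure \<sigma> (U - K) \<le> B * (2 * d)" using B d by (simp add: \<sigma>.emeasure_eq_measure ennreal_mult[symmetric])
      then have 1: "measure \<sigma> (U - K) \<le> e / 4" using d by linarith
      have 2: "measure \<sigma> (U - K) = measure \<sigma> U - measure \<sigma> K"
        using mb KU by (intro \<sigma>.finite_measure_Diff) auto
      have 3: "measure \<sigma> K \<le> measure \<sigma> A" "measure \<sigma> A \<le> measure \<sigma> U"
        using mb K U A by (auto intro!: \<sigma>.finite_measure_mono)
      show ?thesis
        using between[OF \<sigma> f K(1) U(1)] 1 2 3 by linarith
    qed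
    have "(\<lambda>n. LINT x|\<rho> (r n). f x) \<longlonglongrightarrow> (LINT x|M0. f x)"
      by (rule wi[of f 1]) (use f in \<open>auto simp: abs_le_iff intro: order_trans[of _ 0]\<close>)
    then obtain no where no: "\<And>n. n \<ge> no \<Longrightarrow> \<bar>(LINT x|\<rho> (r n). f x) - (LINT x|M0. f x)\<bar> < e / 4"
      using LIMSEQ_D[of _ _ "e / 4"] e by (metis divide_pos_pos real_norm_def zero_less_numeral)
    show "\<exists>no. \<forall>n\<ge>no. norm (measure (\<rho> (r n)) A - measure M0 A) < e"
    proof (intro exI[of _ no] allI impI)
      fix n assume "no \<le> n"
      then show "norm (measure (\<rho> (r n)) A - measure M0 A) < e"
        using no[of n] close[OF rho[of "r n"] rle] close[OF M0 M0le] e unfolding real_norm_def by linarith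
    qed
  qed
  define M where "M = restrict_space M0 {0..1}"
  have sM: "sets M = sets unit_borel" unfolding M_def unit_borel_def by (rule sets_restrict_space_cong) simp
  have eM: "emeasure M A = emeasure M0 A" if "A \<subseteq> {0..1}" for A
    unfolding M_def using that by (intro emeasure_restrict_space) auto
  have mM: "measure M A = measure M0 A" if "A \<subseteq> {0..1}" for A unfolding measure_def eM[OF that] ..
  have nu: "measure (\<rho> n) A = measure (\<nu> n) A" if "A \<in> sets borel" "A \<subseteq> {0..1}" for n A
    using ms[OF that(1)] that(2) by (simp add: Int_absorb2)
  have one: "measure M0 {0..1} = 1"
  proof -
    have "measure (\<rho> (r n)) {0..1} = 1" for n using nu[of "{0..1}"] prob_space.prob_space[OF p[of "r n"]] by (simp add: sp)
    then have "(\<lambda>n::nat. 1) \<longlonglongrightarrow> measure M0 {0..1}" using conv[of "{0..1}"] by simp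
    then show ?thesis by (simp add: LIMSEQ_const_iff)
  qed
  have spM: "space M = {0..1}" using sets_eq_imp_space_eq[OF sM] space_unit_borel by simp
  have pM: "prob_space M"
    by (rule prob_spaceI) (simp add: spM eM M0.emeasure_eq_measure one)
  show thesis
  proof (rule that[OF r sM pM])
    show "emeasure M A \<le> ennreal B * emeasure lborel A" if "A \<in> sets borel" "A \<subseteq> {0..1}" for A
      unfolding eM[OF that(2)] by (rule M0le[OF that(1)])
    show "(\<lambda>n. measure (\<nu> (r n)) A) \<longlonglongrightarrow> measure M A" if "A \<in> sets borel" "A \<subseteq> {0..1}" for A
      using conv[OF that] unfolding mM[OF that(2)] nu[OF that] .
    fix g :: "real \<Rightarrow> real" assume g: "continuous_on {0..1} g"
    \<comment> \<open>Clamping the argument extends g to a bounded continuous function on the line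
      without changing it on [0,1].\<close>
    define h where "h x = g (max 0 (min 1 x))" for x
    have hc: "continuous_on UNIV h"
      unfolding h_def by (rule continuous_on_compose2[OF g]) (auto intro!: continuous_intros)
    have hm: "h \<in> borel_measurable borel" using hc by (rule borel_measurable_continuous_onI)
    have "bounded (g ` {0..1})" using compact_continuous_image[OF g compact_Icc] by (rule compact_imp_bounded)
    then obtain K where K: "\<forall>y\<in>g ` {0..1}. norm y \<le> K" unfolding bounded_iff by blast
    have hK: "\<bar>h x\<bar> \<le> K" for x
    proof -
      have "g (max 0 (min 1 x)) \<in> g ` {0..1}" by (rule imageI) auto
      with K show ?thesis unfolding h_def real_norm_def by blast
    qed
    have 1: "(LINT x|\<nu> n. g x) = (LINT x|\<rho> n. h x)" for n
    proof -
      have "(LINT x|\<rho> n. h x) = (LINT x|\<nu> n. h x)"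
        unfolding \<rho>_def by (rule integral_distr[OF idm hm])
      also have "\<dots> = (LINT x|\<nu> n. g x)" by (intro Bochner_Integration.integral_cong) (auto simp: sp h_def)
      finally show ?thesis ..
    qed
    have 2: "(LINT x|M. g x) = (LINT x|M0. h x)"
    proof -
      have ae: "AE x in M0. x \<in> {0..1}" using one by (subst M0.AE_in_set_eq_1) auto
      have "(LINT x|M. g x) = (LINT x|M. h x)" by (intro Bochner_Integration.integral_cong) (auto simp: spM h_def)
      also have "\<dots> = (LINT x|M0. indicator {0..1} x *\<^sub>R h x)" unfolding M_def by (rule integral_restrict_space) simp
      also have "\<dots> = (LINT x|M0. h x)"
      proof (rule integral_cong_AE)
        show "AE x in M0. indicator {0..1} x *\<^sub>R h x = h x" using ae by eventually_elim (simp add: indicator_def)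
      qed (use hm in auto)
      finally show ?thesis .
    qed
    show "(\<lambda>n. LINT x|\<nu> (r n). g x) \<longlonglongrightarrow> (LINT x|M. g x)"
      unfolding 1 2 by (rule wi[OF _ hK]) (use hc in \<open>simp add: continuous_on_eq_continuous_at\<close>)
  qed
qed

text \<open>If convergence failed, some sequence of parameters tending to 0 would keep f at a fixed
  distance from L, and no subsequence could converge to L.\<close>

lemma tendsto_at_right_0_subseq:
  fixes f :: "real \<Rightarrow> 'a :: metric_space"
  assumes t: "0 < t"
    and sub: "\<And>X. (\<And>n. X n \<in> {0<..t}) \<Longrightarrow> X \<longlonglongrightarrow> 0 \<Longrightarrow> \<exists>r. strict_mono (r :: nat \<Rightarrow> nat) \<and> (\<lambda>n. f (X (r n))) \<longlonglongrightarrow> L"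
  shows "(f \<longlongrightarrow> L) (at_right 0)"
proof (rule ccontr)
  assume "\<not> ?thesis"
  then obtain e where e: "0 < e" "\<not> (\<forall>\<^sub>F s in at_right 0. dist (f s) L < e)" unfolding tendsto_iff by blast
  have "\<exists>s\<in>{0<..t}. s < 1 / Suc n \<and> e \<le> dist (f s) L" for n
  proof (rule ccontr)
    assume "\<not> ?thesis"
    then have "\<forall>s>0. s < min t (1 / Suc n) \<longrightarrow> dist (f s) L < e" by (auto simp: not_le)
    moreover have "0 < min t (1 / Suc n)" using t by simp
    ultimately have "\<forall>\<^sub>F s in at_right 0. dist (f s) L < e" unfolding eventually_at_right_field by blast
    then show False using e by blast
  qed
  then obtain X where X: "\<And>n. X n \<in> {0<..t}" "\<And>n. X n < 1 / Suc n" "\<And>n. e \<le> dist (f (X n)) L" by metis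
  have "X \<longlonglongrightarrow> 0"
  proof (rule tendsto_sandwich[OF _ _ tendsto_const LIMSEQ_inverse_real_of_nat])
    show "\<forall>\<^sub>F n in sequentially. 0 \<le> X n" using X(1) by (intro always_eventually allI) (simp add: less_imp_le)
    show "\<forall>\<^sub>F n in sequentially. X n \<le> inverse (real (Suc n))"
      using X(2) by (intro always_eventually allI) (simp add: inverse_eq_divide less_imp_le)
  qed
  then obtain r where r: "strict_mono r" "(\<lambda>n. f (X (r n))) \<longlonglongrightarrow> L" using sub[of X, OF X(1)] by blast
  from tendstoD[OF r(2) e(1)] obtain n where "dist (f (X (r n))) L < e" by (auto simp: eventually_sequentially)
  then show False using X(3)[of "r n"] by simp
qed

text \<open>Over {f > g} the integral of f - g is the difference of the two measures of that one
  set, hence at most e, and likewise over {f < g}; this is the factor 2.\<close>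

lemma L1_dist_le:
  assumes \<nu>: "sets \<nu> = sets unit_borel" "prob_space \<nu>" "absolutely_continuous unit_lborel \<nu>"
    and \<nu>': "sets \<nu>' = sets unit_borel" "prob_space \<nu>'" "absolutely_continuous unit_lborel \<nu>'"
    and e: "\<And>A. A \<in> sets borel \<Longrightarrow> A \<subseteq> {0..1} \<Longrightarrow> \<bar>measure \<nu> A - measure \<nu>' A\<bar> \<le> e"
  shows "(\<integral>\<^sup>+x. ennreal \<bar>enn2real (RN_deriv unit_lborel \<nu> x) - enn2real (RN_deriv unit_lborel \<nu>' x)\<bar> \<partial>unit_lborel) \<le> ennreal (2 * e)"
proof -
  interpret u: sigma_finite_measure unit_lborel by (rule sigma_finite_unit_lborel)
  interpret n1: prob_space \<nu> by (rule \<nu>)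
  interpret n2: prob_space \<nu>' by (rule \<nu>')
  have spu: "space unit_lborel = {0..1}" by (simp add: unit_lborel_def space_restrict_space)
  have su: "A \<in> sets unit_lborel \<longleftrightarrow> A \<in> sets borel \<and> A \<subseteq> {0..1}" for A using sets_unit_lborel sets_unit_borel by blast
  define f where "f = RN_deriv unit_lborel \<nu>"
  define g where "g = RN_deriv unit_lborel \<nu>'"
  have fm[measurable]: "f \<in> borel_measurable unit_lborel" "g \<in> borel_measurable unit_lborel" by (simp_all add: f_def g_def)
  have fd: "density unit_lborel f = \<nu>" "density unit_lborel g = \<nu>'"
    unfolding f_def g_def
    by (rule u.density_RN_deriv[OF \<nu>(3)] u.density_RN_deriv[OF \<nu>'(3)], simp only: \<nu>(1) \<nu>'(1) sets_unit_lborel)+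
  have ef: "emeasure \<nu> A = (\<integral>\<^sup>+x\<in>A. f x \<partial>unit_lborel)" "emeasure \<nu>' A = (\<integral>\<^sup>+x\<in>A. g x \<partial>unit_lborel)"
    if "A \<in> sets unit_lborel" for A using that fm by (simp_all add: fd[symmetric] emeasure_density)
  have fin: "AE x in unit_lborel. f x \<noteq> \<infinity>" "AE x in unit_lborel. g x \<noteq> \<infinity>"
  proof -
    have "(\<integral>\<^sup>+x. f x \<partial>unit_lborel) = emeasure \<nu> (space unit_lborel)"
      by (subst ef(1)) (auto intro!: nn_integral_cong)
    then have "(\<integral>\<^sup>+x. f x \<partial>unit_lborel) \<noteq> \<infinity>" by simp
    then show "AE x in unit_lborel. f x \<noteq> \<infinity>" by (intro nn_integral_PInf_AE) auto
    have "(\<integral>\<^sup>+x. g x \<partial>unit_lborel) = emeasure \<nu>' (space unit_lborel)"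
      by (subst ef(2)) (auto intro!: nn_integral_cong)
    then have "(\<integral>\<^sup>+x. g x \<partial>unit_lborel) \<noteq> \<infinity>" by simp
    then show "AE x in unit_lborel. g x \<noteq> \<infinity>" by (intro nn_integral_PInf_AE) auto
  qed
  have e0: "0 \<le> e" using e[of "{}"] by simp
  have half: "(\<integral>\<^sup>+x\<in>{x \<in> space unit_lborel. b x < a x}. (a x - b x) \<partial>unit_lborel) \<le> ennreal e"
    if [measurable]: "a \<in> borel_measurable unit_lborel" "b \<in> borel_measurable unit_lborel"
      and N: "prob_space N" "prob_space N'"
      and eab: "\<And>A. A \<in> sets unit_lborel \<Longrightarrow> emeasure N A = (\<integral>\<^sup>+x\<in>A. a x \<partial>unit_lborel)"
        "\<And>A. A \<in> sets unit_lborel \<Longrightarrow> emeasure N' A = (\<integral>\<^sup>+x\<in>A. b x \<partial>unit_lborel)"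
      and d: "\<And>A. A \<in> sets unit_lborel \<Longrightarrow> measure N A - measure N' A \<le> e"
    for a b :: "real \<Rightarrow> ennreal" and N N'
  proof -
    interpret N: prob_space N by (rule N)
    interpret N': prob_space N' by (rule N)
    let ?A = "{x \<in> space unit_lborel. b x < a x}"
    have A: "?A \<in> sets unit_lborel" by measurable
    have "(\<integral>\<^sup>+x\<in>?A. a x \<partial>unit_lborel) = (\<integral>\<^sup>+x. b x * indicator ?A x + (a x - b x) * indicator ?A x \<partial>unit_lborel)"
      by (intro nn_integral_cong) (auto simp: indicator_def add_diff_inverse_ennreal less_imp_le)
    also have "\<dots> = (\<integral>\<^sup>+x\<in>?A. b x \<partial>unit_lborel) + (\<integral>\<^sup>+x\<in>?A. (a x - b x) \<partial>unit_lborel)"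
      by (rule nn_integral_add) measurable
    finally have eq: "emeasure N ?A = emeasure N' ?A + (\<integral>\<^sup>+x\<in>?A. (a x - b x) \<partial>unit_lborel)" using eab[OF A] by simp
    have "measure N ?A \<le> measure N' ?A + e" using d[OF A] by simp
    then have "ennreal (measure N ?A) \<le> ennreal (measure N' ?A + e)" by (rule ennreal_leI)
    also have "\<dots> = ennreal (measure N' ?A) + ennreal e" using e0 by simp
    finally have "emeasure N ?A \<le> emeasure N' ?A + ennreal e"
      by (simp add: N.emeasure_eq_measure N'.emeasure_eq_measure)
    then have "emeasure N' ?A + (\<integral>\<^sup>+x\<in>?A. (a x - b x) \<partial>unit_lborel) \<le> emeasure N' ?A + ennreal e"
      unfolding eq .
    then show ?thesis by (simp add: ennreal_add_left_cancel_le N'.emeasure_eq_measure)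
  qed
  have "(\<integral>\<^sup>+x. ennreal \<bar>enn2real (f x) - enn2real (g x)\<bar> \<partial>unit_lborel)
    = (\<integral>\<^sup>+x. (f x - g x) * indicator {x \<in> space unit_lborel. g x < f x} x + (g x - f x) * indicator {x \<in> space unit_lborel. f x < g x} x \<partial>unit_lborel)"
  proof (intro nn_integral_cong_AE, use fin AE_space in eventually_elim)
    case (elim x)
    obtain a b where ab: "f x = ennreal a" "0 \<le> a" "g x = ennreal b" "0 \<le> b"
      using elim by (cases "f x"; cases "g x") auto
    show ?case using elim ab by (cases a b rule: linorder_cases) (auto simp: ennreal_minus ennreal_less_iff)
  qed
  also have "\<dots> = (\<integral>\<^sup>+x\<in>{x \<in> space unit_lborel. g x < f x}. (f x - g x) \<partial>unit_lborel) + (\<integral>\<^sup>+x\<in>{x \<in> space unit_lborel. f x < g x}. (g x - f x) \<partial>unit_lborel)"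
    by (rule nn_integral_add) measurable
  also have "\<dots> \<le> ennreal e + ennreal e"
  proof (rule add_mono)
    have d: "measure \<nu> A - measure \<nu>' A \<le> e \<and> measure \<nu>' A - measure \<nu> A \<le> e" if "A \<in> sets unit_lborel" for A
      using e[of A] that unfolding su by linarith
    show "(\<integral>\<^sup>+x\<in>{x \<in> space unit_lborel. g x < f x}. (f x - g x) \<partial>unit_lborel) \<le> ennreal e"
      by (rule half[OF fm(1,2) \<nu>(2) \<nu>'(2) ef conjunct1[OF d]])
    show "(\<integral>\<^sup>+x\<in>{x \<in> space unit_lborel. f x < g x}. (g x - f x) \<partial>unit_lborel) \<le> ennreal e"
      by (rule half[OF fm(2,1) \<nu>'(2) \<nu>(2) ef(2,1) conjunct2[OF d]])
  qed
  also have "\<dots> = ennreal (2 * e)" using e0 by (simp add: ennreal_plus[symmetric] del: ennreal_plus)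
  finally show ?thesis unfolding f_def g_def .
qed

section \<open>Invariant limits\<close>

lemma absolutely_continuous_if_bounded:
  assumes "sets \<nu> = sets unit_borel"
    and "\<And>A. A \<in> sets borel \<Longrightarrow> A \<subseteq> {0..1} \<Longrightarrow> emeasure \<nu> A \<le> ennreal B * emeasure lborel A"
  shows "absolutely_continuous unit_lborel \<nu>"
  unfolding absolutely_continuous_def
proof
  fix A assume A: "A \<in> null_sets unit_lborel"
  then have s: "A \<in> sets borel" "A \<subseteq> {0..1}" using sets_unit_lborel sets_unit_borel by blast+
  have "emeasure lborel A = 0" using A emeasure_unit_lborel[OF s(2)] by (simp add: null_sets_def)
  then have "emeasure \<nu> A = 0" using assms(2)[OF s] by simp
  then show "A \<in> null_sets \<nu>" using s by (simp add: null_sets_def assms(1) sets_unit_borel)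
qed

lemma mem_grid_iff: "0 < n \<Longrightarrow> x \<in> grid n k \<longleftrightarrow> \<lfloor>x * n\<rfloor> = int k"
  unfolding grid_def floor_eq_iff atLeastLessThan_iff by (simp add: pos_divide_le_eq pos_less_divide_eq add.commute)

text \<open>Each measure of A is within e of what its grid masses predict from the share of A in
  each grid interval. The predictions differ only through the masses of the grid intervals, so the
  remaining sum does not depend on A.\<close>

lemma grid_comparison:
  assumes \<nu>: "sets \<nu> = sets unit_borel" "prob_space \<nu>" "emeasure \<nu> {1} = 0"
    and \<nu>': "sets \<nu>' = sets unit_borel" "prob_space \<nu>'" "emeasure \<nu>' {1} = 0"
    and n: "0 < n" and A: "A \<in> sets borel" "A \<subseteq> {0..1}"
    and b: "(\<Sum>k<n. \<bar>measure \<nu> (A \<inter> grid n k) - n * measure lborel (A \<inter> grid n k) * measure \<nu> (grid n k)\<bar>) \<le> e"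
    and b': "(\<Sum>k<n. \<bar>measure \<nu>' (A \<inter> grid n k) - n * measure lborel (A \<inter> grid n k) * measure \<nu>' (grid n k)\<bar>) \<le> e"
  shows "\<bar>measure \<nu> A - measure \<nu>' A\<bar> \<le> 2 * e + (\<Sum>k<n. \<bar>measure \<nu> (grid n k) - measure \<nu>' (grid n k)\<bar>)"
proof -
  have un: "A - {1} = (\<Union>k<n. A \<inter> grid n k)"
  proof (intro equalityI subsetI)
    fix x assume x: "x \<in> A - {1}"
    then have x01: "0 \<le> x" "x < 1" using A(2) by force+
    then have "0 \<le> x * n" "x * n < n" using n by simp_all
    then have "\<lfloor>x * n\<rfloor> = int (nat \<lfloor>x * n\<rfloor>)" "nat \<lfloor>x * n\<rfloor> < n" by linarith+
    then show "x \<in> (\<Union>k<n. A \<inter> grid n k)" using x unfolding mem_grid_iff[OF n, symmetric] by blast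
  next
    fix x assume "x \<in> (\<Union>k<n. A \<inter> grid n k)"
    then obtain k where k: "k < n" "x \<in> A" "x \<in> grid n k" by blast
    have "x < real (Suc k) / real n" using k(3) unfolding grid_def by simp
    also have "\<dots> \<le> 1" using k(1) by (simp add: divide_le_eq)
    finally show "x \<in> A - {1}" using k(2) by simp
  qed
  have dec: "measure \<sigma> A = (\<Sum>k<n. measure \<sigma> (A \<inter> grid n k))"
    if \<sigma>: "sets \<sigma> = sets unit_borel" "prob_space \<sigma>" "emeasure \<sigma> {1} = 0" for \<sigma>
  proof -
    interpret \<sigma>: prob_space \<sigma> by (rule \<sigma>)
    have A': "A \<in> sets \<sigma>" unfolding \<sigma>(1) sets_unit_borel using A by blast
    have "{1} \<in> null_sets \<sigma>" using \<sigma>(3) by (simp add: null_sets_def \<sigma>(1) sets_unit_borel)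
    then have "measure \<sigma> A = measure \<sigma> (A - {1})" using A' by (simp add: measure_Diff_null_set)
    also have "\<dots> = (\<Sum>k<n. measure \<sigma> (A \<inter> grid n k))"
      unfolding un
    proof (rule \<sigma>.finite_measure_finite_Union)
      show "(\<lambda>k. A \<inter> grid n k) ` {..<n} \<subseteq> sets \<sigma>"
        unfolding \<sigma>(1) using A grid_facts(1) by (auto simp: sets_unit_borel)
      show "disjoint_family_on (\<lambda>k. A \<inter> grid n k) {..<n}"
        unfolding disjoint_family_on_def
      proof (intro ballI impI equals0I)
        fix i j x assume "i \<noteq> j" "x \<in> A \<inter> grid n i \<inter> (A \<inter> grid n j)"
        then show False unfolding Int_iff mem_grid_iff[OF n] by simp
      qed
    qed simp
    finally show ?thesis .
  qed
  let ?m = "\<lambda>k. n * measure lborel (A \<inter> grid n k)"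
  have one: "\<bar>measure \<nu> (A \<inter> grid n k) - measure \<nu>' (A \<inter> grid n k)\<bar> \<le>
      \<bar>measure \<nu> (A \<inter> grid n k) - ?m k * measure \<nu> (grid n k)\<bar> +
      \<bar>measure \<nu>' (A \<inter> grid n k) - ?m k * measure \<nu>' (grid n k)\<bar> + \<bar>measure \<nu> (grid n k) - measure \<nu>' (grid n k)\<bar>"
    if "k < n" for k
  proof -
    have m: "0 \<le> ?m k" "?m k \<le> 1"
      using measure_sub_grid[OF that A(1)] n by (simp_all add: pos_le_divide_eq mult.commute)
    have "\<bar>?m k * measure \<nu> (grid n k) - ?m k * measure \<nu>' (grid n k)\<bar> = ?m k * \<bar>measure \<nu> (grid n k) - measure \<nu>' (grid n k)\<bar>"
      unfolding right_diff_distrib[symmetric] abs_mult[of "?m k"] abs_of_nonneg[OF m(1)] ..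
    also have "\<dots> \<le> \<bar>measure \<nu> (grid n k) - measure \<nu>' (grid n k)\<bar>" using m by (intro mult_left_le_one_le) auto
    finally show ?thesis by linarith
  qed
  have "measure \<nu> A - measure \<nu>' A = (\<Sum>k<n. measure \<nu> (A \<inter> grid n k) - measure \<nu>' (A \<inter> grid n k))"
    by (simp only: dec[OF \<nu>] dec[OF \<nu>'] sum_subtractf)
  then have "\<bar>measure \<nu> A - measure \<nu>' A\<bar> \<le> (\<Sum>k<n. \<bar>measure \<nu> (A \<inter> grid n k) - measure \<nu>' (A \<inter> grid n k)\<bar>)"
    by (simp only: sum_abs)
  also have "\<dots> \<le> (\<Sum>k<n. \<bar>measure \<nu> (A \<inter> grid n k) - ?m k * measure \<nu> (grid n k)\<bar> +
      \<bar>measure \<nu>' (A \<inter> grid n k) - ?m k * measure \<nu>' (grid n k)\<bar> + \<bar>measure \<nu> (grid n k) - measure \<nu>' (grid n k)\<bar>)"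
    by (intro sum_mono one) (simp only: lessThan_iff)
  also have "\<dots> = (\<Sum>k<n. \<bar>measure \<nu> (A \<inter> grid n k) - ?m k * measure \<nu> (grid n k)\<bar>) +
      (\<Sum>k<n. \<bar>measure \<nu>' (A \<inter> grid n k) - ?m k * measure \<nu>' (grid n k)\<bar>) +
      (\<Sum>k<n. \<bar>measure \<nu> (grid n k) - measure \<nu>' (grid n k)\<bar>)"
    by (simp only: sum.distrib)
  also have "\<dots> \<le> e + e + (\<Sum>k<n. \<bar>measure \<nu> (grid n k) - measure \<nu>' (grid n k)\<bar>)"
    by (intro add_mono b b' order.refl)
  finally show ?thesis by (simp only: mult_2)
qed

context expanding
begin

lemma acim_limit:
  fixes \<nu> :: "nat \<Rightarrow> real measure"
  assumes s: "\<And>n. sets (\<nu> n) = sets unit_borel" and p: "\<And>n. prob_space (\<nu> n)" and B: "0 \<le> B"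
    and le: "\<And>n A. A \<in> sets borel \<Longrightarrow> A \<subseteq> {0..1} \<Longrightarrow> emeasure (\<nu> n) A \<le> ennreal B * emeasure lborel A"
    and inv: "\<And>n A. A \<in> sets borel \<Longrightarrow> A \<subseteq> {0..1} \<Longrightarrow> \<bar>measure (\<nu> n) {x \<in> {0..1}. T x \<in> A} - measure (\<nu> n) A\<bar> \<le> e n"
    and e: "e \<longlonglongrightarrow> 0"
  obtains r M where "strict_mono (r :: nat \<Rightarrow> nat)" "acim T M"
    "\<And>A. A \<in> sets borel \<Longrightarrow> A \<subseteq> {0..1} \<Longrightarrow> (\<lambda>n. measure (\<nu> (r n)) A) \<longlonglongrightarrow> measure M A"
    "\<And>g :: real \<Rightarrow> real. continuous_on {0..1} g \<Longrightarrow> (\<lambda>n. LINT x|\<nu> (r n). g x) \<longlonglongrightarrow> (LINT x|M. g x)"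
proof -
  obtain r M where r: "strict_mono (r :: nat \<Rightarrow> nat)" and sM: "sets M = sets unit_borel" and pM: "prob_space M"
    and Mle: "\<And>A. A \<in> sets borel \<Longrightarrow> A \<subseteq> {0..1} \<Longrightarrow> emeasure M A \<le> ennreal B * emeasure lborel A"
    and conv: "\<And>A. A \<in> sets borel \<Longrightarrow> A \<subseteq> {0..1} \<Longrightarrow> (\<lambda>n. measure (\<nu> (r n)) A) \<longlonglongrightarrow> measure M A"
    and weak: "\<And>g :: real \<Rightarrow> real. continuous_on {0..1} g \<Longrightarrow> (\<lambda>n. LINT x|\<nu> (r n). g x) \<longlonglongrightarrow> (LINT x|M. g x)"
    by (rule bounded_densities_compact[OF s p B le], assumption+, rule that)
  interpret M: prob_space M by (rule pM)
  have spM: "space M = {0..1}" using sets_eq_imp_space_eq[OF sM] space_unit_borel by simp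
  have Tm: "T \<in> measurable M M" using T_measurable sM by (simp cong: measurable_cong_sets)
  have "distr M M T = M"
  proof (rule measure_eqI)
    fix A assume "A \<in> sets (distr M M T)"
    then have AM: "A \<in> sets M" by simp
    then have A: "A \<in> sets borel" "A \<subseteq> {0..1}" unfolding sM sets_unit_borel by blast+
    let ?A = "{x \<in> {0..1}. T x \<in> A}"
    have A': "?A \<in> sets borel" "?A \<subseteq> {0..1}" using T_preimage_sets[OF A(1)] by blast+
    have "(\<lambda>n. \<bar>measure (\<nu> (r n)) ?A - measure (\<nu> (r n)) A\<bar>) \<longlonglongrightarrow> \<bar>measure M ?A - measure M A\<bar>"
      by (intro tendsto_intros conv A A')
    moreover have "(\<lambda>n. e (r n)) \<longlonglongrightarrow> 0" using LIMSEQ_subseq_LIMSEQ[OF e r] by (simp add: comp_def)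
    ultimately have "\<bar>measure M ?A - measure M A\<bar> \<le> 0"
      by (rule LIMSEQ_le) (use inv[OF A] in blast)
    then have eq: "measure M ?A = measure M A" by simp
    have "emeasure (distr M M T) A = emeasure M (T -` A \<inter> space M)" by (rule emeasure_distr[OF Tm AM])
    also have "T -` A \<inter> space M = ?A" unfolding spM by blast
    finally show "emeasure (distr M M T) A = emeasure M A" using eq by (simp add: M.emeasure_eq_measure)
  qed simp
  then have "acim T M" unfolding acim_def using sM pM absolutely_continuous_if_bounded[OF sM Mle] by blast
  from that[OF r this conv weak] show thesis .
qed

text \<open>If no partition interval met J, then J would lie in H up to finitely many points. One
  that meets J has its element of Q inside J, since branch domains are disjoint; and being nonempty
  of length at most 2 * \<delta>, it shows \<delta> > 0.\<close>

lemma partition_in_branch: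
  assumes H: "hole H" and sp: "small_partition (mono_intervals Ihat H) H \<delta> N \<Lambda>"
    and J: "J \<in> Ihat" and less: "emeasure lborel H < emeasure lborel J"
  shows "0 < \<delta>" "ennreal \<delta> \<le> emeasure lborel J" "\<exists>K\<in>mono_intervals Ihat H. K \<subseteq> J"
proof -
  interpret c: cutting T Ihat \<alpha> \<mu> Chat "mono_intervals Ihat H" H by (rule hole_cutting[OF H sp])
  have J01: "J \<subseteq> {0..1}" "J \<in> sets lborel" using Ihat_interval[OF J] by auto
  have "\<exists>k<N. J \<inter> \<Lambda> k \<noteq> {}"
  proof (rule ccontr)
    assume "\<not> ?thesis"
    then have "J - H \<subseteq> ({0..1} - H) - (\<Union>k<N. \<Lambda> k)" using J01 by blast
    then have f: "finite (J - H)" using sp unfolding small_partition_def by (meson finite_subset)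
    have b: "H \<in> sets lborel" "J - H \<in> sets lborel" using hole_open[OF H] J01(2) by auto
    have "emeasure lborel J \<le> emeasure lborel (H \<union> (J - H))"
      using b by (intro emeasure_mono sets.Un) blast+
    also have "\<dots> \<le> emeasure lborel H + emeasure lborel (J - H)"
      using b by (rule emeasure_subadditive)
    also have "\<dots> = emeasure lborel H" using emeasure_finite_set[OF f] by simp
    finally show False using less by simp
  qed
  then obtain k x where k: "k < N" "x \<in> J" "x \<in> \<Lambda> k" by blast
  then obtain l r K where lr: "\<Lambda> k = {l<..<r}" "\<delta> \<le> r - l" "r - l \<le> 2 * \<delta>" and K: "K \<in> mono_intervals Ihat H" "\<Lambda> k \<subseteq> K"
    using sp unfolding small_partition_def by blast
  obtain J' where J': "J' \<in> Ihat" "K \<subseteq> J'" using c.Q_Ihat[OF K(1)] by blast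
  have "J' = J" using disjoint_Ihat J J' K k unfolding pairwise_def disjnt_def by blast
  then have KJ: "K \<subseteq> J" using J' by simp
  then show "\<exists>K\<in>mono_intervals Ihat H. K \<subseteq> J" using K(1) by blast
  have lt: "l < r" using k(3) lr(1) by simp
  then show "0 < \<delta>" using lr by linarith
  have "ennreal \<delta> \<le> ennreal (r - l)" using lr(2) by (rule ennreal_leI)
  also have "\<dots> = emeasure lborel (\<Lambda> k)" using lt lr(1) by simp
  also have "\<dots> \<le> emeasure lborel J" using K(2) KJ J01 by (intro emeasure_mono) auto
  finally show "ennreal \<delta> \<le> emeasure lborel J" .
qed

text \<open>A branch domain of length at least \<delta> is expanded by \<mu> within [0,1], so \<mu>
  * \<delta> \<le> 1. One factor \<delta> of (A1) is left over; the other factors are at most 1, and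
  1 - sqrt(2/\<mu>) is strictly below 1.\<close>

lemma A1_hole_small:
  assumes \<delta>: "0 < \<delta>" and A1: "condition_A1 Ihat H \<alpha> \<mu> Chat \<delta>"
    and J: "J \<in> Ihat" and le: "ennreal \<delta> \<le> emeasure lborel J"
  shows "measure lborel H < \<delta>"
proof -
  have "ennreal \<mu> * ennreal \<delta> \<le> ennreal \<mu> * emeasure lborel J" by (rule mult_left_mono[OF le]) simp
  also have "\<dots> \<le> 1" using branch_emeasure_le[OF branch_1[OF J]] by simp
  finally have \<mu>\<delta>: "\<mu> * \<delta> \<le> 1" using \<mu>_gt_2 \<delta> by (simp add: ennreal_mult[symmetric])
  define C where "C = C_const \<alpha> \<mu> Chat \<delta>"
  define a where "a = a_const \<alpha> \<mu> Chat \<delta>"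
  define q where "q = sqrt (2 / \<mu>)"
  have q: "0 < q" "q < 1" using \<mu>_gt_2 unfolding q_def by simp_all
  have "1 \<le> \<mu> powr \<alpha>" using \<mu>_gt_2 \<alpha>_pos by (intro ge_one_powr_ge_zero) auto
  then have C: "0 \<le> C" unfolding C_def C_const_def using \<mu>_gt_2 Chat_pos by simp
  have a: "0 < a \<and> a < 1"
  proof (cases "\<alpha> = 1")
    case True
    then show ?thesis using q unfolding a_def a_const_def q_def by simp
  next
    case False
    then have "2 powr \<alpha> * (1 + C_const \<alpha> \<mu> Chat \<delta>) / \<mu> powr \<alpha> < 1"
      using A1 unfolding condition_A1_def admissible_delta_def by simp
    then show ?thesis using q False unfolding a_def a_const_def q_def by (simp only: if_False less_max_iff_disj max_less_iff_conj) simp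
  qed
  have "measure lborel H \<le> (1 - a)\<^sup>2 * \<mu> * \<delta>\<^sup>2 * (1 - q) / (1 + C)"
    using A1 unfolding condition_A1_def a_def C_def q_def by blast
  also have "\<dots> \<le> (1 - a)\<^sup>2 * \<mu> * \<delta>\<^sup>2 * (1 - q) / 1"
    using C q \<mu>_gt_2 by (intro divide_left_mono) auto
  also have "\<dots> = ((1 - a)\<^sup>2 * (\<mu> * \<delta>)) * (\<delta> * (1 - q))" by (simp add: power2_eq_square)
  also have "\<dots> \<le> 1 * (\<delta> * (1 - q))"
  proof (rule mult_right_mono)
    have "(1 - a)\<^sup>2 \<le> 1" using a by (simp add: power_le_one)
    then show "(1 - a)\<^sup>2 * (\<mu> * \<delta>) \<le> 1" using \<mu>\<delta> \<delta> \<mu>_gt_2 by (intro mult_le_one[OF _ _ \<mu>\<delta>]) auto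
  qed (use \<delta> q in auto)
  also have "\<dots> < \<delta>" using \<delta> q by simp
  finally show ?thesis .
qed

end

section \<open>Passage to the limit as the holes shrink\<close>

theorem theorem3p3:
  fixes T :: "real \<Rightarrow> real" and Ihat :: "real set set"
    and \<alpha> \<mu> Chat \<delta> t :: real
    and H :: "real \<Rightarrow> real set" and \<nu>s :: "real \<Rightarrow> real measure"
  assumes "expanding_map T Ihat \<alpha> \<mu> Chat"
    and "0 < t"
    and "\<And>s. s \<in> {0<..t} \<Longrightarrow> hole (H s)"
    and "condition_A1 Ihat (H t) \<alpha> \<mu> Chat \<delta>"
    and "\<And>s. s \<in> {0<..t} \<Longrightarrow> measure lborel (H s) \<le> s \<and> H s \<subseteq> H t"
    and "\<And>s c c1 c2. s \<in> {0<..t} \<Longrightarrow> c \<in> components (H t) \<Longrightarrow>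
           c1 \<in> components (H s) \<Longrightarrow> c2 \<in> components (H s) \<Longrightarrow> c1 \<subseteq> c \<Longrightarrow> c2 \<subseteq> c \<Longrightarrow> c1 = c2"
    and "\<And>s e J. s \<in> {0<..t} \<Longrightarrow> J \<in> Ihat \<Longrightarrow> e \<in> frontier J \<Longrightarrow>
           e \<in> closure (H t) \<Longrightarrow> e \<in> closure (H s)"
    and "\<And>J. J \<in> mono_intervals Ihat (H t) \<Longrightarrow>
           \<exists>m. finite ({0..1} - (J \<union> (\<Union>i\<in>{1..m}. (T ^^ i) ` (J \<inter> surviving T (H t) (i - 1)))))"
    and "\<And>s. s \<in> {0<..t} \<Longrightarrow> tower_measure T Ihat \<alpha> \<mu> Chat \<delta> (H s) (\<nu>s s)"
  shows "\<exists>\<nu>. acim T \<nu> \<and> (\<forall>\<nu>'. acim T \<nu>' \<longrightarrow> \<nu>' = \<nu>) \<and>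
           converges_weakly \<nu>s \<nu> (at_right 0) \<and>
           (\<alpha> = 1 \<longrightarrow> densities_converge_L1 \<nu>s \<nu> (at_right 0))"
proof -
  interpret expanding T Ihat \<alpha> \<mu> Chat by unfold_locales (rule assms(1))
  have tt: "t \<in> {0<..t}" using assms(2) by simp
  have part: "\<exists>N \<Lambda>. small_partition (mono_intervals Ihat (H s)) (H s) \<delta> N \<Lambda>" if "s \<in> {0<..t}" for s
    using assms(9)[OF that] unfolding tower_measure_def Let_def by blast
  have eH: "emeasure lborel (H s) = ennreal (measure lborel (H s))" if "s \<in> {0<..t}" for s
    using hole_open[OF assms(3)[OF that]] assms(3)[OF that] unfolding hole_def by (intro emeasure_eq_measure_unit) auto
  have mI: "0 < measure lborel J \<and> emeasure lborel J = ennreal (measure lborel J)" if J: "J \<in> Ihat" for J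
  proof -
    obtain l r where "l < r" "J = {l<..<r}" using Ihat_props[OF J] by blast
    then show ?thesis by simp
  qed
  \<comment> \<open>The length of the shortest branch domain, capped by t so that s = m / 2 is a
    legitimate parameter; the hole for this s is too short to fill any branch domain.\<close>
  define m where "m = Min (insert t (measure lborel ` Ihat))"
  have m: "0 < m" "m \<le> t" unfolding m_def using finite_Ihat mI assms(2) by auto
  have mJ: "m \<le> measure lborel J" if "J \<in> Ihat" for J
    unfolding m_def using finite_Ihat that by (intro Min_le) auto
  have s0: "m / 2 \<in> {0<..t}" using m by simp
  have \<delta>J: "0 < \<delta> \<and> ennreal \<delta> \<le> emeasure lborel J" if J: "J \<in> Ihat" for J
  proof -
    have "measure lborel (H (m / 2)) < measure lborel J" using assms(5)[OF s0] mJ[OF J] m by linarith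
    then have "emeasure lborel (H (m / 2)) < emeasure lborel J"
      using eH[OF s0] mI[OF J] by (simp add: ennreal_lessI)
    then show ?thesis using partition_in_branch(1,2)[OF assms(3)[OF s0] _ J] part[OF s0] by blast
  qed
  have "Ihat \<noteq> {}"
  proof
    assume "Ihat = {}"
    then have "finite {0..1::real}" using cofinite_Ihat by simp
    then show False using infinite_Icc[of "0 :: real" 1] by simp
  qed
  then have \<delta>: "0 < \<delta>" using \<delta>J by blast
  \<comment> \<open>By (A1) the hole \<open>H t\<close> is shorter than \<delta>, hence than J, so J
    contains an interval of monotonicity K for \<open>H t\<close>. Condition (3) for K passes to J,
    whose images contain those of the surviving part of K.\<close>
  have covers: "\<exists>m::nat. finite ({0..1} - (\<Union>i\<le>m. (T ^^ i) ` J))" if J: "J \<in> Ihat" for J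
  proof -
    have "measure lborel (H t) < \<delta>" using A1_hole_small[OF \<delta> assms(4) J] \<delta>J[OF J] by blast
    then have "emeasure lborel (H t) < ennreal \<delta>" using eH[OF tt] \<delta> by (simp add: ennreal_lessI)
    then have "emeasure lborel (H t) < emeasure lborel J" using \<delta>J[OF J] by (meson less_le_trans)
    then obtain K where K: "K \<in> mono_intervals Ihat (H t)" "K \<subseteq> J"
      using partition_in_branch(3)[OF assms(3)[OF tt] _ J] part[OF tt] by blast
    obtain m where f: "finite ({0..1} - (K \<union> (\<Union>i\<in>{1..m}. (T ^^ i) ` (K \<inter> surviving T (H t) (i - 1)))))"
      using assms(8)[OF K(1)] by blast
    have "K \<subseteq> (\<Union>i\<le>m. (T ^^ i) ` J)"
    proof
      fix x assume "x \<in> K"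
      then have "x \<in> (T ^^ 0) ` J" using K(2) by auto
      then show "x \<in> (\<Union>i\<le>m. (T ^^ i) ` J)" by blast
    qed
    moreover have "(\<Union>i\<in>{1..m}. (T ^^ i) ` (K \<inter> surviving T (H t) (i - 1))) \<subseteq> (\<Union>i\<le>m. (T ^^ i) ` J)"
    proof (rule UN_mono)
      show "{1..m} \<subseteq> {..m}" by auto
      show "(T ^^ i) ` (K \<inter> surviving T (H t) (i - 1)) \<subseteq> (T ^^ i) ` J" for i using K(2) by (intro image_mono) blast
    qed
    ultimately have "finite ({0..1} - (\<Union>i\<le>m. (T ^^ i) ` J))" by (intro finite_subset[OF _ f]) blast
    then show ?thesis by blast
  qed
  show ?thesis
  proof (rule tower_measure_facts[OF \<delta>])
    fix B C0 :: real and P :: "nat \<Rightarrow> real"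
    assume prob: "\<And>H \<nu>. hole H \<Longrightarrow> tower_measure T Ihat \<alpha> \<mu> Chat \<delta> H \<nu> \<Longrightarrow> sets \<nu> = sets unit_borel \<and> prob_space \<nu>"
      and bd: "\<And>H \<nu> A. hole H \<Longrightarrow> tower_measure T Ihat \<alpha> \<mu> Chat \<delta> H \<nu> \<Longrightarrow> A \<in> sets borel \<Longrightarrow> A \<subseteq> {0..1} \<Longrightarrow>
        emeasure \<nu> A \<le> ennreal B * emeasure lborel A"
      and inv: "\<And>H \<nu> A. hole H \<Longrightarrow> tower_measure T Ihat \<alpha> \<mu> Chat \<delta> H \<nu> \<Longrightarrow> A \<in> sets borel \<Longrightarrow> A \<subseteq> {0..1} \<Longrightarrow>
        \<bar>measure \<nu> {x \<in> {0..1}. T x \<in> A} - measure \<nu> A\<bar> \<le> B * real (card Ihat) * measure lborel H"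
      and grd: "\<And>H \<nu> A n L. hole H \<Longrightarrow> tower_measure T Ihat \<alpha> \<mu> Chat \<delta> H \<nu> \<Longrightarrow> \<alpha> = 1 \<Longrightarrow> 0 < n \<Longrightarrow> A \<in> sets borel \<Longrightarrow>
        (\<Sum>k<n. \<bar>measure \<nu> (A \<inter> grid n k) - n * measure lborel (A \<inter> grid n k) * measure \<nu> (grid n k)\<bar>)
        \<le> P L / n + C0 * sqrt (2 / \<mu>) ^ L / (1 - sqrt (2 / \<mu>))"
      and B: "0 \<le> B"
    have sub: "\<exists>r M. strict_mono (r :: nat \<Rightarrow> nat) \<and> acim T M \<and>
        (\<forall>A. A \<in> sets borel \<longrightarrow> A \<subseteq> {0..1} \<longrightarrow> (\<lambda>n. measure (\<nu>s (X (r n))) A) \<longlonglongrightarrow> measure M A) \<and>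
        (\<forall>g :: real \<Rightarrow> real. continuous_on {0..1} g \<longrightarrow> (\<lambda>n. LINT x|\<nu>s (X (r n)). g x) \<longlonglongrightarrow> (LINT x|M. g x))"
      if X: "\<And>n. X n \<in> {0<..t}" "X \<longlonglongrightarrow> 0" for X :: "nat \<Rightarrow> real"
    proof (rule acim_limit[of "\<lambda>n. \<nu>s (X n)" B "\<lambda>n. B * real (card Ihat) * X n"])
      show "sets (\<nu>s (X n)) = sets unit_borel" "prob_space (\<nu>s (X n))" for n
        using prob[OF assms(3)[OF X(1)] assms(9)[OF X(1)]] by blast+
      show "emeasure (\<nu>s (X n)) A \<le> ennreal B * emeasure lborel A" if "A \<in> sets borel" "A \<subseteq> {0..1}" for n A
        by (rule bd[OF assms(3)[OF X(1)] assms(9)[OF X(1)] that])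
      show "\<bar>measure (\<nu>s (X n)) {x \<in> {0..1}. T x \<in> A} - measure (\<nu>s (X n)) A\<bar> \<le> B * real (card Ihat) * X n"
        if "A \<in> sets borel" "A \<subseteq> {0..1}" for n A
      proof (rule order.trans[OF inv[OF assms(3)[OF X(1)] assms(9)[OF X(1)] that]])
        show "B * real (card Ihat) * measure lborel (H (X n)) \<le> B * real (card Ihat) * X n"
          using assms(5)[OF X(1)] B by (intro mult_left_mono) auto
      qed
      show "(\<lambda>n. B * real (card Ihat) * X n) \<longlonglongrightarrow> 0" using tendsto_mult_left[OF X(2), of "B * real (card Ihat)"] by simp
    qed (rule B, blast)
    \<comment> \<open>Any admissible sequence tending to 0 produces \<nu>; uniqueness then
      identifies all subsequential limits with it.\<close>
    have "t / real (Suc n) \<in> {0<..t}" for n using assms(2) by (simp add: divide_le_eq)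
    from sub[OF this LIMSEQ_Suc[OF lim_const_over_n]] obtain \<nu> where \<nu>: "acim T \<nu>" by blast
    have uniq: "\<nu>' = \<nu>" if "acim T \<nu>'" for \<nu>' by (rule acim_unique[OF covers that \<nu>])
    have setwise: "((\<lambda>s. measure (\<nu>s s) A) \<longlongrightarrow> measure \<nu> A) (at_right 0)" if A: "A \<in> sets borel" "A \<subseteq> {0..1}" for A
    proof (rule tendsto_at_right_0_subseq[OF assms(2)])
      fix X :: "nat \<Rightarrow> real" assume X: "\<And>n. X n \<in> {0<..t}" "X \<longlonglongrightarrow> 0"
      obtain r M where "strict_mono r" "acim T M" "(\<lambda>n. measure (\<nu>s (X (r n))) A) \<longlonglongrightarrow> measure M A"
        using sub[OF X] A by blast
      then show "\<exists>r. strict_mono r \<and> (\<lambda>n. measure (\<nu>s (X (r n))) A) \<longlonglongrightarrow> measure \<nu> A" using uniq by blast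
    qed
    have weak: "converges_weakly \<nu>s \<nu> (at_right 0)"
      unfolding converges_weakly_def
    proof (intro allI impI tendsto_at_right_0_subseq[OF assms(2)])
      fix g :: "real \<Rightarrow> real" and X :: "nat \<Rightarrow> real"
      assume g: "continuous_on {0..1} g" and X: "\<And>n. X n \<in> {0<..t}" "X \<longlonglongrightarrow> 0"
      obtain r M where "strict_mono r" "acim T M" "(\<lambda>n. LINT x|\<nu>s (X (r n)). g x) \<longlonglongrightarrow> (LINT x|M. g x)"
        using sub[OF X] g by blast
      then show "\<exists>r. strict_mono r \<and> (\<lambda>n. LINT x|\<nu>s (X (r n)). g x) \<longlonglongrightarrow> (LINT x|\<nu>. g x)" using uniq by blast
    qed
    have near: "\<forall>\<^sub>F s in at_right 0. s \<in> {0<..t}"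
      using eventually_at_right_real[OF assms(2)] by eventually_elim simp
    have \<nu>f: "sets \<nu> = sets unit_borel" "prob_space \<nu>" "absolutely_continuous unit_lborel \<nu>"
      using \<nu> unfolding acim_def by blast+
    have \<nu>sf: "sets (\<nu>s s) = sets unit_borel" "prob_space (\<nu>s s)" "absolutely_continuous unit_lborel (\<nu>s s)" "emeasure (\<nu>s s) {1} = 0"
      if s: "s \<in> {0<..t}" for s
    proof -
      note pb = prob[OF assms(3)[OF s] assms(9)[OF s]] bd[OF assms(3)[OF s] assms(9)[OF s]]
      show "sets (\<nu>s s) = sets unit_borel" "prob_space (\<nu>s s)" using pb(1) by blast+
      then show "absolutely_continuous unit_lborel (\<nu>s s)" by (intro absolutely_continuous_if_bounded[OF _ pb(2)])
      show "emeasure (\<nu>s s) {1} = 0" using pb(2)[of "{1}"] by simp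
    qed
    have \<nu>1: "emeasure \<nu> {1} = 0"
    proof -
      have "{1} \<in> null_sets unit_lborel"
        unfolding null_sets_def mem_Collect_eq sets_unit_lborel sets_unit_borel by (simp add: emeasure_unit_lborel)
      from subsetD[OF \<nu>f(3)[unfolded absolutely_continuous_def] this] show ?thesis by (rule null_setsD1)
    qed
    have L1: "densities_converge_L1 \<nu>s \<nu> (at_right 0)" if \<alpha>: "\<alpha> = 1"
    proof -
      \<comment> \<open>L1 convergence of the densities amounts to convergence of the measures
        uniformly over all Borel sets.\<close>
      have unif: "\<forall>\<^sub>F s in at_right 0. \<forall>A. A \<in> sets borel \<longrightarrow> A \<subseteq> {0..1} \<longrightarrow> \<bar>measure (\<nu>s s) A - measure \<nu> A\<bar> \<le> e"
        if e: "0 < e" for e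
      proof -
        define q where "q = sqrt (2 / \<mu>)"
        have q: "0 \<le> q" "q < 1" unfolding q_def using \<mu>_gt_2 by simp_all
        \<comment> \<open>L is chosen first to control the high levels, then n for the grid error of
          the levels below L; each receives e/8.\<close>
        have "(\<lambda>L. C0 * q ^ L / (1 - q)) \<longlonglongrightarrow> C0 * 0 / (1 - q)"
          using q by (intro tendsto_intros LIMSEQ_realpow_zero) auto
        then have "\<forall>\<^sub>F L in sequentially. C0 * q ^ L / (1 - q) < e / 8" using e by (intro order_tendstoD(2)) auto
        then obtain L where L: "C0 * q ^ L / (1 - q) < e / 8" unfolding eventually_sequentially by blast
        have "\<forall>\<^sub>F n in sequentially. P L / real n < e / 8" using e by (intro order_tendstoD(2)[OF lim_const_over_n]) auto
        then have "\<forall>\<^sub>F n in sequentially. P L / real n < e / 8 \<and> 0 < n" using eventually_gt_at_top[of 0] by eventually_elim blast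
        then obtain n where n: "P L / real n < e / 8" "0 < n" unfolding eventually_sequentially by blast
        have b: "(\<Sum>k<n. \<bar>measure (\<nu>s s) (A \<inter> grid n k) - n * measure lborel (A \<inter> grid n k) * measure (\<nu>s s) (grid n k)\<bar>) \<le> e / 4"
          if s: "s \<in> {0<..t}" and A: "A \<in> sets borel" for s A
          using grd[OF assms(3)[OF s] assms(9)[OF s] \<alpha> n(2) A, of L] L n(1) unfolding q_def by linarith
        \<comment> \<open>For fixed A only finitely many sets are involved, so the bound passes to
          \<nu> by setwise convergence.\<close>
        have b': "(\<Sum>k<n. \<bar>measure \<nu> (A \<inter> grid n k) - n * measure lborel (A \<inter> grid n k) * measure \<nu> (grid n k)\<bar>) \<le> e / 4"
          if A: "A \<in> sets borel" for A
        proof (rule tendsto_upperbound)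
          show "((\<lambda>s. \<Sum>k<n. \<bar>measure (\<nu>s s) (A \<inter> grid n k) - n * measure lborel (A \<inter> grid n k) * measure (\<nu>s s) (grid n k)\<bar>)
            \<longlongrightarrow> (\<Sum>k<n. \<bar>measure \<nu> (A \<inter> grid n k) - n * measure lborel (A \<inter> grid n k) * measure \<nu> (grid n k)\<bar>)) (at_right 0)"
          proof (intro tendsto_sum tendsto_rabs tendsto_diff tendsto_mult tendsto_const setwise)
            fix k assume "k \<in> {..<n}"
            then have "k < n" by simp
            note g = grid_facts(1,2)[OF this]
            show "A \<inter> grid n k \<in> sets borel" "A \<inter> grid n k \<subseteq> {0..1}" "grid n k \<in> sets borel" "grid n k \<subseteq> {0..1}"
              using g A by blast+
          qed
          show "\<forall>\<^sub>F s in at_right 0. (\<Sum>k<n. \<bar>measure (\<nu>s s) (A \<inter> grid n k) - n * measure lborel (A \<inter> grid n k) * measure (\<nu>s s) (grid n k)\<bar>) \<le> e / 4"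
            using near by eventually_elim (rule b[OF _ A])
        qed simp
        have "((\<lambda>s. \<Sum>k<n. \<bar>measure (\<nu>s s) (grid n k) - measure \<nu> (grid n k)\<bar>) \<longlongrightarrow> (\<Sum>k<n. \<bar>measure \<nu> (grid n k) - measure \<nu> (grid n k)\<bar>)) (at_right 0)"
          by (intro tendsto_sum tendsto_rabs tendsto_diff tendsto_const setwise) (simp_all only: lessThan_iff grid_facts(1,2))
        then have "((\<lambda>s. \<Sum>k<n. \<bar>measure (\<nu>s s) (grid n k) - measure \<nu> (grid n k)\<bar>) \<longlongrightarrow> 0) (at_right 0)" by simp
        then have "\<forall>\<^sub>F s in at_right 0. (\<Sum>k<n. \<bar>measure (\<nu>s s) (grid n k) - measure \<nu> (grid n k)\<bar>) < e / 2"
          using e by (intro order_tendstoD(2)) auto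
        with near show ?thesis
        proof eventually_elim
          case (elim s)
          show ?case
          proof (intro allI impI)
            fix A :: "real set" assume A: "A \<in> sets borel" "A \<subseteq> {0..1}"
            \<comment> \<open>Twice e/4 comes from the grid bounds and e/2 from the masses of the
              grid intervals.\<close>
            show "\<bar>measure (\<nu>s s) A - measure \<nu> A\<bar> \<le> e"
              using grid_comparison[OF \<nu>sf(1,2,4)[OF elim(1)] \<nu>f(1,2) \<nu>1 n(2) A b[OF elim(1) A(1)] b'[OF A(1)]] elim(2)
              by linarith
          qed
        qed
      qed
      show ?thesis
        unfolding densities_converge_L1_def
      proof (rule order_tendstoI)
        fix a :: ennreal assume "0 < a"
        then obtain y where "0 < y" "y < a" using dense by blast
        then have e: "0 < enn2real y" "ennreal (enn2real y) < a"
          using less_le_trans[OF \<open>y < a\<close> top_greatest] by (simp_all add: enn2real_positive_iff)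
        \<comment> \<open>Setwise closeness e/2 is required below because \<open>L1_dist_le\<close>
          doubles it.\<close>
        define e where "e = enn2real y"
        note e = e[folded e_def]
        have "\<forall>\<^sub>F s in at_right 0. \<forall>A. A \<in> sets borel \<longrightarrow> A \<subseteq> {0..1} \<longrightarrow> \<bar>measure (\<nu>s s) A - measure \<nu> A\<bar> \<le> e / 2"
          by (rule unif) (use e in simp)
        with near show "\<forall>\<^sub>F s in at_right 0. (\<integral>\<^sup>+x. ennreal \<bar>enn2real (RN_deriv unit_lborel (\<nu>s s) x) -
            enn2real (RN_deriv unit_lborel \<nu> x)\<bar> \<partial>unit_lborel) < a"
        proof eventually_elim
          case (elim s)
          have "(\<integral>\<^sup>+x. ennreal \<bar>enn2real (RN_deriv unit_lborel (\<nu>s s) x) -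
            enn2real (RN_deriv unit_lborel \<nu> x)\<bar> \<partial>unit_lborel) \<le> ennreal (2 * (e / 2))"
            by (rule L1_dist_le[OF \<nu>sf(1-3)[OF elim(1)] \<nu>f]) (use elim(2) in blast)
          also have "\<dots> < a" using e by simp
          finally show ?case .
        qed
      qed simp
    qed
    show ?thesis by (intro exI[of _ \<nu>] conjI allI impI \<nu> uniq weak L1)
  qed
qed

end
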